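(* Let $k$ be an algebraically closed field, let $F$ be a $k$-vector space of dimension $n\geq 2$, and let $G\subseteq \mathrm{GL}(F)$ be a finite small group such that $\operatorname{char} k\nmid |G|$. Let $S=k[F]=k[x_1,\dots,x_n]$ and let $R=S^G$ be the invariant ring. Then the differential symmetric signature of $R$ exists and equals $$s_{\mathrm{d}\sigma}(R)=\frac{1}{|G|}.$$
   Context: Group action. An element $\sigma\in \mathrm{GL}(F)$ of finite order is a pseudo-reflection if its fixed subspace $\{v\in F:\sigma(v)=v\}$ has codimension one in $F$. A subgroup of $\mathrm{GL}(F)$ is small if it contains no pseudo-reflections. Fix a basis $e_1,\dots,e_n$ of $F$ and identify $e_i$ with the variable $x_i$ of $S=k[F]=k[x_1,\dots,x_n]$; the group $G$ acts on $S$ by $k$-algebra automorphisms determined by $\sigma(x_i)=\sigma(e_i)$ for $\sigma\in G$. The ring $S$ has the standard grading, and $R=S^G$ is graded as a subring of $S$. The characteristic of $k$ may be $0$. Ranks. Let $R$ be a $\mathbb{Z}$-graded Noetherian $k$-domain. For a finitely generated graded $R$-module $M$, $\operatorname{rank}_R M$ is the usual rank (the dimension of $M\otimes_R \mathrm{Frac}(R)$ over $\mathrm{Frac}(R)$), and the free rank is $$\operatorname{frk}_R M=\max\{m\in\mathbb{N}:\ \text{there is a surjection } M\twoheadrightarrow L,\ \text{homogeneous of degree } 0,\ \text{with } L \text{ a free graded } R\text{-module of rank } m\}$$ (free graded modules may have shifted generators). Differential symmetric signature. Let $(-)^*=\mathrm{Hom}_R(-,R)$, let $\Omega_{R/k}$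 be the module of Kähler differentials of $R$ over $k$, and for $q\in\mathbb{N}$ let $\mathcal{C}^q=\left(\mathrm{Sym}^q_R(\Omega_{R/k})\right)^{**}$. The differential symmetric signature of $R$ is $$s_{\mathrm{d}\sigma}(R)=\lim_{N\to+\infty}\frac{\sum_{q=0}^N\operatorname{frk}_R\mathcal{C}^q}{\sum_{q=0}^N\operatorname{rank}_R\mathcal{C}^q},$$ provided the limit exists. *)

theory Defs
  imports
    "HOL-Library.Poly_Mapping"
    "HOL-Library.Multiset"
    "HOL-Computational_Algebra.Polynomial"
    "HOL-Algebra.AbelCoset"
    "HOL-Algebra.Generated_Groups"
    "Jordan_Normal_Form.Missing_VectorSpace"
begin

section \<open>Graded rings and modules\<close>

record 'a graded_ring = "'a ring" +
  ring_comp :: "int \<Rightarrow> 'a set"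

record ('a, 'b) graded_module = "('a, 'b) module" +
  mod_comp :: "int \<Rightarrow> 'b set"

definition with_grading :: "('a, 'b) module \<Rightarrow> (int \<Rightarrow> 'b set) \<Rightarrow> ('a, 'b) graded_module" where
  "with_grading M c = module.extend M (graded_module.fields c)"

definition regular_module :: "'a graded_ring \<Rightarrow> ('a, 'a) graded_module" where
  "regular_module R =
     \<lparr>carrier = carrier R, mult = mult R, one = one R, zero = zero R, add = add R,
      smult = mult R, mod_comp = ring_comp R\<rparr>"


section \<open>Modules given by generators and relations\<close>

definition free_module :: "('a, 'r) ring_scheme \<Rightarrow> 'x set \<Rightarrow> ('a, 'x \<Rightarrow> 'a) module" where
  "free_module R X = (ring.func_space R X)
     \<lparr>carrier := {f \<in> X \<rightarrow>\<^sub>E carrier R. finite {x \<in> X. f x \<noteq> \<zero>\<^bsub>R\<^esub>}}\<rparr>"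

definition free_gen :: "('a, 'r) ring_scheme \<Rightarrow> 'x set \<Rightarrow> 'x \<Rightarrow> 'x \<Rightarrow> 'a" where
  "free_gen R X x = (\<lambda>y\<in>X. if y = x then \<one>\<^bsub>R\<^esub> else \<zero>\<^bsub>R\<^esub>)"

text \<open>As usual for modules in HOL-Algebra, the ring multiplication and unit of the record are
  irrelevant.\<close>

definition quotient_module :: "('a, 'b, 'm) module_scheme \<Rightarrow> 'b set \<Rightarrow> ('a, 'b set) module" where
  "quotient_module M N =
     \<lparr>carrier = a_rcosets\<^bsub>M\<^esub> N, mult = (\<lambda>A B. N), one = N, zero = N,
      add = (\<lambda>A B. A <+>\<^bsub>M\<^esub> B),
      smult = (\<lambda>a A. \<Union>x\<in>A. N +>\<^bsub>M\<^esub> (a \<odot>\<^bsub>M\<^esub> x))\<rparr>"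

definition relation_module :: "('a, 'r) ring_scheme \<Rightarrow> 'x set \<Rightarrow> ('x \<Rightarrow> 'a) set \<Rightarrow> ('x \<Rightarrow> 'a) set" where
  "relation_module R X rel = LinearCombinations.module.span R (free_module R X) rel"

definition presented_module ::
    "('a, 'r) ring_scheme \<Rightarrow> 'x set \<Rightarrow> ('x \<Rightarrow> 'a) set \<Rightarrow> ('a, ('x \<Rightarrow> 'a) set) module" where
  "presented_module R X rel = quotient_module (free_module R X) (relation_module R X rel)"

definition presented_gen ::
    "('a, 'r) ring_scheme \<Rightarrow> 'x set \<Rightarrow> ('x \<Rightarrow> 'a) set \<Rightarrow> 'x \<Rightarrow> ('x \<Rightarrow> 'a) set" where
  "presented_gen R X rel x = relation_module R X rel +>\<^bsub>free_module R X\<^esub> free_gen R X x"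


section \<open>Rank\<close>

definition frac_rel :: "('a, 'r) ring_scheme \<Rightarrow> (('a \<times> 'a) \<times> ('a \<times> 'a)) set" where
  "frac_rel R = {((a, b), (c, d)).
     {a, b, c, d} \<subseteq> carrier R \<and> b \<noteq> \<zero>\<^bsub>R\<^esub> \<and> d \<noteq> \<zero>\<^bsub>R\<^esub> \<and> a \<otimes>\<^bsub>R\<^esub> d = c \<otimes>\<^bsub>R\<^esub> b}"

definition frac_class :: "('a, 'r) ring_scheme \<Rightarrow> 'a \<Rightarrow> 'a \<Rightarrow> ('a \<times> 'a) set" where
  "frac_class R a b = frac_rel R `` {(a, b)}"

definition fraction_field :: "('a, 'r) ring_scheme \<Rightarrow> ('a \<times> 'a) set ring" where
  "fraction_field R =
     \<lparr>carrier = (carrier R \<times> (carrier R - {\<zero>\<^bsub>R\<^esub>})) // frac_rel R,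
      mult = (\<lambda>A B. \<Union>(a, b)\<in>A. \<Union>(c, d)\<in>B. frac_class R (a \<otimes>\<^bsub>R\<^esub> c) (b \<otimes>\<^bsub>R\<^esub> d)),
      one = frac_class R \<one>\<^bsub>R\<^esub> \<one>\<^bsub>R\<^esub>,
      zero = frac_class R \<zero>\<^bsub>R\<^esub> \<one>\<^bsub>R\<^esub>,
      add = (\<lambda>A B. \<Union>(a, b)\<in>A. \<Union>(c, d)\<in>B.
        frac_class R ((a \<otimes>\<^bsub>R\<^esub> d) \<oplus>\<^bsub>R\<^esub> (c \<otimes>\<^bsub>R\<^esub> b)) (b \<otimes>\<^bsub>R\<^esub> d))\<rparr>"

text \<open>The \<open>Q\<close>-module \<open>M \<otimes>\<^sub>R Q\<close> for a ring homomorphism \<open>h\<close> from \<open>R\<close> to \<open>Q\<close>: the generator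
  \<open>(m, q)\<close> stands for \<open>m \<otimes> q\<close>.  The first three families of relations are those of the tensor
  product over \<open>R\<close>; the last one makes \<open>Q\<close> act through the second factor.\<close>

definition base_change_rels ::
    "('a, 'r) ring_scheme \<Rightarrow> ('q, 's) ring_scheme \<Rightarrow> ('a \<Rightarrow> 'q) \<Rightarrow> ('a, 'b, 'm) module_scheme
      \<Rightarrow> ('b \<times> 'q \<Rightarrow> 'q) set" where
  "base_change_rels R Q h M =
     (let X = carrier M \<times> carrier Q; F = free_module Q X; g = free_gen Q X in
       {g (m \<oplus>\<^bsub>M\<^esub> m', q) \<ominus>\<^bsub>F\<^esub> (g (m, q) \<oplus>\<^bsub>F\<^esub> g (m', q)) | m m' q.
          m \<in> carrier M \<and> m' \<in> carrier M \<and> q \<in> carrier Q} \<union>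
       {g (m, q \<oplus>\<^bsub>Q\<^esub> q') \<ominus>\<^bsub>F\<^esub> (g (m, q) \<oplus>\<^bsub>F\<^esub> g (m, q')) | m q q'.
          m \<in> carrier M \<and> q \<in> carrier Q \<and> q' \<in> carrier Q} \<union>
       {g (r \<odot>\<^bsub>M\<^esub> m, q) \<ominus>\<^bsub>F\<^esub> g (m, h r \<otimes>\<^bsub>Q\<^esub> q) | r m q.
          r \<in> carrier R \<and> m \<in> carrier M \<and> q \<in> carrier Q} \<union>
       {g (m, c \<otimes>\<^bsub>Q\<^esub> q) \<ominus>\<^bsub>F\<^esub> (c \<odot>\<^bsub>F\<^esub> g (m, q)) | m q c.
          m \<in> carrier M \<and> q \<in> carrier Q \<and> c \<in> carrier Q})"

definition base_change ::
    "('a, 'r) ring_scheme \<Rightarrow> ('q, 's) ring_scheme \<Rightarrow> ('a \<Rightarrow> 'q) \<Rightarrow> ('a, 'b, 'm) module_scheme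
      \<Rightarrow> ('q, ('b \<times> 'q \<Rightarrow> 'q) set) module" where
  "base_change R Q h M =
     presented_module Q (carrier M \<times> carrier Q) (base_change_rels R Q h M)"

definition module_rank :: "('a, 'r) ring_scheme \<Rightarrow> ('a, 'b, 'm) module_scheme \<Rightarrow> nat" where
  "module_rank R M = vectorspace.dim (fraction_field R)
     (base_change R (fraction_field R) (\<lambda>r. frac_class R r \<one>\<^bsub>R\<^esub>) M)"


section \<open>Free rank\<close>

text \<open>The free graded module of rank \<open>m\<close> whose \<open>i\<close>-th basis element has degree \<open>s i\<close>.\<close>

definition free_graded_module :: "'a graded_ring \<Rightarrow> nat \<Rightarrow> (nat \<Rightarrow> int) \<Rightarrow> ('a, nat \<Rightarrow> 'a) graded_module" where
  "free_graded_module R m s = with_grading (free_module R {..<m})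
     (\<lambda>d. {v \<in> carrier (free_module R {..<m}). \<forall>i<m. v i \<in> ring_comp R (d - s i)})"

definition graded_surjection ::
    "'a graded_ring \<Rightarrow> ('a, 'b) graded_module \<Rightarrow> ('a, 'c) graded_module \<Rightarrow> ('b \<Rightarrow> 'c) \<Rightarrow> bool" where
  "graded_surjection R M L f \<longleftrightarrow>
     f \<in> LinearCombinations.module_hom R M L \<and> f ` carrier M = carrier L \<and>
     (\<forall>d. f ` mod_comp M d \<subseteq> mod_comp L d)"

definition free_rank :: "'a graded_ring \<Rightarrow> ('a, 'b) graded_module \<Rightarrow> nat" where
  "free_rank R M = Max {m. \<exists>s f. graded_surjection R M (free_graded_module R m s) f}"


section \<open>Duals, symmetric powers and Kaehler differentials\<close>

text \<open>Homomorphisms are represented by functions extensional on the carrier.  A homomorphism is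
  homogeneous of degree \<open>d\<close> if it raises degrees by \<open>d\<close>; for a finitely generated module over a
  Noetherian ring these components make up the whole dual.\<close>

definition dual_module :: "'a graded_ring \<Rightarrow> ('a, 'b) graded_module \<Rightarrow> ('a, 'b \<Rightarrow> 'a) graded_module" where
  "dual_module R M =
     (let H = LinearCombinations.module_hom R M (regular_module R) \<inter> extensional (carrier M) in
       with_grading ((ring.func_space R (carrier M)) \<lparr>carrier := H\<rparr>)
         (\<lambda>d. {f \<in> H. \<forall>i. f ` mod_comp M i \<subseteq> ring_comp R (i + d)}))"

text \<open>\<open>Sym\<^sup>q M\<close> is generated by formal commutative products of \<open>q\<close> elements of \<open>M\<close>, that is, by
  multisets of size \<open>q\<close>, subject to multilinearity.  For \<open>q = 0\<close> the only generator is the empty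
  product and there are no relations.\<close>

definition sym_gens :: "nat \<Rightarrow> ('a, 'b, 'm) module_scheme \<Rightarrow> 'b multiset set" where
  "sym_gens q M = {T. size T = q \<and> set_mset T \<subseteq> carrier M}"

definition sym_rels ::
    "('a, 'r) ring_scheme \<Rightarrow> nat \<Rightarrow> ('a, 'b, 'm) module_scheme \<Rightarrow> ('b multiset \<Rightarrow> 'a) set" where
  "sym_rels R q M =
     (let X = sym_gens q M; F = free_module R X; g = free_gen R X in
       {g (add_mset (x \<oplus>\<^bsub>M\<^esub> y) T) \<ominus>\<^bsub>F\<^esub> (g (add_mset x T) \<oplus>\<^bsub>F\<^esub> g (add_mset y T)) | x y T.
          x \<in> carrier M \<and> y \<in> carrier M \<and> set_mset T \<subseteq> carrier M \<and> Suc (size T) = q} \<union>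
       {g (add_mset (a \<odot>\<^bsub>M\<^esub> x) T) \<ominus>\<^bsub>F\<^esub> (a \<odot>\<^bsub>F\<^esub> g (add_mset x T)) | a x T.
          a \<in> carrier R \<and> x \<in> carrier M \<and> set_mset T \<subseteq> carrier M \<and> Suc (size T) = q})"

definition sym_power ::
    "'a graded_ring \<Rightarrow> nat \<Rightarrow> ('a, 'b) graded_module \<Rightarrow> ('a, ('b multiset \<Rightarrow> 'a) set) graded_module" where
  "sym_power R q M =
     (let X = sym_gens q M; P = presented_module R X (sym_rels R q M) in
       with_grading P
         (\<lambda>d. generate (add_monoid P)
           {a \<odot>\<^bsub>P\<^esub> presented_gen R X (sym_rels R q M) T | a i T deg.
              a \<in> ring_comp R i \<and> T \<in> X \<and> (\<forall>x\<in>#T. x \<in> mod_comp M (deg x)) \<and>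
              i + (\<Sum>x\<in>#T. deg x) = d}))"

text \<open>\<open>K\<close> is the image of the base field in \<open>R\<close>.  The generator indexed by \<open>f\<close> is \<open>df\<close>; together
  with the Leibniz rule, \<open>dc = 0\<close> for \<open>c \<in> K\<close> amounts to \<open>K\<close>-linearity of \<open>d\<close>.\<close>

definition kaehler_rels :: "('a, 'r) ring_scheme \<Rightarrow> 'a set \<Rightarrow> ('a \<Rightarrow> 'a) set" where
  "kaehler_rels R K =
     (let X = carrier R; F = free_module R X; g = free_gen R X in
       {g (a \<oplus>\<^bsub>R\<^esub> b) \<ominus>\<^bsub>F\<^esub> (g a \<oplus>\<^bsub>F\<^esub> g b) | a b. a \<in> carrier R \<and> b \<in> carrier R} \<union>
       {g (a \<otimes>\<^bsub>R\<^esub> b) \<ominus>\<^bsub>F\<^esub> ((a \<odot>\<^bsub>F\<^esub> g b) \<oplus>\<^bsub>F\<^esub> (b \<odot>\<^bsub>F\<^esub> g a)) | a b.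
          a \<in> carrier R \<and> b \<in> carrier R} \<union>
       g ` K)"

definition kaehler_differentials :: "'a graded_ring \<Rightarrow> 'a set \<Rightarrow> ('a, ('a \<Rightarrow> 'a) set) graded_module" where
  "kaehler_differentials R K =
     (let P = presented_module R (carrier R) (kaehler_rels R K) in
       with_grading P
         (\<lambda>d. generate (add_monoid P)
           {a \<odot>\<^bsub>P\<^esub> presented_gen R (carrier R) (kaehler_rels R K) f | a f i j.
              a \<in> ring_comp R i \<and> f \<in> ring_comp R j \<and> i + j = d}))"


section \<open>Differential symmetric signature\<close>

definition reflexive_sym_kaehler ::
    "'a graded_ring \<Rightarrow> 'a set \<Rightarrow> nat
      \<Rightarrow> ('a, ((('a \<Rightarrow> 'a) set multiset \<Rightarrow> 'a) set \<Rightarrow> 'a) \<Rightarrow> 'a) graded_module" where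
  "reflexive_sym_kaehler R K q =
     dual_module R (dual_module R (sym_power R q (kaehler_differentials R K)))"

definition diff_sym_ratio :: "'a graded_ring \<Rightarrow> 'a set \<Rightarrow> nat \<Rightarrow> real" where
  "diff_sym_ratio R K N =
     real (\<Sum>q\<le>N. free_rank R (reflexive_sym_kaehler R K q)) /
     real (\<Sum>q\<le>N. module_rank R (reflexive_sym_kaehler R K q))"

text \<open>Meaningful only if \<^term>\<open>convergent (diff_sym_ratio R K)\<close>.\<close>

definition diff_sym_signature :: "'a graded_ring \<Rightarrow> 'a set \<Rightarrow> real" where
  "diff_sym_signature R K = lim (diff_sym_ratio R K)"


section \<open>Linear groups and invariant rings\<close>

definition general_linear_group :: "('k::field \<Rightarrow> 'v::ab_group_add \<Rightarrow> 'v) \<Rightarrow> ('v \<Rightarrow> 'v) monoid" where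
  "general_linear_group scale =
     \<lparr>carrier = {f. Vector_Spaces.linear scale scale f \<and> bij f}, mult = (\<circ>), one = id\<rparr>"

definition pseudo_reflection :: "('k::field \<Rightarrow> 'v::ab_group_add \<Rightarrow> 'v) \<Rightarrow> ('v \<Rightarrow> 'v) \<Rightarrow> bool" where
  "pseudo_reflection scale f \<longleftrightarrow>
     f \<in> carrier (general_linear_group scale) \<and> (\<exists>m>0. f ^^ m = id) \<and>
     vector_space.dim scale {v. f v = v} + 1 = vector_space.dim scale UNIV"

definition small_group :: "('k::field \<Rightarrow> 'v::ab_group_add \<Rightarrow> 'v) \<Rightarrow> ('v \<Rightarrow> 'v) set \<Rightarrow> bool" where
  "small_group scale G \<longleftrightarrow> (\<forall>f\<in>G. \<not> pseudo_reflection scale f)"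

text \<open>Polynomials over \<open>'k\<close> in variables \<open>x\<^sub>i\<close> indexed by \<open>'n\<close>, as finitely supported functions on
  exponent vectors.\<close>

type_synonym ('n, 'k) polynomial = "('n \<Rightarrow>\<^sub>0 nat) \<Rightarrow>\<^sub>0 'k"

definition poly_const :: "'k::zero \<Rightarrow> ('n, 'k) polynomial" where
  "poly_const c = Poly_Mapping.single 0 c"

definition poly_var :: "'n \<Rightarrow> ('n, 'k::zero_neq_one) polynomial" where
  "poly_var i = Poly_Mapping.single (Poly_Mapping.single i 1) 1"

definition monomial_degree :: "('n::finite \<Rightarrow>\<^sub>0 nat) \<Rightarrow> nat" where
  "monomial_degree m = (\<Sum>i\<in>UNIV. Poly_Mapping.lookup m i)"

definition poly_subst ::
    "('n::finite \<Rightarrow> ('n, 'k::comm_ring_1) polynomial) \<Rightarrow> ('n, 'k) polynomial \<Rightarrow> ('n, 'k) polynomial" where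
  "poly_subst h p = (\<Sum>m\<in>Poly_Mapping.keys p.
     poly_const (Poly_Mapping.lookup p m) * (\<Prod>i\<in>UNIV. h i ^ Poly_Mapping.lookup m i))"

text \<open>The family \<open>e\<close> is a basis of the vector space; the vector \<open>e i\<close> is identified with the
  variable \<open>x\<^sub>i\<close>, hence every vector with a linear form.\<close>

definition vec_poly ::
    "('k::field \<Rightarrow> 'v::ab_group_add \<Rightarrow> 'v) \<Rightarrow> ('n::finite \<Rightarrow> 'v) \<Rightarrow> 'v \<Rightarrow> ('n, 'k) polynomial" where
  "vec_poly scale e v =
     (\<Sum>i\<in>UNIV. poly_const (Modules.module.representation scale (range e) v (e i)) * poly_var i)"

definition poly_action ::
    "('k::field \<Rightarrow> 'v::ab_group_add \<Rightarrow> 'v) \<Rightarrow> ('n::finite \<Rightarrow> 'v) \<Rightarrow> ('v \<Rightarrow> 'v)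
      \<Rightarrow> ('n, 'k) polynomial \<Rightarrow> ('n, 'k) polynomial" where
  "poly_action scale e f = poly_subst (\<lambda>i. vec_poly scale e (f (e i)))"

definition invariant_ring ::
    "('k::field \<Rightarrow> 'v::ab_group_add \<Rightarrow> 'v) \<Rightarrow> ('n::finite \<Rightarrow> 'v) \<Rightarrow> ('v \<Rightarrow> 'v) set
      \<Rightarrow> ('n, 'k) polynomial graded_ring" where
  "invariant_ring scale e G =
     (let C = {p. \<forall>f\<in>G. poly_action scale e f p = p} in
       \<lparr>carrier = C, mult = (*), one = 1, zero = 0, add = (+),
        ring_comp = (\<lambda>d. {p \<in> C. \<forall>m\<in>Poly_Mapping.keys p. int (monomial_degree m) = d})\<rparr>)"

end

theory Submission
  imports Defs "Jordan_Normal_Form.Determinant"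
begin

text \<open>The invariant ring is compared with the polynomial ring \<open>S\<close> over which everything is free. Let \<open>\<Gamma>\<close>
  be the image of \<open>G\<close> in the automorphisms of \<open>S\<close>, \<open>R = S\<^sup>\<Gamma>\<close>, and write \<open>X\<^sub>q\<close> for the monomials of
  degree \<open>q\<close>, a basis of \<open>Sym\<^sup>q F\<close>. The total differential maps \<open>Sym\<^sup>q \<Omega>\<^sub>R\<close> to the invariant symmetric
  forms \<open>(S \<otimes> Sym\<^sup>q F)\<^sup>\<Gamma>\<close>, and the point is that this map becomes an isomorphism on biduals:
  the dual of \<open>Sym\<^sup>q \<Omega>\<^sub>R\<close> is \<open>(S \<otimes> (Sym\<^sup>q F)\<^sup>*)\<^sup>\<Gamma>\<close> (lemma \<open>D1_cases\<close>) and the bidual is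
  \<open>(S \<otimes> Sym\<^sup>q F)\<^sup>\<Gamma>\<close> (lemma \<open>D2_cases\<close>).

  Both identifications say that functionals over \<open>R\<close> have no denominators, and this is where
  smallness is used. If \<open>g \<noteq> id\<close> is not a pseudo-reflection, then there are linear forms \<open>v\<close>, \<open>w\<close>
  such that \<open>v - g v\<close> and \<open>w - g w\<close> are coprime. Products of such differences, one for each \<open>g \<noteq> id\<close>,
  are values of elements of \<open>S \<otimes> S\<close> that separate the identity from the other automorphisms;
  they allow an element of \<open>S\<close>, and a derivation of \<open>S\<close>, to be recovered from traces up to this
  product or its square. Since each factor may be chosen in two coprime ways, a denominator that is killed by all
  these products is trivial (lemma \<open>descent\<close>). It follows that every \<open>R\<close>-linear map \<open>S \<rightarrow> R\<close> is
  \<open>s \<mapsto> tr (l s)\<close> for some \<open>l \<in> S\<close> (\<open>functional_is_trace\<close>), and that every derivation of \<open>R\<close> into \<open>S\<close>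
  extends to \<open>S\<close> (\<open>extend_derivation\<close>). The second fact expresses symmetric multiderivations of
  \<open>R\<close> by functions on \<open>X\<^sub>q\<close> with values in \<open>S\<close> (\<open>multiderivation_pairing\<close>).
  As \<open>|G|\<close> is invertible, averaging makes these functions invariant.

  The rank of \<open>(S \<otimes> Sym\<^sup>q F)\<^sup>\<Gamma>\<close> is the number of monomials of degree \<open>q\<close>, because over the fraction
  field the traces span everything (\<open>generic_basis\<close>). Its free rank is the dimension of
  \<open>(Sym\<^sup>q F)\<^sup>\<Gamma> = R\<^sub>q\<close> (\<open>free_rank_reflexive_sym\<close>): a free quotient of rank \<open>m\<close> gives \<open>m\<close> invariant
  functionals and \<open>m\<close> invariant tensors that are dual to each other, and this duality persists
  for their constant terms, whereas conversely a basis of \<open>R\<^sub>q\<close>, viewed as constant tensors,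
  and an averaged dual basis define a free quotient.

  It remains to compare \<open>\<Sum>\<^sub>q\<^sub>\<le>\<^sub>N dim R\<^sub>q\<close> with \<open>\<Sum>\<^sub>q\<^sub>\<le>\<^sub>N dim S\<^sub>q\<close>. If \<open>\<theta>\<close> has \<open>|G|\<close> distinct conjugates,
  then \<open>1, \<theta>, \<dots>, \<theta>\<^bsup>|G|-1\<^esup>\<close> are independent over \<open>R\<close> and span all multiples of a fixed nonzero element. Hence, up to a shift
  of \<open>N\<close> by a constant, the second sum is \<open>|G|\<close> times the first (\<open>count_invariants\<close>). As the second
  sum is polynomial in \<open>N\<close>, the shift does not affect the limit.\<close>

section \<open>Finite groups of ring automorphisms\<close>

locale finite_ring_action =
  fixes \<Gamma> :: "('a::comm_ring_1 \<Rightarrow> 'a) set"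
  assumes finite_group: "finite \<Gamma>"
    and id_mem: "id \<in> \<Gamma>"
    and comp_mem: "g \<in> \<Gamma> \<Longrightarrow> h \<in> \<Gamma> \<Longrightarrow> g \<circ> h \<in> \<Gamma>"
    and inverse_ex: "g \<in> \<Gamma> \<Longrightarrow> \<exists>h\<in>\<Gamma>. h \<circ> g = id \<and> g \<circ> h = id"
    and act_add: "g \<in> \<Gamma> \<Longrightarrow> g (a + b) = g a + g b"
    and act_mult: "g \<in> \<Gamma> \<Longrightarrow> g (a * b) = g a * g b"
    and act_one: "g \<in> \<Gamma> \<Longrightarrow> g 1 = 1"
    and no_zero_div: "(a::'a) * b = 0 \<Longrightarrow> a = 0 \<or> b = 0"
begin

definition invs :: "'a set" where "invs = {a. \<forall>g\<in>\<Gamma>. g a = a}"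

definition tr :: "'a \<Rightarrow> 'a" where "tr a = (\<Sum>g\<in>\<Gamma>. g a)"

lemma cancel: "(c::'a) \<noteq> 0 \<Longrightarrow> c * a = c * b \<longleftrightarrow> a = b"
  using no_zero_div[of c "a - b"] by (auto simp: algebra_simps)

lemma prod_nonzero: "finite F \<Longrightarrow> (\<And>x. x \<in> F \<Longrightarrow> f x \<noteq> 0) \<Longrightarrow> (\<Prod>x\<in>F. f x :: 'a) \<noteq> 0"
proof (induction F rule: finite_induct)
  case empty
  have "(1::'a) \<noteq> 0" by simp
  then show ?case by simp
next
  case (insert x F)
  then show ?case using no_zero_div[of "f x" "prod f F"] by auto
qed

lemma power_nonzero: "(a::'a) \<noteq> 0 \<Longrightarrow> a ^ n \<noteq> 0"
  using no_zero_div by (induction n) auto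

lemma act_zero: "g \<in> \<Gamma> \<Longrightarrow> g 0 = 0"
  using act_add[of g 0 0] by simp

lemma act_minus: "g \<in> \<Gamma> \<Longrightarrow> g (- a) = - g a"
  using act_add[of g a "- a"] act_zero[of g] by (simp add: add_eq_0_iff)

lemma act_diff: "g \<in> \<Gamma> \<Longrightarrow> g (a - b) = g a - g b"
  using act_add[of g a "- b"] act_minus[of g b] by simp

lemma act_sum: "g \<in> \<Gamma> \<Longrightarrow> g (\<Sum>x\<in>F. f x) = (\<Sum>x\<in>F. g (f x))"
  by (induction F rule: infinite_finite_induct) (auto simp: act_zero act_add)

lemma act_prod: "g \<in> \<Gamma> \<Longrightarrow> g (\<Prod>x\<in>F. f x) = (\<Prod>x\<in>F. g (f x))"
  by (induction F rule: infinite_finite_induct) (auto simp: act_one act_mult)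

lemma act_power: "g \<in> \<Gamma> \<Longrightarrow> g (a ^ n) = g a ^ n"
  by (induction n) (auto simp: act_one act_mult)

lemmas act_simps = act_zero act_one act_add act_minus act_diff act_mult act_sum act_prod act_power

lemma act_inj: assumes "g \<in> \<Gamma>" "g a = g b" shows "a = b"
proof -
  from inverse_ex[OF assms(1)] obtain h where "h \<circ> g = id" by blast
  then show ?thesis using assms(2) by (metis comp_apply id_apply)
qed

lemma left_translation: assumes g: "g \<in> \<Gamma>" shows "bij_betw (\<lambda>h. g \<circ> h) \<Gamma> \<Gamma>"
proof -
  from inverse_ex[OF g] obtain k where k: "k \<in> \<Gamma>" "k \<circ> g = id" "g \<circ> k = id" by blast
  show ?thesis
    by (rule bij_betw_byWitness[where f' = "\<lambda>h. k \<circ> h"])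
      (use k g comp_mem in \<open>auto simp: o_assoc\<close>)
qed

lemma sum_left_translation: "g \<in> \<Gamma> \<Longrightarrow> (\<Sum>h\<in>\<Gamma>. f (g \<circ> h)) = (\<Sum>h\<in>\<Gamma>. f h)"
  using sum.reindex_bij_betw[OF left_translation] .

lemma prod_left_translation: "g \<in> \<Gamma> \<Longrightarrow> (\<Prod>h\<in>\<Gamma>. f (g \<circ> h)) = (\<Prod>h\<in>\<Gamma>. f h)"
  using prod.reindex_bij_betw[OF left_translation] .

lemma invsD: "r \<in> invs \<Longrightarrow> g \<in> \<Gamma> \<Longrightarrow> g r = r"
  by (simp add: invs_def)

lemma invs_add: "a \<in> invs \<Longrightarrow> b \<in> invs \<Longrightarrow> a + b \<in> invs"
  and invs_mult: "a \<in> invs \<Longrightarrow> b \<in> invs \<Longrightarrow> a * b \<in> invs"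
  and invs_minus: "a \<in> invs \<Longrightarrow> - a \<in> invs"
  and invs_zero: "0 \<in> invs" and invs_one: "1 \<in> invs"
  and invs_sum: "(\<And>x. x \<in> F \<Longrightarrow> f x \<in> invs) \<Longrightarrow> sum f F \<in> invs"
proof -
  have I: "x \<in> invs \<longleftrightarrow> (\<forall>g\<in>\<Gamma>. g x = x)" for x by (simp add: invs_def)
  show "a \<in> invs \<Longrightarrow> b \<in> invs \<Longrightarrow> a + b \<in> invs"
    "a \<in> invs \<Longrightarrow> b \<in> invs \<Longrightarrow> a * b \<in> invs"
    "a \<in> invs \<Longrightarrow> - a \<in> invs"
    "0 \<in> invs" "1 \<in> invs"
    unfolding I[of "a + b"] I[of "a * b"] I[of "- a"] I[of 0] I[of 1]
    by (simp_all add: act_simps invsD)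
  show "sum f F \<in> invs" if "\<And>x. x \<in> F \<Longrightarrow> f x \<in> invs"
    unfolding I by (simp add: act_simps invsD that cong: sum.cong)
qed

lemma tr_invs: "tr a \<in> invs"
proof -
  have "g (tr a) = tr a" if g: "g \<in> \<Gamma>" for g
  proof -
    have "g (tr a) = (\<Sum>h\<in>\<Gamma>. (g \<circ> h) a)" using g by (simp add: tr_def act_sum)
    also have "\<dots> = tr a" unfolding tr_def by (rule sum_left_translation[OF g, of "\<lambda>h. h a"])
    finally show ?thesis .
  qed
  then show ?thesis by (auto simp: invs_def)
qed

lemma tr_add: "tr (a + b) = tr a + tr b"
  by (simp add: tr_def act_simps sum.distrib)

lemma tr_sum: "tr (\<Sum>x\<in>F. f x) = (\<Sum>x\<in>F. tr (f x))"
  by (induction F rule: infinite_finite_induct) (simp_all add: tr_add, simp_all add: tr_def act_simps)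

lemma tr_smult: "r \<in> invs \<Longrightarrow> tr (r * a) = r * tr a"
  by (simp add: tr_def act_simps invsD sum_distrib_left)

lemma norm_invs: "(\<Prod>g\<in>\<Gamma>. g a) \<in> invs"
proof -
  have "g (\<Prod>h\<in>\<Gamma>. h a) = (\<Prod>h\<in>\<Gamma>. h a)" if g: "g \<in> \<Gamma>" for g
  proof -
    have "g (\<Prod>h\<in>\<Gamma>. h a) = (\<Prod>h\<in>\<Gamma>. (g \<circ> h) a)" using g by (simp add: act_prod)
    also have "\<dots> = (\<Prod>h\<in>\<Gamma>. h a)" by (rule prod_left_translation[OF g, of "\<lambda>h. h a"])
    finally show ?thesis .
  qed
  then show ?thesis by (auto simp: invs_def)
qed

text \<open>The element \<open>\<prod>\<^sub>g (c\<^sub>g \<otimes> 1 - 1 \<otimes> g c\<^sub>g)\<close> of \<open>S \<otimes> S\<close>, written as \<open>\<Sum>\<^sub>i s\<^sub>i \<otimes> t\<^sub>i\<close>,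
  is sent to \<open>\<prod>\<^sub>g (h c\<^sub>g - g c\<^sub>g)\<close> by \<open>a \<otimes> b \<mapsto> h a * b\<close>; the factor \<open>g = h\<close> kills it unless
  \<open>h = id\<close>.  It plays the part of the separability idempotent of \<open>S\<close> over the invariants.  The
  choice of \<open>c\<^sub>g\<close> is left free for each \<open>g\<close>, so that the resulting factor can be varied.\<close>

definition discr :: "(('a \<Rightarrow> 'a) \<Rightarrow> 'a) \<Rightarrow> 'a" where
  "discr c = (\<Prod>g\<in>\<Gamma> - {id}. c g - g (c g))"

lemma separating_product:
  assumes "finite F"
  shows "\<exists>zs. \<forall>h\<in>\<Gamma>. (\<Sum>(s, t)\<leftarrow>zs. h s * t) = (\<Prod>g\<in>F. h (c g) - d g)"
  using assms
proof (induction F rule: finite_induct)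
  case empty
  then show ?case by (intro exI[of _ "[(1, 1)]"]) (simp add: act_simps)
next
  case (insert x F)
  then obtain zs where zs: "\<And>h. h \<in> \<Gamma> \<Longrightarrow> (\<Sum>(s, t)\<leftarrow>zs. h s * t) = (\<Prod>g\<in>F. h (c g) - d g)" by blast
  show ?case
  proof (intro exI[of _ "map (\<lambda>(s, t). (c x * s, t)) zs @ map (\<lambda>(s, t). (s, - d x * t)) zs"] ballI)
    fix h assume h: "h \<in> \<Gamma>"
    have 1: "(\<Sum>(s, t)\<leftarrow>map (\<lambda>(s, t). (c x * s, t)) zs. h s * t) = h (c x) * (\<Sum>(s, t)\<leftarrow>zs. h s * t)" 
      by (induction zs) (auto simp: h act_simps algebra_simps)
    have 2: "(\<Sum>(s, t)\<leftarrow>map (\<lambda>(s, t). (s, - d x * t)) zs. h s * t) = - d x * (\<Sum>(s, t)\<leftarrow>zs. h s * t)" 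
      by (induction zs) (auto simp: h act_simps algebra_simps)
    show "(\<Sum>(s, t)\<leftarrow>map (\<lambda>(s, t). (c x * s, t)) zs @ map (\<lambda>(s, t). (s, - d x * t)) zs. h s * t) =
         (\<Prod>g\<in>insert x F. h (c g) - d g)"
      unfolding map_append sum_list_append 1 2 zs[OF h] using insert.hyps by (simp add: algebra_simps)
  qed
qed

lemma separating:
  obtains n s t where "\<And>h. h \<in> \<Gamma> \<Longrightarrow> (\<Sum>i<n::nat. h (s i) * t i) = (if h = id then discr c else 0)"
proof -
  obtain zs where zs: "\<And>h. h \<in> \<Gamma> \<Longrightarrow>
      (\<Sum>(s, t)\<leftarrow>zs. h s * t) = (\<Prod>g\<in>\<Gamma> - {id}. h (c g) - g (c g))"
    using separating_product[of "\<Gamma> - {id}" c "\<lambda>g. g (c g)"] finite_group by auto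
  have "(\<Sum>i<length zs. h (fst (zs ! i)) * snd (zs ! i)) = (if h = id then discr c else 0)"
    if h: "h \<in> \<Gamma>" for h
  proof -
    have "(\<Sum>i<length zs. h (fst (zs ! i)) * snd (zs ! i)) = (\<Sum>(s, t)\<leftarrow>zs. h s * t)"
      by (simp add: sum_list_sum_nth atLeast0LessThan case_prod_beta)
    also have "\<dots> = (if h = id then discr c else 0)"
    proof (cases "h = id")
      case False
      then have "(\<Prod>g\<in>\<Gamma> - {id}. h (c g) - g (c g)) = 0"
        using h finite_group by (intro prod_zero) auto
      then show ?thesis using zs[OF h] False by simp
    next
      case True
      then show ?thesis using zs[OF h] by (simp add: discr_def)
    qed
    finally show ?thesis .
  qed
  then show ?thesis by (rule that)
qed

text \<open>The coefficient of \<open>h a\<close> on the left is \<open>\<Sum>\<^sub>i s\<^sub>i * h t\<^sub>i\<close>, the image under \<open>h\<close> of the sum in the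
  hypothesis for the inverse of \<open>h\<close>.\<close>

lemma trace_expansion:
  assumes sep: "\<And>h. h \<in> \<Gamma> \<Longrightarrow> (\<Sum>i<n::nat. h (s i) * t i) = (if h = id then e else 0)"
  shows "(\<Sum>i<n. s i * tr (t i * a)) = e * a"
proof -
  have "(\<Sum>i<n. s i * h (t i)) = (if h = id then e else 0)" if h: "h \<in> \<Gamma>" for h
  proof -
    from inverse_ex[OF h] obtain k where k: "k \<in> \<Gamma>" "k \<circ> h = id" "h \<circ> k = id" by blast
    have "(\<Sum>i<n. s i * h (t i)) = h (\<Sum>i<n. k (s i) * t i)"
      using h k(3) by (simp add: act_simps fun_eq_iff)
    also have "\<dots> = h (if k = id then e else 0)" using sep[OF k(1)] by simp
    also have "k = id \<longleftrightarrow> h = id" using k by auto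
    finally show ?thesis using h by (auto simp: act_zero)
  qed
  then have "(\<Sum>h\<in>\<Gamma>. (\<Sum>i<n. s i * h (t i)) * h a) = (\<Sum>h\<in>\<Gamma>. if h = id then e * a else 0)"
    by (intro sum.cong) auto
  also have "\<dots> = e * a" using finite_group id_mem by simp
  finally have "(\<Sum>h\<in>\<Gamma>. (\<Sum>i<n. s i * h (t i)) * h a) = e * a" .
  moreover have "(\<Sum>i<n. s i * tr (t i * a)) = (\<Sum>h\<in>\<Gamma>. (\<Sum>i<n. s i * h (t i)) * h a)"
    unfolding tr_def sum_distrib_left sum_distrib_right
    by (subst sum.swap) (simp add: act_simps mult.assoc)
  ultimately show ?thesis by simp
qed

definition derivation :: "('a \<Rightarrow> 'a) \<Rightarrow> bool" where
  "derivation D \<longleftrightarrow> (\<forall>a b. D (a + b) = D a + D b) \<and> (\<forall>a b. D (a * b) = a * D b + b * D a)"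

definition inv_derivation :: "('a \<Rightarrow> 'a) \<Rightarrow> bool" where
  "inv_derivation D \<longleftrightarrow> (\<forall>a\<in>invs. \<forall>b\<in>invs. D (a + b) = D a + D b \<and> D (a * b) = a * D b + b * D a)"

lemma derivation_sum:
  assumes "derivation D" shows "D (\<Sum>x\<in>F. f x) = (\<Sum>x\<in>F. D (f x))"
proof -
  have D0: "D 0 = 0" using assms by (metis add_cancel_right_left add_0 derivation_def)
  show ?thesis using assms
    by (induction F rule: infinite_finite_induct) (auto simp: derivation_def D0)
qed

text \<open>Squaring the separating element kills the first-order part of a derivation away from
  \<open>h = id\<close>; this recovers the derivation, up to the factor \<open>e\<^sup>2\<close>, from its values on
  invariants.\<close>

lemma derivation_from_invariants:
  assumes D: "derivation D"
    and sep: "\<And>h. h \<in> \<Gamma> \<Longrightarrow> (\<Sum>i<n::nat. h (s i) * t i) = (if h = id then e else 0)"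
  defines "Z \<equiv> \<lambda>a. \<Sum>i<n. \<Sum>j<n. t i * t j * D (tr (s i * s j * a))"
  shows "e\<^sup>2 * D a = Z a - a * Z 1"
proof -
  have Dm: "D (x * y) = x * D y + y * D x" for x y using D by (simp add: derivation_def)
  have D1: "D 1 = 0" using Dm[of 1 1] by simp
  define Y where "Y h = (\<Sum>i<n. t i * D (h (s i)))" for h
  define X where "X h = (\<Sum>i<n. h (s i) * t i)" for h
  have "Z b = e\<^sup>2 * D b + 2 * e * Y id * b" for b
  proof -
    have summand: "(\<Sum>i<n. \<Sum>j<n. t i * t j * D (h (s i * s j * b))) =
        (X h)\<^sup>2 * D (h b) + 2 * X h * Y h * h b" if h: "h \<in> \<Gamma>" for h
    proof -
      have "(\<Sum>i<n. \<Sum>j<n. t i * t j * D (h (s i * s j * b))) = (\<Sum>i<n. \<Sum>j<n.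
        (h (s i) * t i) * (h (s j) * t j) * D (h b)
         + (h (s i) * t i) * (t j * D (h (s j))) * h b + (t i * D (h (s i))) * (h (s j) * t j) * h b)"
        using h by (simp add: act_simps Dm algebra_simps)
      also have "\<dots> = (\<Sum>i<n. \<Sum>j<n. (h (s i) * t i) * (h (s j) * t j)) * D (h b)
         + (\<Sum>i<n. \<Sum>j<n. (h (s i) * t i) * (t j * D (h (s j)))) * h b
         + (\<Sum>i<n. \<Sum>j<n. (t i * D (h (s i))) * (h (s j) * t j)) * h b"
        by (simp only: sum.distrib sum_distrib_right)
      also have "\<dots> = X h * X h * D (h b) + X h * Y h * h b + Y h * X h * h b"
        by (simp only: X_def Y_def sum_product)
      finally show ?thesis by (simp add: power2_eq_square algebra_simps)
    qed
    have "Z b = (\<Sum>i<n. \<Sum>j<n. \<Sum>h\<in>\<Gamma>. t i * t j * D (h (s i * s j * b)))"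
      unfolding Z_def tr_def by (simp only: derivation_sum[OF D] sum_distrib_left)
    also have "\<dots> = (\<Sum>h\<in>\<Gamma>. \<Sum>i<n. \<Sum>j<n. t i * t j * D (h (s i * s j * b)))"
      by (subst sum.swap[of _ "{..<n}" \<Gamma>]) (simp add: sum.swap[of _ "{..<n}" \<Gamma>])
    also have "\<dots> = (\<Sum>h\<in>\<Gamma>. if h = id then e\<^sup>2 * D b + 2 * e * Y id * b else 0)"
    proof (rule sum.cong[OF refl])
      fix h assume h: "h \<in> \<Gamma>"
      have "X h = (if h = id then e else 0)" unfolding X_def by (rule sep[OF h])
      with summand[OF h] show "(\<Sum>i<n. \<Sum>j<n. t i * t j * D (h (s i * s j * b))) =
          (if h = id then e\<^sup>2 * D b + 2 * e * Y id * b else 0)"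
        by (cases "h = id") (simp_all only: simp_thms if_True if_False id_apply power2_eq_square mult_zero_left
            mult_zero_right add_0)
    qed
    also have "\<dots> = e\<^sup>2 * D b + 2 * e * Y id * b"
      by (simp only: sum.delta[OF finite_group] id_mem if_True)
    finally show ?thesis .
  qed
  then show ?thesis by (simp add: D1 algebra_simps)
qed

lemma discr_nonzero: "(\<And>g. g \<in> \<Gamma> \<Longrightarrow> g \<noteq> id \<Longrightarrow> g (c g) \<noteq> c g) \<Longrightarrow> discr c \<noteq> 0"
  unfolding discr_def using finite_group by (intro prod_nonzero) (auto dest: sym)

lemma not_id_moves: assumes "g \<noteq> id" shows "\<exists>x. g x \<noteq> x" 
  using assms by (auto simp: fun_eq_iff)

text \<open>Each \<open>c g\<close> may be any element moved by \<open>g\<close>.\<close>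

lemma discr_nonzero_ex: "\<exists>c. discr c \<noteq> 0"
proof (intro exI[of _ "\<lambda>g. SOME x. g x \<noteq> x"] discr_nonzero)
  fix g assume "g \<noteq> (id :: 'a \<Rightarrow> 'a)"
  from someI_ex[OF not_id_moves[OF this]] show "g (SOME x. g x \<noteq> x) \<noteq> (SOME x. g x \<noteq> x)" .
qed

text \<open>All the derivatives of traces in \<open>derivation_from_invariants\<close> vanish.\<close>

lemma derivation_zero_on_invs:
  assumes D: "derivation D" and inv: "\<And>r. r \<in> invs \<Longrightarrow> D r = 0"
  shows "D a = 0"
proof -
  obtain c where c: "discr c \<noteq> 0" using discr_nonzero_ex by blast
  obtain s t n where sep: "\<And>h. h \<in> \<Gamma> \<Longrightarrow> (\<Sum>i<n::nat. h (s i) * t i) = (if h = id then discr c else 0)"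
    by (rule separating[of c], rule that)
  have "(discr c)\<^sup>2 * D a = 0"
    using derivation_from_invariants[OF D sep, of a] by (simp add: inv tr_invs)
  then show ?thesis using no_zero_div power_nonzero[OF c] by blast
qed


subsection \<open>Extending derivations from the invariants\<close>

text \<open>Univariate polynomials with invariant coefficients stand in for the subring generated
  over the invariants by one element \<open>\<theta>\<close> with pairwise distinct conjugates.\<close>

lemma map_poly_act_mult:
  assumes g: "g \<in> \<Gamma>" shows "map_poly g (p * q) = map_poly g p * map_poly g q"
  by (rule poly_eqI) (simp add: coeff_map_poly act_simps g coeff_mult)

lemma map_poly_act_add:
  assumes g: "g \<in> \<Gamma>" shows "map_poly g (p + q) = map_poly g p + map_poly g q"
  by (rule poly_eqI) (simp add: coeff_map_poly act_simps g)

lemma map_poly_act_diff: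
  assumes g: "g \<in> \<Gamma>" shows "map_poly g (p - q) = map_poly g p - map_poly g q"
  by (rule poly_eqI) (simp add: coeff_map_poly act_simps g)

lemma map_poly_act_one: "g \<in> \<Gamma> \<Longrightarrow> map_poly g 1 = 1"
  by (simp add: one_pCons map_poly_pCons act_simps)

lemma map_poly_act_sum:
  assumes g: "g \<in> \<Gamma>" shows "map_poly g (\<Sum>x\<in>F. f x) = (\<Sum>x\<in>F. map_poly g (f x))"
  by (induction F rule: infinite_finite_induct) (simp_all add: map_poly_act_add[OF g])

lemma map_poly_act_prod:
  assumes g: "g \<in> \<Gamma>" shows "map_poly g (\<Prod>x\<in>F. f x) = (\<Prod>x\<in>F. map_poly g (f x))"
  by (induction F rule: infinite_finite_induct)
     (simp_all add: map_poly_act_mult[OF g] map_poly_act_one[OF g])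

lemma map_poly_act_smult:
  assumes g: "g \<in> \<Gamma>" shows "map_poly g (Polynomial.smult a p) = Polynomial.smult (g a) (map_poly g p)"
  by (rule poly_eqI) (simp add: coeff_map_poly act_simps g)

lemma poly_map_poly_act:
  assumes g: "g \<in> \<Gamma>" shows "poly (map_poly g p) (g x) = g (poly p x)"
  by (induction p) (simp_all add: map_poly_pCons act_simps g)

definition inv_poly :: "'a poly \<Rightarrow> bool" where
  "inv_poly p \<longleftrightarrow> (\<forall>i. coeff p i \<in> invs)"

lemma inv_poly_iff: "inv_poly p \<longleftrightarrow> (\<forall>g\<in>\<Gamma>. map_poly g p = p)"
  unfolding inv_poly_def invs_def poly_eq_iff by (auto simp: coeff_map_poly act_zero)

lemma inv_poly_mult: "inv_poly p \<Longrightarrow> inv_poly q \<Longrightarrow> inv_poly (p * q)"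
  by (simp add: inv_poly_iff map_poly_act_mult)

lemma inv_poly_add: "inv_poly p \<Longrightarrow> inv_poly q \<Longrightarrow> inv_poly (p + q)"
  by (simp add: inv_poly_iff map_poly_act_add)

lemma inv_poly_diff: "inv_poly p \<Longrightarrow> inv_poly q \<Longrightarrow> inv_poly (p - q)"
  by (simp add: inv_poly_iff map_poly_act_diff)

lemma inv_poly_pCons: "inv_poly (pCons a p) \<longleftrightarrow> a \<in> invs \<and> inv_poly p"
  unfolding inv_poly_def by (auto simp: coeff_pCons split: nat.splits)

lemma inv_poly_0: "inv_poly 0"
  by (simp add: inv_poly_def invs_zero)

definition primitive :: "'a \<Rightarrow> bool" where
  "primitive \<theta> \<longleftrightarrow> (\<forall>g\<in>\<Gamma>. g \<noteq> id \<longrightarrow> g \<theta> \<noteq> \<theta>)"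

lemma primitiveD: "primitive \<theta> \<Longrightarrow> g \<in> \<Gamma> \<Longrightarrow> g \<noteq> id \<Longrightarrow> g \<theta> \<noteq> \<theta>"
  by (simp add: primitive_def)

lemma discr_primitive: "primitive \<theta> \<Longrightarrow> discr (\<lambda>_. \<theta>) \<noteq> 0"
  by (rule discr_nonzero) (simp add: primitiveD)

definition char_poly_of :: "'a \<Rightarrow> 'a poly" where
  "char_poly_of \<theta> = (\<Prod>g\<in>\<Gamma>. [:- g \<theta>, 1:])"

text \<open>By Lagrange interpolation, this is the polynomial with value \<open>g (s * discr \<theta>)\<close> at each conjugate
  \<open>g \<theta>\<close>; the factor \<open>discr \<theta>\<close> avoids division.\<close>

definition interpolant :: "'a \<Rightarrow> 'a \<Rightarrow> 'a poly" where
  "interpolant \<theta> s = (\<Sum>g\<in>\<Gamma>. Polynomial.smult (g s) (\<Prod>h\<in>\<Gamma> - {g}. [:- h \<theta>, 1:]))"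

lemma inv_poly_char_poly_of: "inv_poly (char_poly_of \<theta>)"
  unfolding inv_poly_iff
proof
  fix g assume g: "g \<in> \<Gamma>"
  have "map_poly g (char_poly_of \<theta>) = (\<Prod>h\<in>\<Gamma>. [:- (g \<circ> h) \<theta>, 1:])"
    by (simp add: char_poly_of_def map_poly_act_prod[OF g] map_poly_pCons act_simps g)
  also have "\<dots> = char_poly_of \<theta>"
    unfolding char_poly_of_def by (rule prod_left_translation[OF g, of "\<lambda>h. [:- h \<theta>, 1:]"])
  finally show "map_poly g (char_poly_of \<theta>) = char_poly_of \<theta>" .
qed

lemma inv_poly_interpolant: "inv_poly (interpolant \<theta> s)"
  unfolding inv_poly_iff
proof
  fix g assume g: "g \<in> \<Gamma>"
  have inner: "(\<Prod>h\<in>\<Gamma> - {k}. [:- (g \<circ> h) \<theta>, 1:]) = (\<Prod>h\<in>\<Gamma> - {g \<circ> k}. [:- h \<theta>, 1:])"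
    if k: "k \<in> \<Gamma>" for k
  proof (rule prod.reindex_bij_betw[where g = "\<lambda>h. [:- h \<theta>, 1:]"])
    have "inj_on (\<lambda>h. g \<circ> h) \<Gamma>" "(\<lambda>h. g \<circ> h) ` \<Gamma> = \<Gamma>"
      using left_translation[OF g] by (auto simp: bij_betw_def)
    then show "bij_betw (\<lambda>h. g \<circ> h) (\<Gamma> - {k}) (\<Gamma> - {g \<circ> k})"
      using k by (auto simp: bij_betw_def inj_on_def image_set_diff)
  qed
  have "map_poly g (interpolant \<theta> s) =
      (\<Sum>k\<in>\<Gamma>. Polynomial.smult ((g \<circ> k) s) (\<Prod>h\<in>\<Gamma> - {k}. [:- (g \<circ> h) \<theta>, 1:]))"
    by (simp add: interpolant_def map_poly_act_sum[OF g] map_poly_act_smult[OF g]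
        map_poly_act_prod[OF g] map_poly_pCons act_simps g)
  also have "\<dots> = (\<Sum>k\<in>\<Gamma>. Polynomial.smult ((g \<circ> k) s) (\<Prod>h\<in>\<Gamma> - {g \<circ> k}. [:- h \<theta>, 1:]))"
    by (rule sum.cong[OF refl]) (simp only: inner)
  also have "\<dots> = interpolant \<theta> s"
    unfolding interpolant_def
    by (rule sum_left_translation[OF g, of "\<lambda>k. Polynomial.smult (k s) (\<Prod>h\<in>\<Gamma> - {k}. [:- h \<theta>, 1:])"])
  finally show "map_poly g (interpolant \<theta> s) = interpolant \<theta> s" .
qed

lemma poly_interpolant: "poly (interpolant \<theta> s) \<theta> = s * discr (\<lambda>_. \<theta>)"
proof -
  have "poly (interpolant \<theta> s) \<theta> = (\<Sum>g\<in>\<Gamma>. g s * (\<Prod>h\<in>\<Gamma> - {g}. \<theta> - h \<theta>))"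
    by (simp add: interpolant_def poly_sum poly_prod)
  also have "\<dots> = (\<Sum>g\<in>\<Gamma>. if g = id then s * discr (\<lambda>_. \<theta>) else 0)"
  proof (rule sum.cong[OF refl])
    fix g assume "g \<in> \<Gamma>"
    have "(\<Prod>h\<in>\<Gamma> - {g}. \<theta> - h \<theta>) = 0" if "g \<noteq> id"
      by (rule prod_zero) (use that id_mem finite_group in \<open>auto intro!: bexI[of _ id]\<close>)
    then show "g s * (\<Prod>h\<in>\<Gamma> - {g}. \<theta> - h \<theta>) = (if g = id then s * discr (\<lambda>_. \<theta>) else 0)"
      by (auto simp: discr_def)
  qed
  also have "\<dots> = s * discr (\<lambda>_. \<theta>)" using finite_group id_mem by simp
  finally show ?thesis .
qed

lemma monic_mult:
  assumes "lead_coeff p = (1::'a)" "lead_coeff q = 1" shows "lead_coeff (p * q) = 1"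
proof -
  have c: "coeff (p * q) (degree p + degree q) = 1" using coeff_mult_degree_sum[of p q] assms by simp
  then have "degree p + degree q \<le> degree (p * q)" by (intro le_degree) simp
  then have "degree (p * q) = degree p + degree q" using degree_mult_le[of p q] by simp
  with c show ?thesis by simp
qed

lemma monic_prod_linear:
  "finite F \<Longrightarrow> lead_coeff (\<Prod>x\<in>F. [:- f x, 1:]) = (1::'a)"
proof (induction F rule: finite_induct)
  case (insert x F)
  then show ?case using monic_mult[of "[:- f x, 1:]" "\<Prod>x\<in>F. [:- f x, 1:]"] by simp
qed simp

lemma monic_cancel:
  assumes "lead_coeff p = (1::'a)" "p * q = 0" shows "q = 0"
  using coeff_mult_degree_sum[of p q] assms by simp

lemma prod_linear_dvd:
  assumes "finite F" "inj_on f F" "\<And>x. x \<in> F \<Longrightarrow> poly q (f x) = (0::'a)"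
  shows "(\<Prod>x\<in>F. [:- f x, 1:]) dvd q"
  using assms
proof (induction F rule: finite_induct)
  case (insert x F)
  then obtain u where u: "q = (\<Prod>x\<in>F. [:- f x, 1:]) * u" by (auto simp: dvd_def)
  have "(\<Prod>y\<in>F. f x - f y) * poly u (f x) = 0"
    using insert.prems(2)[of x] by (simp add: u poly_prod)
  moreover have "(\<Prod>y\<in>F. f x - f y) \<noteq> 0"
    using insert by (intro prod_nonzero) (auto simp: inj_on_def)
  ultimately have "[:- f x, 1:] dvd u" using no_zero_div poly_eq_0_iff_dvd by blast
  then have "(\<Prod>y\<in>F. [:- f y, 1:]) * [:- f x, 1:] dvd q" unfolding u by (intro mult_dvd_mono dvd_refl)
  then show ?case unfolding prod.insert[OF insert.hyps] by (simp only: mult.commute)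
qed simp

text \<open>The polynomial also vanishes at all conjugates of \<open>\<theta>\<close>, which are distinct; the quotient is
  unique, hence invariant.\<close>

lemma vanishing_inv_poly:
  assumes \<theta>: "primitive \<theta>"
    and q: "inv_poly q" "poly q \<theta> = 0"
  obtains u where "q = char_poly_of \<theta> * u" "inv_poly u"
proof -
  have inj: "inj_on (\<lambda>g. g \<theta>) \<Gamma>"
  proof (rule inj_onI)
    fix g h assume gh: "g \<in> \<Gamma>" "h \<in> \<Gamma>" "g \<theta> = h \<theta>"
    from inverse_ex[OF gh(1)] obtain k where k: "k \<in> \<Gamma>" "k \<circ> g = id" "g \<circ> k = id" by blast
    have "(k \<circ> h) \<theta> = \<theta>" using gh(3) k by (metis comp_apply id_apply)
    then have "k \<circ> h = id" using primitiveD[OF \<theta>, of "k \<circ> h"] comp_mem[OF k(1) gh(2)] by blast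
    then show "g = h" using k by (metis comp_id fun.map_comp id_comp)
  qed
  have "poly q (g \<theta>) = 0" if g: "g \<in> \<Gamma>" for g
    using poly_map_poly_act[OF g, of q \<theta>] q g by (simp add: inv_poly_iff act_zero)
  then obtain u where u: "q = char_poly_of \<theta> * u"
    using prod_linear_dvd[OF finite_group inj] unfolding char_poly_of_def by (auto simp: dvd_def)
  have "map_poly g u = u" if g: "g \<in> \<Gamma>" for g
  proof -
    have "char_poly_of \<theta> * (map_poly g u - u) = map_poly g q - q"
      using inv_poly_char_poly_of[of \<theta>] g
      by (simp add: u map_poly_act_mult[OF g] inv_poly_iff algebra_simps)
    also have "\<dots> = 0" using q g by (simp add: inv_poly_iff)
    finally show ?thesis
      using monic_cancel[of "char_poly_of \<theta>"] monic_prod_linear[OF finite_group]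
      unfolding char_poly_of_def by fastforce
  qed
  then show ?thesis using u that by (auto simp: inv_poly_iff)
qed

text \<open>The formal derivative at \<open>\<theta>\<close>, as the linear coefficient of the Taylor expansion.\<close>

definition deriv_at :: "'a \<Rightarrow> 'a poly \<Rightarrow> 'a" where
  "deriv_at \<theta> p = coeff (pcompose p [:\<theta>, 1:]) 1"

lemma coeff_mult_1: "coeff (p * q) (Suc 0) = coeff p 0 * coeff q (Suc 0) + coeff p (Suc 0) * coeff q 0"
  by (simp add: coeff_mult)

lemma deriv_at_mult: "deriv_at \<theta> (p * q) = poly p \<theta> * deriv_at \<theta> q + poly q \<theta> * deriv_at \<theta> p"
  by (simp add: deriv_at_def pcompose_mult coeff_mult_1 mult.commute)

lemma deriv_at_add: "deriv_at \<theta> (p + q) = deriv_at \<theta> p + deriv_at \<theta> q"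
  by (simp add: deriv_at_def pcompose_add)

lemma deriv_at_linear: "deriv_at \<theta> [:a, 1:] = 1" "deriv_at \<theta> [:a:] = 0"
  by (simp_all add: deriv_at_def pcompose_pCons)

lemma deriv_at_char_poly: "deriv_at \<theta> (char_poly_of \<theta>) = discr (\<lambda>_. \<theta>)"
proof -
  have "char_poly_of \<theta> = [:- \<theta>, 1:] * (\<Prod>g\<in>\<Gamma> - {id}. [:- g \<theta>, 1:])"
    unfolding char_poly_of_def using prod.remove[OF finite_group id_mem, of "\<lambda>g. [:- g \<theta>, 1:]"] by simp
  then show ?thesis by (simp only: deriv_at_mult) (simp add: deriv_at_linear poly_prod discr_def)
qed

context
  fixes \<delta> :: "'a \<Rightarrow> 'a"
  assumes \<delta>: "inv_derivation \<delta>"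
begin

lemma delta_add: "a \<in> invs \<Longrightarrow> b \<in> invs \<Longrightarrow> \<delta> (a + b) = \<delta> a + \<delta> b"
  and delta_mult: "a \<in> invs \<Longrightarrow> b \<in> invs \<Longrightarrow> \<delta> (a * b) = a * \<delta> b + b * \<delta> a"
  using \<delta> by (auto simp: inv_derivation_def)

lemma delta_0: "\<delta> 0 = 0"
  using delta_add[of 0 0] invs_zero by simp

definition coeff_deriv_at :: "'a \<Rightarrow> 'a poly \<Rightarrow> 'a" where
  "coeff_deriv_at \<theta> p = poly (map_poly \<delta> p) \<theta>"

lemma coeff_deriv_at_pCons: "coeff_deriv_at \<theta> (pCons a p) = \<delta> a + \<theta> * coeff_deriv_at \<theta> p"
  by (simp add: coeff_deriv_at_def map_poly_pCons delta_0)

lemma coeff_deriv_at_add: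
  assumes "inv_poly p" "inv_poly q"
  shows "coeff_deriv_at \<theta> (p + q) = coeff_deriv_at \<theta> p + coeff_deriv_at \<theta> q"
proof -
  have "map_poly \<delta> (p + q) = map_poly \<delta> p + map_poly \<delta> q"
    using assms by (intro poly_eqI) (simp add: coeff_map_poly delta_0 delta_add inv_poly_def)
  then show ?thesis by (simp add: coeff_deriv_at_def)
qed

lemma coeff_deriv_at_smult:
  assumes "a \<in> invs" "inv_poly q"
  shows "coeff_deriv_at \<theta> (Polynomial.smult a q) = a * coeff_deriv_at \<theta> q + poly q \<theta> * \<delta> a"
  using assms(2)
proof (induction q)
  case 0
  then show ?case by (simp add: coeff_deriv_at_def)
next
  case (pCons b q)
  then show ?case
    by (simp add: inv_poly_pCons coeff_deriv_at_pCons delta_mult assms(1) algebra_simps)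
qed

lemma coeff_deriv_at_mult:
  assumes "inv_poly p" "inv_poly q"
  shows "coeff_deriv_at \<theta> (p * q) = poly p \<theta> * coeff_deriv_at \<theta> q + poly q \<theta> * coeff_deriv_at \<theta> p"
  using assms(1)
proof (induction p)
  case 0
  then show ?case by (simp add: coeff_deriv_at_def)
next
  case (pCons a p)
  then have a: "a \<in> invs" and p: "inv_poly p" by (simp_all add: inv_poly_pCons)
  have "coeff_deriv_at \<theta> (pCons a p * q) =
      coeff_deriv_at \<theta> (Polynomial.smult a q) + coeff_deriv_at \<theta> (pCons 0 (p * q))"
    using a p assms(2) inv_poly_mult[OF p assms(2)]
    by (simp add: coeff_deriv_at_add inv_poly_def invs_mult invs_zero coeff_pCons split: nat.splits)
  then show ?case
    using pCons.IH[OF p] a assms(2)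
    by (simp add: coeff_deriv_at_smult coeff_deriv_at_pCons delta_0 algebra_simps)
qed

text \<open>Up to the factor \<open>discr \<theta>\<close>, the value at \<open>p(\<theta>)\<close> of the extended derivation; the second
  term corrects for the derivative of \<open>\<theta>\<close>, which is forced by the vanishing of the
  characteristic polynomial at \<open>\<theta>\<close>.\<close>

definition extended :: "'a \<Rightarrow> 'a poly \<Rightarrow> 'a" where
  "extended \<theta> p = discr (\<lambda>_. \<theta>) * coeff_deriv_at \<theta> p
     - coeff_deriv_at \<theta> (char_poly_of \<theta>) * deriv_at \<theta> p"

lemma extended_add:
  "inv_poly p \<Longrightarrow> inv_poly q \<Longrightarrow> extended \<theta> (p + q) = extended \<theta> p + extended \<theta> q"
  by (simp add: extended_def coeff_deriv_at_add deriv_at_add algebra_simps)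

lemma extended_mult:
  "inv_poly p \<Longrightarrow> inv_poly q \<Longrightarrow>
    extended \<theta> (p * q) = poly p \<theta> * extended \<theta> q + poly q \<theta> * extended \<theta> p"
  by (simp add: extended_def coeff_deriv_at_mult deriv_at_mult algebra_simps)

text \<open>The difference of the two polynomials is a multiple of the characteristic polynomial.  By the
  product rule it suffices that \<open>extended\<close> vanishes at the latter, where its two terms cancel.\<close>

lemma extended_well_defined:
  assumes \<theta>: "primitive \<theta>"
    and "inv_poly p" "inv_poly q" "poly p \<theta> = poly q \<theta>"
  shows "extended \<theta> p = extended \<theta> q"
proof -
  have d: "inv_poly (p - q)" "poly (p - q) \<theta> = 0" using assms(2-) by (auto simp: inv_poly_diff)
  obtain u where u: "p - q = char_poly_of \<theta> * u" "inv_poly u"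
    using vanishing_inv_poly[OF \<theta> d] by blast
  have "poly (char_poly_of \<theta>) \<theta> = 0"
    unfolding char_poly_of_def poly_prod
    by (rule prod_zero[OF finite_group], rule bexI[OF _ id_mem]) simp
  moreover have "extended \<theta> (char_poly_of \<theta>) = 0"
    by (simp add: extended_def deriv_at_char_poly)
  ultimately have "extended \<theta> (p - q) = 0"
    unfolding u(1) by (simp add: extended_mult[OF inv_poly_char_poly_of u(2)])
  then show ?thesis using extended_add[OF d(1) assms(3)] by simp
qed

text \<open>The quotient rule turns \<^const>\<open>extended\<close> into a derivation of the whole ring, because
  \<open>discr \<theta>\<close> times any element is a polynomial in \<open>\<theta>\<close>.\<close>

lemma extend_derivation_multiple:
  assumes \<theta>: "primitive \<theta>"
  obtains D where "derivation D" "\<And>r. r \<in> invs \<Longrightarrow> D r = discr (\<lambda>_. \<theta>) ^ 3 * \<delta> r"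
proof -
  define d where "d = discr (\<lambda>_. \<theta>)"
  have d0: "d \<noteq> 0" unfolding d_def by (rule discr_primitive[OF \<theta>])
  \<comment> \<open>The numerator of the quotient rule for \<open>s = (s * d) / d\<close>, where both \<open>s * d\<close> and \<open>d\<close> are values of
    interpolants at \<open>\<theta>\<close>.\<close>
  define D where "D s = d * extended \<theta> (interpolant \<theta> s) - d * s * extended \<theta> (interpolant \<theta> 1)" for s
  note inv = inv_poly_interpolant inv_poly_mult inv_poly_add
  have val: "poly (interpolant \<theta> s) \<theta> = s * d" for s by (simp add: poly_interpolant d_def)
  have Dadd: "D (a + b) = D a + D b" for a b
  proof -
    have "extended \<theta> (interpolant \<theta> (a + b)) = extended \<theta> (interpolant \<theta> a + interpolant \<theta> b)"
      by (rule extended_well_defined[OF \<theta>]) (auto simp: inv val algebra_simps)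
    then show ?thesis by (simp add: D_def extended_add inv algebra_simps)
  qed
  have Dmult: "D (a * b) = a * D b + b * D a" for a b
  proof -
    have "extended \<theta> (interpolant \<theta> 1 * interpolant \<theta> (a * b)) =
        extended \<theta> (interpolant \<theta> a * interpolant \<theta> b)"
      by (rule extended_well_defined[OF \<theta>]) (auto simp: inv val algebra_simps)
    then have "d * extended \<theta> (interpolant \<theta> (a * b)) =
        a * d * extended \<theta> (interpolant \<theta> b) + b * d * extended \<theta> (interpolant \<theta> a)
        - a * b * d * extended \<theta> (interpolant \<theta> 1)"
      by (simp add: extended_mult inv val algebra_simps)
    then show ?thesis by (simp add: D_def algebra_simps)
  qed
  have Dinv: "D r = d ^ 3 * \<delta> r" if r: "r \<in> invs" for r
  proof -
    have c: "inv_poly [:r:]" using r by (simp add: inv_poly_pCons inv_poly_0)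
    have "extended \<theta> (interpolant \<theta> r) = extended \<theta> ([:r:] * interpolant \<theta> 1)"
      by (rule extended_well_defined[OF \<theta> inv(1) inv(2)[OF c inv(1)]]) (simp add: val algebra_simps)
    also have "\<dots> = r * extended \<theta> (interpolant \<theta> 1) + d * (d * \<delta> r)"
      using extended_mult[OF c inv_poly_interpolant, of \<theta> \<theta> 1]
      by (simp add: val extended_def[of \<theta> "[:r:]"] coeff_deriv_at_pCons deriv_at_linear d_def
          coeff_deriv_at_def[of \<theta> 0])
    finally show ?thesis by (simp add: D_def power3_eq_cube algebra_simps)
  qed
  show ?thesis
    by (rule that[of D]) (auto simp: derivation_def Dadd Dmult Dinv d_def[symmetric])
qed

end

end

text \<open>For a linear group, \<open>v g\<close> and \<open>w g\<close> will be linear forms; the differences \<open>v g - g (v g)\<close> and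
  \<open>w g - g (w g)\<close> are then linear forms vanishing on the fixed space of \<open>g\<close> in the dual space, and
  they can be chosen independent, hence coprime, unless \<open>g\<close> is a pseudo-reflection.\<close>

locale small_ring_action = finite_ring_action +
  fixes v w :: "('a \<Rightarrow> 'a) \<Rightarrow> 'a"
  assumes moved: "g \<in> \<Gamma> \<Longrightarrow> g \<noteq> id \<Longrightarrow> v g - g (v g) \<noteq> 0" "g \<in> \<Gamma> \<Longrightarrow> g \<noteq> id \<Longrightarrow> w g - g (w g) \<noteq> 0"
    and regular: "g \<in> \<Gamma> \<Longrightarrow> g \<noteq> id \<Longrightarrow> (v g - g (v g)) * a = (w g - g (w g)) * b \<Longrightarrow> v g - g (v g) dvd b"
    and infinite_invs: "infinite {a. \<forall>g\<in>\<Gamma>. g a = a}"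
begin

lemma regular_squares:
  assumes reg: "\<And>a b. (u::'a) * a = z * b \<Longrightarrow> u dvd b" and nz: "u \<noteq> 0" and eq: "u\<^sup>2 * a = z\<^sup>2 * b"
  shows "u\<^sup>2 dvd b"
proof -
  have reg2: "u dvd b" if "u * a = z\<^sup>2 * b" for a b
  proof -
    from that have "u dvd z * b" by (intro reg[of a]) (simp add: power2_eq_square mult.assoc)
    then obtain c where "u * c = z * b" by (auto simp: dvd_def)
    then show ?thesis by (rule reg)
  qed
  have "u dvd b" using eq by (intro reg2[of "u * a"]) (simp add: power2_eq_square mult.assoc)
  then obtain b' where b: "b = u * b'" by (auto simp: dvd_def)
  have "u * (u * a) = u * (z\<^sup>2 * b')" using eq by (simp add: b power2_eq_square ac_simps)
  then have "u * a = z\<^sup>2 * b'" using cancel[OF nz] by blast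
  from reg2[OF this] show ?thesis by (simp add: b power2_eq_square mult_dvd_mono)
qed

text \<open>The factors of the discriminants can be cleared from the fraction \<open>x / d\<close> one at a time, because
  each of them occurs in two versions without common factor.\<close>

lemma descent_aux:
  assumes "finite F" "F \<subseteq> \<Gamma> - {id}" "d \<noteq> 0"
    and "\<And>c. (\<And>g. c g = v g \<or> c g = w g) \<Longrightarrow> d dvd (\<Prod>g\<in>F. c g - g (c g))\<^sup>2 * x"
  shows "d dvd x"
  using assms(1,2,4)
proof (induction F arbitrary: x rule: finite_induct)
  case empty
  from empty.prems(2)[of v] show ?case by simp
next
  case (insert k F)
  have k: "k \<in> \<Gamma>" "k \<noteq> id" using insert.prems by auto
  show ?case
  proof (rule insert.IH)
    show "F \<subseteq> \<Gamma> - {id}" using insert.prems(1) by blast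
    fix c assume c: "\<And>g. c g = v g \<or> c g = w g"
    define y where "y = (\<Prod>g\<in>F. c g - g (c g))\<^sup>2 * x"
    have P: "(\<Prod>g\<in>insert k F. (c(k := z)) g - g ((c(k := z)) g)) = (z - k z) * (\<Prod>g\<in>F. c g - g (c g))" for z
    proof -
      have "(\<Prod>g\<in>F. (c(k := z)) g - g ((c(k := z)) g)) = (\<Prod>g\<in>F. c g - g (c g))"
        using insert.hyps by (intro prod.cong) auto
      then show ?thesis using insert.hyps by simp
    qed
    have "d dvd (v k - k (v k))\<^sup>2 * y" "d dvd (w k - k (w k))\<^sup>2 * y"
      using insert.prems(2)[of "c(k := v k)"] insert.prems(2)[of "c(k := w k)"] c
      unfolding P by (auto simp: y_def power_mult_distrib mult.assoc)
    then obtain p q where pq: "(v k - k (v k))\<^sup>2 * y = d * p" "(w k - k (w k))\<^sup>2 * y = d * q"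
      by (auto simp: dvd_def)
    have "d * ((v k - k (v k))\<^sup>2 * q) = d * ((w k - k (w k))\<^sup>2 * p)"
      by (metis pq mult.left_commute)
    then have "(v k - k (v k))\<^sup>2 * q = (w k - k (w k))\<^sup>2 * p" using cancel[OF assms(3)] by blast
    then have "(v k - k (v k))\<^sup>2 dvd p"
      by (intro regular_squares[OF regular[OF k] moved(1)[OF k]])
    then obtain p' where "p = (v k - k (v k))\<^sup>2 * p'" by (auto simp: dvd_def)
    then have "(v k - k (v k))\<^sup>2 * y = (v k - k (v k))\<^sup>2 * (d * p')" using pq(1) by (simp add: ac_simps)
    then show "d dvd (\<Prod>g\<in>F. c g - g (c g))\<^sup>2 * x"
      using cancel[OF power_nonzero[OF moved(1)[OF k]]] unfolding y_def by (metis dvd_triv_left)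
  qed
qed

lemma descent:
  assumes "d \<noteq> 0" and "\<And>c. (\<And>g. c g = v g \<or> c g = w g) \<Longrightarrow> d dvd (discr c)\<^sup>2 * x"
  shows "d dvd x"
  by (rule descent_aux[of "\<Gamma> - {id}"]) (use assms finite_group in \<open>auto simp: discr_def\<close>)

text \<open>The inverse different is trivial: over the fraction field, \<open>trace_expansion\<close> represents the
  functional by the trace against some \<open>l\<close>, and the product of \<open>l\<close> with \<open>discr c\<close> lies in the ring for
  every \<open>c\<close>, so that \<open>descent\<close> removes the denominator of \<open>l\<close>.\<close>

theorem functional_is_trace:
  assumes add: "\<And>a b. \<mu> (a + b) = \<mu> a + \<mu> b"
    and smult: "\<And>r a. r \<in> invs \<Longrightarrow> \<mu> (r * a) = r * \<mu> a"
    and closed: "\<And>a. \<mu> a \<in> invs"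
  obtains l where "\<And>a. \<mu> a = tr (l * a)"
proof -
  have sum: "\<mu> (\<Sum>i<n. f i) = (\<Sum>i<n. \<mu> (f i))" for n :: nat and f
    using add[of 0 0] by (induction n) (simp_all add: add)
  obtain c where c: "discr c \<noteq> 0" using discr_nonzero_ex by blast
  obtain s t n where sep: "\<And>h. h \<in> \<Gamma> \<Longrightarrow> (\<Sum>i<n::nat. h (s i) * t i) = (if h = id then discr c else 0)"
    by (rule separating[of c], rule that)
  \<comment> \<open>The other conjugates of the discriminant make it invariant, so that it passes through \<open>\<mu>\<close>.\<close>
  define e' where "e' = (\<Prod>g\<in>\<Gamma> - {id}. g (discr c))"
  define N where "N = discr c * e'"
  have N_eq: "N = (\<Prod>g\<in>\<Gamma>. g (discr c))"
    unfolding N_def e'_def using prod.remove[OF finite_group id_mem, of "\<lambda>g. g (discr c)"] by simp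
  have N_inv: "N \<in> invs" unfolding N_eq by (rule norm_invs)
  have N0: "N \<noteq> 0" unfolding N_eq
    by (rule prod_nonzero[OF finite_group]) (metis act_inj act_zero c)
  define l' where "l' = (\<Sum>i<n. \<mu> (s i) * (t i * e'))"
  have l': "N * \<mu> a = tr (l' * a)" for a
  proof -
    have "N * a = (\<Sum>i<n. tr (t i * (e' * a)) * s i)"
      using trace_expansion[OF sep, of "e' * a"] by (simp add: N_def mult.assoc mult.commute)
    then have "\<mu> (N * a) = (\<Sum>i<n. tr (t i * (e' * a)) * \<mu> (s i))"
      by (simp add: sum smult tr_invs)
    also have "\<dots> = tr (l' * a)"
      unfolding l'_def sum_distrib_right tr_sum
      by (intro sum.cong) (simp_all add: mult.assoc tr_smult[OF closed] mult.commute[of _ "\<mu> _"])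
    finally show ?thesis using smult[OF N_inv] by simp
  qed
  have "N dvd l'"
  proof (rule descent[OF N0])
    fix c
    obtain s t n where sep: "\<And>h. h \<in> \<Gamma> \<Longrightarrow> (\<Sum>i<n::nat. h (s i) * t i) = (if h = id then discr c else 0)"
      by (rule separating[of c], rule that)
    have "N * (\<Sum>i<n. t i * \<mu> (s i)) = (\<Sum>i<n. t i * tr (l' * s i))"
      unfolding sum_distrib_left by (simp only: l' mult.left_commute[of N])
    also have "\<dots> = (\<Sum>h\<in>\<Gamma>. h l' * (\<Sum>i<n. h (s i) * t i))"
      unfolding tr_def sum_distrib_left
      by (subst sum.swap) (simp add: act_simps ac_simps)
    also have "\<dots> = (\<Sum>h\<in>\<Gamma>. if h = id then l' * discr c else 0)"
      by (rule sum.cong[OF refl]) (simp add: sep)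
    also have "\<dots> = l' * discr c" by (simp only: sum.delta[OF finite_group] id_mem if_True)
    finally have "N dvd discr c * l'" by (metis dvd_triv_left mult.commute)
    then have "N dvd discr c * (discr c * l')" by (rule dvd_mult)
    then show "N dvd (discr c)\<^sup>2 * l'" by (simp add: power2_eq_square mult.assoc)
  qed
  then obtain l where l: "l' = N * l" by (auto simp: dvd_def)
  have "\<mu> a = tr (l * a)" for a
    using l'[of a] cancel[OF N0] by (simp add: l mult.assoc tr_smult[OF N_inv])
  then show ?thesis by (rule that)
qed

text \<open>Only finitely many invariants \<open>r\<close> are bad for \<open>\<theta> + r * v k\<close>, so the automorphisms can be
  dealt with one after the other.\<close>

lemma primitive_ex:
  obtains \<theta> where "primitive \<theta>"
proof -
  have "\<exists>\<theta>. \<forall>g\<in>F. g \<theta> \<noteq> \<theta>" if "finite F" "F \<subseteq> \<Gamma> - {id}" for F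
    using that
  proof (induction F rule: finite_induct)
    case (insert k F)
    then obtain \<theta> where \<theta>: "\<And>g. g \<in> F \<Longrightarrow> g \<theta> \<noteq> \<theta>" by auto
    have k: "k \<in> \<Gamma>" "k \<noteq> id" using insert.prems by auto
    have sub: "insert k F \<subseteq> \<Gamma>" using insert.prems by auto
    have vk: "k (v k) \<noteq> v k" using moved(1)[OF k] by auto
    define bad where "bad g = {r \<in> invs. g (\<theta> + r * v k) = \<theta> + r * v k}" for g
    have bad_eq: "g (\<theta> + r * v k) = \<theta> + r * v k \<longleftrightarrow> r * (g (v k) - v k) = \<theta> - g \<theta>"
      if "g \<in> insert k F" "r \<in> invs" for g r
      using that sub by (auto simp: act_simps invsD subset_iff algebra_simps)
    have "finite (bad g)" if g: "g \<in> insert k F" for g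
    proof (cases "g (v k) = v k")
      case True
      then have "g \<noteq> k" using vk by auto
      with g have "g \<theta> \<noteq> \<theta>" using \<theta> by blast
      then have "bad g = {}" using bad_eq[OF g] True by (auto simp: bad_def)
      then show ?thesis by simp
    next
      case False
      have "r = r'" if "r \<in> bad g" "r' \<in> bad g" for r r'
      proof -
        have "(g (v k) - v k) * r = (g (v k) - v k) * r'"
          using that bad_eq[OF g] by (auto simp: bad_def mult.commute)
        then show ?thesis using False cancel by (metis right_minus_eq)
      qed
      then show ?thesis by (metis finite.emptyI finite.insertI finite_subset insertI1 subsetI all_not_in_conv)
    qed
    then have "finite (\<Union>g\<in>insert k F. bad g)" using insert.hyps by blast
    then have "infinite (invs - (\<Union>g\<in>insert k F. bad g))"
      using infinite_invs by (simp add: invs_def Diff_infinite_finite)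
    then obtain r where "r \<in> invs - (\<Union>g\<in>insert k F. bad g)" using infinite_imp_nonempty by blast
    then show ?case by (intro exI[of _ "\<theta> + r * v k"]) (auto simp: bad_def)
  qed auto
  from this[of "\<Gamma> - {id}"] show ?thesis
    using finite_group that by (auto simp: primitive_def)
qed

text \<open>A nonzero multiple of the derivation extends.  By \<open>derivation_from_invariants\<close>, its products
  with all squares \<open>(discr c)\<^sup>2\<close> are expressed by values on invariants, which are divisible by
  that multiple; now \<open>descent\<close> applies.\<close>

theorem extend_derivation:
  assumes \<delta>: "inv_derivation \<delta>"
  obtains D where "derivation D" "\<And>r. r \<in> invs \<Longrightarrow> D r = \<delta> r"
proof -
  obtain \<theta> where \<theta>: "primitive \<theta>" using primitive_ex by blast
  define d where "d = discr (\<lambda>_. \<theta>) ^ 3"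
  have d0: "d \<noteq> 0"
    unfolding d_def by (intro power_nonzero discr_primitive \<theta>)
  obtain E where E: "derivation E" "\<And>r. r \<in> invs \<Longrightarrow> E r = d * \<delta> r"
    using extend_derivation_multiple[OF \<delta> \<theta>] unfolding d_def by blast
  have "d dvd E a" for a
  proof (rule descent[OF d0])
    fix c
    obtain s t n where sep: "\<And>h. h \<in> \<Gamma> \<Longrightarrow> (\<Sum>i<n::nat. h (s i) * t i) = (if h = id then discr c else 0)"
      by (rule separating[of c], rule that)
    have *: "d dvd (\<Sum>i<n. \<Sum>j<n. t i * t j * E (tr (s i * s j * a)))" for a
      by (intro dvd_sum) (simp add: E(2) tr_invs)
    have eq: "(discr c)\<^sup>2 * E a = (\<Sum>i<n. \<Sum>j<n. t i * t j * E (tr (s i * s j * a)))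
        - a * (\<Sum>i<n. \<Sum>j<n. t i * t j * E (tr (s i * s j * 1)))"
      by (rule derivation_from_invariants[OF E(1) sep])
    then show "d dvd (discr c)\<^sup>2 * E a"
      unfolding eq by (intro dvd_diff dvd_mult *)
  qed
  then have "\<forall>a. \<exists>b. E a = d * b" by (auto simp: dvd_def)
  then obtain D where D: "\<And>a. E a = d * D a" by metis
  have "D (a + b) = D a + D b" "D (a * b) = a * D b + b * D a" for a b
  proof -
    have "d * D (a + b) = d * (D a + D b)" "d * D (a * b) = d * (a * D b + b * D a)"
      using E(1) by (auto simp: derivation_def D[symmetric] algebra_simps)
    then show "D (a + b) = D a + D b" "D (a * b) = a * D b + b * D a" using cancel[OF d0] by blast+
  qed
  moreover have "D r = \<delta> r" if "r \<in> invs" for r using E(2)[OF that] D cancel[OF d0] by simp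
  ultimately show ?thesis by (intro that[of D]) (auto simp: derivation_def)
qed

end

section \<open>Semilinear representations\<close>

definition pairing :: "'x set \<Rightarrow> ('x \<Rightarrow> 'a::comm_ring_1) \<Rightarrow> ('x \<Rightarrow> 'a) \<Rightarrow> 'a" where
  "pairing X a b = (\<Sum>x\<in>X. a x * b x)"

lemma pairing_add: "pairing X (\<lambda>x. a x + a' x) b = pairing X a b + pairing X a' b"
    "pairing X a (\<lambda>x. b x + b' x) = pairing X a b + pairing X a b'"
  and pairing_smult: "pairing X (\<lambda>x. r * a x) b = r * pairing X a b"
    "pairing X a (\<lambda>x. r * b x) = r * pairing X a b"
  by (simp_all add: pairing_def sum.distrib algebra_simps sum_distrib_left)

lemma pairing_sum:
  "pairing X (\<lambda>x. \<Sum>i\<in>I. a i x) b = (\<Sum>i\<in>I. pairing X (a i) b)"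
  "pairing X b (\<lambda>x. \<Sum>i\<in>I. a i x) = (\<Sum>i\<in>I. pairing X b (a i))"
  unfolding pairing_def sum_distrib_right sum_distrib_left by (rule sum.swap)+

lemma pairing_commute: "pairing X a b = pairing X b a"
  by (simp add: pairing_def mult.commute)

text \<open>The group acts on \<open>S\<^sup>X\<close> semilinearly through a matrix representation \<open>\<rho>\<close> with invariant
  entries.  For \<open>Sym\<^sup>q F\<close> the entries are constants; the general form has the advantage that the
  contragredient representation is of the same kind.\<close>

locale semilinear_rep = small_ring_action \<Gamma> v w
  for \<Gamma> :: "('a::comm_ring_1 \<Rightarrow> 'a) set" and v w +
  fixes X :: "'x set" and \<rho> :: "('a \<Rightarrow> 'a) \<Rightarrow> 'x \<Rightarrow> 'x \<Rightarrow> 'a"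
  assumes finite_index: "finite X"
    and rho_invs: "g \<in> \<Gamma> \<Longrightarrow> \<rho> g x y \<in> invs"
    and rho_id: "x \<in> X \<Longrightarrow> y \<in> X \<Longrightarrow> \<rho> id x y = (if x = y then 1 else 0)"
    and rho_comp: "g \<in> \<Gamma> \<Longrightarrow> h \<in> \<Gamma> \<Longrightarrow> x \<in> X \<Longrightarrow> z \<in> X \<Longrightarrow> \<rho> (g \<circ> h) x z = (\<Sum>y\<in>X. \<rho> g x y * \<rho> h y z)"
    and card_unit: "\<exists>c\<in>invs. c * of_nat (card \<Gamma>) = 1"
begin

definition act :: "('a \<Rightarrow> 'a) \<Rightarrow> ('x \<Rightarrow> 'a) \<Rightarrow> 'x \<Rightarrow> 'a" where
  "act g b x = (if x \<in> X then \<Sum>y\<in>X. \<rho> g x y * g (b y) else 0)"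

definition fixed :: "('x \<Rightarrow> 'a) set" where
  "fixed = {b. \<forall>g\<in>\<Gamma>. act g b = b}"

lemma fixedD: "b \<in> fixed \<Longrightarrow> g \<in> \<Gamma> \<Longrightarrow> act g b = b"
  by (simp add: fixed_def)

lemma fixed_outside: "b \<in> fixed \<Longrightarrow> x \<notin> X \<Longrightarrow> b x = 0"
  using fixedD[OF _ id_mem] act_def by metis

lemma act_add: "g \<in> \<Gamma> \<Longrightarrow> act g (\<lambda>x. a x + b x) = (\<lambda>x. act g a x + act g b x)"
  by (auto simp: act_def fun_eq_iff act_simps algebra_simps sum.distrib)

lemma act_smult: "g \<in> \<Gamma> \<Longrightarrow> act g (\<lambda>x. r * a x) = (\<lambda>x. g r * act g a x)"
  by (auto simp: act_def fun_eq_iff act_simps sum_distrib_left algebra_simps)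

lemma act_zero_vec: "g \<in> \<Gamma> \<Longrightarrow> act g (\<lambda>x. 0) = (\<lambda>x. 0)"
  by (auto simp: act_def fun_eq_iff act_simps)

lemma act_sum_vec: "g \<in> \<Gamma> \<Longrightarrow> act g (\<lambda>x. \<Sum>i\<in>I. a i x) = (\<lambda>x. \<Sum>i\<in>I. act g (a i) x)"
  by (induction I rule: infinite_finite_induct) (simp_all add: act_zero_vec act_add)

lemma act_act: assumes "g \<in> \<Gamma>" "h \<in> \<Gamma>" shows "act g (act h b) = act (g \<circ> h) b"
proof
  fix x
  have "(\<Sum>y\<in>X. \<rho> g x y * (\<Sum>z\<in>X. \<rho> h y z * g (h (b z)))) = (\<Sum>z\<in>X. \<rho> (g \<circ> h) x z * g (h (b z)))"
    if "x \<in> X"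
    unfolding sum_distrib_left
    by (subst sum.swap) (use that in \<open>simp add: rho_comp assms sum_distrib_right mult.assoc\<close>)
  then show "act g (act h b) x = act (g \<circ> h) b x"
    using assms by (simp add: act_def act_simps invsD[OF rho_invs])
qed

lemma fixed_add: "a \<in> fixed \<Longrightarrow> b \<in> fixed \<Longrightarrow> (\<lambda>x. a x + b x) \<in> fixed"
  by (simp add: fixed_def act_add)

lemma fixed_smult: "r \<in> invs \<Longrightarrow> b \<in> fixed \<Longrightarrow> (\<lambda>x. r * b x) \<in> fixed"
  by (simp add: fixed_def act_smult invsD)

lemma fixed_zero: "(\<lambda>x. 0) \<in> fixed"
  by (simp add: fixed_def act_zero_vec)

lemma fixed_sum: "(\<And>i. i \<in> I \<Longrightarrow> f i \<in> fixed) \<Longrightarrow> (\<lambda>x. \<Sum>i\<in>I. f i x) \<in> fixed"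
  by (induction I rule: infinite_finite_induct) (simp_all add: fixed_zero fixed_add)

definition trace_vec :: "('x \<Rightarrow> 'a) \<Rightarrow> 'x \<Rightarrow> 'a" where
  "trace_vec b = (\<lambda>x. \<Sum>g\<in>\<Gamma>. act g b x)"

lemma trace_vec_fixed: "trace_vec b \<in> fixed"
proof -
  have "act g (trace_vec b) = trace_vec b" if g: "g \<in> \<Gamma>" for g
    using sum_left_translation[OF g, of "\<lambda>k. act k b x" for x]
    by (simp add: trace_vec_def act_sum_vec[OF g] act_act[OF g])
  then show ?thesis by (simp add: fixed_def)
qed

lemma trace_vec_add: "trace_vec (\<lambda>x. a x + b x) = (\<lambda>x. trace_vec a x + trace_vec b x)"
  by (simp add: trace_vec_def act_add sum.distrib)

lemma trace_vec_smult: "r \<in> invs \<Longrightarrow> trace_vec (\<lambda>x. r * b x) = (\<lambda>x. r * trace_vec b x)"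
  by (simp add: trace_vec_def act_smult invsD sum_distrib_left)

lemma trace_vec_of_fixed: "b \<in> fixed \<Longrightarrow> trace_vec b = (\<lambda>x. of_nat (card \<Gamma>) * b x)"
  by (simp add: trace_vec_def fixed_def)

definition unit_vec_of :: "'a \<Rightarrow> 'x \<Rightarrow> 'x \<Rightarrow> 'a" where
  "unit_vec_of s y = (\<lambda>x. if x = y then s else 0)"

lemma act_unit_vec:
  "g \<in> \<Gamma> \<Longrightarrow> y \<in> X \<Longrightarrow> act g (unit_vec_of s y) x = (if x \<in> X then \<rho> g x y * g s else 0)"
proof -
  assume g: "g \<in> \<Gamma>" and y: "y \<in> X"
  have "(\<Sum>z\<in>X. \<rho> g x z * g (unit_vec_of s y z)) = (\<Sum>z\<in>X. if z = y then \<rho> g x y * g s else 0)"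
    by (rule sum.cong[OF refl]) (simp add: unit_vec_of_def act_zero g)
  then show ?thesis using y finite_index by (simp add: act_def)
qed

lemma decompose: "(\<And>x. x \<notin> X \<Longrightarrow> b x = 0) \<Longrightarrow> b = (\<lambda>x. \<Sum>y\<in>X. unit_vec_of (b y) y x)"
  using finite_index by (auto simp: unit_vec_of_def fun_eq_iff)

definition dual_rho :: "('a \<Rightarrow> 'a) \<Rightarrow> 'x \<Rightarrow> 'x \<Rightarrow> 'a" where
  "dual_rho g x y = \<rho> (inv_into UNIV g) y x"

lemma inverse: assumes "g \<in> \<Gamma>" shows "inv_into UNIV g \<in> \<Gamma>" "inv_into UNIV g \<circ> g = id" "g \<circ> inv_into UNIV g = id" "bij g"
proof -
  from inverse_ex[OF assms] obtain k where k: "k \<in> \<Gamma>" "k \<circ> g = id" "g \<circ> k = id" by blast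
  have "bij g" using k o_bij by blast
  moreover have "inv_into UNIV g = k" using k by (metis comp_id inv_unique_comp)
  ultimately show "inv_into UNIV g \<in> \<Gamma>" "inv_into UNIV g \<circ> g = id" "g \<circ> inv_into UNIV g = id" "bij g" using k by auto
qed

lemma dual: "semilinear_rep \<Gamma> v w X dual_rho"
proof (unfold_locales)
  show "finite X" by (rule finite_index)
  show "dual_rho g x y \<in> invs" if "g \<in> \<Gamma>" for g x y
    using that by (simp add: dual_rho_def rho_invs inverse)
  show "dual_rho id x y = (if x = y then 1 else 0)" if "x \<in> X" "y \<in> X" for x y
    using that rho_id[of y x] by (auto simp: dual_rho_def)
  show "dual_rho (g \<circ> h) x z = (\<Sum>y\<in>X. dual_rho g x y * dual_rho h y z)"
    if "g \<in> \<Gamma>" "h \<in> \<Gamma>" "x \<in> X" "z \<in> X" for g h x z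
    using that inverse[of g] inverse[of h]
    by (simp add: dual_rho_def o_inv_distrib rho_comp mult.commute)
  show "\<exists>c\<in>invs. c * of_nat (card \<Gamma>) = 1" by (rule card_unit)
qed

lemma pairing_act:
  assumes g: "g \<in> \<Gamma>"
  shows "pairing X (semilinear_rep.act X dual_rho g a) (act g b) = g (pairing X a b)"
proof -
  interpret D: semilinear_rep \<Gamma> v w X dual_rho by (rule dual)
  have orth: "(\<Sum>x\<in>X. \<rho> (inv_into UNIV g) y x * \<rho> g x z) = (if y = z then 1 else 0)" if "y \<in> X" "z \<in> X" for y z
    using rho_comp[of "inv_into UNIV g" g y z] that inverse[OF g] g rho_id by simp
  have "pairing X (D.act g a) (act g b) =
      (\<Sum>x\<in>X. \<Sum>y\<in>X. \<Sum>z\<in>X. (\<rho> (inv_into UNIV g) y x * \<rho> g x z) * (g (a y) * g (b z)))"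
    unfolding pairing_def
  proof (rule sum.cong[OF refl])
    fix x assume "x \<in> X"
    then show "D.act g a x * act g b x =
        (\<Sum>y\<in>X. \<Sum>z\<in>X. (\<rho> (inv_into UNIV g) y x * \<rho> g x z) * (g (a y) * g (b z)))"
      by (simp only: D.act_def act_def if_True sum_product dual_rho_def) (simp only: ac_simps)
  qed
  also have "\<dots> = (\<Sum>y\<in>X. \<Sum>z\<in>X. (\<Sum>x\<in>X. \<rho> (inv_into UNIV g) y x * \<rho> g x z) * (g (a y) * g (b z)))"
    unfolding sum_distrib_right
    by (subst sum.swap, rule sum.cong[OF refl], rule sum.swap)
  also have "\<dots> = (\<Sum>y\<in>X. \<Sum>z\<in>X. if y = z then g (a y) * g (b z) else 0)"
    by (intro sum.cong refl) (simp add: orth)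
  also have "\<dots> = g (pairing X a b)"
    using g finite_index by (simp add: pairing_def act_simps)
  finally show ?thesis .
qed

definition dual_fixed :: "('x \<Rightarrow> 'a) set" where
  "dual_fixed = semilinear_rep.fixed \<Gamma> X dual_rho"

lemma pairing_invs:
  assumes "a \<in> dual_fixed" "b \<in> fixed" shows "pairing X a b \<in> invs"
proof -
  interpret D: semilinear_rep \<Gamma> v w X dual_rho by (rule dual)
  have "g (pairing X a b) = pairing X a b" if "g \<in> \<Gamma>" for g
    using pairing_act[OF that, of a b] assms that by (simp add: dual_fixed_def D.fixedD fixedD)
  then show ?thesis by (simp add: invs_def)
qed

text \<open>Invariance of the pairing under the simultaneous action makes all the summands equal.\<close>

lemma pairing_dual_trace_vec:
  assumes "b \<in> fixed" "pairing X a b \<in> invs"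
  shows "pairing X (semilinear_rep.trace_vec \<Gamma> X dual_rho a) b = of_nat (card \<Gamma>) * pairing X a b"
proof -
  interpret D: semilinear_rep \<Gamma> v w X dual_rho by (rule dual)
  have "pairing X (D.act g a) b = pairing X a b" if g: "g \<in> \<Gamma>" for g
    using pairing_act[OF g, of a b] fixedD[OF assms(1) g] invsD[OF assms(2) g] by simp
  then show ?thesis by (simp add: D.trace_vec_def pairing_sum)
qed

text \<open>Averaging over the contragredient action does not change those values that are invariant
  already.\<close>

lemma average_functional:
  assumes "\<And>b. b \<in> B \<Longrightarrow> b \<in> fixed" "\<And>b. b \<in> B \<Longrightarrow> pairing X a b \<in> invs"
  obtains a' where "a' \<in> dual_fixed" "\<And>b. b \<in> B \<Longrightarrow> pairing X a' b = pairing X a b"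
proof -
  interpret D: semilinear_rep \<Gamma> v w X dual_rho by (rule dual)
  obtain c where c: "c \<in> invs" "c * of_nat (card \<Gamma>) = 1" using card_unit by blast
  define a' where "a' = (\<lambda>x. c * D.trace_vec a x)"
  have "a' \<in> dual_fixed" unfolding dual_fixed_def a'_def by (rule D.fixed_smult[OF c(1) D.trace_vec_fixed])
  moreover have "pairing X a' b = pairing X a b" if b: "b \<in> B" for b
    using pairing_dual_trace_vec[OF assms(1)[OF b] assms(2)[OF b]] c(2)
    by (simp add: a'_def pairing_smult mult.assoc[symmetric])
  ultimately show ?thesis by (rule that)
qed

lemma dual_dual_fixed: "semilinear_rep.dual_fixed \<Gamma> X dual_rho = fixed"
proof -
  interpret D: semilinear_rep \<Gamma> v w X dual_rho by (rule dual)
  interpret DD: semilinear_rep \<Gamma> v w X D.dual_rho by (rule D.dual)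
  have "DD.act g b = act g b" if "g \<in> \<Gamma>" for g b
  proof
    have ii: "inv_into UNIV (inv_into UNIV g) = g" by (rule inv_inv_eq[OF inverse(4)[OF that]])
    show "DD.act g b x = act g b x" for x
      by (simp add: DD.act_def act_def D.dual_rho_def dual_rho_def ii)
  qed
  then show ?thesis by (auto simp: D.dual_fixed_def DD.fixed_def fixed_def)
qed

text \<open>Composing \<open>\<phi>\<close> with the trace of \<open>s\<close> times a unit vector gives functionals on \<open>S\<close>, which are of the
  form \<open>functional_is_trace\<close>.  On a fixed vector the trace is multiplication by the invertible group
  order, hence these functionals determine \<open>\<phi>\<close>.\<close>

theorem functional_on_fixed:
  assumes add: "\<And>a b. a \<in> fixed \<Longrightarrow> b \<in> fixed \<Longrightarrow> \<phi> (\<lambda>x. a x + b x) = \<phi> a + \<phi> b"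
    and smult: "\<And>r b. r \<in> invs \<Longrightarrow> b \<in> fixed \<Longrightarrow> \<phi> (\<lambda>x. r * b x) = r * \<phi> b"
    and closed: "\<And>b. b \<in> fixed \<Longrightarrow> \<phi> b \<in> invs"
  obtains a where "a \<in> dual_fixed" "\<And>b. b \<in> fixed \<Longrightarrow> \<phi> b = pairing X a b"
proof -
  obtain c where c: "c \<in> invs" "c * of_nat (card \<Gamma>) = 1" using card_unit by blast
  have zero: "\<phi> (\<lambda>x. 0) = 0" using add[OF fixed_zero fixed_zero] by simp
  have sum: "\<phi> (\<lambda>x. \<Sum>i\<in>I. f i x) = (\<Sum>i\<in>I. \<phi> (f i))" if "\<And>i. i \<in> I \<Longrightarrow> f i \<in> fixed"
    for I :: "'x set" and f
    using that by (induction I rule: infinite_finite_induct) (simp_all add: zero add fixed_sum)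
  define T where "T y s = trace_vec (unit_vec_of s y)" for y s
  have T_add: "T y (s + t) = (\<lambda>x. T y s x + T y t x)" for y s t
    unfolding T_def trace_vec_add[symmetric] by (rule arg_cong[of _ _ trace_vec]) (auto simp: unit_vec_of_def)
  have T_smult: "T y (r * s) = (\<lambda>x. r * T y s x)" if "r \<in> invs" for y r s
    unfolding T_def trace_vec_smult[OF that, symmetric]
    by (rule arg_cong[of _ _ trace_vec]) (auto simp: unit_vec_of_def)
  have T_fixed: "T y s \<in> fixed" for y s by (simp add: T_def trace_vec_fixed)
  have "\<exists>l. \<forall>s. \<phi> (T y s) = tr (l * s)" if y: "y \<in> X" for y
  proof -
    have "\<phi> (T y (a + b)) = \<phi> (T y a) + \<phi> (T y b)" for a b
      by (simp add: T_add add T_fixed)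
    moreover have "\<phi> (T y (r * a)) = r * \<phi> (T y a)" if "r \<in> invs" for r a
      by (simp add: T_smult that smult T_fixed)
    moreover have "\<phi> (T y a) \<in> invs" for a by (simp add: closed T_fixed)
    ultimately show ?thesis using functional_is_trace[of "\<lambda>s. \<phi> (T y s)"] by metis
  qed
  then obtain l where l: "\<And>y s. y \<in> X \<Longrightarrow> \<phi> (T y s) = tr (l y * s)" by metis
  interpret D: semilinear_rep \<Gamma> v w X dual_rho by (rule dual)
  define a where "a = (\<lambda>x. c * D.trace_vec l x)"
  have "a \<in> dual_fixed" unfolding dual_fixed_def a_def by (rule D.fixed_smult[OF c(1) D.trace_vec_fixed])
  moreover have "\<phi> b = pairing X a b" if b: "b \<in> fixed" for b
  proof -
    have "(\<lambda>x. of_nat (card \<Gamma>) * b x) = (\<lambda>x. \<Sum>y\<in>X. T y (b y) x)"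
    proof -
      have "trace_vec b = trace_vec (\<lambda>x. \<Sum>y\<in>X. unit_vec_of (b y) y x)"
        using decompose[of b] fixed_outside[OF b] by metis
      also have "\<dots> = (\<lambda>x. \<Sum>g\<in>\<Gamma>. \<Sum>y\<in>X. act g (unit_vec_of (b y) y) x)"
        by (simp add: trace_vec_def act_sum_vec)
      also have "\<dots> = (\<lambda>x. \<Sum>y\<in>X. T y (b y) x)"
        unfolding T_def trace_vec_def by (rule ext, rule sum.swap)
      finally show ?thesis by (simp add: trace_vec_of_fixed[OF b])
    qed
    moreover have "of_nat n \<in> invs" for n by (simp add: invs_def) (induction n; simp add: act_simps)
    ultimately have "of_nat (card \<Gamma>) * \<phi> b = (\<Sum>y\<in>X. tr (l y * b y))"
      using smult[of "of_nat (card \<Gamma>)" b] b by (simp add: sum T_fixed l)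
    also have "\<dots> = tr (pairing X l b)" by (simp add: pairing_def tr_sum)
    also have "\<dots> = (\<Sum>g\<in>\<Gamma>. pairing X (D.act g l) b)"
      unfolding tr_def by (rule sum.cong[OF refl]) (simp add: pairing_act[symmetric] fixedD[OF b])
    also have "\<dots> = pairing X (D.trace_vec l) b"
      by (simp add: D.trace_vec_def pairing_sum)
    finally have "c * (of_nat (card \<Gamma>) * \<phi> b) = pairing X a b"
      by (simp add: a_def pairing_smult)
    then show ?thesis using c by (simp add: mult.assoc[symmetric])
  qed
  ultimately show ?thesis by (rule that)
qed

text \<open>The determinant of \<open>discr c\<close> times the identity expands, by multilinearity in the rows, into
  determinants of trace vectors; one of these does not vanish.\<close>

lemma independent_traces:
  assumes ix: "bij_betw ix {0..<r} X"
  obtains M where "M \<in> carrier_mat r r" "det M \<noteq> 0"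
    "\<And>i. i < r \<Longrightarrow> \<exists>b\<in>fixed. \<forall>j<r. M $$ (i, j) = b (ix j)"
proof -
  obtain c where c: "discr c \<noteq> 0" using discr_nonzero_ex by blast
  obtain s t n where sep: "\<And>h. h \<in> \<Gamma> \<Longrightarrow> (\<Sum>i<n::nat. h (s i) * t i) = (if h = id then discr c else 0)"
    by (rule separating[of c], rule that)
  have ixX: "i < r \<Longrightarrow> ix i \<in> X" for i using ix by (auto simp: bij_betw_def)
  define T where "T k i = trace_vec (unit_vec_of (s k) (ix i))" for k i
  have T: "T k i (ix j) = (\<Sum>g\<in>\<Gamma>. \<rho> g (ix j) (ix i) * g (s k))" if "i < r" "j < r" for k i j
    using that by (simp add: T_def trace_vec_def act_unit_vec ixX)
  have TI: "(\<Sum>k<n. t k * T k i (ix j)) = (if i = j then discr c else 0)" if ij: "i < r" "j < r" for i j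
  proof -
    have "(\<Sum>k<n. t k * T k i (ix j)) = (\<Sum>g\<in>\<Gamma>. \<rho> g (ix j) (ix i) * (\<Sum>k<n. g (s k) * t k))"
      unfolding T[OF ij] sum_distrib_left by (subst sum.swap) (simp add: ac_simps)
    also have "\<dots> = (\<Sum>g\<in>\<Gamma>. if g = id then \<rho> id (ix j) (ix i) * discr c else 0)"
      by (rule sum.cong[OF refl]) (simp add: sep)
    also have "\<dots> = \<rho> id (ix j) (ix i) * discr c"
      by (simp only: sum.delta[OF finite_group] id_mem if_True)
    also have "\<dots> = (if i = j then discr c else 0)"
      using ij ix rho_id[OF ixX ixX, of j i] by (auto simp: bij_betw_def inj_on_def)
    finally show ?thesis .
  qed
  define M where "M f = mat r r (\<lambda>(i, j). T (f i) i (ix j))" for f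
  define P where "P = {p. p permutes {0..<r}}"
  have detM: "det (M f) = (\<Sum>p\<in>P. signof p * (\<Prod>i=0..<r. T (f i) i (ix (p i))))" for f
    unfolding P_def by (subst det_def'[of _ r]) (auto simp: M_def intro!: sum.cong prod.cong)
  have "(discr c) ^ r = det (discr c \<cdot>\<^sub>m 1\<^sub>m r)" by simp
  also have "\<dots> = (\<Sum>p\<in>P. signof p * (\<Prod>i=0..<r. \<Sum>k<n. t k * T k i (ix (p i))))"
    unfolding P_def by (subst det_def'[of _ r])
      (auto simp: TI if_distrib[of "\<lambda>z. discr c * z"] intro!: sum.cong prod.cong cong: if_cong)
  also have "\<dots> = (\<Sum>p\<in>P. signof p * (\<Sum>f\<in>{0..<r} \<rightarrow>\<^sub>E {..<n}. \<Prod>i=0..<r. t (f i) * T (f i) i (ix (p i))))"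
    by (subst prod_sum_PiE) auto
  also have "\<dots> = (\<Sum>f\<in>{0..<r} \<rightarrow>\<^sub>E {..<n}. (\<Prod>i=0..<r. t (f i)) * det (M f))"
    unfolding detM sum_distrib_left prod.distrib by (subst sum.swap) (simp add: ac_simps)
  finally have "(\<Sum>f\<in>{0..<r} \<rightarrow>\<^sub>E {..<n}. (\<Prod>i=0..<r. t (f i)) * det (M f)) \<noteq> 0"
    using power_nonzero[OF c] by metis
  then obtain f where f: "det (M f) \<noteq> 0" by (metis (no_types, lifting) mult_zero_right sum.neutral)
  show ?thesis
  proof (rule that[of "M f"])
    show "\<exists>b\<in>fixed. \<forall>j<r. M f $$ (i, j) = b (ix j)" if "i < r" for i
      using that by (intro bexI[of _ "T (f i) i"]) (auto simp: M_def T_def trace_vec_fixed)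
  qed (use f in \<open>auto simp: M_def\<close>)
qed

text \<open>The fixed vectors \<open>c x\<close> form a basis over the fraction field, with dual basis \<open>h x / N\<close>: the matrix \<open>M\<close>
  of \<open>independent_traces\<close> provides the \<open>c x\<close> and its adjugate the \<open>h x\<close>, where the determinant is
  multiplied by its conjugates in order to become invariant.  The resulting functionals have
  invariant values on fixed vectors, so that averaging them changes nothing there.\<close>

theorem generic_basis:
  obtains c h N where "N \<in> invs" "N \<noteq> 0"
    "\<And>x. x \<in> X \<Longrightarrow> c x \<in> fixed" "\<And>x. x \<in> X \<Longrightarrow> h x \<in> dual_fixed"
    "\<And>x y. x \<in> X \<Longrightarrow> y \<in> X \<Longrightarrow> pairing X (h x) (c y) = (if x = y then N else 0)"
    "\<And>b. b \<in> fixed \<Longrightarrow> (\<lambda>z. N * b z) = (\<lambda>z. \<Sum>x\<in>X. pairing X (h x) b * c x z)"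
proof -
  define r where "r = card X"
  obtain ix where ix: "bij_betw ix {0..<r} X"
    using ex_bij_betw_nat_finite[OF finite_index] r_def by blast
  define iy where "iy = the_inv_into {0..<r} ix"
  have ixX: "i < r \<Longrightarrow> ix i \<in> X" and iyr: "x \<in> X \<Longrightarrow> iy x < r"
    and ixiy: "x \<in> X \<Longrightarrow> ix (iy x) = x" and iyix: "i < r \<Longrightarrow> iy (ix i) = i" for i x
    using ix the_inv_into_into[of ix "{0..<r}" x "{0..<r}"] f_the_inv_into_f[of ix "{0..<r}" x]
      the_inv_into_f_f[of ix "{0..<r}" i]
    by (auto simp: bij_betw_def iy_def)
  obtain M where M: "M \<in> carrier_mat r r" "det M \<noteq> 0"
    "\<And>i. i < r \<Longrightarrow> \<exists>b\<in>fixed. \<forall>j<r. M $$ (i, j) = b (ix j)"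
    using independent_traces[OF ix] by blast
  then obtain b where b: "\<And>i. i < r \<Longrightarrow> b i \<in> fixed" "\<And>i j. i < r \<Longrightarrow> j < r \<Longrightarrow> M $$ (i, j) = b i (ix j)"
    by metis
  define c where "c x = b (iy x)" for x
  have c: "c x \<in> fixed" if "x \<in> X" for x using b iyr that by (simp add: c_def)
  define e' where "e' = (\<Prod>g\<in>\<Gamma> - {id}. g (det M))"
  define N where "N = det M * e'"
  have N_eq: "N = (\<Prod>g\<in>\<Gamma>. g (det M))"
    unfolding N_def e'_def using prod.remove[OF finite_group id_mem, of "\<lambda>g. g (det M)"] by simp
  have N_inv: "N \<in> invs" unfolding N_eq by (rule norm_invs)
  have N0: "N \<noteq> 0" unfolding N_eq
    by (rule prod_nonzero[OF finite_group]) (metis act_inj act_zero M(2))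
  define H where "H x = (\<lambda>y. e' * adj_mat M $$ (iy y, iy x))" for x
  note adj = adj_mat[OF M(1)]
  have sum_ix: "(\<Sum>z\<in>X. f z) = (\<Sum>k=0..<r. f (ix k))" for f :: "'x \<Rightarrow> 'a"
    by (rule sum.reindex_bij_betw[OF ix, symmetric])
  have Hc: "pairing X (H x) (c y) = (if x = y then N else 0)" if xy: "x \<in> X" "y \<in> X" for x y
  proof -
    have "pairing X (H x) (c y) = e' * (\<Sum>k=0..<r. M $$ (iy y, k) * adj_mat M $$ (k, iy x))"
      using xy by (simp add: pairing_def sum_ix H_def c_def b iyr iyix sum_distrib_left ac_simps)
    also have "(\<Sum>k=0..<r. M $$ (iy y, k) * adj_mat M $$ (k, iy x)) = (M * adj_mat M) $$ (iy y, iy x)"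
      using M(1) adj(1) xy iyr by (simp add: scalar_prod_def)
    also have "\<dots> = (if x = y then det M else 0)"
      unfolding adj(2) using xy iyr ixiy by (auto, metis ixiy)
    finally show ?thesis by (simp add: N_def mult.commute)
  qed
  have expand: "(\<Sum>x\<in>X. pairing X (H x) a * c x z) = N * a z" if z: "z \<in> X" for a z
  proof -
    have "(\<Sum>x\<in>X. pairing X (H x) a * c x z) =
        (\<Sum>i=0..<r. (\<Sum>k=0..<r. e' * adj_mat M $$ (k, i) * a (ix k)) * M $$ (i, iy z))"
      using z by (simp add: sum_ix pairing_def H_def c_def b iyr ixiy iyix)
    also have "\<dots> = (\<Sum>k=0..<r. e' * a (ix k) * (\<Sum>i=0..<r. adj_mat M $$ (k, i) * M $$ (i, iy z)))"
      unfolding sum_distrib_left sum_distrib_right by (subst sum.swap) (simp add: ac_simps)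
    also have "\<dots> = (\<Sum>k=0..<r. e' * a (ix k) * (adj_mat M * M) $$ (k, iy z))"
      using M(1) adj(1) iyr[OF z] by (intro sum.cong refl) (simp add: scalar_prod_def)
    also have "\<dots> = (\<Sum>k=0..<r. if k = iy z then e' * a z * det M else 0)"
      unfolding adj(3) using iyr[OF z] ixiy[OF z] by (intro sum.cong refl) auto
    finally show ?thesis using iyr[OF z] by (simp add: N_def ac_simps)
  qed
  have fixed_expand: "(\<lambda>z. N * b z) = (\<lambda>z. \<Sum>x\<in>X. pairing X (H x) b * c x z)" if b: "b \<in> fixed" for b
  proof
    fix z show "N * b z = (\<Sum>x\<in>X. pairing X (H x) b * c x z)"
      using expand[of z b] fixed_outside[OF b, of z] fixed_outside[OF c, of _ z]
      by (cases "z \<in> X") auto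
  qed
  have H_inv: "pairing X (H x) b \<in> invs" if x: "x \<in> X" and b: "b \<in> fixed" for x b
  proof -
    have "g (pairing X (H x) b) = pairing X (H x) b" if g: "g \<in> \<Gamma>" for g
    proof -
      have "(\<lambda>z. N * b z) = act g (\<lambda>z. N * b z)"
        using fixedD[OF fixed_smult[OF N_inv b] g] by simp
      also have "\<dots> = (\<lambda>z. \<Sum>y\<in>X. g (pairing X (H y) b) * c y z)"
        unfolding fixed_expand[OF b] act_sum_vec[OF g] act_smult[OF g]
        by (intro ext sum.cong refl) (simp add: fixedD[OF c g])
      finally have "pairing X (H x) (\<lambda>z. N * b z) = pairing X (H x) (\<lambda>z. \<Sum>y\<in>X. g (pairing X (H y) b) * c y z)"
        by simp
      then have "N * pairing X (H x) b = (\<Sum>y\<in>X. g (pairing X (H y) b) * (if x = y then N else 0))"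
        by (simp only: pairing_smult pairing_sum) (simp add: Hc x)
      also have "\<dots> = (\<Sum>y\<in>X. if x = y then N * g (pairing X (H y) b) else 0)"
        by (rule sum.cong[OF refl]) (simp add: mult.commute)
      also have "\<dots> = N * g (pairing X (H x) b)"
        using x finite_index by simp
      finally show ?thesis using cancel[OF N0] by simp
    qed
    then show ?thesis by (simp add: invs_def)
  qed
  have "\<exists>h. h \<in> dual_fixed \<and> (\<forall>b\<in>fixed. pairing X h b = pairing X (H x) b)" if "x \<in> X" for x
    using average_functional[of fixed "H x"] H_inv[OF that] by metis
  then obtain h where h: "\<And>x. x \<in> X \<Longrightarrow> h x \<in> dual_fixed"
    "\<And>x b. x \<in> X \<Longrightarrow> b \<in> fixed \<Longrightarrow> pairing X (h x) b = pairing X (H x) b" by metis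
  show ?thesis
    by (rule that[of N c h]) (use N_inv N0 c h Hc fixed_expand in \<open>simp_all cong: sum.cong\<close>)
qed

end

section \<open>Polynomials in finitely many variables\<close>

abbreviation lookup :: "('a \<Rightarrow>\<^sub>0 'b::zero) \<Rightarrow> 'a \<Rightarrow> 'b" where "lookup \<equiv> Poly_Mapping.lookup"

abbreviation keys :: "('a \<Rightarrow>\<^sub>0 'b::zero) \<Rightarrow> 'a set" where "keys \<equiv> Poly_Mapping.keys"

lemma poly_mapping_as_sum: "p = (\<Sum>m\<in>keys p. Poly_Mapping.single m (lookup p m))"
  by (rule poly_mapping_eqI) (auto simp: lookup_sum lookup_single when_def in_keys_iff)

lemma poly_mapping_single_induct [case_names zero single add]:
  assumes "P 0" "\<And>m c. P (Poly_Mapping.single m c)" "\<And>p q. P p \<Longrightarrow> P q \<Longrightarrow> P (p + q)"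
  shows "P (p :: 'm \<Rightarrow>\<^sub>0 'c::comm_monoid_add)"
proof -
  have "P (\<Sum>m\<in>A. Poly_Mapping.single m (lookup p m))" for A
    by (induction A rule: infinite_finite_induct) (auto intro: assms)
  then show ?thesis by (subst poly_mapping_as_sum)
qed

lemma poly_const_add: "poly_const (a + b) = poly_const a + poly_const b"
  by (simp add: poly_const_def single_add)

lemma poly_const_mult: "poly_const (a * b) = poly_const a * poly_const (b::'c::comm_semiring_1)"
  by (simp add: poly_const_def mult_single)

lemma poly_const_0: "poly_const 0 = 0" and poly_const_1: "poly_const (1::'c::comm_semiring_1) = 1"
  by (simp_all add: poly_const_def)

lemma poly_const_diff: "poly_const (a - b) = poly_const a - poly_const (b::'d::ab_group_add)"
  by (simp add: poly_const_def single_diff)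

lemma poly_const_sum: "poly_const (\<Sum>i\<in>I. f i) = (\<Sum>i\<in>I. poly_const (f i))"
  by (induction I rule: infinite_finite_induct) (simp_all add: poly_const_0 poly_const_add)

lemma poly_const_of_nat: "poly_const (of_nat n :: 'c::comm_semiring_1) = of_nat n"
  by (induction n) (simp_all add: poly_const_0 poly_const_add poly_const_1)

lemma poly_const_eq_0: "poly_const c = 0 \<longleftrightarrow> c = 0"
proof
  assume eq: "poly_const c = 0"
  show "c = 0" using arg_cong[OF eq, of "\<lambda>p. lookup p 0"] by (simp add: poly_const_def)
qed (simp add: poly_const_0)

lemma poly_const_single: "poly_const c * Poly_Mapping.single m d = Poly_Mapping.single m (c * d :: 'c::comm_semiring_1)"
  by (simp add: poly_const_def mult_single)

lemma lookup_const_mult: "lookup (poly_const c * p) m = c * lookup (p :: ('n, 'c::comm_semiring_1) polynomial) m"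
  by (induction p rule: poly_mapping_single_induct)
     (simp_all add: poly_const_single lookup_single when_def distrib_left lookup_add)

lemma poly_var_power: "poly_var i ^ k = Poly_Mapping.single (Poly_Mapping.single i k) (1::'c::comm_semiring_1)"
  by (induction k) (simp_all add: poly_var_def mult_single single_add[symmetric])

lemma monomial_as_product:
  "Poly_Mapping.single m c = poly_const (c::'c::comm_semiring_1) * (\<Prod>i\<in>(UNIV::'n::finite set). poly_var i ^ lookup m i)"
proof -
  have "(\<Prod>i\<in>A. poly_var i ^ lookup m i) =
      Poly_Mapping.single (\<Sum>i\<in>A. Poly_Mapping.single i (lookup m i)) (1::'c)" for A :: "'n set"
    by (induction A rule: infinite_finite_induct) (simp_all add: poly_var_power mult_single)
  moreover have "(\<Sum>i\<in>UNIV. Poly_Mapping.single i (lookup m i)) = m"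
    by (rule poly_mapping_eqI) (simp add: lookup_sum lookup_single when_def)
  ultimately show ?thesis by (simp add: poly_const_single)
qed

lemma polynomial_induct [case_names const var add mult]:
  assumes const: "\<And>c. P (poly_const c)" and var: "\<And>i. P (poly_var i)"
    and add: "\<And>p q. P p \<Longrightarrow> P q \<Longrightarrow> P (p + q)" and mult: "\<And>p q. P p \<Longrightarrow> P q \<Longrightarrow> P (p * q)"
  shows "P (p :: ('n::finite, 'c::comm_semiring_1) polynomial)"
proof (induction p rule: poly_mapping_single_induct)
  case zero
  show ?case using const[of 0] by (simp add: poly_const_0)
next
  case (single m c)
  have pow: "P (p ^ k)" if "P p" for p k
    using that by (induction k) (use const[of 1] in \<open>auto intro: mult simp: poly_const_1\<close>)
  have "P (\<Prod>i\<in>A. poly_var i ^ lookup m i)" for A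
    by (induction A rule: infinite_finite_induct) (use const[of 1] in \<open>auto intro: mult pow var simp: poly_const_1\<close>)
  then show ?case unfolding monomial_as_product by (intro mult const)
qed (rule add)

subsection \<open>Evaluation homomorphisms\<close>

definition poly_eval :: "('c::comm_ring_1 \<Rightarrow> 'd::comm_ring_1) \<Rightarrow> ('n::finite \<Rightarrow> 'd) \<Rightarrow> ('n, 'c) polynomial \<Rightarrow> 'd" where
  "poly_eval \<phi> h p = (\<Sum>m\<in>keys p. \<phi> (lookup p m) * (\<Prod>i\<in>UNIV. h i ^ lookup m i))"

locale ring_map =
  fixes \<phi> :: "'c::comm_ring_1 \<Rightarrow> 'd::comm_ring_1"
  assumes map_add: "\<phi> (a + b) = \<phi> a + \<phi> b" and map_mult: "\<phi> (a * b) = \<phi> a * \<phi> b" and map_one: "\<phi> 1 = 1"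
begin

lemma map_zero: "\<phi> 0 = 0" using map_add[of 0 0] by simp

lemma map_sum: "\<phi> (\<Sum>i\<in>I. f i) = (\<Sum>i\<in>I. \<phi> (f i))"
  by (induction I rule: infinite_finite_induct) (simp_all add: map_zero map_add)

lemma map_prod: "\<phi> (\<Prod>i\<in>I. f i) = (\<Prod>i\<in>I. \<phi> (f i))"
  by (induction I rule: infinite_finite_induct) (simp_all add: map_one map_mult)

lemma map_power: "\<phi> (a ^ k) = \<phi> a ^ k"
  by (induction k) (simp_all add: map_one map_mult)

lemma poly_eval_single: "poly_eval \<phi> h (Poly_Mapping.single m c) = \<phi> c * (\<Prod>i\<in>UNIV. h i ^ lookup m i)"
  by (simp add: poly_eval_def map_zero)

lemma poly_eval_add: "poly_eval \<phi> h (p + q) = poly_eval \<phi> h p + poly_eval \<phi> h q"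
  unfolding poly_eval_def
  by (rule setsum_keys_plus_distrib) (simp_all add: map_zero map_add distrib_right)

lemma poly_eval_const: "poly_eval \<phi> h (poly_const c) = \<phi> c"
  by (simp add: poly_const_def poly_eval_single)

lemma poly_eval_var: "poly_eval \<phi> h (poly_var i) = h i"
proof -
  have "(\<Prod>j\<in>UNIV. h j ^ lookup (Poly_Mapping.single i 1) j) = (\<Prod>j\<in>UNIV. if j = i then h i else 1)"
    by (rule prod.cong[OF refl]) (simp add: lookup_single when_def)
  then show ?thesis by (simp add: poly_var_def poly_eval_single map_one)
qed

lemma poly_eval_mult: "poly_eval \<phi> h (p * q) = poly_eval \<phi> h p * poly_eval \<phi> h q"
proof -
  have zero: "poly_eval \<phi> h 0 = 0" by (simp add: poly_eval_def)
  have "poly_eval \<phi> h (Poly_Mapping.single m c * q) = poly_eval \<phi> h (Poly_Mapping.single m c) * poly_eval \<phi> h q" for m c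
    by (induction q rule: poly_mapping_single_induct)
       (simp_all add: zero mult_single poly_eval_single map_mult lookup_add power_add prod.distrib
         distrib_left poly_eval_add mult.assoc mult.left_commute)
  then show ?thesis
    by (induction p rule: poly_mapping_single_induct) (simp_all add: zero distrib_right poly_eval_add)
qed

lemma ring_map_poly_eval: "ring_map (poly_eval \<phi> h)"
  by unfold_locales (simp_all add: poly_eval_add poly_eval_mult poly_const_1[symmetric] poly_eval_const,
     simp add: poly_const_1 map_one)

end

lemma ring_map_eqI:
  assumes "ring_map (\<phi> :: ('n::finite, 'c::comm_ring_1) polynomial \<Rightarrow> 'd::comm_ring_1)" "ring_map \<psi>"
    and "\<And>c. \<phi> (poly_const c) = \<psi> (poly_const c)" "\<And>i. \<phi> (poly_var i) = \<psi> (poly_var i)"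
  shows "\<phi> p = \<psi> p"
  using assms by (induction p rule: polynomial_induct) (simp_all add: ring_map_def)

lemma ring_map_poly_const: "ring_map (poly_const :: 'c::comm_ring_1 \<Rightarrow> ('n, 'c) polynomial)"
  by unfold_locales (simp_all add: poly_const_add poly_const_mult poly_const_1)

lemma ring_map_comp: "ring_map \<phi> \<Longrightarrow> ring_map \<psi> \<Longrightarrow> ring_map (\<phi> \<circ> \<psi>)"
  by (simp add: ring_map_def)

lemma poly_subst_eq_eval: "poly_subst h = poly_eval poly_const h"
  by (simp add: fun_eq_iff poly_subst_def poly_eval_def)

interpretation poly_subst: ring_map "poly_subst h :: ('n::finite, 'k::comm_ring_1) polynomial \<Rightarrow> _" for h
  unfolding poly_subst_eq_eval by (rule ring_map.ring_map_poly_eval[OF ring_map_poly_const])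

lemma poly_subst_const: "poly_subst h (poly_const c) = poly_const c"
  and poly_subst_var: "poly_subst h (poly_var i) = h i"
  unfolding poly_subst_eq_eval
  by (rule ring_map.poly_eval_const[OF ring_map_poly_const], rule ring_map.poly_eval_var[OF ring_map_poly_const])

text \<open>Renaming the variables to natural numbers embeds the ring into one whose exponents are
  linearly ordered, which is a domain.\<close>

lemma polynomial_no_zero_div:
  assumes "p * q = (0 :: ('n::finite, 'k::idom) polynomial)" shows "p = 0 \<or> q = 0"
proof -
  obtain \<iota> :: "'n \<Rightarrow> nat" where \<iota>: "inj \<iota>" using finite_imp_inj_to_nat_seg[of "UNIV :: 'n set"] by auto
  define \<mu> :: "('n \<Rightarrow>\<^sub>0 nat) \<Rightarrow> (nat \<Rightarrow>\<^sub>0 nat)" where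
    "\<mu> m = (\<Sum>i\<in>UNIV. Poly_Mapping.single (\<iota> i) (lookup m i))" for m
  have \<mu>_add: "\<mu> (m + m') = \<mu> m + \<mu> m'" for m m'
    by (simp add: \<mu>_def lookup_add single_add sum.distrib)
  have \<mu>_lookup: "lookup (\<mu> m) (\<iota> i) = lookup m i" for m i
    using \<iota> by (simp add: \<mu>_def lookup_sum lookup_single when_def inj_eq)
  have \<mu>_inj: "\<mu> m = \<mu> m' \<longleftrightarrow> m = m'" for m m'
  proof
    assume eq: "\<mu> m = \<mu> m'"
    show "m = m'"
      by (rule poly_mapping_eqI) (simp only: \<mu>_lookup[symmetric] eq)
  qed simp
  define E :: "('n, 'k) polynomial \<Rightarrow> (nat \<Rightarrow>\<^sub>0 nat) \<Rightarrow>\<^sub>0 'k" where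
    "E p = (\<Sum>m\<in>keys p. Poly_Mapping.single (\<mu> m) (lookup p m))" for p
  have E_single: "E (Poly_Mapping.single m c) = Poly_Mapping.single (\<mu> m) c" for m c
    by (simp add: E_def)
  have E_add: "E (p + q) = E p + E q" for p q
    unfolding E_def by (rule setsum_keys_plus_distrib) (simp_all add: single_add)
  have E_0: "E 0 = 0" by (simp add: E_def)
  have "E (Poly_Mapping.single m c * q) = E (Poly_Mapping.single m c) * E q" for m c q
    by (induction q rule: poly_mapping_single_induct)
       (simp_all add: E_0 mult_single E_single \<mu>_add distrib_left E_add)
  then have E_mult: "E (p * q) = E p * E q" for p q
    by (induction p rule: poly_mapping_single_induct) (simp_all add: E_0 distrib_right E_add)
  have "lookup (E p) (\<mu> m) = lookup p m" for p m
    by (induction p rule: poly_mapping_single_induct)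
       (simp_all add: E_0 E_single E_add lookup_add lookup_single when_def \<mu>_inj)
  then have E_lookup: "lookup p m = lookup (E p) (\<mu> m)" for p m by simp
  have E_inj: "p = 0" if "E p = 0" for p
  proof (rule poly_mapping_eqI)
    show "lookup p m = lookup 0 m" for m using E_lookup[of p m] that by simp
  qed
  have "E p * E q = 0" unfolding E_mult[symmetric] assms by (rule E_0)
  then have "E p = 0 \<or> E q = 0" by (rule mult_eq_0_iff[THEN iffD1])
  then show ?thesis using E_inj by blast
qed

subsection \<open>Partial derivatives\<close>

definition pd :: "'n \<Rightarrow> ('n, 'k::comm_ring_1) polynomial \<Rightarrow> ('n, 'k) polynomial" where
  "pd i p = (\<Sum>m\<in>keys p. Poly_Mapping.single (m - Poly_Mapping.single i 1) (of_nat (lookup m i) * lookup p m))"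

lemma pd_single: "pd i (Poly_Mapping.single m c) =
    Poly_Mapping.single (m - Poly_Mapping.single i 1) (of_nat (lookup m i) * c)"
  by (simp add: pd_def)

lemma pd_add: "pd i (p + q) = pd i p + pd i q"
  unfolding pd_def by (rule setsum_keys_plus_distrib) (simp_all add: single_add distrib_left)

lemma pd_0: "pd i 0 = 0" by (simp add: pd_def)

lemma pd_mult: "pd i (p * q) = p * pd i q + q * pd i p"
proof -
  have shift: "Poly_Mapping.single (m + (m' - Poly_Mapping.single i 1)) (of_nat (lookup m' i) * c) =
      Poly_Mapping.single (m + m' - Poly_Mapping.single i 1) (of_nat (lookup m' i) * (c::'b))"
    for m m' :: "'a \<Rightarrow>\<^sub>0 nat" and c
  proof (cases "lookup m' i = 0")
    case False
    then have "m + (m' - Poly_Mapping.single i 1) = m + m' - Poly_Mapping.single i 1"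
      by (intro poly_mapping_eqI) (auto simp: lookup_add lookup_minus lookup_single when_def)
    then show ?thesis by simp
  qed simp
  have single: "pd i (Poly_Mapping.single m c * Poly_Mapping.single m' c') =
      Poly_Mapping.single m c * pd i (Poly_Mapping.single m' c') +
      Poly_Mapping.single m' c' * pd i (Poly_Mapping.single m c)" for m m' and c c' :: 'b
  proof -
    have 1: "Poly_Mapping.single m c * pd i (Poly_Mapping.single m' c') =
        Poly_Mapping.single (m + m' - Poly_Mapping.single i 1) (of_nat (lookup m' i) * (c * c'))"
      using shift[of m m' "c * c'"] by (simp only: pd_single mult_single mult.left_commute[of c])
    have 2: "Poly_Mapping.single m' c' * pd i (Poly_Mapping.single m c) =
        Poly_Mapping.single (m + m' - Poly_Mapping.single i 1) (of_nat (lookup m i) * (c * c'))"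
      using shift[of m' m "c' * c"]
      by (simp only: pd_single mult_single mult.left_commute[of c'] add.commute[of m' m] mult.commute[of c' c])
    show ?thesis
      unfolding 1 2 single_add[symmetric] by (simp add: mult_single pd_single lookup_add algebra_simps)
  qed
  have "pd i (Poly_Mapping.single m c * q) = Poly_Mapping.single m c * pd i q + q * pd i (Poly_Mapping.single m c)"
    for m and c :: 'b
    by (induction q rule: poly_mapping_single_induct) (simp_all add: pd_0 single distrib_left distrib_right pd_add)
  then show ?thesis
    by (induction p rule: poly_mapping_single_induct) (simp_all add: pd_0 distrib_left distrib_right pd_add)
qed

lemma pd_const: "pd i (poly_const c) = 0"
  by (simp add: poly_const_def pd_single)

lemma pd_var: "pd i (poly_var j) = (if i = j then 1 else 0)"
  by (auto simp: poly_var_def pd_single lookup_single when_def)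

lemma pd_sum: "pd i (\<Sum>x\<in>A. f x) = (\<Sum>x\<in>A. pd i (f x))"
  by (induction A rule: infinite_finite_induct) (simp_all add: pd_0 pd_add)

subsection \<open>Homogeneous polynomials\<close>

definition homogeneous :: "nat \<Rightarrow> ('n::finite, 'k::zero) polynomial \<Rightarrow> bool" where
  "homogeneous d p \<longleftrightarrow> (\<forall>m\<in>keys p. monomial_degree m = d)"

definition monomials_of_degree :: "nat \<Rightarrow> ('n::finite \<Rightarrow>\<^sub>0 nat) set" where
  "monomials_of_degree d = {m. monomial_degree m = d}"

lemma monomial_degree_add: "monomial_degree (m + m') = monomial_degree m + monomial_degree m'"
  by (simp add: monomial_degree_def lookup_add sum.distrib)

lemma monomial_degree_single: "monomial_degree (Poly_Mapping.single i k) = k"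
  by (simp add: monomial_degree_def lookup_single when_def)

lemma monomial_degree_0: "monomial_degree 0 = 0"
  by (simp add: monomial_degree_def)

lemma homogeneous_lookup: "homogeneous d p \<Longrightarrow> monomial_degree m \<noteq> d \<Longrightarrow> lookup p m = 0"
  by (rule ccontr) (simp add: homogeneous_def in_keys_iff)

lemma homogeneous_alt: "homogeneous d p \<longleftrightarrow> (\<forall>m. monomial_degree m \<noteq> d \<longrightarrow> lookup p m = 0)"
  by (auto simp: homogeneous_def in_keys_iff)

lemma homogeneous_0: "homogeneous d 0" by (simp add: homogeneous_def)

lemma homogeneous_single: "homogeneous (monomial_degree m) (Poly_Mapping.single m c)"
  by (simp add: homogeneous_def)

lemma homogeneous_add: "homogeneous d p \<Longrightarrow> homogeneous d q \<Longrightarrow> homogeneous d (p + q)"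
  by (simp add: homogeneous_alt lookup_add)

lemma homogeneous_sum: "(\<And>i. i \<in> I \<Longrightarrow> homogeneous d (f i)) \<Longrightarrow> homogeneous d (\<Sum>i\<in>I. f i)"
  by (simp add: homogeneous_alt lookup_sum)

lemma homogeneous_mult:
  "homogeneous d p \<Longrightarrow> homogeneous e q \<Longrightarrow> homogeneous (d + e) (p * q)"
  using keys_mult[of p q] by (auto simp: homogeneous_def monomial_degree_add)

lemma homogeneous_const: "homogeneous 0 (poly_const c)"
  by (simp add: homogeneous_def poly_const_def monomial_degree_0)

lemma homogeneous_one: "homogeneous 0 (1 :: ('n::finite, 'k::comm_semiring_1) polynomial)"
  unfolding poly_const_1[symmetric] by (rule homogeneous_const)

lemma homogeneous_const_mult:
  "homogeneous d p \<Longrightarrow> homogeneous d (poly_const c * p :: ('n::finite, 'k::comm_semiring_1) polynomial)"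
  by (simp add: homogeneous_alt lookup_const_mult)

lemma homogeneous_var: "homogeneous 1 (poly_var i)"
  by (simp add: homogeneous_def poly_var_def monomial_degree_single)

lemma homogeneous_power: "homogeneous d p \<Longrightarrow> homogeneous (k * d) (p ^ k :: ('n::finite, 'k::comm_semiring_1) polynomial)"
  by (induction k) (auto intro: homogeneous_one homogeneous_mult)

lemma homogeneous_prod:
  "(\<And>i. i \<in> I \<Longrightarrow> homogeneous (d i) (f i)) \<Longrightarrow> homogeneous (\<Sum>i\<in>I. d i) (\<Prod>i\<in>I. f i :: ('n::finite, 'k::comm_semiring_1) polynomial)"
  by (induction I rule: infinite_finite_induct) (auto intro: homogeneous_one homogeneous_mult)

lemma monomial_degree_pos: "lookup m i \<le> monomial_degree m"
  unfolding monomial_degree_def by (rule member_le_sum) auto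

lemma homogeneous_pd: assumes "homogeneous (Suc d) p" shows "homogeneous d (pd i p)"
  unfolding pd_def
proof (rule homogeneous_sum)
  fix m assume m: "m \<in> keys p"
  show "homogeneous d (Poly_Mapping.single (m - Poly_Mapping.single i 1) (of_nat (lookup m i) * lookup p m))"
  proof (cases "lookup m i = 0")
    case False
    have "(m - Poly_Mapping.single i 1) + Poly_Mapping.single i 1 = m"
      using False by (intro poly_mapping_eqI) (auto simp: lookup_add lookup_minus lookup_single when_def)
    then have "monomial_degree (m - Poly_Mapping.single i 1) + 1 = Suc d"
      using monomial_degree_add[of "m - Poly_Mapping.single i 1" "Poly_Mapping.single i 1"] m assms
      by (simp add: homogeneous_def monomial_degree_single)
    then show ?thesis using homogeneous_single[of "m - Poly_Mapping.single i 1"] by simp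
  qed (simp add: homogeneous_0)
qed

lemma pd_degree_0: assumes "homogeneous 0 p" shows "pd i p = 0"
proof -
  have "lookup m i = 0" if "m \<in> keys p" for m
    using assms that monomial_degree_pos[of m i] by (auto simp: homogeneous_def)
  then show ?thesis unfolding pd_def by (intro sum.neutral) simp
qed

lemma finite_monomials_of_degree: "finite (monomials_of_degree d :: ('n::finite \<Rightarrow>\<^sub>0 nat) set)"
proof (rule inj_on_finite)
  show "inj_on lookup (monomials_of_degree d :: ('n \<Rightarrow>\<^sub>0 nat) set)" 
    by (intro inj_onI poly_mapping_eqI) simp
  show "lookup ` monomials_of_degree d \<subseteq> (UNIV :: 'n set) \<rightarrow>\<^sub>E {..d}"
  proof (rule image_subsetI)
    fix m :: "'n \<Rightarrow>\<^sub>0 nat" assume "m \<in> monomials_of_degree d"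
    then show "lookup m \<in> UNIV \<rightarrow>\<^sub>E {..d}"
      using monomial_degree_pos[of m] by (simp add: monomials_of_degree_def PiE_def extensional_def)
  qed
  show "finite ((UNIV :: 'n set) \<rightarrow>\<^sub>E {..d})" by (rule finite_PiE) simp_all
qed

subsection \<open>Linear forms\<close>

definition linear_form :: "('n::finite \<Rightarrow> 'k::comm_ring_1) \<Rightarrow> ('n, 'k) polynomial" where
  "linear_form c = (\<Sum>i\<in>UNIV. poly_const (c i) * poly_var i)"

lemma lookup_linear_form: "lookup (linear_form c) (Poly_Mapping.single i 1) = c i"
proof -
  have "lookup (linear_form c) (Poly_Mapping.single i 1) = (\<Sum>j\<in>UNIV. if j = i then c i else 0)"
    unfolding linear_form_def lookup_sum lookup_const_mult
  proof (rule sum.cong[OF refl])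
    fix j
    have "Poly_Mapping.single j (1::nat) = Poly_Mapping.single i 1 \<longleftrightarrow> j = i"
      by (auto dest!: arg_cong[of _ _ "\<lambda>m. lookup m i"] simp: lookup_single when_def split: if_splits)
    then show "c j * lookup (poly_var j) (Poly_Mapping.single i 1) = (if j = i then c i else 0)"
      by (simp add: poly_var_def lookup_single when_def)
  qed
  then show ?thesis by simp
qed

lemma linear_form_inject: "linear_form c = linear_form d \<longleftrightarrow> c = d"
proof
  assume eq: "linear_form c = linear_form d"
  show "c = d"
    by (rule ext) (use lookup_linear_form[of c] lookup_linear_form[of d] eq in simp)
qed simp

lemma linear_form_add: "linear_form (\<lambda>i. c i + d i) = linear_form c + linear_form d"
  and linear_form_scale: "linear_form (\<lambda>i. a * c i) = poly_const a * linear_form c"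
  and linear_form_diff: "linear_form (\<lambda>i. c i - d i) = linear_form c - linear_form d"
  by (simp_all add: linear_form_def poly_const_add poly_const_mult poly_const_diff sum.distrib sum_subtractf
    algebra_simps sum_distrib_left)

lemma homogeneous_linear_form: "homogeneous 1 (linear_form c)"
  unfolding linear_form_def by (intro homogeneous_sum homogeneous_const_mult homogeneous_var)

lemma poly_subst_linear_form: "poly_subst h (linear_form c) = (\<Sum>i\<in>UNIV. poly_const (c i) * h i)"
  by (simp add: linear_form_def poly_subst.map_sum poly_subst.map_mult poly_subst_const poly_subst_var)

lemma pd_linear_form: "pd i (linear_form c) = poly_const (c i)"
proof -
  have "pd i (linear_form c) = (\<Sum>j\<in>UNIV. if j = i then poly_const (c i) else 0)"
    unfolding linear_form_def pd_sum by (rule sum.cong[OF refl]) (simp add: pd_mult pd_const pd_var)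
  then show ?thesis by simp
qed

text \<open>Eliminating a variable with the help of the first form is a ring homomorphism whose
  kernel is generated by that form.  It does not kill the second form, and there are no zero
  divisors, so it kills \<open>q\<close>.\<close>

lemma linear_forms_regular:
  fixes a b :: "'n::finite \<Rightarrow> 'k::field"
  assumes a: "a \<noteq> (\<lambda>_. 0)" and indep: "\<And>t. b \<noteq> (\<lambda>i. t * a i)"
    and eq: "linear_form a * p = linear_form b * q"
  shows "linear_form a dvd q"
proof -
  obtain j where j: "a j \<noteq> 0" using a unfolding fun_eq_iff by blast
  define h where "h i = (if i = j then linear_form (\<lambda>i. if i = j then 0 else - a i / a j) else poly_var i)" for i
  have hj: "poly_var j - h j = poly_const (1 / a j) * linear_form a"
  proof -
    have v: "poly_var j = linear_form (\<lambda>i. if i = j then 1 else 0 :: 'k)"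
    proof -
      have "linear_form (\<lambda>i. if i = j then 1 else 0 :: 'k) = (\<Sum>i\<in>UNIV. if i = j then poly_var j else 0)"
        unfolding linear_form_def by (rule sum.cong[OF refl]) (simp add: poly_const_1 poly_const_0)
      then show ?thesis by simp
    qed
    have "h j = linear_form (\<lambda>i. if i = j then 0 else - a i / a j)" by (simp add: h_def)
    then have "poly_var j - h j = linear_form (\<lambda>i. (if i = j then 1 else 0) - (if i = j then 0 else - a i / a j))"
      by (simp only: v linear_form_diff)
    also have "\<dots> = linear_form (\<lambda>i. (1 / a j) * a i)"
      by (rule arg_cong[of _ _ linear_form]) (use j in auto)
    finally show ?thesis by (simp only: linear_form_scale)
  qed
  have ker: "linear_form a dvd r - poly_subst h r" for r
  proof (induction r rule: polynomial_induct)
    case (var i)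
    show ?case
    proof (cases "i = j")
      case True
      then show ?thesis using hj by (simp add: poly_subst_var)
    qed (simp add: poly_subst_var h_def)
  next
    case (add p q)
    then show ?case using dvd_add[OF add] by (simp add: poly_subst.map_add algebra_simps)
  next
    case (mult p q)
    have "p * q - poly_subst h (p * q) = (p - poly_subst h p) * q + poly_subst h p * (q - poly_subst h q)"
      by (simp add: poly_subst.map_mult algebra_simps)
    then show ?case using mult by (metis dvd_add dvd_mult dvd_mult2)
  qed (simp add: poly_subst_const)
  have sub: "poly_subst h (linear_form c) = linear_form (\<lambda>i. if i = j then 0 else c i - c j * a i / a j)" for c
  proof -
    have "poly_subst h (linear_form c) = poly_const (c j) * h j + (\<Sum>i\<in>UNIV - {j}. poly_const (c i) * poly_var i)"
      unfolding poly_subst_linear_form by (subst sum.remove[of _ j]) (auto simp: h_def intro!: sum.cong)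
    also have "(\<Sum>i\<in>UNIV - {j}. poly_const (c i) * poly_var i) = linear_form (\<lambda>i. if i = j then 0 else c i)"
      unfolding linear_form_def by (subst (2) sum.remove[of _ j]) (auto simp: poly_const_0 intro!: sum.cong)
    also have "h j = linear_form (\<lambda>i. if i = j then 0 else - a i / a j)" by (simp add: h_def)
    also have "poly_const (c j) * linear_form (\<lambda>i. if i = j then 0 else - a i / a j)
        + linear_form (\<lambda>i. if i = j then 0 else c i)
      = linear_form (\<lambda>i. c j * (if i = j then 0 else - a i / a j) + (if i = j then 0 else c i))"
      by (simp only: linear_form_scale linear_form_add)
    also have "\<dots> = linear_form (\<lambda>i. if i = j then 0 else c i - c j * a i / a j)"
      by (rule arg_cong[of _ _ linear_form]) auto
    finally show ?thesis .
  qed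
  have "poly_subst h (linear_form a) = 0"
  proof -
    have "(\<lambda>i. if i = j then 0 else a i - a j * a i / a j) = (\<lambda>_. 0)" using j by auto
    then show ?thesis unfolding sub by (simp add: linear_form_def poly_const_0)
  qed
  moreover have "poly_subst h (linear_form b) \<noteq> 0"
  proof
    assume z: "poly_subst h (linear_form b) = 0"
    have c: "(if i = j then 0 else b i - b j * a i / a j) = 0" for i
      using arg_cong[OF z, of "\<lambda>p. lookup p (Poly_Mapping.single i 1)"]
      by (simp only: sub lookup_linear_form lookup_zero)
    have "b i = b j / a j * a i" for i using c[of i] j by (cases "i = j") simp_all
    then have "b = (\<lambda>i. b j / a j * a i)" by (rule ext)
    with indep[of "b j / a j"] show False by (rule notE)
  qed
  ultimately have "poly_subst h q = 0"
    using arg_cong[OF eq, of "poly_subst h"] polynomial_no_zero_div[of "poly_subst h (linear_form b)" "poly_subst h q"]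
    by (simp add: poly_subst.map_mult)
  then show ?thesis using ker[of q] by simp
qed

section \<open>Symmetric differential forms\<close>

text \<open>Forms on the vector space with coefficients in \<open>S\<close> are polynomials over \<open>S\<close>, in which the variable
  of index \<open>i\<close> stands for the differential of \<open>x\<^sub>i\<close>.  The present map replaces each \<open>x\<^sub>i\<close> by its
  differential.\<close>

definition lift_poly :: "('n::finite, 'k::comm_ring_1) polynomial \<Rightarrow> ('n, ('n, 'k) polynomial) polynomial" where
  "lift_poly = poly_eval (poly_const \<circ> poly_const) poly_var"

definition total_diff :: "('n::finite, 'k::comm_ring_1) polynomial \<Rightarrow> ('n, ('n, 'k) polynomial) polynomial" where
  "total_diff f = linear_form (\<lambda>i. pd i f)"

interpretation lift_poly: ring_map "lift_poly :: ('n::finite, 'k::comm_ring_1) polynomial \<Rightarrow> _"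
  unfolding lift_poly_def
  by (intro ring_map.ring_map_poly_eval ring_map_comp ring_map_poly_const)

lemma ring_map_const_const: "ring_map (poly_const \<circ> poly_const :: 'k::comm_ring_1 \<Rightarrow> ('n::finite, ('n, 'k) polynomial) polynomial)"
  by (intro ring_map_comp ring_map_poly_const)

lemma lift_poly_const: "lift_poly (poly_const c) = poly_const (poly_const c)"
  and lift_poly_var: "lift_poly (poly_var i) = poly_var i"
  by (simp_all add: lift_poly_def ring_map.poly_eval_const[OF ring_map_const_const]
      ring_map.poly_eval_var[OF ring_map_const_const])

lemma lift_poly_single: "lift_poly (Poly_Mapping.single m c) = Poly_Mapping.single m (poly_const c)"
  unfolding monomial_as_product[of m c] monomial_as_product[of m "poly_const c"]
  by (simp only: lift_poly.map_mult lift_poly.map_prod lift_poly.map_power lift_poly_const lift_poly_var)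

lemma lookup_lift_poly: "lookup (lift_poly p) m = poly_const (lookup p m)"
  by (induction p rule: poly_mapping_single_induct)
     (simp_all add: lift_poly.map_zero lift_poly.map_add lift_poly_single lookup_add poly_const_add poly_const_0
      lookup_single when_def)

lemma lift_poly_linear_form: "lift_poly (linear_form c) = linear_form (\<lambda>i. poly_const (c i))"
  by (simp add: linear_form_def lift_poly.map_sum lift_poly.map_mult lift_poly_const lift_poly_var)

lemma total_diff_add: "total_diff (f + g) = total_diff f + total_diff g"
  by (simp add: total_diff_def pd_add linear_form_add)

lemma total_diff_mult: "total_diff (f * g) = poly_const f * total_diff g + poly_const g * total_diff f"
  by (simp add: total_diff_def pd_mult linear_form_add linear_form_scale)

lemma linear_form_zero: "linear_form (\<lambda>_. 0) = 0"
  by (simp add: linear_form_def poly_const_0)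

lemma total_diff_const: "total_diff (poly_const c) = 0"
  by (simp add: total_diff_def pd_const linear_form_zero)

lemma linear_form_unit: "linear_form (\<lambda>j. if j = i then 1 else 0) = poly_var i"
proof -
  have "linear_form (\<lambda>j. if j = i then 1 else 0) = (\<Sum>j\<in>UNIV. if j = i then poly_var i else 0)"
    unfolding linear_form_def by (rule sum.cong[OF refl]) (simp add: poly_const_1 poly_const_0)
  then show ?thesis by simp
qed

lemma total_diff_var: "total_diff (poly_var i) = poly_var i"
  by (simp add: total_diff_def pd_var linear_form_unit)

lemma total_diff_linear_form: "total_diff (linear_form c) = lift_poly (linear_form c)"
  by (simp add: total_diff_def pd_linear_form lift_poly_linear_form)

lemma homogeneous_total_diff: "homogeneous 1 (total_diff f)"
  unfolding total_diff_def by (rule homogeneous_linear_form)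

definition lin_fun :: "(('n \<Rightarrow>\<^sub>0 nat) \<Rightarrow> 'c::comm_ring_1) \<Rightarrow> ('n, 'c) polynomial \<Rightarrow> 'c" where
  "lin_fun a b = (\<Sum>x\<in>keys b. lookup b x * a x)"

lemma lin_fun_add: "lin_fun a (b + c) = lin_fun a b + lin_fun a c"
  unfolding lin_fun_def by (rule setsum_keys_plus_distrib) (simp_all add: distrib_right)

lemma lin_fun_single: "lin_fun a (Poly_Mapping.single m c) = c * a m"
  by (simp add: lin_fun_def)

lemma lin_fun_0: "lin_fun a 0 = 0" by (simp add: lin_fun_def)

lemma lin_fun_sum: "lin_fun a (\<Sum>i\<in>I. f i) = (\<Sum>i\<in>I. lin_fun a (f i))"
  by (induction I rule: infinite_finite_induct) (simp_all add: lin_fun_0 lin_fun_add)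

lemma lin_fun_const_mult: "lin_fun a (poly_const s * b) = s * lin_fun a b"
  by (induction b rule: poly_mapping_single_induct)
     (simp_all add: lin_fun_0 poly_const_single lin_fun_single lin_fun_add distrib_left mult.assoc)

lemma lin_fun_eq_pairing:
  assumes "homogeneous q b" shows "lin_fun a b = pairing (monomials_of_degree q) a (lookup b)"
proof -
  have "keys b \<subseteq> monomials_of_degree q" using assms by (auto simp: homogeneous_def monomials_of_degree_def)
  then show ?thesis
    unfolding lin_fun_def pairing_def
    by (subst sum.mono_neutral_left[OF finite_monomials_of_degree]) (auto simp: in_keys_iff mult.commute)
qed

definition exponent :: "'n list \<Rightarrow> 'n \<Rightarrow>\<^sub>0 nat" where
  "exponent is = (\<Sum>i\<leftarrow>is. Poly_Mapping.single i 1)"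

lemma exponent_simps: "exponent [] = 0" "exponent (i # is) = Poly_Mapping.single i 1 + exponent is"
  by (simp_all add: exponent_def)

lemma lookup_exponent: "lookup (exponent is) i = count (mset is) i"
  by (induction "is") (auto simp: exponent_simps lookup_add lookup_single when_def)

lemma exponent_eq_iff: "exponent is = exponent js \<longleftrightarrow> mset is = mset js"
proof
  assume eq: "exponent is = exponent js"
  show "mset is = mset js"
    by (rule multiset_eqI) (simp only: lookup_exponent[symmetric] eq)
next
  assume eq: "mset is = mset js"
  show "exponent is = exponent js"
    by (rule poly_mapping_eqI) (simp only: lookup_exponent eq)
qed

lemma monomial_degree_exponent: "monomial_degree (exponent is :: 'n::finite \<Rightarrow>\<^sub>0 nat) = length is"
  by (induction "is") (simp_all add: exponent_simps monomial_degree_0 monomial_degree_add monomial_degree_single)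

lemma exponent_surj: "monomial_degree (m :: 'n::finite \<Rightarrow>\<^sub>0 nat) = q \<Longrightarrow> \<exists>is. length is = q \<and> exponent is = m"
proof (induction q arbitrary: m)
  case 0
  then have "lookup m i = 0" for i using monomial_degree_pos[of m i] by simp
  then have "m = 0" by (intro poly_mapping_eqI) simp
  then show ?case by (simp add: exponent_simps)
next
  case (Suc q)
  then obtain i where i: "lookup m i \<noteq> 0" by (fastforce simp: monomial_degree_def)
  define m' where "m' = m - Poly_Mapping.single i 1"
  have m: "m = Poly_Mapping.single i 1 + m'"
    using i by (intro poly_mapping_eqI) (auto simp: m'_def lookup_add lookup_minus lookup_single when_def)
  then have "monomial_degree m' = q" using Suc.prems by (simp add: monomial_degree_add monomial_degree_single)
  from Suc.IH[OF this] obtain "is" where "length is = q" "exponent is = m'" by blast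
  then show ?case by (intro exI[of _ "i # is"]) (simp add: exponent_simps m)
qed

fun tensor_eval :: "('n::finite list \<Rightarrow> ('n, 'k::comm_ring_1) polynomial) \<Rightarrow> ('n, 'k) polynomial list \<Rightarrow> ('n, 'k) polynomial" where
  "tensor_eval \<alpha> [] = \<alpha> []"
| "tensor_eval \<alpha> (f # fs) = (\<Sum>i\<in>UNIV. tensor_eval (\<lambda>is. \<alpha> (i # is)) fs * pd i f)"

lemma tensor_eval_cong:
  "(\<And>is. length is = length fs \<Longrightarrow> \<alpha> is = \<beta> is) \<Longrightarrow> tensor_eval \<alpha> fs = tensor_eval \<beta> fs"
proof (induction fs arbitrary: \<alpha> \<beta>)
  case (Cons f fs)
  have "tensor_eval (\<lambda>is. \<alpha> (i # is)) fs = tensor_eval (\<lambda>is. \<beta> (i # is)) fs" for i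
    by (rule Cons.IH) (simp add: Cons.prems)
  then show ?case by simp
qed simp

lemma tensor_eval_lin_fun:
  fixes fs :: "('n::finite, 'k::comm_ring_1) polynomial list"
  shows "tensor_eval (\<lambda>is. a (m + exponent is)) fs =
    lin_fun a (Poly_Mapping.single m 1 * (\<Prod>f\<leftarrow>fs. total_diff f))"
proof (induction fs arbitrary: m)
  case Nil
  then show ?case by (simp add: exponent_simps lin_fun_single)
next
  case (Cons f fs)
  have "tensor_eval (\<lambda>is. a (m + exponent is)) (f # fs) =
      (\<Sum>i\<in>UNIV. tensor_eval (\<lambda>is. a ((m + Poly_Mapping.single i 1) + exponent is)) fs * pd i f)"
    by (simp add: exponent_simps add.assoc)
  also have "\<dots> = (\<Sum>i\<in>UNIV. lin_fun a (poly_const (pd i f) *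
      (Poly_Mapping.single (m + Poly_Mapping.single i 1) 1 * (\<Prod>f\<leftarrow>fs. total_diff f))))"
    by (simp only: Cons.IH lin_fun_const_mult mult.commute)
  also have "\<dots> = lin_fun a (Poly_Mapping.single m 1 * total_diff f * (\<Prod>f\<leftarrow>fs. total_diff f))"
  proof -
    have "(\<Sum>i\<in>UNIV. poly_const (pd i f) * (Poly_Mapping.single (m + Poly_Mapping.single i 1) 1 * P)) =
        Poly_Mapping.single m 1 * total_diff f * P" for P
    proof -
      have "Poly_Mapping.single (m + Poly_Mapping.single i 1) (1 :: ('n, 'k) polynomial)
          = Poly_Mapping.single m 1 * poly_var i" for i
        by (simp add: poly_var_def mult_single)
      then show ?thesis
        by (simp add: total_diff_def linear_form_def sum_distrib_left sum_distrib_right ac_simps)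
    qed
    then show ?thesis by (simp add: lin_fun_sum[symmetric])
  qed
  finally show ?case by (simp add: mult.assoc)
qed

locale linear_action = small_ring_action \<Gamma> v w
  for \<Gamma> :: "(('n::finite, 'k::field) polynomial \<Rightarrow> ('n, 'k) polynomial) set" and v w +
  assumes act_const: "g \<in> \<Gamma> \<Longrightarrow> g (poly_const c) = poly_const c"
    and act_linear: "g \<in> \<Gamma> \<Longrightarrow> \<exists>c. g (poly_var i) = linear_form c"
    and card_nonzero: "of_nat (card \<Gamma>) \<noteq> (0::'k)"
begin

lemma ring_map_act: "g \<in> \<Gamma> \<Longrightarrow> ring_map g"
  by (simp add: ring_map_def act_simps)

lemma poly_const_invs: "poly_const c \<in> invs"
  by (simp add: invs_def act_const)

lemma homogeneous_act: assumes g: "g \<in> \<Gamma>" and p: "homogeneous d p" shows "homogeneous d (g p)"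
proof -
  have single: "homogeneous (monomial_degree m) (g (Poly_Mapping.single m c))" for m c
  proof -
    have var: "homogeneous 1 (g (poly_var i))" for i
      using act_linear[OF g, of i] homogeneous_linear_form by auto
    have "homogeneous (\<Sum>i\<in>UNIV. lookup m i * 1) (\<Prod>i\<in>UNIV. g (poly_var i) ^ lookup m i)"
      by (intro homogeneous_prod homogeneous_power var)
    then show ?thesis
      unfolding monomial_as_product[of m c]
      by (simp add: act_simps g act_const homogeneous_const_mult monomial_degree_def)
  qed
  have "homogeneous d (\<Sum>m\<in>keys p. g (Poly_Mapping.single m (lookup p m)))"
  proof (rule homogeneous_sum)
    fix m assume "m \<in> keys p"
    then have "monomial_degree m = d" using p by (simp add: homogeneous_def)
    with single show "homogeneous d (g (Poly_Mapping.single m (lookup p m)))" by blast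
  qed
  then show ?thesis
    by (subst poly_mapping_as_sum[of p]) (simp add: act_sum[OF g])
qed

definition form_act :: "(('n, 'k) polynomial \<Rightarrow> ('n, 'k) polynomial)
    \<Rightarrow> ('n, ('n, 'k) polynomial) polynomial \<Rightarrow> ('n, ('n, 'k) polynomial) polynomial" where
  "form_act g = poly_eval (poly_const \<circ> g) (\<lambda>i. lift_poly (g (poly_var i)))"

lemma ring_map_const_act: "g \<in> \<Gamma> \<Longrightarrow> ring_map (poly_const \<circ> g :: _ \<Rightarrow> ('n, ('n, 'k) polynomial) polynomial)"
  by (intro ring_map_comp ring_map_poly_const ring_map_act)

lemma ring_map_form_act: "g \<in> \<Gamma> \<Longrightarrow> ring_map (form_act g)"
  unfolding form_act_def by (rule ring_map.ring_map_poly_eval[OF ring_map_const_act])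

lemma form_act_const: "g \<in> \<Gamma> \<Longrightarrow> form_act g (poly_const s) = poly_const (g s)"
  and form_act_var: "g \<in> \<Gamma> \<Longrightarrow> form_act g (poly_var i) = lift_poly (g (poly_var i))"
  by (simp_all add: form_act_def ring_map.poly_eval_const[OF ring_map_const_act]
     ring_map.poly_eval_var[OF ring_map_const_act])

lemma form_act_single:
  assumes g: "g \<in> \<Gamma>"
  shows "form_act g (Poly_Mapping.single m s) = poly_const (g s) * lift_poly (g (Poly_Mapping.single m 1))"
  unfolding monomial_as_product[of m s] monomial_as_product[of m 1]
  by (simp add: ring_map.map_mult[OF ring_map_form_act[OF g]] ring_map.map_prod[OF ring_map_form_act[OF g]]
      ring_map.map_power[OF ring_map_form_act[OF g]] form_act_const[OF g] form_act_var[OF g] act_simps g act_const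
      poly_const_1 lift_poly.map_prod lift_poly.map_power)

lemma total_diff_act: assumes g: "g \<in> \<Gamma>" shows "total_diff (g f) = form_act g (total_diff f)"
proof (induction f rule: polynomial_induct)
  case (const c)
  then show ?case
    by (simp add: act_const g total_diff_const ring_map.map_zero[OF ring_map_form_act[OF g]])
next
  case (var i)
  obtain c where "g (poly_var i) = linear_form c" using act_linear[OF g] by blast
  then show ?case by (simp add: total_diff_var form_act_var[OF g] total_diff_linear_form)
next
  case (add p q)
  then show ?case
    by (simp add: act_simps g total_diff_add ring_map.map_add[OF ring_map_form_act[OF g]])
next
  case (mult p q)
  then show ?case
    by (simp add: act_simps g total_diff_mult ring_map.map_add[OF ring_map_form_act[OF g]]
      ring_map.map_mult[OF ring_map_form_act[OF g]] form_act_const[OF g])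
qed

lemma total_diff_invariant: "g \<in> \<Gamma> \<Longrightarrow> f \<in> invs \<Longrightarrow> form_act g (total_diff f) = total_diff f"
  by (simp add: total_diff_act[symmetric] invsD)

definition mono_rho :: "(('n, 'k) polynomial \<Rightarrow> ('n, 'k) polynomial) \<Rightarrow> ('n \<Rightarrow>\<^sub>0 nat) \<Rightarrow> ('n \<Rightarrow>\<^sub>0 nat) \<Rightarrow> ('n, 'k) polynomial" where
  "mono_rho g x y = poly_const (lookup (g (Poly_Mapping.single y 1)) x)"

text \<open>The action on homogeneous polynomials is linear over the ground field.\<close>

lemma monomial_act_expand:
  assumes g: "g \<in> \<Gamma>" and p: "homogeneous q p"
  shows "lookup (g p) x = (\<Sum>y\<in>monomials_of_degree q. lookup (g (Poly_Mapping.single y 1)) x * lookup p y)"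
proof -
  have "keys p \<subseteq> monomials_of_degree q" using p by (auto simp: homogeneous_def monomials_of_degree_def)
  then have "p = (\<Sum>y\<in>monomials_of_degree q. poly_const (lookup p y) * Poly_Mapping.single y 1)"
    by (subst poly_mapping_as_sum)
       (auto intro!: sum.mono_neutral_cong_left finite_monomials_of_degree simp: in_keys_iff poly_const_single)
  then have "g p = g (\<Sum>y\<in>monomials_of_degree q. poly_const (lookup p y) * Poly_Mapping.single y 1)" by simp
  also have "\<dots> = (\<Sum>y\<in>monomials_of_degree q. poly_const (lookup p y) * g (Poly_Mapping.single y 1))"
    by (simp add: act_simps g act_const)
  finally show ?thesis by (simp add: lookup_sum lookup_const_mult mult.commute)
qed

lemma monomial_rep: "semilinear_rep \<Gamma> v w (monomials_of_degree q) mono_rho"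
proof (unfold_locales)
  show "finite (monomials_of_degree q :: ('n \<Rightarrow>\<^sub>0 nat) set)" by (rule finite_monomials_of_degree)
  show "mono_rho g x y \<in> invs" for g x y by (simp add: mono_rho_def poly_const_invs)
  show "mono_rho id x y = (if x = y then 1 else 0)" for x y
    by (simp add: mono_rho_def lookup_single when_def poly_const_1 poly_const_0)
  show "mono_rho (g \<circ> h) x z = (\<Sum>y\<in>monomials_of_degree q. mono_rho g x y * mono_rho h y z)"
    if "g \<in> \<Gamma>" "h \<in> \<Gamma>" "x \<in> monomials_of_degree q" "z \<in> monomials_of_degree q" for g h x z
  proof -
    have "homogeneous q (h (Poly_Mapping.single z 1))"
      using homogeneous_act[OF that(2) homogeneous_single[of z]] that(4) by (simp add: monomials_of_degree_def)
    from monomial_act_expand[OF that(1) this, of x] show ?thesis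
      by (simp add: mono_rho_def poly_const_sum poly_const_mult)
  qed
  show "\<exists>c\<in>invs. c * of_nat (card \<Gamma>) = 1"
    using card_nonzero by (intro bexI[of _ "poly_const (1 / of_nat (card \<Gamma>))"] poly_const_invs)
      (simp add: poly_const_of_nat[symmetric] poly_const_mult[symmetric] poly_const_1)
qed

text \<open>This identifies the forms of degree \<open>q\<close> with \<open>S\<^sup>X\<close> for the set \<open>X\<close> of monomials of degree \<open>q\<close>.\<close>

lemma homogeneous_form_act:
  assumes g: "g \<in> \<Gamma>" and b: "homogeneous q b"
  shows "lookup (form_act g b) = semilinear_rep.act (monomials_of_degree q) mono_rho g (lookup b)"
proof
  fix x
  interpret semilinear_rep \<Gamma> v w "monomials_of_degree q" mono_rho by (rule monomial_rep)
  have sub: "keys b \<subseteq> monomials_of_degree q" using b by (auto simp: homogeneous_def monomials_of_degree_def)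
  have "form_act g b = (\<Sum>y\<in>keys b. form_act g (Poly_Mapping.single y (lookup b y)))"
    by (subst (1) poly_mapping_as_sum[of b]) (simp add: ring_map.map_sum[OF ring_map_form_act[OF g]])
  then have "lookup (form_act g b) x = (\<Sum>y\<in>keys b. mono_rho g x y * g (lookup b y))"
    by (simp add: lookup_sum form_act_single[OF g] lookup_const_mult lookup_lift_poly mono_rho_def mult.commute)
  also have "\<dots> = (\<Sum>y\<in>monomials_of_degree q. mono_rho g x y * g (lookup b y))"
    by (rule sum.mono_neutral_left[OF finite_monomials_of_degree sub]) (auto simp: in_keys_iff act_simps g)
  also have "\<dots> = act g (lookup b) x"
  proof (cases "x \<in> monomials_of_degree q")
    case False
    have "mono_rho g x y = 0" if "y \<in> monomials_of_degree q" for y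
      using homogeneous_lookup[OF homogeneous_act[OF g homogeneous_single[of y 1]], of x] that False
      by (simp add: mono_rho_def poly_const_0 monomials_of_degree_def)
    then show ?thesis using False by (simp add: act_def)
  qed (simp add: act_def)
  finally show "lookup (form_act g b) x = act g (lookup b) x" .
qed

lemma homogeneous_fixed:
  assumes "homogeneous q b" "\<And>g. g \<in> \<Gamma> \<Longrightarrow> form_act g b = b"
  shows "lookup b \<in> semilinear_rep.fixed \<Gamma> (monomials_of_degree q) mono_rho"
  unfolding semilinear_rep.fixed_def[OF monomial_rep]
  using homogeneous_form_act[OF _ assms(1)] assms(2) by auto

subsection \<open>Derivations of the invariant ring\<close>

lemma derivation_pd: "derivation (\<lambda>f. \<Sum>i\<in>UNIV. a i * pd i f)"
  unfolding derivation_def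
  by (simp add: pd_add pd_mult algebra_simps sum.distrib sum_distrib_left)

text \<open>A derivation that vanishes on the invariants is zero, also on the variables.\<close>

lemma pd_independent:
  assumes "\<And>f. f \<in> invs \<Longrightarrow> (\<Sum>i\<in>UNIV. a i * pd i f) = 0" shows "a j = 0"
proof -
  have "(\<Sum>i\<in>UNIV. a i * pd i (poly_var j)) = 0"
    using derivation_zero_on_invs[OF derivation_pd assms] by blast
  moreover have "(\<Sum>i\<in>UNIV. a i * pd i (poly_var j)) = (\<Sum>i\<in>UNIV. if i = j then a j else 0)"
    by (rule sum.cong[OF refl]) (simp add: pd_var)
  ultimately show ?thesis by simp
qed

lemma pd_unique:
  assumes "\<And>f. f \<in> invs \<Longrightarrow> (\<Sum>i\<in>UNIV. a i * pd i f) = (\<Sum>i\<in>UNIV. b i * pd i f)" shows "a j = b j"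
proof -
  have "a j - b j = 0"
    by (rule pd_independent[of "\<lambda>i. a i - b i"]) (simp add: assms left_diff_distrib sum_subtractf)
  then show ?thesis by simp
qed

text \<open>Extend to the polynomial ring, where a derivation is determined by its values on the variables.\<close>

lemma inv_derivation_pd:
  assumes \<delta>: "inv_derivation \<delta>" "\<And>c. \<delta> (poly_const c) = 0"
  shows "\<exists>a. \<forall>f\<in>invs. \<delta> f = (\<Sum>i\<in>UNIV. a i * pd i f)"
proof -
  obtain D where D: "derivation D" "\<And>r. r \<in> invs \<Longrightarrow> D r = \<delta> r" using extend_derivation[OF \<delta>(1)] by blast
  have "D f = (\<Sum>i\<in>UNIV. D (poly_var i) * pd i f)" for f
  proof (induction f rule: polynomial_induct)
    case (const c)
    then show ?case by (simp add: D(2) poly_const_invs \<delta>(2) pd_const)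
  next
    case (var j)
    have "(\<Sum>i\<in>UNIV. D (poly_var i) * pd i (poly_var j)) = (\<Sum>i\<in>UNIV. if i = j then D (poly_var j) else 0)"
      by (rule sum.cong[OF refl]) (simp add: pd_var)
    then show ?case by simp
  next
    case (add p q)
    have "D (p + q) = D p + D q" using D(1) by (simp add: derivation_def)
    also have "\<dots> = (\<Sum>i\<in>UNIV. D (poly_var i) * pd i p) + (\<Sum>i\<in>UNIV. D (poly_var i) * pd i q)"
      using add by simp
    finally show ?case by (simp only: pd_add distrib_left sum.distrib)
  next
    case (mult p q)
    have "D (p * q) = p * D q + q * D p" using D(1) by (simp add: derivation_def)
    also have "\<dots> = p * (\<Sum>i\<in>UNIV. D (poly_var i) * pd i q) + q * (\<Sum>i\<in>UNIV. D (poly_var i) * pd i p)"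
      using mult by simp
    finally show ?case
      by (simp only: pd_mult distrib_left sum.distrib sum_distrib_left mult.left_commute)
  qed
  then have "\<forall>f\<in>invs. \<delta> f = (\<Sum>i\<in>UNIV. D (poly_var i) * pd i f)" using D(2) by metis
  then show ?thesis by (rule exI[of _ "\<lambda>i. D (poly_var i)"])
qed

text \<open>Symmetric multiderivations are functions of multisets; a condition on one argument suffices.\<close>

definition multiderivation :: "nat \<Rightarrow> (('n, 'k) polynomial multiset \<Rightarrow> ('n, 'k) polynomial) \<Rightarrow> bool" where
  "multiderivation q D \<longleftrightarrow> (\<forall>T. Suc (size T) = q \<longrightarrow> set_mset T \<subseteq> invs \<longrightarrow>
     inv_derivation (\<lambda>f. D (add_mset f T)) \<and> (\<forall>c. D (add_mset (poly_const c) T) = 0))"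

text \<open>Fixing all arguments but one gives coefficients by \<open>inv_derivation_pd\<close>.  They are unique by
  \<open>pd_unique\<close>, hence themselves multiderivations in the remaining arguments.\<close>

lemma multiderivation_tensor:
  "multiderivation q D \<Longrightarrow> \<exists>\<alpha>. \<forall>fs. length fs = q \<longrightarrow> set fs \<subseteq> invs \<longrightarrow> D (mset fs) = tensor_eval \<alpha> fs"
proof (induction q arbitrary: D)
  case 0
  then show ?case by (intro exI[of _ "\<lambda>_. D {#}"]) simp
next
  case (Suc q)
  define ok where "ok T \<longleftrightarrow> size T = q \<and> set_mset T \<subseteq> invs" for T :: "('n, 'k) polynomial multiset"
  have der: "inv_derivation (\<lambda>f. D (add_mset f T))" "D (add_mset (poly_const c) T) = 0" if "ok T" for T c
    using Suc.prems that by (auto simp: multiderivation_def ok_def)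
  have "\<forall>T. \<exists>a. ok T \<longrightarrow> (\<forall>f\<in>invs. D (add_mset f T) = (\<Sum>i\<in>UNIV. a i * pd i f))"
    using inv_derivation_pd[OF der] by blast
  then obtain a where a: "\<And>T f. ok T \<Longrightarrow> f \<in> invs \<Longrightarrow> D (add_mset f T) = (\<Sum>i\<in>UNIV. a T i * pd i f)"
    by metis
  have "multiderivation q (\<lambda>T. a T i)" for i
    unfolding multiderivation_def
  proof (intro allI impI conjI)
    fix T :: "('n, 'k) polynomial multiset" assume T: "Suc (size T) = q" "set_mset T \<subseteq> invs"
    have ok: "ok (add_mset f T)" if "f \<in> invs" for f using that T by (simp add: ok_def)
    have val: "(\<Sum>i\<in>UNIV. a (add_mset f T) i * pd i h) = D (add_mset f (add_mset h T))" if "f \<in> invs" "h \<in> invs" for f h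
      using a[OF ok that(2)] that by (simp add: add_mset_commute)
    show "inv_derivation (\<lambda>f. a (add_mset f T) i)"
      unfolding inv_derivation_def
    proof (intro ballI conjI)
      fix f g assume fg: "f \<in> invs" "g \<in> invs"
      show "a (add_mset (f + g) T) i = a (add_mset f T) i + a (add_mset g T) i"
      proof (rule pd_unique[of _ "\<lambda>i. a (add_mset f T) i + a (add_mset g T) i"])
        fix h assume h: "h \<in> invs"
        show "(\<Sum>i\<in>UNIV. a (add_mset (f + g) T) i * pd i h) =
            (\<Sum>i\<in>UNIV. (a (add_mset f T) i + a (add_mset g T) i) * pd i h)"
          using der(1)[OF ok[OF h]] fg
          by (simp add: distrib_right sum.distrib val fg h invs_add inv_derivation_def)
      qed
      show "a (add_mset (f * g) T) i = f * a (add_mset g T) i + g * a (add_mset f T) i"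
      proof (rule pd_unique[of _ "\<lambda>i. f * a (add_mset g T) i + g * a (add_mset f T) i"])
        fix h assume h: "h \<in> invs"
        show "(\<Sum>i\<in>UNIV. a (add_mset (f * g) T) i * pd i h) =
            (\<Sum>i\<in>UNIV. (f * a (add_mset g T) i + g * a (add_mset f T) i) * pd i h)"
          using der(1)[OF ok[OF h]] fg
          by (simp add: distrib_right sum.distrib mult.assoc sum_distrib_left[symmetric] val fg h invs_mult
              inv_derivation_def)
      qed
    qed
    fix c
    show "a (add_mset (poly_const c) T) i = 0"
    proof (rule pd_independent)
      fix h assume h: "h \<in> invs"
      show "(\<Sum>i\<in>UNIV. a (add_mset (poly_const c) T) i * pd i h) = 0"
        using der(2)[OF ok[OF h]] by (simp add: val poly_const_invs h)
    qed
  qed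
  then have "\<forall>i. \<exists>\<alpha>. \<forall>fs. length fs = q \<longrightarrow> set fs \<subseteq> invs \<longrightarrow> a (mset fs) i = tensor_eval \<alpha> fs"
    using Suc.IH by blast
  then obtain A where A: "\<And>i fs. length fs = q \<Longrightarrow> set fs \<subseteq> invs \<Longrightarrow> a (mset fs) i = tensor_eval (A i) fs"
    by metis
  show ?case
  proof (intro exI[of _ "\<lambda>is. A (hd is) (tl is)"] allI impI)
    fix fs :: "('n, 'k) polynomial list" assume fs: "length fs = Suc q" "set fs \<subseteq> invs"
    then obtain f fs' where f: "fs = f # fs'" by (cases fs) auto
    then show "D (mset fs) = tensor_eval (\<lambda>is. A (hd is) (tl is)) fs"
      using fs a[of "mset fs'" f] by (simp add: ok_def A)
  qed
qed

lemma tensor_unique: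
  assumes "\<And>fs. length fs = q \<Longrightarrow> set fs \<subseteq> invs \<Longrightarrow> tensor_eval \<alpha> fs = tensor_eval \<beta> fs" "length is = q"
  shows "\<alpha> is = \<beta> is"
  using assms
proof (induction q arbitrary: \<alpha> \<beta> "is")
  case 0
  from 0(1)[of "[]"] 0(2) show ?case by simp
next
  case (Suc q)
  obtain i js where "is": "is = i # js" "length js = q" using Suc.prems(2) by (cases "is") auto
  have "tensor_eval (\<lambda>is. \<alpha> (i # is)) fs = tensor_eval (\<lambda>is. \<beta> (i # is)) fs"
    if fs: "length fs = q" "set fs \<subseteq> invs" for fs
  proof (rule pd_unique[of "\<lambda>i. tensor_eval (\<lambda>is. \<alpha> (i # is)) fs" "\<lambda>i. tensor_eval (\<lambda>is. \<beta> (i # is)) fs"])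
    fix f assume "f \<in> invs"
    with Suc.prems(1)[of "f # fs"] fs
    show "(\<Sum>i\<in>UNIV. tensor_eval (\<lambda>is. \<alpha> (i # is)) fs * pd i f) = (\<Sum>i\<in>UNIV. tensor_eval (\<lambda>is. \<beta> (i # is)) fs * pd i f)"
      by simp
  qed
  from Suc.IH[OF this "is"(2)] show ?case by (simp add: "is")
qed

text \<open>Uniqueness of the coefficients transfers symmetry in the arguments to symmetry in the indices; it
  suffices to move the first index and to swap the first two.\<close>

lemma tensor_symmetric:
  assumes "\<And>fs gs. length fs = q \<Longrightarrow> set fs \<subseteq> invs \<Longrightarrow> mset fs = mset gs \<Longrightarrow> tensor_eval \<alpha> fs = tensor_eval \<alpha> gs"
    and "length is = q" "mset is = mset js"
  shows "\<alpha> is = \<alpha> js"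
  using assms
proof (induction q arbitrary: \<alpha> "is" js)
  case 0
  then show ?case by simp
next
  case (Suc q)
  have sym: "tensor_eval (\<lambda>is. \<alpha> (i # is)) fs = tensor_eval (\<lambda>is. \<alpha> (i # is)) gs"
    if fs: "length fs = q" "set fs \<subseteq> invs" "mset fs = mset gs" for fs gs i
  proof (rule pd_unique[of "\<lambda>i. tensor_eval (\<lambda>is. \<alpha> (i # is)) fs" "\<lambda>i. tensor_eval (\<lambda>is. \<alpha> (i # is)) gs"])
    fix f assume "f \<in> invs"
    with Suc.prems(1)[of "f # fs" "f # gs"] fs
    show "(\<Sum>i\<in>UNIV. tensor_eval (\<lambda>is. \<alpha> (i # is)) fs * pd i f) = (\<Sum>i\<in>UNIV. tensor_eval (\<lambda>is. \<alpha> (i # is)) gs * pd i f)"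
      by simp
  qed
  have tail: "\<alpha> (i # ks) = \<alpha> (i # ls)" if "length ks = q" "mset ks = mset ls" for i ks ls
    using Suc.IH[of "\<lambda>is. \<alpha> (i # is)" ks ls] sym that by blast
  obtain i ks where i: "is = i # ks" "length ks = q" using Suc.prems(2) by (cases "is") auto
  have "length js = Suc q" using Suc.prems by (metis size_mset)
  then obtain j ls where j: "js = j # ls" "length ls = q" by (cases js) auto
  show ?case
  proof (cases "i = j")
    case True
    with Suc.prems(3) have "mset ks = mset ls" by (simp add: i(1) j(1))
    then show ?thesis unfolding i(1) j(1) True by (rule tail[OF i(2)])
  next
    case False
    with Suc.prems(3) obtain N where N: "mset ks = add_mset j N" "mset ls = add_mset i N"
      by (auto simp: i j add_eq_conv_ex)
    obtain ns where ns: "mset ns = N" using ex_mset by blast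
    have len: "Suc (length ns) = q" using i(2) N(1) ns by (metis size_mset size_add_mset)
    have swap: "\<alpha> (i # j # ns) = \<alpha> (j # i # ns)"
    proof -
      \<comment> \<open>\<open>\<alpha>\<close> with the first two indices exchanged; it evaluates to the same values by symmetry.\<close>
      define \<beta> where "\<beta> is = \<alpha> (is ! 1 # is ! 0 # drop 2 is)" for "is"
      have "\<alpha> (i # j # ns) = \<beta> (i # j # ns)"
      proof (rule tensor_unique[of "Suc q"])
        fix fs :: "('n, 'k) polynomial list" assume fs: "length fs = Suc q" "set fs \<subseteq> invs"
        with len obtain f g fs' where f: "fs = f # g # fs'" by (cases fs; cases "tl fs") auto
        have "tensor_eval \<beta> fs = (\<Sum>i\<in>UNIV. \<Sum>j\<in>UNIV. tensor_eval (\<lambda>is. \<alpha> (j # i # is)) fs' * pd j g * pd i f)"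
          by (simp add: f \<beta>_def sum_distrib_right)
        also have "\<dots> = tensor_eval \<alpha> (g # f # fs')"
          by (subst sum.swap) (simp add: sum_distrib_right mult.assoc mult.commute[of "pd _ g"])
        also have "\<dots> = tensor_eval \<alpha> fs" using Suc.prems(1)[of fs "g # f # fs'"] fs by (simp add: f)
        finally show "tensor_eval \<alpha> fs = tensor_eval \<beta> fs" by simp
      qed (simp add: len)
      then show ?thesis by (simp add: \<beta>_def)
    qed
    have "\<alpha> is = \<alpha> (i # j # ns)" unfolding i(1) by (rule tail[OF i(2)]) (simp add: N ns)
    also have "\<dots> = \<alpha> (j # i # ns)" by (rule swap)
    also have "\<dots> = \<alpha> js" unfolding j(1) by (rule tail) (simp_all add: N ns len)
    finally show ?thesis .
  qed
qed

definition diff_prod :: "('n, 'k) polynomial multiset \<Rightarrow> ('n, ('n, 'k) polynomial) polynomial" where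
  "diff_prod T = (\<Prod>f\<in>#T. total_diff f)"

lemma tensor_eval_diff_prod:
  "tensor_eval (\<lambda>is. a (exponent is)) fs = lin_fun a (diff_prod (mset fs))"
  using tensor_eval_lin_fun[of a 0 fs]
  by (simp add: diff_prod_def prod_mset_prod_list mset_map[symmetric] del: mset_map)

lemma homogeneous_diff_prod: "homogeneous (size T) (diff_prod T)"
proof (induction T)
  case empty
  then show ?case by (simp add: diff_prod_def homogeneous_one)
next
  case (add f T)
  then show ?case using homogeneous_mult[OF homogeneous_total_diff add] by (simp add: diff_prod_def)
qed

text \<open>The coefficients of the representing tensor are symmetric, so that they are a function of the
  monomial \<open>exponent is\<close>.  There is no division by multinomial coefficients, because the
  sum over the index sequences with the same monomial is already part of the coefficient of that
  monomial in the product of the differentials.\<close>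

theorem multiderivation_pairing:
  assumes D: "multiderivation q D"
  obtains a where "\<And>T. size T = q \<Longrightarrow> set_mset T \<subseteq> invs \<Longrightarrow>
    D T = pairing (monomials_of_degree q) a (lookup (diff_prod T))"
proof -
  obtain \<alpha> where \<alpha>: "\<And>fs. length fs = q \<Longrightarrow> set fs \<subseteq> invs \<Longrightarrow> D (mset fs) = tensor_eval \<alpha> fs"
    using multiderivation_tensor[OF D] by blast
  have sym: "\<alpha> is = \<alpha> js" if "length is = q" "mset is = mset js" for "is" js
  proof (rule tensor_symmetric[OF _ that])
    fix fs gs :: "('n, 'k) polynomial list"
    assume fs: "length fs = q" "set fs \<subseteq> invs" "mset fs = mset gs"
    then have "length gs = q" "set gs \<subseteq> invs" by (metis size_mset, metis mset_eq_setD)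
    then show "tensor_eval \<alpha> fs = tensor_eval \<alpha> gs" using \<alpha>[of fs] \<alpha>[of gs] fs by simp
  qed
  define a where "a m = \<alpha> (SOME is. exponent is = m)" for m
  have a: "a (exponent is) = \<alpha> is" if "length is = q" for "is"
  proof -
    have "exponent (SOME js. exponent js = exponent is) = exponent is"
      by (rule someI[of "\<lambda>js. exponent js = exponent is" "is"]) (rule refl)
    then have "mset is = mset (SOME js. exponent js = exponent is)" by (simp only: exponent_eq_iff)
    from sym[OF that this] show ?thesis by (simp add: a_def)
  qed
  show ?thesis
  proof (rule that[of a])
    fix T assume T: "size T = q" "set_mset T \<subseteq> invs"
    obtain fs where fs: "mset fs = T" using ex_mset by blast
    have "D T = tensor_eval \<alpha> fs" using \<alpha>[of fs] T by (auto simp: fs[symmetric])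
    also have "\<dots> = tensor_eval (\<lambda>is. a (exponent is)) fs"
      by (rule tensor_eval_cong) (use T in \<open>auto simp: fs[symmetric] a\<close>)
    also have "\<dots> = lin_fun a (diff_prod T)" by (simp only: tensor_eval_diff_prod fs)
    also have "\<dots> = pairing (monomials_of_degree q) a (lookup (diff_prod T))"
      using homogeneous_diff_prod[of T] T by (simp add: lin_fun_eq_pairing)
    finally show "D T = pairing (monomials_of_degree q) a (lookup (diff_prod T))" .
  qed
qed

theorem pairing_diff_prod_faithful:
  assumes "\<And>T. size T = q \<Longrightarrow> set_mset T \<subseteq> invs \<Longrightarrow> pairing (monomials_of_degree q) a (lookup (diff_prod T)) = 0"
    and "m \<in> monomials_of_degree q"
  shows "a m = 0"
proof -
  have z: "tensor_eval (\<lambda>_. 0) fs = 0" for fs :: "('n, 'k) polynomial list" by (induction fs) auto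
  obtain "is" where "is": "length is = q" "exponent is = m"
    using exponent_surj[of m q] assms(2) by (auto simp: monomials_of_degree_def)
  have "(\<lambda>is. a (exponent is)) is = (\<lambda>_. 0) is"
  proof (rule tensor_unique[OF _ "is"(1)])
    fix fs :: "('n, 'k) polynomial list" assume fs: "length fs = q" "set fs \<subseteq> invs"
    have "tensor_eval (\<lambda>is. a (exponent is)) fs = pairing (monomials_of_degree q) a (lookup (diff_prod (mset fs)))"
      using homogeneous_diff_prod[of "mset fs"] fs by (simp add: tensor_eval_diff_prod lin_fun_eq_pairing)
    then show "tensor_eval (\<lambda>is. a (exponent is)) fs = tensor_eval (\<lambda>_. 0) fs"
      using assms(1)[of "mset fs"] fs by (simp add: z)
  qed
  then show ?thesis by (simp add: "is")
qed

end

section \<open>Modules given by generators and relations\<close>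

lemma module_homI:
  assumes "\<And>x. x \<in> carrier M \<Longrightarrow> f x \<in> carrier N"
    "\<And>x y. x \<in> carrier M \<Longrightarrow> y \<in> carrier M \<Longrightarrow> f (x \<oplus>\<^bsub>M\<^esub> y) = f x \<oplus>\<^bsub>N\<^esub> f y"
    "\<And>a x. a \<in> carrier R \<Longrightarrow> x \<in> carrier M \<Longrightarrow> f (a \<odot>\<^bsub>M\<^esub> x) = a \<odot>\<^bsub>N\<^esub> f x"
  shows "f \<in> LinearCombinations.module_hom R M N"
  using assms by (auto simp: LinearCombinations.module_hom_def)

lemma module_hom_mem: "f \<in> LinearCombinations.module_hom R M N \<Longrightarrow> x \<in> carrier M \<Longrightarrow> f x \<in> carrier N"
  by (auto simp: LinearCombinations.module_hom_def)

lemma module_hom_zero: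
  assumes "module R M" "module R N" "f \<in> LinearCombinations.module_hom R M N"
  shows "f \<zero>\<^bsub>M\<^esub> = \<zero>\<^bsub>N\<^esub>"
proof -
  interpret mod_hom R M N f using assms by (simp add: mod_hom_def mod_hom_axioms_def)
  show ?thesis by simp
qed

lemma module_hom_minus:
  assumes "module R M" "module R N" "f \<in> LinearCombinations.module_hom R M N"
    and "x \<in> carrier M" "y \<in> carrier M"
  shows "f (x \<ominus>\<^bsub>M\<^esub> y) = f x \<ominus>\<^bsub>N\<^esub> f y"
proof -
  interpret mod_hom R M N f using assms by (simp add: mod_hom_def mod_hom_axioms_def)
  show ?thesis using assms by simp
qed

lemma minus_eq_zero_iff:
  assumes "abelian_group M" "x \<in> carrier M" "y \<in> carrier M"
  shows "x \<ominus>\<^bsub>M\<^esub> y = \<zero>\<^bsub>M\<^esub> \<longleftrightarrow> x = y"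
proof -
  interpret abelian_group M by fact
  show ?thesis using assms(2,3) by (metis a_minus_def add.inv_equality add.inv_closed local.minus_minus r_neg)
qed

subsection \<open>Quotients\<close>

lemma submodule_abelian_subgroup:
  assumes "LinearCombinations.submodule R N M" shows "abelian_subgroup N M"
proof -
  interpret S: LinearCombinations.submodule R N M by fact
  interpret M: module R M by (rule S.module)
  have inv: "\<ominus>\<^bsub>M\<^esub> x \<in> N" if "x \<in> N" for x
  proof -
    have "\<ominus>\<^bsub>R\<^esub> \<one>\<^bsub>R\<^esub> \<odot>\<^bsub>M\<^esub> x \<in> N" using that by (intro S.smult_closed) auto
    moreover have "\<ominus>\<^bsub>R\<^esub> \<one>\<^bsub>R\<^esub> \<odot>\<^bsub>M\<^esub> x = \<ominus>\<^bsub>M\<^esub> x" using that S.subset by (intro M.smult_minus_1) auto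
    ultimately show ?thesis by simp
  qed
  have "subgroup N (add_monoid M)"
    by (rule subgroup.intro) (use S.subset inv in \<open>auto simp: a_inv_def[symmetric]\<close>)
  then show ?thesis
    by (intro abelian_subgroupI3 additive_subgroupI M.abelian_group_axioms)
qed

locale quotient_of_module = M?: module R M for R and M (structure) +
  fixes N
  assumes sub: "LinearCombinations.submodule R N M"
begin

sublocale N: abelian_subgroup N M
  by (rule submodule_abelian_subgroup[OF sub])

lemma N_smult: "a \<in> carrier R \<Longrightarrow> x \<in> N \<Longrightarrow> a \<odot>\<^bsub>M\<^esub> x \<in> N"
  using sub by (rule LinearCombinations.submodule.smult_closed)

abbreviation "Q \<equiv> quotient_module M N"

definition proj where "proj x = N +>\<^bsub>M\<^esub> x"

lemma carrier_Q: "carrier Q = proj ` carrier M"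
  by (auto simp: quotient_module_def proj_def A_RCOSETS_def')

lemma proj_eq_iff: "x \<in> carrier M \<Longrightarrow> y \<in> carrier M \<Longrightarrow> proj x = proj y \<longleftrightarrow> x \<ominus>\<^bsub>M\<^esub> y \<in> N"
proof
  assume x: "x \<in> carrier M" and y: "y \<in> carrier M"
  { assume "proj x = proj y"
    then have "x \<in> N +>\<^bsub>M\<^esub> y" using N.a_rcos_self[OF x] by (simp add: proj_def)
    then show "x \<ominus>\<^bsub>M\<^esub> y \<in> N" using N.a_rcos_module[OF y x] by (simp add: a_minus_def) }
  { assume "x \<ominus>\<^bsub>M\<^esub> y \<in> N"
    then have "x \<in> N +>\<^bsub>M\<^esub> y" using N.a_rcos_module_rev[OF y x] by (simp add: a_minus_def)
    then show "proj x = proj y" using N.a_repr_independence'[OF _ y] by (simp add: proj_def) }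
qed

lemma proj_add: "x \<in> carrier M \<Longrightarrow> y \<in> carrier M \<Longrightarrow> proj x \<oplus>\<^bsub>Q\<^esub> proj y = proj (x \<oplus>\<^bsub>M\<^esub> y)"
  by (simp add: quotient_module_def proj_def N.a_rcos_sum)

lemma proj_zero: "\<zero>\<^bsub>Q\<^esub> = proj \<zero>\<^bsub>M\<^esub>"
  by (simp add: quotient_module_def proj_def N.a_subset)

lemma proj_smult:
  assumes a: "a \<in> carrier R" and x: "x \<in> carrier M"
  shows "a \<odot>\<^bsub>Q\<^esub> proj x = proj (a \<odot>\<^bsub>M\<^esub> x)"
proof -
  have "proj (a \<odot>\<^bsub>M\<^esub> y) = proj (a \<odot>\<^bsub>M\<^esub> x)" if y: "y \<in> N +>\<^bsub>M\<^esub> x" for y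
  proof -
    obtain h where h: "h \<in> N" "y = h \<oplus>\<^bsub>M\<^esub> x" using y by (auto simp: a_r_coset_def')
    then have hM: "h \<in> carrier M" using N.a_subset by auto
    have "a \<odot>\<^bsub>M\<^esub> y \<ominus>\<^bsub>M\<^esub> (a \<odot>\<^bsub>M\<^esub> x) = a \<odot>\<^bsub>M\<^esub> h"
      using a x hM by (simp add: h smult_r_distr a_minus_def M.a_assoc M.r_neg)
    then show ?thesis using N_smult[OF a h(1)] a x hM by (simp add: proj_eq_iff h)
  qed
  then have "(\<Union>y\<in>N +>\<^bsub>M\<^esub> x. N +>\<^bsub>M\<^esub> (a \<odot>\<^bsub>M\<^esub> y)) = (\<Union>y\<in>N +>\<^bsub>M\<^esub> x. proj (a \<odot>\<^bsub>M\<^esub> x))"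
    by (auto simp: proj_def)
  also have "\<dots> = proj (a \<odot>\<^bsub>M\<^esub> x)" using N.a_rcos_self[OF x] by auto
  finally show ?thesis by (simp add: quotient_module_def proj_def)
qed

lemma proj_mem: "x \<in> carrier M \<Longrightarrow> proj x \<in> carrier Q"
  by (simp add: carrier_Q)

lemma proj_cases: "z \<in> carrier Q \<Longrightarrow> (\<And>x. x \<in> carrier M \<Longrightarrow> z = proj x \<Longrightarrow> P) \<Longrightarrow> P"
  by (auto simp: carrier_Q)

lemma quotient_is_module: "module R Q"
proof (rule moduleI)
  show "cring R" by (rule R.cring_axioms)
  show "abelian_group Q"
  proof (rule abelian_groupI)
    show "\<exists>y\<in>carrier Q. y \<oplus>\<^bsub>Q\<^esub> x = \<zero>\<^bsub>Q\<^esub>" if "x \<in> carrier Q" for x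
    proof -
      obtain z where z: "z \<in> carrier M" "x = proj z" using \<open>x \<in> carrier Q\<close> by (rule proj_cases)
      show ?thesis
        by (rule bexI[of _ "proj (\<ominus>\<^bsub>M\<^esub> z)"]) (use z in \<open>simp_all add: proj_add proj_mem proj_zero M.l_neg\<close>)
    qed
  qed (auto simp: proj_zero proj_add proj_mem M.a_ac elim!: proj_cases)
qed (auto simp: proj_add proj_smult proj_mem smult_l_distr smult_r_distr smult_assoc1 elim!: proj_cases)

lemma hom_from_quotient:
  assumes mod: "module R L" and f: "f \<in> LinearCombinations.module_hom R M L"
    and ker: "\<And>x. x \<in> N \<Longrightarrow> f x = \<zero>\<^bsub>L\<^esub>"
  obtains h where "h \<in> LinearCombinations.module_hom R Q L" "\<And>x. x \<in> carrier M \<Longrightarrow> h (proj x) = f x"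
proof -
  interpret L: module R L by fact
  define h where "h z = f (SOME x. x \<in> carrier M \<and> proj x = z)" for z
  have h: "h (proj x) = f x" if x: "x \<in> carrier M" for x
  proof -
    have "(SOME y. y \<in> carrier M \<and> proj y = proj x) \<in> carrier M \<and>
        proj (SOME y. y \<in> carrier M \<and> proj y = proj x) = proj x"
      by (rule someI[of "\<lambda>y. y \<in> carrier M \<and> proj y = proj x" x]) (simp add: x)
    then obtain y where y: "y = (SOME y. y \<in> carrier M \<and> proj y = proj x)" "y \<in> carrier M" "proj y = proj x" by blast
    then have "y \<ominus>\<^bsub>M\<^esub> x \<in> N" using x by (simp add: proj_eq_iff)
    then have "f y \<ominus>\<^bsub>L\<^esub> f x = \<zero>\<^bsub>L\<^esub>"
      using module_hom_minus[OF module_axioms mod f y(2) x] ker by simp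
    then have "f y = f x" using minus_eq_zero_iff[OF L.M.abelian_group_axioms] module_hom_mem[OF f] x y(2) by blast
    then show ?thesis by (simp add: h_def y(1)[symmetric])
  qed
  have "h \<in> LinearCombinations.module_hom R Q L"
    by (rule module_homI)
      (auto elim!: proj_cases simp: h proj_add proj_smult module_hom_mem[OF f]
        LinearCombinations.module_hom_add[OF f] LinearCombinations.module_hom_smult[OF f])
  then show ?thesis using h that by blast
qed

end

subsection \<open>Free modules\<close>

context cring
begin

abbreviation "Free X \<equiv> free_module R X"

lemma free_carrier: "carrier (Free X) = {f \<in> X \<rightarrow>\<^sub>E carrier R. finite {x \<in> X. f x \<noteq> \<zero>}}"
  and free_add: "f \<oplus>\<^bsub>Free X\<^esub> g = (\<lambda>x\<in>X. f x \<oplus> g x)"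
  and free_smult: "a \<odot>\<^bsub>Free X\<^esub> f = (\<lambda>x\<in>X. a \<otimes> f x)"
  and free_zero: "\<zero>\<^bsub>Free X\<^esub> = (\<lambda>x\<in>X. \<zero>)"
  by (simp_all add: free_module_def func_space_def)

lemma free_is_module: "module R (Free X)"
proof -
  interpret F: module R "func_space X" by (rule func_space_is_module)
  have "LinearCombinations.submodule R {f \<in> X \<rightarrow>\<^sub>E carrier R. finite {x \<in> X. f x \<noteq> \<zero>}} (func_space X)"
  proof (rule LinearCombinations.submodule.intro)
    show "module R (func_space X)" by (rule func_space_is_module)
    fix f g assume f: "f \<in> {f \<in> X \<rightarrow>\<^sub>E carrier R. finite {x \<in> X. f x \<noteq> \<zero>}}"
      and g: "g \<in> {f \<in> X \<rightarrow>\<^sub>E carrier R. finite {x \<in> X. f x \<noteq> \<zero>}}"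
    have "{x \<in> X. (\<lambda>x\<in>X. f x \<oplus> g x) x \<noteq> \<zero>} \<subseteq> {x \<in> X. f x \<noteq> \<zero>} \<union> {x \<in> X. g x \<noteq> \<zero>}" by auto
    then have "finite {x \<in> X. (\<lambda>x\<in>X. f x \<oplus> g x) x \<noteq> \<zero>}" using f g finite_subset by blast
    then show "f \<oplus>\<^bsub>func_space X\<^esub> g \<in> {f \<in> X \<rightarrow>\<^sub>E carrier R. finite {x \<in> X. f x \<noteq> \<zero>}}"
      using f g by (auto simp: func_space_def PiE_iff)
  next
    fix c f assume c: "c \<in> carrier R" and f: "f \<in> {f \<in> X \<rightarrow>\<^sub>E carrier R. finite {x \<in> X. f x \<noteq> \<zero>}}"
    have "{x \<in> X. (\<lambda>x\<in>X. c \<otimes> f x) x \<noteq> \<zero>} \<subseteq> {x \<in> X. f x \<noteq> \<zero>}" using c by auto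
    then have "finite {x \<in> X. (\<lambda>x\<in>X. c \<otimes> f x) x \<noteq> \<zero>}" using f finite_subset by blast
    then show "c \<odot>\<^bsub>func_space X\<^esub> f \<in> {f \<in> X \<rightarrow>\<^sub>E carrier R. finite {x \<in> X. f x \<noteq> \<zero>}}"
      using c f by (auto simp: func_space_def PiE_iff)
  qed (auto simp: func_space_def)
  from F.submodule_is_module[OF this] show ?thesis by (simp add: free_module_def)
qed

lemma free_gen_mem: "x \<in> X \<Longrightarrow> free_gen R X x \<in> carrier (Free X)"
proof -
  have "{y \<in> X. (\<lambda>y\<in>X. if y = x then \<one> else \<zero>) y \<noteq> \<zero>} \<subseteq> {x}" by auto
  then have "finite {y \<in> X. (\<lambda>y\<in>X. if y = x then \<one> else \<zero>) y \<noteq> \<zero>}" using finite_subset by blast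
  then show ?thesis by (auto simp: free_carrier free_gen_def)
qed

lemma free_induct [consumes 1, case_names zero step]:
  assumes f: "f \<in> carrier (Free X)" and zero: "P \<zero>\<^bsub>Free X\<^esub>"
    and step: "\<And>f a x. f \<in> carrier (Free X) \<Longrightarrow> P f \<Longrightarrow> a \<in> carrier R \<Longrightarrow> x \<in> X \<Longrightarrow>
      P (f \<oplus>\<^bsub>Free X\<^esub> a \<odot>\<^bsub>Free X\<^esub> free_gen R X x)"
  shows "P f"
proof -
  have "P f" if "finite A" "f \<in> carrier (Free X)" "{x \<in> X. f x \<noteq> \<zero>} = A" for A f
    using that
  proof (induction A arbitrary: f rule: finite_induct)
    case empty
    then have "f = \<zero>\<^bsub>Free X\<^esub>" by (auto simp: free_carrier free_zero fun_eq_iff PiE_iff extensional_def)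
    then show ?case using zero by simp
  next
    case (insert x A)
    have x: "x \<in> X" "f x \<in> carrier R" using insert.prems by (auto simp: free_carrier)
    define f' where "f' = (\<lambda>y\<in>X. if y = x then \<zero> else f y)"
    have supp: "{y \<in> X. f' y \<noteq> \<zero>} = A" using insert.prems insert.hyps by (auto simp: f'_def)
    have "f' \<in> X \<rightarrow>\<^sub>E carrier R" using insert.prems(1) by (auto simp: f'_def free_carrier PiE_iff)
    then have f': "f' \<in> carrier (Free X)" using supp insert.hyps by (simp add: free_carrier)
    have "f = f' \<oplus>\<^bsub>Free X\<^esub> f x \<odot>\<^bsub>Free X\<^esub> free_gen R X x"
    proof
      fix y show "f y = (f' \<oplus>\<^bsub>Free X\<^esub> f x \<odot>\<^bsub>Free X\<^esub> free_gen R X x) y"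
        using insert.prems(1) x
        by (auto simp: free_add free_smult free_gen_def f'_def free_carrier PiE_iff extensional_def)
    qed
    then show ?case using step[OF f' insert.IH[OF f' supp] x(2,1)] by simp
  qed
  then show ?thesis using f by (auto simp: free_carrier)
qed

lemma hom_from_free:
  assumes mod: "module R N" and u: "\<And>x. x \<in> X \<Longrightarrow> u x \<in> carrier N"
  obtains h where "h \<in> LinearCombinations.module_hom R (Free X) N" "\<And>x. x \<in> X \<Longrightarrow> h (free_gen R X x) = u x"
proof -
  interpret N: module R N by fact
  define h where "h f = (\<Oplus>\<^bsub>N\<^esub>x\<in>{x \<in> X. f x \<noteq> \<zero>}. f x \<odot>\<^bsub>N\<^esub> u x)" for f
  have val: "f x \<in> carrier R" if "f \<in> carrier (Free X)" "x \<in> X" for f x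
    using that by (auto simp: free_carrier)
  have h_sup: "h f = (\<Oplus>\<^bsub>N\<^esub>x\<in>A. f x \<odot>\<^bsub>N\<^esub> u x)"
    if "f \<in> carrier (Free X)" "finite A" "A \<subseteq> X" "{x \<in> X. f x \<noteq> \<zero>} \<subseteq> A" for f A
    unfolding h_def
    by (rule N.add.finprod_mono_neutral_cong_left[OF that(2,4)]) (use that val u in auto)
  have fin: "finite {x \<in> X. f x \<noteq> \<zero>}" if "f \<in> carrier (Free X)" for f
    using that by (auto simp: free_carrier)
  interpret F: module R "Free X" by (rule free_is_module)
  have "h \<in> LinearCombinations.module_hom R (Free X) N"
  proof (rule module_homI)
    show "h f \<in> carrier N" if "f \<in> carrier (Free X)" for f
      unfolding h_def by (rule N.M.finsum_closed) (use that val u in auto)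
    show "h (f \<oplus>\<^bsub>Free X\<^esub> g) = h f \<oplus>\<^bsub>N\<^esub> h g" if fg: "f \<in> carrier (Free X)" "g \<in> carrier (Free X)" for f g
    proof -
      define A where "A = {x \<in> X. f x \<noteq> \<zero>} \<union> {x \<in> X. g x \<noteq> \<zero>}"
      have A: "finite A" "A \<subseteq> X" using fin fg by (auto simp: A_def)
      have "h (f \<oplus>\<^bsub>Free X\<^esub> g) = (\<Oplus>\<^bsub>N\<^esub>x\<in>A. (f \<oplus>\<^bsub>Free X\<^esub> g) x \<odot>\<^bsub>N\<^esub> u x)"
        by (rule h_sup[OF F.M.a_closed[OF fg] A]) (use fg in \<open>auto simp: A_def free_add\<close>)
      also have "\<dots> = (\<Oplus>\<^bsub>N\<^esub>x\<in>A. f x \<odot>\<^bsub>N\<^esub> u x \<oplus>\<^bsub>N\<^esub> g x \<odot>\<^bsub>N\<^esub> u x)"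
        by (rule N.M.finsum_cong') (use A fg val u N.smult_l_distr in \<open>auto simp: free_add subset_iff\<close>)
      also have "\<dots> = (\<Oplus>\<^bsub>N\<^esub>x\<in>A. f x \<odot>\<^bsub>N\<^esub> u x) \<oplus>\<^bsub>N\<^esub> (\<Oplus>\<^bsub>N\<^esub>x\<in>A. g x \<odot>\<^bsub>N\<^esub> u x)"
        by (rule N.M.finsum_addf) (use A fg val u in auto)
      also have "\<dots> = h f \<oplus>\<^bsub>N\<^esub> h g"
        using h_sup[OF fg(1) A] h_sup[OF fg(2) A] by (simp add: A_def)
      finally show ?thesis .
    qed
    show "h (a \<odot>\<^bsub>Free X\<^esub> f) = a \<odot>\<^bsub>N\<^esub> h f" if a: "a \<in> carrier R" and f: "f \<in> carrier (Free X)" for a f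
    proof -
      define A where "A = {x \<in> X. f x \<noteq> \<zero>}"
      have A: "finite A" "A \<subseteq> X" using fin f by (auto simp: A_def)
      have "h (a \<odot>\<^bsub>Free X\<^esub> f) = (\<Oplus>\<^bsub>N\<^esub>x\<in>A. (a \<odot>\<^bsub>Free X\<^esub> f) x \<odot>\<^bsub>N\<^esub> u x)"
        by (rule h_sup[OF F.smult_closed[OF a f] A]) (use a f in \<open>auto simp: A_def free_smult\<close>)
      also have "\<dots> = (\<Oplus>\<^bsub>N\<^esub>x\<in>A. a \<odot>\<^bsub>N\<^esub> (f x \<odot>\<^bsub>N\<^esub> u x))"
        by (rule N.M.finsum_cong') (use A a f val u N.smult_assoc1 in \<open>auto simp: free_smult subset_iff\<close>)
      also have "\<dots> = a \<odot>\<^bsub>N\<^esub> h f"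
        unfolding h_def A_def[symmetric] by (rule N.finsum_smult_ldistr[symmetric]) (use A a f val u in auto)
      finally show ?thesis .
    qed
  qed
  moreover have "h (free_gen R X x) = u x" if x: "x \<in> X" for x
  proof -
    have "h (free_gen R X x) = (\<Oplus>\<^bsub>N\<^esub>y\<in>{x}. free_gen R X x y \<odot>\<^bsub>N\<^esub> u y)"
      by (rule h_sup[OF free_gen_mem[OF x]]) (use x in \<open>auto simp: free_gen_def split: if_splits\<close>)
    then show ?thesis using x u by (simp add: free_gen_def)
  qed
  ultimately show ?thesis by (rule that)
qed

subsection \<open>Presented modules\<close>

lemma presented_quotient:
  assumes "rel \<subseteq> carrier (Free X)"
  shows "quotient_of_module R (Free X) (relation_module R X rel)"
proof -
  interpret F: module R "Free X" by (rule free_is_module)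
  show ?thesis
    using F.span_is_submodule[OF assms] F.module_axioms
    by (simp add: quotient_of_module_def quotient_of_module_axioms_def relation_module_def)
qed

lemma presented_is_module:
  assumes "rel \<subseteq> carrier (Free X)" shows "module R (presented_module R X rel)"
  unfolding presented_module_def by (rule quotient_of_module.quotient_is_module[OF presented_quotient[OF assms]])

lemma presented_gen_eq:
  assumes "rel \<subseteq> carrier (Free X)"
  shows "presented_gen R X rel x = quotient_of_module.proj (Free X) (relation_module R X rel) (free_gen R X x)"
  by (simp add: presented_gen_def quotient_of_module.proj_def[OF presented_quotient[OF assms]])

lemma presented_gen_mem:
  assumes "rel \<subseteq> carrier (Free X)" "x \<in> X"
  shows "presented_gen R X rel x \<in> carrier (presented_module R X rel)"
  unfolding presented_module_def presented_gen_eq[OF assms(1)]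
  by (rule quotient_of_module.proj_mem[OF presented_quotient[OF assms(1)] free_gen_mem[OF assms(2)]])

lemma presented_induct [consumes 2, case_names zero step]:
  assumes rel: "rel \<subseteq> carrier (Free X)" and z: "z \<in> carrier (presented_module R X rel)"
    and zero: "P \<zero>\<^bsub>presented_module R X rel\<^esub>"
    and step: "\<And>z a x. z \<in> carrier (presented_module R X rel) \<Longrightarrow> P z \<Longrightarrow> a \<in> carrier R \<Longrightarrow> x \<in> X \<Longrightarrow>
      P (z \<oplus>\<^bsub>presented_module R X rel\<^esub> a \<odot>\<^bsub>presented_module R X rel\<^esub> presented_gen R X rel x)"
  shows "P z"
proof -
  interpret Q: quotient_of_module R "Free X" "relation_module R X rel" by (rule presented_quotient[OF rel])
  obtain f where f: "f \<in> carrier (Free X)" "z = Q.proj f"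
    using z Q.proj_cases unfolding presented_module_def by blast
  have "P (Q.proj f)" using f(1)
  proof (induction rule: free_induct)
    case zero
    then show ?case using assms(3) by (simp add: presented_module_def Q.proj_zero)
  next
    case (step f a x)
    note g = free_gen_mem[OF step.hyps(3)] 
    have "P (Q.proj f \<oplus>\<^bsub>presented_module R X rel\<^esub> a \<odot>\<^bsub>presented_module R X rel\<^esub> presented_gen R X rel x)"
      by (rule assms(4)) (use step Q.proj_mem in \<open>auto simp: presented_module_def\<close>)
    then show ?case
      using step.hyps(1,2) g
      by (simp add: presented_gen_eq[OF rel] presented_module_def Q.proj_smult Q.proj_add)
  qed
  then show ?thesis by (simp add: f)
qed

lemma hom_from_presented:
  assumes rel: "rel \<subseteq> carrier (Free X)" and mod: "module R N" and u: "\<And>x. x \<in> X \<Longrightarrow> u x \<in> carrier N"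
    and kills: "\<And>h r. h \<in> LinearCombinations.module_hom R (Free X) N \<Longrightarrow>
      (\<And>x. x \<in> X \<Longrightarrow> h (free_gen R X x) = u x) \<Longrightarrow> r \<in> rel \<Longrightarrow> h r = \<zero>\<^bsub>N\<^esub>"
  obtains h where "h \<in> LinearCombinations.module_hom R (presented_module R X rel) N"
    "\<And>x. x \<in> X \<Longrightarrow> h (presented_gen R X rel x) = u x"
proof -
  interpret Q: quotient_of_module R "Free X" "relation_module R X rel" by (rule presented_quotient[OF rel])
  obtain f where f: "f \<in> LinearCombinations.module_hom R (Free X) N" "\<And>x. x \<in> X \<Longrightarrow> f (free_gen R X x) = u x"
    using hom_from_free[OF mod, of X u] u by blast
  interpret f: mod_hom R "Free X" N f
    using f(1) mod free_is_module by (simp add: mod_hom_def mod_hom_axioms_def)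
  have "relation_module R X rel \<subseteq> f.ker"
    unfolding relation_module_def
    by (rule Q.span_is_subset[OF _ f.ker_is_submodule]) (use rel kills[OF f] in \<open>auto simp: f.ker_def\<close>)
  then have "f x = \<zero>\<^bsub>N\<^esub>" if "x \<in> relation_module R X rel" for x using that f.f_ker by blast
  from Q.hom_from_quotient[OF mod f(1) this] obtain h
    where h: "h \<in> LinearCombinations.module_hom R Q.Q N" "\<And>x. x \<in> carrier (Free X) \<Longrightarrow> h (Q.proj x) = f x"
    by blast
  show ?thesis
  proof (rule that[of h])
    show "h \<in> LinearCombinations.module_hom R (presented_module R X rel) N"
      using h(1) by (simp add: presented_module_def)
    show "h (presented_gen R X rel x) = u x" if "x \<in> X" for x
      using h(2)[OF free_gen_mem[OF that]] f(2)[OF that] by (simp add: presented_gen_eq[OF rel])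
  qed
qed

lemma presented_relation:
  assumes rel: "rel \<subseteq> carrier (Free X)" and r: "a \<ominus>\<^bsub>Free X\<^esub> b \<in> rel" "a \<in> carrier (Free X)" "b \<in> carrier (Free X)"
    and p: "p = quotient_of_module.proj (Free X) (relation_module R X rel)"
  shows "p a = p b"
proof -
  interpret Q: quotient_of_module R "Free X" "relation_module R X rel" by (rule presented_quotient[OF rel])
  have "a \<ominus>\<^bsub>Free X\<^esub> b \<in> relation_module R X rel"
    using Q.in_own_span[OF rel] r(1) by (auto simp: relation_module_def)
  then show ?thesis using Q.proj_eq_iff r by (simp add: p)
qed

end

section \<open>Fraction fields and the rank\<close>

lemma UN_pairs_const:
  assumes "(a0, b0) \<in> A" "(c0, d0) \<in> B"
    and const: "\<And>a b c d. (a, b) \<in> A \<Longrightarrow> (c, d) \<in> B \<Longrightarrow> f a b c d = C"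
  shows "(\<Union>(a, b)\<in>A. \<Union>(c, d)\<in>B. f a b c d) = C"
proof
  show "(\<Union>(a, b)\<in>A. \<Union>(c, d)\<in>B. f a b c d) \<subseteq> C" using const by blast
  show "C \<subseteq> (\<Union>(a, b)\<in>A. \<Union>(c, d)\<in>B. f a b c d)"
  proof
    fix x assume "x \<in> C"
    then have "x \<in> f a0 b0 c0 d0" using const[OF assms(1,2)] by simp
    then show "x \<in> (\<Union>(a, b)\<in>A. \<Union>(c, d)\<in>B. f a b c d)"
      by (intro UN_I[OF assms(1)]) (simp, intro bexI[OF _ assms(2)], simp)
  qed
qed

context domain
begin

definition fraction :: "'a \<Rightarrow> 'a \<Rightarrow> bool" where
  "fraction a b \<longleftrightarrow> a \<in> carrier R \<and> b \<in> carrier R \<and> b \<noteq> \<zero>"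

abbreviation "FF \<equiv> fraction_field R"

lemma frac_rel_iff:
  "((a, b), (c, d)) \<in> frac_rel R \<longleftrightarrow> fraction a b \<and> fraction c d \<and> a \<otimes> d = c \<otimes> b"
  by (auto simp: frac_rel_def fraction_def)

lemma frac_rel_trans:
  assumes "((a, b), (c, d)) \<in> frac_rel R" "((c, d), (e, f)) \<in> frac_rel R"
  shows "((a, b), (e, f)) \<in> frac_rel R"
proof -
  have car: "a \<in> carrier R" "b \<in> carrier R" "c \<in> carrier R" "d \<in> carrier R" "e \<in> carrier R" "f \<in> carrier R" "d \<noteq> \<zero>"
    and eq: "a \<otimes> d = c \<otimes> b" "c \<otimes> f = e \<otimes> d"
    using assms by (auto simp: frac_rel_iff fraction_def)
  have "d \<otimes> (a \<otimes> f) = (a \<otimes> d) \<otimes> f" using car by (simp add: m_ac)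
  also have "\<dots> = (c \<otimes> f) \<otimes> b" unfolding eq(1) using car by (simp add: m_ac)
  also have "\<dots> = d \<otimes> (e \<otimes> b)" unfolding eq(2) using car by (simp add: m_ac)
  finally have "a \<otimes> f = e \<otimes> b" using m_lcancel[of d "a \<otimes> f" "e \<otimes> b"] car by simp
  then show ?thesis using assms by (auto simp: frac_rel_iff)
qed

lemma frac_rel_sym: "((a, b), (c, d)) \<in> frac_rel R \<Longrightarrow> ((c, d), (a, b)) \<in> frac_rel R"
  by (auto simp: frac_rel_iff)

lemma frac_class_eq_iff:
  assumes "fraction a b" "fraction c d"
  shows "frac_class R a b = frac_class R c d \<longleftrightarrow> a \<otimes> d = c \<otimes> b"
proof
  assume "frac_class R a b = frac_class R c d"
  moreover have "(c, d) \<in> frac_class R c d" using assms by (auto simp: frac_class_def frac_rel_iff)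
  ultimately have "(c, d) \<in> frac_class R a b" by simp
  then show "a \<otimes> d = c \<otimes> b" by (auto simp: frac_class_def frac_rel_iff)
next
  assume "a \<otimes> d = c \<otimes> b"
  then have r: "((a, b), (c, d)) \<in> frac_rel R" using assms by (simp add: frac_rel_iff)
  show "frac_class R a b = frac_class R c d"
    unfolding frac_class_def using frac_rel_trans[OF r] frac_rel_trans[OF frac_rel_sym[OF r]] by auto
qed

lemma mem_frac_class: "fraction a b \<Longrightarrow> (c, d) \<in> frac_class R a b \<longleftrightarrow> fraction c d \<and> frac_class R c d = frac_class R a b"
proof -
  assume ab: "fraction a b"
  have "(c, d) \<in> frac_class R a b \<longleftrightarrow> fraction c d \<and> c \<otimes> b = a \<otimes> d"
    using ab by (auto simp: frac_class_def frac_rel_iff)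
  then show ?thesis using frac_class_eq_iff[of c d a b] ab by auto
qed

lemma fraction_self: "fraction a b \<Longrightarrow> (a, b) \<in> frac_class R a b"
  by (simp add: mem_frac_class)

lemma frac_cases:
  assumes "z \<in> carrier FF" obtains a b where "fraction a b" "z = frac_class R a b"
  using assms by (auto simp: fraction_field_def quotient_def frac_class_def fraction_def)

lemma frac_mem: "fraction a b \<Longrightarrow> frac_class R a b \<in> carrier FF"
  by (auto simp: fraction_field_def quotient_def frac_class_def fraction_def)

lemma fraction_mult: "fraction a b \<Longrightarrow> fraction c d \<Longrightarrow> fraction (a \<otimes> c) (b \<otimes> d)"
  using integral by (auto simp: fraction_def)

lemma fraction_add: "fraction a b \<Longrightarrow> fraction c d \<Longrightarrow> fraction (a \<otimes> d \<oplus> c \<otimes> b) (b \<otimes> d)"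
  using integral by (auto simp: fraction_def)

lemma frac_mult:
  assumes "fraction a b" "fraction c d"
  shows "frac_class R a b \<otimes>\<^bsub>FF\<^esub> frac_class R c d = frac_class R (a \<otimes> c) (b \<otimes> d)"
proof -
  have "frac_class R (a' \<otimes> c') (b' \<otimes> d') = frac_class R (a \<otimes> c) (b \<otimes> d)"
    if "(a', b') \<in> frac_class R a b" "(c', d') \<in> frac_class R c d" for a' b' c' d'
  proof -
    have f: "fraction a' b'" "fraction c' d'"
      using that mem_frac_class[OF assms(1)] mem_frac_class[OF assms(2)] by blast+
    have eq: "a' \<otimes> b = a \<otimes> b'" "c' \<otimes> d = c \<otimes> d'"
      using that mem_frac_class[OF assms(1)] mem_frac_class[OF assms(2)]
        frac_class_eq_iff[OF f(1) assms(1)] frac_class_eq_iff[OF f(2) assms(2)] by blast+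
    have "(a' \<otimes> c') \<otimes> (b \<otimes> d) = (a' \<otimes> b) \<otimes> (c' \<otimes> d)" using f assms by (simp add: fraction_def m_ac)
    also have "\<dots> = (a \<otimes> c) \<otimes> (b' \<otimes> d')" unfolding eq using f assms by (simp add: fraction_def m_ac)
    finally show ?thesis using f assms by (subst frac_class_eq_iff) (auto intro: fraction_mult)
  qed
  then have "(\<Union>(a', b')\<in>frac_class R a b. \<Union>(c', d')\<in>frac_class R c d. frac_class R (a' \<otimes> c') (b' \<otimes> d'))
      = frac_class R (a \<otimes> c) (b \<otimes> d)"
    by (rule UN_pairs_const[OF fraction_self[OF assms(1)] fraction_self[OF assms(2)]])
  then show ?thesis by (simp add: fraction_field_def)
qed

lemma frac_add:
  assumes "fraction a b" "fraction c d"
  shows "frac_class R a b \<oplus>\<^bsub>FF\<^esub> frac_class R c d = frac_class R (a \<otimes> d \<oplus> c \<otimes> b) (b \<otimes> d)"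
proof -
  have "frac_class R (a' \<otimes> d' \<oplus> c' \<otimes> b') (b' \<otimes> d') = frac_class R (a \<otimes> d \<oplus> c \<otimes> b) (b \<otimes> d)"
    if "(a', b') \<in> frac_class R a b" "(c', d') \<in> frac_class R c d" for a' b' c' d'
  proof -
    have f: "fraction a' b'" "fraction c' d'"
      using that mem_frac_class[OF assms(1)] mem_frac_class[OF assms(2)] by blast+
    have eq: "a' \<otimes> b = a \<otimes> b'" "c' \<otimes> d = c \<otimes> d'"
      using that mem_frac_class[OF assms(1)] mem_frac_class[OF assms(2)]
        frac_class_eq_iff[OF f(1) assms(1)] frac_class_eq_iff[OF f(2) assms(2)] by blast+
    have "(a' \<otimes> d' \<oplus> c' \<otimes> b') \<otimes> (b \<otimes> d) = (a' \<otimes> b) \<otimes> (d' \<otimes> d) \<oplus> (c' \<otimes> d) \<otimes> (b' \<otimes> b)"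
      using f assms by (simp add: fraction_def l_distr r_distr m_ac)
    also have "\<dots> = (a \<otimes> d \<oplus> c \<otimes> b) \<otimes> (b' \<otimes> d')"
      unfolding eq using f assms by (simp add: fraction_def l_distr r_distr m_ac)
    finally show ?thesis using f assms by (subst frac_class_eq_iff) (auto intro: fraction_add)
  qed
  then have "(\<Union>(a', b')\<in>frac_class R a b. \<Union>(c', d')\<in>frac_class R c d. frac_class R (a' \<otimes> d' \<oplus> c' \<otimes> b') (b' \<otimes> d'))
      = frac_class R (a \<otimes> d \<oplus> c \<otimes> b) (b \<otimes> d)"
    by (rule UN_pairs_const[OF fraction_self[OF assms(1)] fraction_self[OF assms(2)]])
  then show ?thesis by (simp add: fraction_field_def)
qed

lemma frac_one: "\<one>\<^bsub>FF\<^esub> = frac_class R \<one> \<one>" and frac_zero: "\<zero>\<^bsub>FF\<^esub> = frac_class R \<zero> \<one>"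
  by (simp_all add: fraction_field_def)

lemma fraction_ints: "a \<in> carrier R \<Longrightarrow> fraction a \<one>"
  by (simp add: fraction_def)

lemma fraction_field_is_field: "field FF"
proof -
  have cring: "cring FF"
  proof (rule cringI)
    show "abelian_group FF"
    proof (rule abelian_groupI)
      fix x y z assume xyz: "x \<in> carrier FF" "y \<in> carrier FF" "z \<in> carrier FF"
      from xyz(1) obtain a b where x: "fraction a b" "x = frac_class R a b" by (rule frac_cases)
      from xyz(2) obtain c d where y: "fraction c d" "y = frac_class R c d" by (rule frac_cases)
      from xyz(3) obtain e f where z: "fraction e f" "z = frac_class R e f" by (rule frac_cases)
      show "x \<oplus>\<^bsub>FF\<^esub> y \<in> carrier FF" by (simp add: x y frac_add frac_mem fraction_add)
      show "x \<oplus>\<^bsub>FF\<^esub> y \<oplus>\<^bsub>FF\<^esub> z = x \<oplus>\<^bsub>FF\<^esub> (y \<oplus>\<^bsub>FF\<^esub> z)"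
      proof -
        have "(a \<otimes> d \<oplus> c \<otimes> b) \<otimes> f \<oplus> e \<otimes> (b \<otimes> d) = a \<otimes> (d \<otimes> f) \<oplus> (c \<otimes> f \<oplus> e \<otimes> d) \<otimes> b"
          "b \<otimes> d \<otimes> f = b \<otimes> (d \<otimes> f)"
          using x(1) y(1) z(1) by (simp_all add: fraction_def l_distr r_distr m_ac a_ac)
        then show ?thesis by (simp add: x y z frac_add fraction_add)
      qed
      show "x \<oplus>\<^bsub>FF\<^esub> y = y \<oplus>\<^bsub>FF\<^esub> x"
      proof -
        have "a \<otimes> d \<oplus> c \<otimes> b = c \<otimes> b \<oplus> a \<otimes> d" "b \<otimes> d = d \<otimes> b"
          using x(1) y(1) by (simp_all add: fraction_def m_ac a_ac)
        then show ?thesis by (simp add: x y frac_add)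
      qed
      show "\<zero>\<^bsub>FF\<^esub> \<oplus>\<^bsub>FF\<^esub> x = x"
      proof -
        have "\<zero> \<otimes> b \<oplus> a \<otimes> \<one> = a" "\<one> \<otimes> b = b" using x(1) by (simp_all add: fraction_def)
        then show ?thesis using frac_add[OF fraction_ints[OF zero_closed] x(1)] by (simp only: x frac_zero)
      qed
      show "\<exists>y\<in>carrier FF. y \<oplus>\<^bsub>FF\<^esub> x = \<zero>\<^bsub>FF\<^esub>"
      proof (intro bexI[of _ "frac_class R (\<ominus> a) b"])
        have f: "fraction (\<ominus> a) b" using x(1) by (simp add: fraction_def)
        show "frac_class R (\<ominus> a) b \<in> carrier FF" by (rule frac_mem[OF f])
        have "\<ominus> a \<otimes> b \<oplus> a \<otimes> b = \<zero>" using x(1) by (simp add: fraction_def l_minus l_neg)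
        then show "frac_class R (\<ominus> a) b \<oplus>\<^bsub>FF\<^esub> x = \<zero>\<^bsub>FF\<^esub>"
          using f x fraction_mult[OF x(1) x(1)]
          by (simp add: x frac_add frac_zero) (subst frac_class_eq_iff, auto simp: fraction_def)
      qed
    qed (simp add: frac_zero frac_mem fraction_ints)
    show "comm_monoid FF"
    proof (rule comm_monoidI)
      fix x y z assume xyz: "x \<in> carrier FF" "y \<in> carrier FF" "z \<in> carrier FF"
      from xyz(1) obtain a b where x: "fraction a b" "x = frac_class R a b" by (rule frac_cases)
      from xyz(2) obtain c d where y: "fraction c d" "y = frac_class R c d" by (rule frac_cases)
      from xyz(3) obtain e f where z: "fraction e f" "z = frac_class R e f" by (rule frac_cases)
      show "x \<otimes>\<^bsub>FF\<^esub> y \<in> carrier FF" by (simp add: x y frac_mult frac_mem fraction_mult)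
      show "x \<otimes>\<^bsub>FF\<^esub> y \<otimes>\<^bsub>FF\<^esub> z = x \<otimes>\<^bsub>FF\<^esub> (y \<otimes>\<^bsub>FF\<^esub> z)"
      proof -
        have "a \<otimes> c \<otimes> e = a \<otimes> (c \<otimes> e)" "b \<otimes> d \<otimes> f = b \<otimes> (d \<otimes> f)"
          using x(1) y(1) z(1) by (simp_all add: fraction_def m_assoc)
        then show ?thesis by (simp add: x y z frac_mult fraction_mult)
      qed
      show "x \<otimes>\<^bsub>FF\<^esub> y = y \<otimes>\<^bsub>FF\<^esub> x"
      proof -
        have "a \<otimes> c = c \<otimes> a" "b \<otimes> d = d \<otimes> b"
          using x(1) y(1) by (simp_all add: fraction_def m_comm)
        then show ?thesis by (simp add: x y frac_mult)
      qed
      show "\<one>\<^bsub>FF\<^esub> \<otimes>\<^bsub>FF\<^esub> x = x"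
      proof -
        have "\<one> \<otimes> a = a" "\<one> \<otimes> b = b" using x(1) by (simp_all add: fraction_def)
        then show ?thesis using frac_mult[OF fraction_ints[OF one_closed] x(1)] by (simp only: x frac_one)
      qed
    qed (simp add: frac_one frac_mem fraction_ints)
    fix x y z assume xyz: "x \<in> carrier FF" "y \<in> carrier FF" "z \<in> carrier FF"
    from xyz(1) obtain a b where x: "fraction a b" "x = frac_class R a b" by (rule frac_cases)
    from xyz(2) obtain c d where y: "fraction c d" "y = frac_class R c d" by (rule frac_cases)
    from xyz(3) obtain e f where z: "fraction e f" "z = frac_class R e f" by (rule frac_cases)
    show "(x \<oplus>\<^bsub>FF\<^esub> y) \<otimes>\<^bsub>FF\<^esub> z = x \<otimes>\<^bsub>FF\<^esub> z \<oplus>\<^bsub>FF\<^esub> y \<otimes>\<^bsub>FF\<^esub> z"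
    proof -
      have "((a \<otimes> d \<oplus> c \<otimes> b) \<otimes> e) \<otimes> ((b \<otimes> f) \<otimes> (d \<otimes> f)) =
          ((a \<otimes> e) \<otimes> (d \<otimes> f) \<oplus> (c \<otimes> e) \<otimes> (b \<otimes> f)) \<otimes> ((b \<otimes> d) \<otimes> f)"
        using x(1) y(1) z(1) by (simp add: fraction_def l_distr r_distr m_ac)
      then show ?thesis
        by (simp add: x y z frac_add frac_mult fraction_add fraction_mult) 
          (subst frac_class_eq_iff, auto simp: x y z fraction_add fraction_mult)
    qed
  qed
  show ?thesis
  proof (rule cring.cring_fieldI[OF cring])
    interpret F: cring FF by (rule cring)
    have inv: "\<exists>y\<in>carrier FF. x \<otimes>\<^bsub>FF\<^esub> y = \<one>\<^bsub>FF\<^esub>" if x: "x \<in> carrier FF" "x \<noteq> \<zero>\<^bsub>FF\<^esub>" for x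
    proof -
      from x(1) obtain a b where ab: "fraction a b" "x = frac_class R a b" by (rule frac_cases)
      have "a \<noteq> \<zero>"
        using x(2) ab frac_class_eq_iff[OF ab(1) fraction_ints[OF zero_closed]] by (auto simp: frac_zero fraction_def)
      then have ba: "fraction b a" using ab(1) by (simp add: fraction_def)
      have "x \<otimes>\<^bsub>FF\<^esub> frac_class R b a = \<one>\<^bsub>FF\<^esub>"
        unfolding ab(2) frac_mult[OF ab(1) ba] frac_one
        using fraction_mult[OF ab(1) ba] ab(1) fraction_ints[OF one_closed]
        by (subst frac_class_eq_iff) (auto simp: fraction_def m_comm)
      then show ?thesis using frac_mem[OF ba] by blast
    qed
    have ne: "\<one>\<^bsub>FF\<^esub> \<noteq> \<zero>\<^bsub>FF\<^esub>"
      using frac_class_eq_iff[OF fraction_ints[OF one_closed] fraction_ints[OF zero_closed]]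
      by (simp add: frac_one frac_zero)
    show "Units FF = carrier FF - {\<zero>\<^bsub>FF\<^esub>}"
    proof
      show "carrier FF - {\<zero>\<^bsub>FF\<^esub>} \<subseteq> Units FF"
        using inv F.m_comm unfolding Units_def by fastforce
      show "Units FF \<subseteq> carrier FF - {\<zero>\<^bsub>FF\<^esub>}"
        using ne F.Units_closed by (auto simp: Units_def)
    qed
  qed
qed

definition frac_of :: "'a \<Rightarrow> ('a \<times> 'a) set" where "frac_of r = frac_class R r \<one>"

lemma frac_of_mem: "r \<in> carrier R \<Longrightarrow> frac_of r \<in> carrier FF"
  by (simp add: frac_of_def frac_mem fraction_ints)

lemma frac_of_add: "r \<in> carrier R \<Longrightarrow> s \<in> carrier R \<Longrightarrow> frac_of (r \<oplus> s) = frac_of r \<oplus>\<^bsub>FF\<^esub> frac_of s"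
  and frac_of_mult: "r \<in> carrier R \<Longrightarrow> s \<in> carrier R \<Longrightarrow> frac_of (r \<otimes> s) = frac_of r \<otimes>\<^bsub>FF\<^esub> frac_of s"
  by (simp_all add: frac_of_def frac_add frac_mult fraction_ints)

lemma frac_of_zero: "frac_of \<zero> = \<zero>\<^bsub>FF\<^esub>"
  by (simp add: frac_of_def frac_zero)

lemma frac_of_eq_zero: "r \<in> carrier R \<Longrightarrow> frac_of r = \<zero>\<^bsub>FF\<^esub> \<longleftrightarrow> r = \<zero>"
  using frac_class_eq_iff[OF fraction_ints fraction_ints[OF zero_closed]] by (simp add: frac_of_def frac_zero)

end

definition self_module :: "('a, 'r) ring_scheme \<Rightarrow> ('a, 'a) module" where
  "self_module R = \<lparr>carrier = carrier R, mult = mult R, one = one R, zero = zero R, add = add R, smult = mult R\<rparr>"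

lemma (in cring) self_is_module: "module R (self_module R)"
  by (rule module_criteria)
    (auto simp: self_module_def cring_axioms a_ac m_ac l_distr r_distr intro: exI[of _ "\<ominus> _"] r_neg a_inv_closed)

text \<open>The rank is read off from elements \<open>c x\<close> and functionals \<open>l x\<close> that are dual to each other up
  to a nonzero factor \<open>d\<close>, provided that \<open>d\<close> carries the module into the span of the \<open>c x\<close>.\<close>

context
  fixes R :: "('a, 'r) ring_scheme" (structure) and M :: "('a, 'b, 'm) module_scheme" and X :: "'x set"
    and c :: "'x \<Rightarrow> 'b" and l :: "'x \<Rightarrow> 'b \<Rightarrow> 'a" and d :: 'a
  assumes dom: "domain R" and mod: "module R M" and finX: "finite X"
    and c: "\<And>x. x \<in> X \<Longrightarrow> c x \<in> carrier M"
    and l: "\<And>x. x \<in> X \<Longrightarrow> l x \<in> LinearCombinations.module_hom R M (self_module R)"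
    and d: "d \<in> carrier R" "d \<noteq> \<zero>"
    and lc: "\<And>x y. x \<in> X \<Longrightarrow> y \<in> X \<Longrightarrow> l x (c y) = (if x = y then d else \<zero>)"
    and generates: "\<And>P m. LinearCombinations.submodule R P M \<Longrightarrow> (\<And>x. x \<in> X \<Longrightarrow> c x \<in> P) \<Longrightarrow> m \<in> carrier M \<Longrightarrow>
       d \<odot>\<^bsub>M\<^esub> m \<in> P"
begin

interpretation R: domain R by (rule dom)
interpretation M: module R M by (rule mod)
interpretation Q: field "fraction_field R" by (rule R.fraction_field_is_field)

abbreviation (input) "FQ \<equiv> fraction_field R"
abbreviation (input) "GX \<equiv> carrier M \<times> carrier FQ"
abbreviation (input) "rels \<equiv> base_change_rels R FQ R.frac_of M"
abbreviation (input) "BC \<equiv> presented_module FQ GX rels"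
abbreviation (input) "pg \<equiv> presented_gen FQ GX rels"

interpretation F: module FQ "free_module FQ GX" by (rule Q.free_is_module)

lemma base_change_rels_subset: "rels \<subseteq> carrier (free_module FQ GX)"
  unfolding base_change_rels_def Let_def
  by (auto intro!: F.M.minus_closed F.M.a_closed F.smult_closed Q.free_gen_mem R.frac_of_mem)

interpretation B: vectorspace FQ BC
  by (intro vectorspace.intro Q.presented_is_module base_change_rels_subset Q.field_axioms)

interpretation P: quotient_of_module FQ "free_module FQ GX" "relation_module FQ GX rels"
  by (rule Q.presented_quotient[OF base_change_rels_subset])

lemma pg_mem: "m \<in> carrier M \<Longrightarrow> q \<in> carrier FQ \<Longrightarrow> pg (m, q) \<in> carrier BC"
  by (rule Q.presented_gen_mem[OF base_change_rels_subset]) simp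

lemma pg_eq: "pg x = P.proj (free_gen FQ GX x)"
  by (rule Q.presented_gen_eq[OF base_change_rels_subset])

lemma rel_add: assumes "m \<in> carrier M" "m' \<in> carrier M" "q \<in> carrier FQ"
  shows "free_gen FQ GX (m \<oplus>\<^bsub>M\<^esub> m', q) \<ominus>\<^bsub>free_module FQ GX\<^esub>
    (free_gen FQ GX (m, q) \<oplus>\<^bsub>free_module FQ GX\<^esub> free_gen FQ GX (m', q)) \<in> rels"
  unfolding base_change_rels_def Let_def
  by (rule UnI1, rule UnI1, rule UnI1, rule CollectI, intro exI conjI, rule refl) (rule assms)+

lemma rel_smult: assumes "r \<in> carrier R" "m \<in> carrier M" "q \<in> carrier FQ"
  shows "free_gen FQ GX (r \<odot>\<^bsub>M\<^esub> m, q) \<ominus>\<^bsub>free_module FQ GX\<^esub>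
    free_gen FQ GX (m, R.frac_of r \<otimes>\<^bsub>FQ\<^esub> q) \<in> rels"
  unfolding base_change_rels_def Let_def
  by (rule UnI1, rule UnI2, rule CollectI, intro exI conjI, rule refl) (rule assms)+

lemma rel_scale: assumes "m \<in> carrier M" "q \<in> carrier FQ" "k \<in> carrier FQ"
  shows "free_gen FQ GX (m, k \<otimes>\<^bsub>FQ\<^esub> q) \<ominus>\<^bsub>free_module FQ GX\<^esub>
    (k \<odot>\<^bsub>free_module FQ GX\<^esub> free_gen FQ GX (m, q)) \<in> rels"
  unfolding base_change_rels_def Let_def
  by (rule UnI2, rule CollectI, intro exI conjI, rule refl) (rule assms)+

lemma pg_add: assumes "m \<in> carrier M" "m' \<in> carrier M" "q \<in> carrier FQ"
  shows "pg (m \<oplus>\<^bsub>M\<^esub> m', q) = pg (m, q) \<oplus>\<^bsub>BC\<^esub> pg (m', q)"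
proof -
  have "P.proj (free_gen FQ GX (m \<oplus>\<^bsub>M\<^esub> m', q)) =
      P.proj (free_gen FQ GX (m, q) \<oplus>\<^bsub>free_module FQ GX\<^esub> free_gen FQ GX (m', q))"
    by (rule Q.presented_relation[OF base_change_rels_subset rel_add[OF assms] _ _ refl])
      (use assms in \<open>auto intro!: Q.free_gen_mem F.M.a_closed\<close>)
  also have "\<dots> = P.proj (free_gen FQ GX (m, q)) \<oplus>\<^bsub>P.Q\<^esub> P.proj (free_gen FQ GX (m', q))"
    by (rule P.proj_add[symmetric]) (use assms in \<open>auto intro!: Q.free_gen_mem\<close>)
  finally show ?thesis by (simp only: pg_eq presented_module_def)
qed

lemma pg_smult: assumes "r \<in> carrier R" "m \<in> carrier M" "q \<in> carrier FQ"
  shows "pg (r \<odot>\<^bsub>M\<^esub> m, q) = pg (m, R.frac_of r \<otimes>\<^bsub>FQ\<^esub> q)"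
proof -
  have "P.proj (free_gen FQ GX (r \<odot>\<^bsub>M\<^esub> m, q)) = P.proj (free_gen FQ GX (m, R.frac_of r \<otimes>\<^bsub>FQ\<^esub> q))"
    by (rule Q.presented_relation[OF base_change_rels_subset rel_smult[OF assms] _ _ refl])
      (use assms in \<open>auto intro!: Q.free_gen_mem R.frac_of_mem\<close>)
  then show ?thesis by (simp only: pg_eq)
qed

lemma pg_scale: assumes "m \<in> carrier M" "q \<in> carrier FQ" "k \<in> carrier FQ"
  shows "pg (m, k \<otimes>\<^bsub>FQ\<^esub> q) = k \<odot>\<^bsub>BC\<^esub> pg (m, q)"
proof -
  have "P.proj (free_gen FQ GX (m, k \<otimes>\<^bsub>FQ\<^esub> q)) = P.proj (k \<odot>\<^bsub>free_module FQ GX\<^esub> free_gen FQ GX (m, q))"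
    by (rule Q.presented_relation[OF base_change_rels_subset rel_scale[OF assms] _ _ refl])
      (use assms in \<open>auto intro!: Q.free_gen_mem F.smult_closed\<close>)
  also have "\<dots> = k \<odot>\<^bsub>P.Q\<^esub> P.proj (free_gen FQ GX (m, q))"
    by (rule P.proj_smult[symmetric]) (use assms in \<open>auto intro!: Q.free_gen_mem\<close>)
  finally show ?thesis by (simp only: pg_eq presented_module_def)
qed

lemma pg_frac_smult: assumes "r \<in> carrier R" "m \<in> carrier M"
  shows "pg (r \<odot>\<^bsub>M\<^esub> m, \<one>\<^bsub>FQ\<^esub>) = R.frac_of r \<odot>\<^bsub>BC\<^esub> pg (m, \<one>\<^bsub>FQ\<^esub>)"
  using pg_smult[OF assms Q.one_closed] pg_scale[OF assms(2) Q.one_closed R.frac_of_mem[OF assms(1)]] by simp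

lemma base_change_functional:
  assumes x: "x \<in> X"
  obtains h where "h \<in> LinearCombinations.module_hom FQ BC (self_module FQ)"
    "\<And>m q. m \<in> carrier M \<Longrightarrow> q \<in> carrier FQ \<Longrightarrow> h (pg (m, q)) = R.frac_of (l x m) \<otimes>\<^bsub>FQ\<^esub> q"
proof -
  define u where "u = (\<lambda>(m, q). R.frac_of (l x m) \<otimes>\<^bsub>FQ\<^esub> q)"
  have lm: "l x m \<in> carrier R" if "m \<in> carrier M" for m
    using module_hom_mem[OF l[OF x] that] by (simp add: self_module_def)
  have ladd: "l x (m \<oplus>\<^bsub>M\<^esub> m') = l x m \<oplus>\<^bsub>R\<^esub> l x m'" if "m \<in> carrier M" "m' \<in> carrier M" for m m'
    using LinearCombinations.module_hom_add[OF l[OF x] that] by (simp add: self_module_def)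
  have lsm: "l x (r \<odot>\<^bsub>M\<^esub> m) = r \<otimes>\<^bsub>R\<^esub> l x m" if "r \<in> carrier R" "m \<in> carrier M" for r m
    using LinearCombinations.module_hom_smult[OF l[OF x] that] by (simp add: self_module_def)
  have um: "u z \<in> carrier (self_module FQ)" if "z \<in> GX" for z
    using that lm R.frac_of_mem by (auto simp: u_def self_module_def)
  obtain h where h: "h \<in> LinearCombinations.module_hom FQ BC (self_module FQ)" "\<And>z. z \<in> GX \<Longrightarrow> h (pg z) = u z"
  proof (rule Q.hom_from_presented[OF base_change_rels_subset Q.self_is_module, of u])
    fix h r assume h: "h \<in> LinearCombinations.module_hom FQ (free_module FQ GX) (self_module FQ)"
      and hu: "\<And>z. z \<in> GX \<Longrightarrow> h (free_gen FQ GX z) = u z" and r: "r \<in> rels"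
    interpret h: mod_hom FQ "free_module FQ GX" "self_module FQ" h
      using h Q.self_is_module F.module_axioms by (simp add: mod_hom_def mod_hom_axioms_def)
    interpret S: module FQ "self_module FQ" by (rule Q.self_is_module)
    have zero: "h (a \<ominus>\<^bsub>free_module FQ GX\<^esub> b) = \<zero>\<^bsub>self_module FQ\<^esub>"
      if "a \<in> carrier (free_module FQ GX)" "b \<in> carrier (free_module FQ GX)" "h a = h b" for a b
      using that minus_eq_zero_iff[OF module.axioms(2)[OF Q.self_is_module], of "h a" "h b"] h.f_im[of a]
      by simp
    have S_add: "a \<oplus>\<^bsub>self_module FQ\<^esub> b = a \<oplus>\<^bsub>FQ\<^esub> b" "a \<odot>\<^bsub>self_module FQ\<^esub> b = a \<otimes>\<^bsub>FQ\<^esub> b" for a b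
      by (simp_all add: self_module_def)
    note clo = Q.free_gen_mem F.M.a_closed F.smult_closed R.frac_of_mem
    show "h r = \<zero>\<^bsub>self_module FQ\<^esub>"
      using r unfolding base_change_rels_def Let_def
      by (elim UnE CollectE exE conjE; hypsubst; intro zero)
        (simp_all add: clo hu u_def S_add lm ladd lsm R.frac_of_add R.frac_of_mult Q.l_distr Q.r_distr Q.m_ac)
  qed (use um in auto)
  show ?thesis by (rule that[OF h(1)]) (simp add: h(2) u_def)
qed

lemma module_rank_eq_card: "module_rank R M = card X"
proof -
  define e where "e x = pg (c x, \<one>\<^bsub>FQ\<^esub>)" for x
  have e: "e x \<in> carrier BC" if "x \<in> X" for x using that by (simp add: e_def pg_mem c)
  have sub: "LinearCombinations.submodule FQ (B.span (e ` X)) BC"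
    by (rule B.span_is_submodule) (use e in auto)
  note sub_add = LinearCombinations.submodule.m_closed[OF sub]
    and sub_smult = LinearCombinations.submodule.smult_closed[OF sub]
    and sub_zero = LinearCombinations.submodule.zero_closed[OF sub]
  have eX: "e x \<in> B.span (e ` X)" if "x \<in> X" for x
    using B.in_own_span[of "e ` X"] e that by auto
  have "LinearCombinations.submodule R {m \<in> carrier M. pg (m, \<one>\<^bsub>FQ\<^esub>) \<in> B.span (e ` X)} M"
  proof (rule LinearCombinations.submodule.intro)
    have "pg (\<zero>\<^bsub>M\<^esub>, \<one>\<^bsub>FQ\<^esub>) = \<zero>\<^bsub>BC\<^esub>"
      using pg_frac_smult[OF R.zero_closed M.M.zero_closed] pg_mem[OF M.M.zero_closed Q.one_closed]
      by (simp add: R.frac_of_zero)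
    then show "\<zero>\<^bsub>M\<^esub> \<in> {m \<in> carrier M. pg (m, \<one>\<^bsub>FQ\<^esub>) \<in> B.span (e ` X)}" using sub_zero by simp
  qed (auto simp: mod pg_add pg_frac_smult R.frac_of_mem intro!: sub_add sub_smult)
  note gen = generates[OF this]
  have one: "pg (m, \<one>\<^bsub>FQ\<^esub>) \<in> B.span (e ` X)" if m: "m \<in> carrier M" for m
  proof -
    have "d \<odot>\<^bsub>M\<^esub> m \<in> {m \<in> carrier M. pg (m, \<one>\<^bsub>FQ\<^esub>) \<in> B.span (e ` X)}"
      by (rule gen[OF _ m]) (use c eX in \<open>auto simp: e_def\<close>)
    then have in_span: "R.frac_of d \<odot>\<^bsub>BC\<^esub> pg (m, \<one>\<^bsub>FQ\<^esub>) \<in> B.span (e ` X)" using pg_frac_smult[OF d(1) m] by simp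
    have u: "R.frac_of d \<in> Units FQ"
      using d R.frac_of_mem R.frac_of_eq_zero by (simp add: Q.field_Units)
    have "inv\<^bsub>FQ\<^esub> (R.frac_of d) \<odot>\<^bsub>BC\<^esub> (R.frac_of d \<odot>\<^bsub>BC\<^esub> pg (m, \<one>\<^bsub>FQ\<^esub>)) = pg (m, \<one>\<^bsub>FQ\<^esub>)"
      using u pg_mem[OF m Q.one_closed] R.frac_of_mem[OF d(1)] by (simp add: B.smult_assoc1[symmetric])
    then show ?thesis using sub_smult[OF Q.Units_inv_closed[OF u] in_span] by simp
  qed
  have gen_all: "z \<in> B.span (e ` X)" if z: "z \<in> carrier BC" for z
    using base_change_rels_subset z
  proof (induction rule: Q.presented_induct)
    case zero
    then show ?case by (rule sub_zero)
  next
    case (step z a x)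
    obtain m q where x: "x = (m, q)" "m \<in> carrier M" "q \<in> carrier FQ" using step.hyps by auto
    have "pg x = q \<odot>\<^bsub>BC\<^esub> pg (m, \<one>\<^bsub>FQ\<^esub>)" using pg_scale[OF x(2) Q.one_closed x(3)] x by simp
    then have "pg x \<in> B.span (e ` X)" using sub_smult[OF x(3) one[OF x(2)]] by simp
    then show ?case using step by (intro sub_add sub_smult)
  qed
  have "\<forall>x\<in>X. \<exists>h. h \<in> LinearCombinations.module_hom FQ BC (self_module FQ) \<and>
      (\<forall>y\<in>X. h (e y) = (if x = y then R.frac_of d else \<zero>\<^bsub>FQ\<^esub>))"
  proof
    fix x assume x: "x \<in> X"
    obtain h where h: "h \<in> LinearCombinations.module_hom FQ BC (self_module FQ)"
      "\<And>m q. m \<in> carrier M \<Longrightarrow> q \<in> carrier FQ \<Longrightarrow> h (pg (m, q)) = R.frac_of (l x m) \<otimes>\<^bsub>FQ\<^esub> q"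
      using base_change_functional[OF x] by blast
    have "h (e y) = (if x = y then R.frac_of d else \<zero>\<^bsub>FQ\<^esub>)" if "y \<in> X" for y
      using h(2)[OF c[OF that] Q.one_closed] lc[OF x that] R.frac_of_mem[OF d(1)]
      by (simp add: e_def R.frac_of_zero)
    with h(1) show "\<exists>h. h \<in> LinearCombinations.module_hom FQ BC (self_module FQ) \<and>
      (\<forall>y\<in>X. h (e y) = (if x = y then R.frac_of d else \<zero>\<^bsub>FQ\<^esub>))" by blast
  qed
  then obtain h where h: "\<And>x. x \<in> X \<Longrightarrow> h x \<in> LinearCombinations.module_hom FQ BC (self_module FQ)"
    "\<And>x y. x \<in> X \<Longrightarrow> y \<in> X \<Longrightarrow> h x (e y) = (if x = y then R.frac_of d else \<zero>\<^bsub>FQ\<^esub>)" by metis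
  have d0: "R.frac_of d \<noteq> \<zero>\<^bsub>FQ\<^esub>" using d R.frac_of_eq_zero by simp
  have inj: "inj_on e X"
  proof (rule inj_onI, rule ccontr)
    fix x y assume xy: "x \<in> X" "y \<in> X" "e x = e y" "x \<noteq> y"
    then show False using h(2)[of x x] h(2)[of x y] d0 by simp
  qed
  have "B.lin_indpt (e ` X)"
  proof (rule B.finite_lin_indpt2)
    show "finite (e ` X)" "e ` X \<subseteq> carrier BC" using finX e by auto
    fix a assume a: "a \<in> e ` X \<rightarrow> carrier FQ" and z: "B.lincomb a (e ` X) = \<zero>\<^bsub>BC\<^esub>"
    show "\<forall>v\<in>e ` X. a v = \<zero>\<^bsub>FQ\<^esub>"
    proof
      fix v assume "v \<in> e ` X"
      then obtain x where x: "x \<in> X" "v = e x" by auto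
      interpret S: module FQ "self_module FQ" by (rule Q.self_is_module)
      interpret h: mod_hom FQ BC "self_module FQ" "h x"
        using h(1)[OF x(1)] by (simp add: mod_hom_def mod_hom_axioms_def S.module_axioms B.module_axioms)
      have ain: "a w \<in> carrier FQ" if "w \<in> e ` X" for w using a that by auto
      have "h x (B.lincomb a (e ` X)) = (\<Oplus>\<^bsub>self_module FQ\<^esub>w\<in>e ` X. h x (a w \<odot>\<^bsub>BC\<^esub> w))"
        unfolding B.lincomb_def using h.hom_sum[of "e ` X" "\<lambda>w. a w \<odot>\<^bsub>BC\<^esub> w"] finX e ain by auto
      also have "\<dots> = (\<Oplus>\<^bsub>self_module FQ\<^esub>w\<in>e ` X. if v = w then a w \<otimes>\<^bsub>FQ\<^esub> R.frac_of d else \<zero>\<^bsub>self_module FQ\<^esub>)"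
      proof (rule S.M.finsum_cong')
        fix w assume w: "w \<in> e ` X"
        then obtain y where y: "y \<in> X" "w = e y" by auto
        have "h x (a w \<odot>\<^bsub>BC\<^esub> w) = a w \<odot>\<^bsub>self_module FQ\<^esub> h x w"
          using y e ain[OF w] by simp
        also have "\<dots> = (if v = w then a w \<otimes>\<^bsub>FQ\<^esub> R.frac_of d else \<zero>\<^bsub>self_module FQ\<^esub>)"
          using x y h(2)[OF x(1) y(1)] inj ain[OF w] by (auto simp: self_module_def inj_on_def)
        finally show "h x (a w \<odot>\<^bsub>BC\<^esub> w) = (if v = w then a w \<otimes>\<^bsub>FQ\<^esub> R.frac_of d else \<zero>\<^bsub>self_module FQ\<^esub>)" .
      qed (use ain R.frac_of_mem[OF d(1)] in \<open>auto simp: self_module_def\<close>)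
      also have "\<dots> = a v \<otimes>\<^bsub>FQ\<^esub> R.frac_of d"
        by (rule S.M.finsum_singleton) (use x finX ain R.frac_of_mem[OF d(1)] in \<open>auto simp: self_module_def\<close>)
      finally have "a v \<otimes>\<^bsub>FQ\<^esub> R.frac_of d = \<zero>\<^bsub>FQ\<^esub>" by (simp add: z) (simp add: self_module_def)
      then show "a v = \<zero>\<^bsub>FQ\<^esub>"
        using d0 Q.integral[OF _ ain R.frac_of_mem[OF d(1)]] x by blast
    qed
  qed
  moreover have "B.span (e ` X) = carrier BC"
    using gen_all B.span_is_subset2[of "e ` X"] e by auto
  ultimately have "B.basis (e ` X)" using e by (auto simp: B.basis_def)
  then have "B.dim = card (e ` X)" using finX by (intro B.dim_basis) auto
  also have "\<dots> = card X" by (rule card_image[OF inj])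
  finally show ?thesis by (simp add: module_rank_def base_change_def R.frac_of_def[abs_def])
qed

end

section \<open>Graded modules and duals\<close>

lemma with_grading_simps:
  "carrier (with_grading M c) = carrier M" "add (with_grading M c) = add M" "zero (with_grading M c) = zero M"
  "mult (with_grading M c) = mult M" "one (with_grading M c) = one M"
  "module.smult (with_grading M c) = module.smult M" "mod_comp (with_grading M c) = c"
  by (simp_all add: with_grading_def module.defs graded_module.defs)

lemma abelian_group_cong:
  assumes "abelian_group M" "carrier N = carrier M" "add N = add M" "zero N = zero M"
  shows "abelian_group N"
proof -
  interpret M: abelian_group M by fact
  show ?thesis
    by (rule abelian_groupI) (use M.a_assoc M.a_comm M.l_neg in \<open>auto simp: assms intro: bexI[of _ "\<ominus>\<^bsub>M\<^esub> _"]\<close>)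
qed

lemma minus_zero_right:
  assumes "abelian_group M" "x \<in> carrier M" shows "x \<ominus>\<^bsub>M\<^esub> \<zero>\<^bsub>M\<^esub> = x"
proof -
  interpret abelian_group M by fact
  show ?thesis using assms(2) by (simp add: a_minus_def)
qed

lemma module_cong:
  assumes "module R M" "carrier N = carrier M" "add N = add M" "zero N = zero M" "module.smult N = module.smult M"
  shows "module R N"
proof -
  interpret M: module R M by fact
  show ?thesis
    by (rule moduleI[OF M.R.is_cring abelian_group_cong[OF M.M.abelian_group_axioms assms(2-4)]])
      (auto simp: assms M.smult_l_distr M.smult_r_distr M.smult_assoc1)
qed

lemma module_hom_cong:
  assumes "carrier N = carrier M" "add N = add M" "module.smult N = module.smult M"
    "carrier N' = carrier M'" "add N' = add M'" "module.smult N' = module.smult M'"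
  shows "LinearCombinations.module_hom R N N' = LinearCombinations.module_hom R M M'"
  by (simp add: LinearCombinations.module_hom_def assms)

lemma dual_module_simps:
  "carrier (dual_module R M) = LinearCombinations.module_hom R M (regular_module R) \<inter> extensional (carrier M)"
  "add (dual_module R M) = add (ring.func_space R (carrier M))"
  "zero (dual_module R M) = zero (ring.func_space R (carrier M))"
  "module.smult (dual_module R M) = module.smult (ring.func_space R (carrier M))"
  "mod_comp (dual_module R M) d = {f \<in> carrier (dual_module R M). \<forall>i. f ` mod_comp M i \<subseteq> ring_comp R (i + d)}"
  by (simp_all add: dual_module_def Let_def with_grading_simps)

lemma regular_module_simps:
  "carrier (regular_module R) = carrier R" "add (regular_module R) = add R" "zero (regular_module R) = zero R"
  "module.smult (regular_module R) = mult R"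
  by (simp_all add: regular_module_def)

lemma dual_is_module:
  assumes "cring R" "module R M" shows "module R (dual_module R M)"
proof -
  interpret R: cring R by fact
  interpret M: module R M by fact
  interpret F: module R "R.func_space (carrier M)" by (rule R.func_space_is_module)
  define H where "H = LinearCombinations.module_hom R M (regular_module R) \<inter> extensional (carrier M)"
  have H: "f \<in> H \<longleftrightarrow> f \<in> carrier M \<rightarrow>\<^sub>E carrier R \<and>
      (\<forall>x\<in>carrier M. \<forall>y\<in>carrier M. f (x \<oplus>\<^bsub>M\<^esub> y) = f x \<oplus>\<^bsub>R\<^esub> f y) \<and>
      (\<forall>r\<in>carrier R. \<forall>x\<in>carrier M. f (r \<odot>\<^bsub>M\<^esub> x) = r \<otimes>\<^bsub>R\<^esub> f x)" for f
    by (auto simp: H_def LinearCombinations.module_hom_def regular_module_simps PiE_def)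
  have "LinearCombinations.submodule R H (R.func_space (carrier M))"
  proof (rule LinearCombinations.submodule.intro)
    show "H \<subseteq> carrier (R.func_space (carrier M))" by (auto simp: H R.func_space_def)
    show "\<zero>\<^bsub>R.func_space (carrier M)\<^esub> \<in> H" by (auto simp: H R.func_space_def)
    show "f \<oplus>\<^bsub>R.func_space (carrier M)\<^esub> g \<in> H" if "f \<in> H" "g \<in> H" for f g
      using that by (auto simp: H R.func_space_def PiE_iff R.a_ac R.r_distr)
    show "c \<odot>\<^bsub>R.func_space (carrier M)\<^esub> f \<in> H" if "c \<in> carrier R" "f \<in> H" for c f
      using that by (auto simp: H R.func_space_def PiE_iff R.r_distr R.m_ac)
  qed (rule R.func_space_is_module)
  from F.submodule_is_module[OF this] show ?thesis
    by (rule module_cong) (simp_all add: dual_module_simps H_def)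
qed

lemma (in ring) func_space_simps:
  "add (func_space X) f g = (\<lambda>x\<in>X. f x \<oplus> g x)" "module.smult (func_space X) a f = (\<lambda>x\<in>X. a \<otimes> f x)"
  by (simp_all add: func_space_def)

section \<open>Differentials over the invariant ring\<close>

definition degree_part :: "int \<Rightarrow> ('n::finite, 'k::zero) polynomial set" where
  "degree_part d = {p. \<forall>m\<in>keys p. int (monomial_degree m) = d}"

lemma degree_part_0: "0 \<in> degree_part d"
  by (simp add: degree_part_def)

lemma degree_part_alt: "p \<in> degree_part d \<longleftrightarrow> (\<forall>m. int (monomial_degree m) \<noteq> d \<longrightarrow> lookup p m = 0)"
  by (auto simp: degree_part_def in_keys_iff)

lemma degree_part_add: "p \<in> degree_part d \<Longrightarrow> q \<in> degree_part d \<Longrightarrow> p + q \<in> degree_part d"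
  by (simp add: degree_part_alt lookup_add)

lemma degree_part_uminus: "p \<in> degree_part d \<Longrightarrow> - p \<in> (degree_part d :: ('n::finite, 'k::ab_group_add) polynomial set)"
  by (simp add: degree_part_alt)

lemma degree_part_sum: "(\<And>i. i \<in> I \<Longrightarrow> f i \<in> degree_part d) \<Longrightarrow> (\<Sum>i\<in>I. f i) \<in> degree_part d"
  by (simp add: degree_part_alt lookup_sum)

lemma degree_part_mult: "p \<in> degree_part d \<Longrightarrow> q \<in> degree_part e \<Longrightarrow> p * q \<in> degree_part (d + e)"
  using keys_mult[of p q] by (auto simp: degree_part_def monomial_degree_add)

lemma degree_part_const: "poly_const c \<in> degree_part 0"
  by (simp add: degree_part_def poly_const_def monomial_degree_0)

lemma degree_part_pd: assumes "p \<in> degree_part d" shows "pd i p \<in> degree_part (d - 1)"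
proof (cases "p = 0")
  case True
  then show ?thesis by (simp add: pd_0 degree_part_0)
next
  case False
  then obtain m where "m \<in> keys p" using poly_mapping_as_sum[of p] by fastforce
  then have d: "d = int (nat d)" using assms by (auto simp: degree_part_def)
  have h: "homogeneous (nat d) p" using assms by (auto simp: degree_part_def homogeneous_def)
  show ?thesis
  proof (cases "nat d")
    case 0
    then have "homogeneous 0 p" using h by simp
    then show ?thesis by (simp add: pd_degree_0 degree_part_0)
  next
    case (Suc e)
    then have "homogeneous e (pd i p)" using homogeneous_pd h by simp
    moreover have "d - 1 = int e" using d Suc by simp
    ultimately show ?thesis by (auto simp: homogeneous_def degree_part_def)
  qed
qed

text \<open>Degrees refer to the coefficients only, so that a differential \<open>dx\<^sub>i\<close> has degree \<open>0\<close> instead of \<open>1\<close>;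
  this accounts for the shifts by \<open>1\<close> and \<open>q\<close> below.\<close>

definition coeffs_in_degree :: "int \<Rightarrow> ('n::finite, ('n, 'k::comm_ring_1) polynomial) polynomial set" where
  "coeffs_in_degree d = {b. \<forall>x. lookup b x \<in> degree_part d}"

lemma coeffs_in_degree_add: "b \<in> coeffs_in_degree d \<Longrightarrow> c \<in> coeffs_in_degree d \<Longrightarrow> b + c \<in> coeffs_in_degree d"
  by (simp add: coeffs_in_degree_def lookup_add degree_part_add)

lemma coeffs_in_degree_0: "0 \<in> coeffs_in_degree d"
  by (simp add: coeffs_in_degree_def degree_part_0)

lemma coeffs_in_degree_uminus: "b \<in> coeffs_in_degree d \<Longrightarrow> - b \<in> coeffs_in_degree d"
  by (simp add: coeffs_in_degree_def degree_part_uminus)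

lemma coeffs_in_degree_single: "s \<in> degree_part d \<Longrightarrow> Poly_Mapping.single m s \<in> coeffs_in_degree d"
  by (simp add: coeffs_in_degree_def lookup_single when_def degree_part_0)

lemma coeffs_in_degree_sum: "(\<And>i. i \<in> I \<Longrightarrow> f i \<in> coeffs_in_degree d) \<Longrightarrow> (\<Sum>i\<in>I. f i) \<in> coeffs_in_degree d"
  by (simp add: coeffs_in_degree_def lookup_sum degree_part_sum)

lemma coeffs_in_degree_mult:
  assumes "b \<in> coeffs_in_degree d" "c \<in> coeffs_in_degree e" shows "b * c \<in> coeffs_in_degree (d + e)"
proof -
  have "b * c = (\<Sum>m\<in>keys b. \<Sum>m'\<in>keys c. Poly_Mapping.single (m + m') (lookup b m * lookup c m'))"
    by (subst (1) poly_mapping_as_sum[of b], subst (1) poly_mapping_as_sum[of c]) (simp add: sum_product mult_single)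
  also have "\<dots> \<in> coeffs_in_degree (d + e)"
    using assms by (intro coeffs_in_degree_sum coeffs_in_degree_single degree_part_mult) (simp_all add: coeffs_in_degree_def)
  finally show ?thesis .
qed

lemma coeffs_in_degree_const: "s \<in> degree_part d \<Longrightarrow> poly_const s \<in> coeffs_in_degree d"
  unfolding poly_const_def by (rule coeffs_in_degree_single)

lemma coeffs_in_degree_total_diff: "f \<in> degree_part d \<Longrightarrow> total_diff f \<in> coeffs_in_degree (d - 1)"
  unfolding total_diff_def linear_form_def
proof (rule coeffs_in_degree_sum)
  fix i assume f: "f \<in> degree_part d"
  have "poly_var i \<in> (coeffs_in_degree 0 :: ('a, ('a, 'b) polynomial) polynomial set)"
    unfolding poly_var_def poly_const_1[symmetric] by (intro coeffs_in_degree_single degree_part_const)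
  from coeffs_in_degree_mult[OF coeffs_in_degree_const[OF degree_part_pd[OF f]] this]
  show "poly_const (pd i f) * poly_var i \<in> coeffs_in_degree (d - 1)" by simp
qed

context linear_action
begin

definition inv_ring :: "('n, 'k) polynomial graded_ring" where
  "inv_ring = \<lparr>carrier = invs, mult = (*), one = 1, zero = 0, add = (+), ring_comp = \<lambda>d. invs \<inter> degree_part d\<rparr>"

lemma inv_ring_simps:
  "carrier inv_ring = invs" "mult inv_ring = (*)" "one inv_ring = 1" "zero inv_ring = 0"
  "add inv_ring = (+)" "ring_comp inv_ring d = invs \<inter> degree_part d"
  by (simp_all add: inv_ring_def)

lemma inv_ring_domain: "domain inv_ring"
proof -
  have "cring inv_ring"
  proof (rule cringI)
    show "abelian_group inv_ring"
      by (rule abelian_groupI)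
        (auto simp: inv_ring_simps invs_add invs_zero algebra_simps intro: bexI[of _ "- _"] invs_minus)
    show "comm_monoid inv_ring"
      by (rule comm_monoidI) (auto simp: inv_ring_simps invs_mult invs_one algebra_simps)
  qed (auto simp: inv_ring_simps algebra_simps)
  then show ?thesis
    by (intro domain.intro domain_axioms.intro) (auto simp: inv_ring_simps no_zero_div)
qed

definition form_module :: "(('n, 'k) polynomial, ('n, ('n, 'k) polynomial) polynomial) module" where
  "form_module = \<lparr>carrier = UNIV, mult = (*), one = 1, zero = 0, add = (+), smult = \<lambda>r b. poly_const r * b\<rparr>"

lemma form_module_simps:
  "carrier form_module = UNIV" "add form_module = (+)" "zero form_module = 0"
  "module.smult form_module r b = poly_const r * b"
  by (simp_all add: form_module_def)

lemma form_module_is_module: "module inv_ring form_module"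
proof (rule moduleI)
  show "cring inv_ring" using inv_ring_domain by (rule domain.axioms)
  show "abelian_group form_module"
    by (rule abelian_groupI) (auto simp: form_module_simps algebra_simps intro: exI[of _ "- _"])
qed (auto simp: form_module_simps inv_ring_simps poly_const_add poly_const_mult poly_const_1 algebra_simps)

lemma form_module_minus: "a \<ominus>\<^bsub>form_module\<^esub> b = a - b"
proof -
  interpret M: module inv_ring form_module by (rule form_module_is_module)
  have "\<ominus>\<^bsub>form_module\<^esub> b = - b"
    by (rule M.M.minus_equality) (simp_all add: form_module_simps)
  then show ?thesis by (simp add: a_minus_def form_module_simps)
qed

definition inv_forms :: "nat \<Rightarrow> ('n, ('n, 'k) polynomial) polynomial set" where
  "inv_forms q = {b. homogeneous q b \<and> (\<forall>g\<in>\<Gamma>. form_act g b = b)}"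

lemma inv_forms_add: "b \<in> inv_forms q \<Longrightarrow> c \<in> inv_forms q \<Longrightarrow> b + c \<in> inv_forms q"
  by (simp add: inv_forms_def homogeneous_add ring_map.map_add[OF ring_map_form_act])

lemma inv_forms_0: "0 \<in> inv_forms q"
  by (simp add: inv_forms_def homogeneous_0 ring_map.map_zero[OF ring_map_form_act])

lemma inv_forms_smult: "r \<in> invs \<Longrightarrow> b \<in> inv_forms q \<Longrightarrow> poly_const r * b \<in> inv_forms q"
  by (simp add: inv_forms_def homogeneous_const_mult ring_map.map_mult[OF ring_map_form_act] form_act_const invsD)

lemma inv_forms_mult: "b \<in> inv_forms p \<Longrightarrow> c \<in> inv_forms q \<Longrightarrow> b * c \<in> inv_forms (p + q)"
  by (simp add: inv_forms_def homogeneous_mult ring_map.map_mult[OF ring_map_form_act])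

lemma inv_forms_1: "1 \<in> inv_forms 0"
  by (simp add: inv_forms_def homogeneous_one ring_map.map_one[OF ring_map_form_act])

lemma inv_forms_total_diff: "f \<in> invs \<Longrightarrow> total_diff f \<in> inv_forms 1"
  unfolding inv_forms_def using homogeneous_total_diff total_diff_invariant by blast

lemma inv_forms_fixed:
  "b \<in> inv_forms q \<Longrightarrow> lookup b \<in> semilinear_rep.fixed \<Gamma> (monomials_of_degree q) mono_rho"
  by (intro homogeneous_fixed) (simp_all add: inv_forms_def)

interpretation R: domain inv_ring by (rule inv_ring_domain)
interpretation SF: module inv_ring form_module by (rule form_module_is_module)

subsection \<open>Kaehler differentials\<close>

abbreviation "Omega_rels \<equiv> kaehler_rels inv_ring (range poly_const)"
abbreviation "Omega \<equiv> kaehler_differentials inv_ring (range poly_const)"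
abbreviation "dgen \<equiv> presented_gen inv_ring invs Omega_rels"
abbreviation "Omega_P \<equiv> presented_module inv_ring invs Omega_rels"

interpretation FO: module inv_ring "free_module inv_ring invs" by (rule R.free_is_module)

lemma Omega_rels_subset: "Omega_rels \<subseteq> carrier (free_module inv_ring invs)"
  unfolding kaehler_rels_def Let_def inv_ring_simps
  by (auto intro!: FO.M.minus_closed FO.M.a_closed FO.smult_closed R.free_gen_mem
      simp: invs_add invs_mult poly_const_invs inv_ring_simps)

interpretation PO: quotient_of_module inv_ring "free_module inv_ring invs" "relation_module inv_ring invs Omega_rels"
  by (rule R.presented_quotient[OF Omega_rels_subset])

lemma Omega_simps:
  "carrier Omega = carrier Omega_P" "add Omega = add Omega_P" "zero Omega = zero Omega_P"
  "module.smult Omega = module.smult Omega_P"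
  by (simp_all add: kaehler_differentials_def Let_def with_grading_simps inv_ring_simps)

lemma Omega_P_module: "module inv_ring Omega_P"
  by (rule R.presented_is_module[OF Omega_rels_subset])

lemma Omega_module: "module inv_ring Omega"
  by (rule module_cong[OF Omega_P_module]) (simp_all add: Omega_simps)

interpretation OM: module inv_ring Omega by (rule Omega_module)

lemma dgen_mem: "f \<in> invs \<Longrightarrow> dgen f \<in> carrier Omega"
  unfolding Omega_simps by (rule R.presented_gen_mem[OF Omega_rels_subset])

lemma dgen_eq: "dgen f = PO.proj (free_gen inv_ring invs f)"
  by (rule R.presented_gen_eq[OF Omega_rels_subset])

lemma free_gen_invs: "f \<in> invs \<Longrightarrow> free_gen inv_ring invs f \<in> carrier (free_module inv_ring invs)"
  by (rule R.free_gen_mem)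

lemma dgen_add: assumes "f \<in> invs" "g \<in> invs" shows "dgen (f + g) = dgen f \<oplus>\<^bsub>Omega\<^esub> dgen g"
proof -
  have "free_gen inv_ring invs (f + g) \<ominus>\<^bsub>free_module inv_ring invs\<^esub>
      (free_gen inv_ring invs f \<oplus>\<^bsub>free_module inv_ring invs\<^esub> free_gen inv_ring invs g) \<in> Omega_rels"
    unfolding kaehler_rels_def Let_def inv_ring_simps
    by (rule UnI1, rule UnI1, rule CollectI, intro exI conjI, rule refl) (rule assms)+
  then have "PO.proj (free_gen inv_ring invs (f + g)) =
      PO.proj (free_gen inv_ring invs f \<oplus>\<^bsub>free_module inv_ring invs\<^esub> free_gen inv_ring invs g)"
    by (rule R.presented_relation[OF Omega_rels_subset _ _ _ refl])
      (use assms in \<open>auto intro!: free_gen_invs FO.M.a_closed invs_add\<close>)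
  also have "\<dots> = PO.proj (free_gen inv_ring invs f) \<oplus>\<^bsub>PO.Q\<^esub> PO.proj (free_gen inv_ring invs g)"
    by (rule PO.proj_add[symmetric]) (use assms in \<open>auto intro!: free_gen_invs\<close>)
  finally show ?thesis by (simp only: dgen_eq presented_module_def Omega_simps)
qed

lemma dgen_mult: assumes "f \<in> invs" "g \<in> invs"
  shows "dgen (f * g) = f \<odot>\<^bsub>Omega\<^esub> dgen g \<oplus>\<^bsub>Omega\<^esub> g \<odot>\<^bsub>Omega\<^esub> dgen f"
proof -
  let ?F = "free_module inv_ring invs"
  have f: "f \<in> carrier inv_ring" "g \<in> carrier inv_ring" using assms by (simp_all add: inv_ring_simps)
  note gens = free_gen_invs[OF assms(1)] free_gen_invs[OF assms(2)]
  have "free_gen inv_ring invs (f * g) \<ominus>\<^bsub>?F\<^esub>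
      ((f \<odot>\<^bsub>?F\<^esub> free_gen inv_ring invs g) \<oplus>\<^bsub>?F\<^esub> (g \<odot>\<^bsub>?F\<^esub> free_gen inv_ring invs f)) \<in> Omega_rels"
    unfolding kaehler_rels_def Let_def inv_ring_simps
    by (rule UnI1, rule UnI2, rule CollectI, intro exI conjI, rule refl) (rule assms)+
  then have "PO.proj (free_gen inv_ring invs (f * g)) =
      PO.proj ((f \<odot>\<^bsub>?F\<^esub> free_gen inv_ring invs g) \<oplus>\<^bsub>?F\<^esub> (g \<odot>\<^bsub>?F\<^esub> free_gen inv_ring invs f))"
    by (rule R.presented_relation[OF Omega_rels_subset _ _ _ refl])
      (use assms in \<open>auto intro!: free_gen_invs FO.M.a_closed FO.smult_closed invs_mult simp: inv_ring_simps\<close>)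
  also have "\<dots> = f \<odot>\<^bsub>PO.Q\<^esub> PO.proj (free_gen inv_ring invs g) \<oplus>\<^bsub>PO.Q\<^esub> g \<odot>\<^bsub>PO.Q\<^esub> PO.proj (free_gen inv_ring invs f)"
    using f gens by (simp add: PO.proj_add PO.proj_smult FO.smult_closed)
  finally show ?thesis by (simp only: dgen_eq presented_module_def Omega_simps)
qed

lemma dgen_const: "dgen (poly_const c) = \<zero>\<^bsub>Omega\<^esub>"
proof -
  let ?F = "free_module inv_ring invs"
  note gen = free_gen_invs[OF poly_const_invs]
  have "free_gen inv_ring invs (poly_const c) \<ominus>\<^bsub>?F\<^esub> \<zero>\<^bsub>?F\<^esub> = free_gen inv_ring invs (poly_const c)"
    by (rule minus_zero_right[OF FO.M.abelian_group_axioms gen])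
  then have "free_gen inv_ring invs (poly_const c) \<ominus>\<^bsub>?F\<^esub> \<zero>\<^bsub>?F\<^esub> \<in> Omega_rels"
    by (auto simp: kaehler_rels_def Let_def inv_ring_simps)
  then have "PO.proj (free_gen inv_ring invs (poly_const c)) = PO.proj \<zero>\<^bsub>?F\<^esub>"
    by (rule R.presented_relation[OF Omega_rels_subset _ gen FO.M.zero_closed refl])
  then show ?thesis by (simp only: dgen_eq presented_module_def Omega_simps PO.proj_zero)
qed

text \<open>The map \<open>\<Omega>\<^sub>R \<rightarrow> S \<otimes> F\<close> induced by the total differential.\<close>

lemma omega_map_ex:
  "\<exists>h. h \<in> LinearCombinations.module_hom inv_ring Omega form_module \<and> (\<forall>f\<in>invs. h (dgen f) = total_diff f)"
proof -
  obtain h where h: "h \<in> LinearCombinations.module_hom inv_ring Omega_P form_module"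
    "\<And>f. f \<in> invs \<Longrightarrow> h (dgen f) = total_diff f"
  proof (rule R.hom_from_presented[OF Omega_rels_subset form_module_is_module, of total_diff])
    fix h r assume h: "h \<in> LinearCombinations.module_hom inv_ring (free_module inv_ring invs) form_module"
      and hg: "\<And>f. f \<in> invs \<Longrightarrow> h (free_gen inv_ring invs f) = total_diff f" and r: "r \<in> Omega_rels"
    have minus: "h (a \<ominus>\<^bsub>free_module inv_ring invs\<^esub> b) = h a - h b"
      if "a \<in> carrier (free_module inv_ring invs)" "b \<in> carrier (free_module inv_ring invs)" for a b
      using module_hom_minus[OF FO.module_axioms form_module_is_module h that] by (simp add: form_module_minus)
    have add: "h (a \<oplus>\<^bsub>free_module inv_ring invs\<^esub> b) = h a + h b"
      if "a \<in> carrier (free_module inv_ring invs)" "b \<in> carrier (free_module inv_ring invs)" for a b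
      using LinearCombinations.module_hom_add[OF h that] by (simp add: form_module_simps)
    have sm: "h (a \<odot>\<^bsub>free_module inv_ring invs\<^esub> b) = poly_const a * h b"
      if "a \<in> invs" "b \<in> carrier (free_module inv_ring invs)" for a b
      using LinearCombinations.module_hom_smult[OF h _ that(2), of a] that by (simp add: form_module_simps inv_ring_simps)
    have smc: "a \<odot>\<^bsub>free_module inv_ring invs\<^esub> b \<in> carrier (free_module inv_ring invs)"
      if "a \<in> invs" "b \<in> carrier (free_module inv_ring invs)" for a b
      using that by (intro FO.smult_closed) (simp_all add: inv_ring_simps)
    show "h r = \<zero>\<^bsub>form_module\<^esub>"
      using r unfolding kaehler_rels_def Let_def inv_ring_simps form_module_simps
      by (elim UnE CollectE exE conjE imageE)
        (simp_all add: minus add sm smc hg free_gen_invs invs_add invs_mult poly_const_invs FO.M.a_closed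
          total_diff_add total_diff_mult total_diff_const)
  qed (auto simp: form_module_simps)
  have "h \<in> LinearCombinations.module_hom inv_ring Omega form_module"
    using h(1) module_hom_cong[of Omega Omega_P form_module form_module inv_ring] by (simp add: Omega_simps)
  then show ?thesis using h(2) by blast
qed

definition omega_map where
  "omega_map = (SOME h. h \<in> LinearCombinations.module_hom inv_ring Omega form_module \<and> (\<forall>f\<in>invs. h (dgen f) = total_diff f))"

lemma omega_map_hom: "omega_map \<in> LinearCombinations.module_hom inv_ring Omega form_module"
  and omega_map_dgen: "f \<in> invs \<Longrightarrow> omega_map (dgen f) = total_diff f"
  using someI_ex[OF omega_map_ex] by (simp_all add: omega_map_def)

lemma omega_map_add: "x \<in> carrier Omega \<Longrightarrow> y \<in> carrier Omega \<Longrightarrow> omega_map (x \<oplus>\<^bsub>Omega\<^esub> y) = omega_map x + omega_map y"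
  using LinearCombinations.module_hom_add[OF omega_map_hom] by (simp add: form_module_simps)

lemma omega_map_smult: "r \<in> invs \<Longrightarrow> x \<in> carrier Omega \<Longrightarrow> omega_map (r \<odot>\<^bsub>Omega\<^esub> x) = poly_const r * omega_map x"
  using LinearCombinations.module_hom_smult[OF omega_map_hom] by (simp add: form_module_simps inv_ring_simps)

lemma omega_map_zero: "omega_map \<zero>\<^bsub>Omega\<^esub> = 0"
  using module_hom_zero[OF Omega_module form_module_is_module omega_map_hom] by (simp add: form_module_simps)

text \<open>Already the multiples of the \<open>df\<close> generate, because they span the free module that is being divided.\<close>

lemma omega_induct [consumes 1, case_names zero step]:
  assumes "z \<in> carrier Omega" "P \<zero>\<^bsub>Omega\<^esub>"
    and "\<And>z r f. z \<in> carrier Omega \<Longrightarrow> P z \<Longrightarrow> r \<in> invs \<Longrightarrow> f \<in> invs \<Longrightarrow> P (z \<oplus>\<^bsub>Omega\<^esub> r \<odot>\<^bsub>Omega\<^esub> dgen f)"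
  shows "P z"
  using R.presented_induct[OF Omega_rels_subset, of z P] assms by (simp add: Omega_simps inv_ring_simps)

lemma omega_map_inv_forms: "z \<in> carrier Omega \<Longrightarrow> omega_map z \<in> inv_forms 1"
proof (induction rule: omega_induct)
  case zero
  then show ?case by (simp add: omega_map_zero inv_forms_0)
next
  case (step z r f)
  have m: "r \<odot>\<^bsub>Omega\<^esub> dgen f \<in> carrier Omega"
    using step dgen_mem by (intro OM.smult_closed) (simp_all add: inv_ring_simps)
  then have "omega_map (z \<oplus>\<^bsub>Omega\<^esub> r \<odot>\<^bsub>Omega\<^esub> dgen f) = omega_map z + poly_const r * total_diff f" using step
    by (simp add: omega_map_add omega_map_smult omega_map_dgen dgen_mem)
  then show ?case
    using inv_forms_add[OF step.IH inv_forms_smult[OF _ inv_forms_total_diff]] step.hyps by simp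
qed

lemma omega_map_degree: "z \<in> mod_comp Omega d \<Longrightarrow> z \<in> carrier Omega \<and> omega_map z \<in> coeffs_in_degree (d - 1)"
proof -
  have mc: "mod_comp Omega d = generate (add_monoid Omega_P)
      {a \<odot>\<^bsub>Omega_P\<^esub> dgen f | a f i j. a \<in> ring_comp inv_ring i \<and> f \<in> ring_comp inv_ring j \<and> i + j = d}"
    by (simp add: kaehler_differentials_def Let_def with_grading_simps inv_ring_simps(1))
  have gen: "a \<odot>\<^bsub>Omega_P\<^esub> dgen f \<in> carrier Omega \<and> omega_map (a \<odot>\<^bsub>Omega_P\<^esub> dgen f) \<in> coeffs_in_degree (d - 1)"
    if "a \<in> ring_comp inv_ring i" "f \<in> ring_comp inv_ring j" "i + j = d" for a f i j
  proof -
    have a: "a \<in> invs" "a \<in> degree_part i" "f \<in> invs" "f \<in> degree_part j" using that by (simp_all add: inv_ring_simps)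
    have "a \<odot>\<^bsub>Omega\<^esub> dgen f \<in> carrier Omega" using a dgen_mem by (intro OM.smult_closed) (simp_all add: inv_ring_simps)
    moreover have "omega_map (a \<odot>\<^bsub>Omega\<^esub> dgen f) = poly_const a * total_diff f"
      using a by (simp add: omega_map_smult omega_map_dgen dgen_mem)
    moreover have "poly_const a * total_diff f \<in> coeffs_in_degree (i + (j - 1))"
      by (intro coeffs_in_degree_mult coeffs_in_degree_const coeffs_in_degree_total_diff a)
    moreover have "i + (j - 1) = d - 1" using that by simp
    ultimately show ?thesis by (simp add: Omega_simps)
  qed
  assume "z \<in> mod_comp Omega d"
  then show ?thesis unfolding mc
  proof (induction rule: generate.induct)
    case one
    then show ?case using OM.M.zero_closed by (simp add: Omega_simps[symmetric] omega_map_zero coeffs_in_degree_0)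
  next
    case (incl h)
    then show ?case using gen by blast
  next
    case (inv h)
    then have h: "h \<in> carrier Omega" "omega_map h \<in> coeffs_in_degree (d - 1)" using gen by blast+
    have e: "inv\<^bsub>add_monoid Omega_P\<^esub> h = \<ominus>\<^bsub>Omega\<^esub> h"
      by (simp add: a_inv_def m_inv_def Omega_simps)
    have "omega_map (\<ominus>\<^bsub>Omega\<^esub> h) + omega_map h = 0"
      using h(1) by (simp add: omega_map_add[symmetric] OM.M.l_neg omega_map_zero)
    then have "omega_map (\<ominus>\<^bsub>Omega\<^esub> h) = - omega_map h" by (simp add: eq_neg_iff_add_eq_0)
    then show ?case unfolding e using h by (simp add: coeffs_in_degree_uminus)
  next
    case (eng h1 h2)
    then show ?case
      using OM.M.a_closed[of h1 h2] by (simp add: Omega_simps[symmetric] omega_map_add coeffs_in_degree_add)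
  qed
qed

end

context linear_action
begin

interpretation R: domain inv_ring by (rule inv_ring_domain)
interpretation SF: module inv_ring form_module by (rule form_module_is_module)
interpretation OM: module inv_ring Omega by (rule Omega_module)
interpretation rep: semilinear_rep \<Gamma> v w "monomials_of_degree q" mono_rho for q by (rule monomial_rep)

subsection \<open>Symmetric powers\<close>

abbreviation "sym_index q \<equiv> sym_gens q Omega"
abbreviation "sym_relations q \<equiv> sym_rels inv_ring q Omega"
abbreviation "Sym q \<equiv> sym_power inv_ring q Omega"
abbreviation "Sym_P q \<equiv> presented_module inv_ring (sym_index q) (sym_relations q)"
abbreviation "sgen q \<equiv> presented_gen inv_ring (sym_index q) (sym_relations q)"
abbreviation "FS q \<equiv> free_module inv_ring (sym_index q)"

interpretation FS: module inv_ring "FS q" for q by (rule R.free_is_module)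

lemma sym_index_add_mset:
  "Suc (size T) = q \<Longrightarrow> set_mset T \<subseteq> carrier Omega \<Longrightarrow> x \<in> carrier Omega \<Longrightarrow> add_mset x T \<in> sym_index q"
  by (auto simp: sym_gens_def)

lemma sym_rels_subset: "sym_relations q \<subseteq> carrier (FS q)"
  unfolding sym_rels_def Let_def
  by (auto intro!: FS.M.minus_closed FS.M.a_closed FS.smult_closed R.free_gen_mem sym_index_add_mset)

interpretation PS: quotient_of_module inv_ring "FS q" "relation_module inv_ring (sym_index q) (sym_relations q)" for q
  by (rule R.presented_quotient[OF sym_rels_subset])

lemma Sym_simps:
  "carrier (Sym q) = carrier (Sym_P q)" "add (Sym q) = add (Sym_P q)" "zero (Sym q) = zero (Sym_P q)"
  "module.smult (Sym q) = module.smult (Sym_P q)"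
  by (simp_all add: sym_power_def Let_def with_grading_simps)

lemma Sym_module: "module inv_ring (Sym q)"
  by (rule module_cong[OF R.presented_is_module[OF sym_rels_subset]]) (simp_all add: Sym_simps)

interpretation SM: module inv_ring "Sym q" for q by (rule Sym_module)

lemma sgen_mem: "T \<in> sym_index q \<Longrightarrow> sgen q T \<in> carrier (Sym q)"
  unfolding Sym_simps by (rule R.presented_gen_mem[OF sym_rels_subset])

lemma sgen_eq: "sgen q T = PS.proj q (free_gen inv_ring (sym_index q) T)"
  by (rule R.presented_gen_eq[OF sym_rels_subset])

lemma sgen_add:
  assumes "x \<in> carrier Omega" "y \<in> carrier Omega" "set_mset T \<subseteq> carrier Omega" "Suc (size T) = q"
  shows "sgen q (add_mset (x \<oplus>\<^bsub>Omega\<^esub> y) T) = sgen q (add_mset x T) \<oplus>\<^bsub>Sym q\<^esub> sgen q (add_mset y T)"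
proof -
  let ?g = "free_gen inv_ring (sym_index q)"
  have gx: "?g (add_mset x T) \<in> carrier (FS q)" "?g (add_mset y T) \<in> carrier (FS q)"
    "?g (add_mset (x \<oplus>\<^bsub>Omega\<^esub> y) T) \<in> carrier (FS q)"
    by (intro R.free_gen_mem sym_index_add_mset assms OM.M.a_closed)+
  have "?g (add_mset (x \<oplus>\<^bsub>Omega\<^esub> y) T) \<ominus>\<^bsub>FS q\<^esub> (?g (add_mset x T) \<oplus>\<^bsub>FS q\<^esub> ?g (add_mset y T)) \<in> sym_relations q"
    unfolding sym_rels_def Let_def
    by (rule UnI1, rule CollectI, intro exI conjI, rule refl) (rule assms)+
  then have "PS.proj q (?g (add_mset (x \<oplus>\<^bsub>Omega\<^esub> y) T)) = PS.proj q (?g (add_mset x T) \<oplus>\<^bsub>FS q\<^esub> ?g (add_mset y T))"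
    by (rule R.presented_relation[OF sym_rels_subset _ gx(3) FS.M.a_closed[OF gx(1,2)] refl])
  also have "\<dots> = PS.proj q (?g (add_mset x T)) \<oplus>\<^bsub>Sym_P q\<^esub> PS.proj q (?g (add_mset y T))"
    using PS.proj_add[OF gx(1,2)] by (simp add: presented_module_def)
  finally show ?thesis by (simp only: sgen_eq Sym_simps)
qed

lemma sgen_smult:
  assumes "r \<in> invs" "x \<in> carrier Omega" "set_mset T \<subseteq> carrier Omega" "Suc (size T) = q"
  shows "sgen q (add_mset (r \<odot>\<^bsub>Omega\<^esub> x) T) = r \<odot>\<^bsub>Sym q\<^esub> sgen q (add_mset x T)"
proof -
  let ?g = "free_gen inv_ring (sym_index q)"
  have r: "r \<in> carrier inv_ring" using assms by (simp add: inv_ring_simps)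
  have gx: "?g (add_mset x T) \<in> carrier (FS q)" "?g (add_mset (r \<odot>\<^bsub>Omega\<^esub> x) T) \<in> carrier (FS q)"
    by (intro R.free_gen_mem sym_index_add_mset assms OM.smult_closed r)+
  have "?g (add_mset (r \<odot>\<^bsub>Omega\<^esub> x) T) \<ominus>\<^bsub>FS q\<^esub> (r \<odot>\<^bsub>FS q\<^esub> ?g (add_mset x T)) \<in> sym_relations q"
    unfolding sym_rels_def Let_def
    by (rule UnI2, rule CollectI, intro exI conjI, rule refl) (rule assms r)+
  then have "PS.proj q (?g (add_mset (r \<odot>\<^bsub>Omega\<^esub> x) T)) = PS.proj q (r \<odot>\<^bsub>FS q\<^esub> ?g (add_mset x T))"
    by (rule R.presented_relation[OF sym_rels_subset _ gx(2) FS.smult_closed[OF r gx(1)] refl])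
  also have "\<dots> = r \<odot>\<^bsub>Sym_P q\<^esub> PS.proj q (?g (add_mset x T))"
    using PS.proj_smult[OF r gx(1)] by (simp add: presented_module_def)
  finally show ?thesis by (simp only: sgen_eq Sym_simps)
qed

lemma sgen_zero:
  assumes "set_mset T \<subseteq> carrier Omega" "Suc (size T) = q"
  shows "sgen q (add_mset \<zero>\<^bsub>Omega\<^esub> T) = \<zero>\<^bsub>Sym q\<^esub>"
proof -
  have z: "\<zero>\<^bsub>Omega\<^esub> \<in> carrier Omega" by (rule OM.M.zero_closed)
  have "\<zero>\<^bsub>Omega\<^esub> = \<zero>\<^bsub>inv_ring\<^esub> \<odot>\<^bsub>Omega\<^esub> \<zero>\<^bsub>Omega\<^esub>" by simp
  then have "sgen q (add_mset \<zero>\<^bsub>Omega\<^esub> T) = sgen q (add_mset (0 \<odot>\<^bsub>Omega\<^esub> \<zero>\<^bsub>Omega\<^esub>) T)"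
    by (simp add: inv_ring_simps)
  also have "\<dots> = 0 \<odot>\<^bsub>Sym q\<^esub> sgen q (add_mset \<zero>\<^bsub>Omega\<^esub> T)" by (rule sgen_smult[OF invs_zero z assms])
  also have "\<dots> = \<zero>\<^bsub>Sym q\<^esub>"
    using SM.smult_l_null[OF sgen_mem[OF sym_index_add_mset[OF assms(2,1) z]]] by (simp add: inv_ring_simps)
  finally show ?thesis .
qed

lemma sym_induct [consumes 1, case_names zero step]:
  assumes "z \<in> carrier (Sym q)" "P \<zero>\<^bsub>Sym q\<^esub>"
    and "\<And>z r T. z \<in> carrier (Sym q) \<Longrightarrow> P z \<Longrightarrow> r \<in> invs \<Longrightarrow> T \<in> sym_index q \<Longrightarrow> P (z \<oplus>\<^bsub>Sym q\<^esub> r \<odot>\<^bsub>Sym q\<^esub> sgen q T)"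
  shows "P z"
  using R.presented_induct[OF sym_rels_subset, of z q P] assms by (simp add: Sym_simps inv_ring_simps)

text \<open>By multilinearity, products of arbitrary differentials reduce to products of the \<open>df\<close>.\<close>

lemma sym_hom_eq:
  assumes N: "module inv_ring N" and \<mu>: "\<mu> \<in> LinearCombinations.module_hom inv_ring (Sym q) N"
    and \<psi>: "\<psi> \<in> LinearCombinations.module_hom inv_ring (Sym q) N"
    and agree: "\<And>T. size T = q \<Longrightarrow> set_mset T \<subseteq> invs \<Longrightarrow> \<mu> (sgen q (image_mset dgen T)) = \<psi> (sgen q (image_mset dgen T))"
    and m: "m \<in> carrier (Sym q)"
  shows "\<mu> m = \<psi> m"
proof -
  note hz = module_hom_zero[OF Sym_module N \<mu>] module_hom_zero[OF Sym_module N \<psi>]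
  note add_\<mu> = LinearCombinations.module_hom_add[OF \<mu>] and add_\<psi> = LinearCombinations.module_hom_add[OF \<psi>]
  have sm: "\<mu> (r \<odot>\<^bsub>Sym q\<^esub> x) = r \<odot>\<^bsub>N\<^esub> \<mu> x" "\<psi> (r \<odot>\<^bsub>Sym q\<^esub> x) = r \<odot>\<^bsub>N\<^esub> \<psi> x" if "r \<in> invs" "x \<in> carrier (Sym q)" for r x
    using LinearCombinations.module_hom_smult[OF \<mu>] LinearCombinations.module_hom_smult[OF \<psi>] that
    by (simp_all add: inv_ring_simps)
  have smc: "r \<odot>\<^bsub>Sym q\<^esub> x \<in> carrier (Sym q)" if "r \<in> invs" "x \<in> carrier (Sym q)" for r x
    using that by (intro SM.smult_closed) (simp_all add: inv_ring_simps)
  have gens: "\<mu> (sgen q (U + image_mset dgen T)) = \<psi> (sgen q (U + image_mset dgen T))"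
    if "set_mset U \<subseteq> carrier Omega" "set_mset T \<subseteq> invs" "size U + size T = q" for U T
    using that
  proof (induction U arbitrary: T)
    case empty
    then show ?case using agree by simp
  next
    case (add z U)
    define V where "V = U + image_mset dgen T"
    have V: "set_mset V \<subseteq> carrier Omega" "Suc (size V) = q"
      using add.prems dgen_mem by (auto simp: V_def)
    have "z \<in> carrier Omega" using add.prems by simp
    then have "\<mu> (sgen q (add_mset z V)) = \<psi> (sgen q (add_mset z V))"
    proof (induction rule: omega_induct)
      case zero
      show ?case by (simp only: sgen_zero[OF V] hz)
    next
      case (step z r f)
      have d: "dgen f \<in> carrier Omega" using step dgen_mem by simp
      have rd: "r \<odot>\<^bsub>Omega\<^esub> dgen f \<in> carrier Omega" using step d by (intro OM.smult_closed) (simp_all add: inv_ring_simps)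
      have eq: "sgen q (add_mset (z \<oplus>\<^bsub>Omega\<^esub> r \<odot>\<^bsub>Omega\<^esub> dgen f) V) =
          sgen q (add_mset z V) \<oplus>\<^bsub>Sym q\<^esub> r \<odot>\<^bsub>Sym q\<^esub> sgen q (add_mset (dgen f) V)"
        using sgen_add[OF step.hyps(1) rd V] sgen_smult[OF step.hyps(2) d V] by simp
      have z: "sgen q (add_mset z V) \<in> carrier (Sym q)" "sgen q (add_mset (dgen f) V) \<in> carrier (Sym q)"
        using sgen_mem sym_index_add_mset[OF V(2,1)] step.hyps(1) d by auto
      have "\<mu> (sgen q (add_mset (dgen f) V)) = \<psi> (sgen q (add_mset (dgen f) V))"
        using add.IH[of "add_mset f T"] add.prems step.hyps(3) by (simp add: V_def)
      then show ?case unfolding eq using step.IH z smc[OF step.hyps(2) z(2)] step.hyps(2) by (simp add: add_\<mu> add_\<psi> sm)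
    qed
    then show ?case by (simp add: V_def)
  qed
  show ?thesis using m
  proof (induction rule: sym_induct)
    case zero
    show ?case by (simp only: hz)
  next
    case (step z r T)
    have "\<mu> (sgen q T) = \<psi> (sgen q T)" using gens[of T "{#}"] step.hyps(3) by (simp add: sym_gens_def)
    then show ?case using step sgen_mem[OF step.hyps(3)] smc[OF step.hyps(2) sgen_mem[OF step.hyps(3)]]
      by (simp add: add_\<mu> add_\<psi> sm)
  qed
qed

definition omega_prod where "omega_prod T = (\<Prod>x\<in>#T. omega_map x)"

lemma omega_prod_dgen: "set_mset T \<subseteq> invs \<Longrightarrow> omega_prod (image_mset dgen T) = diff_prod T"
  by (induction T) (simp_all add: omega_prod_def diff_prod_def omega_map_dgen)

lemma omega_prod_inv_forms: "set_mset T \<subseteq> carrier Omega \<Longrightarrow> omega_prod T \<in> inv_forms (size T)"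
proof (induction T)
  case empty
  then show ?case by (simp add: omega_prod_def inv_forms_1)
next
  case (add x T)
  then show ?case
    using inv_forms_mult[OF omega_map_inv_forms, of x "omega_prod T" "size T"] by (simp add: omega_prod_def)
qed

lemma sym_map_ex:
  "\<exists>h. h \<in> LinearCombinations.module_hom inv_ring (Sym q) form_module \<and> (\<forall>T\<in>sym_index q. h (sgen q T) = omega_prod T)"
proof -
  obtain h where h: "h \<in> LinearCombinations.module_hom inv_ring (Sym_P q) form_module"
    "\<And>T. T \<in> sym_index q \<Longrightarrow> h (sgen q T) = omega_prod T"
  proof (rule R.hom_from_presented[OF sym_rels_subset form_module_is_module, of q omega_prod])
    fix h r assume h: "h \<in> LinearCombinations.module_hom inv_ring (FS q) form_module"
      and hg: "\<And>T. T \<in> sym_index q \<Longrightarrow> h (free_gen inv_ring (sym_index q) T) = omega_prod T" and r: "r \<in> sym_relations q"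
    have minus: "h (a \<ominus>\<^bsub>FS q\<^esub> b) = h a - h b" if "a \<in> carrier (FS q)" "b \<in> carrier (FS q)" for a b
      using module_hom_minus[OF FS.module_axioms form_module_is_module h that] by (simp add: form_module_minus)
    have add: "h (a \<oplus>\<^bsub>FS q\<^esub> b) = h a + h b" if "a \<in> carrier (FS q)" "b \<in> carrier (FS q)" for a b
      using LinearCombinations.module_hom_add[OF h that] by (simp add: form_module_simps)
    have sm: "h (a \<odot>\<^bsub>FS q\<^esub> b) = poly_const a * h b" if "a \<in> carrier inv_ring" "b \<in> carrier (FS q)" for a b
      using LinearCombinations.module_hom_smult[OF h that] by (simp add: form_module_simps)
    note mem = R.free_gen_mem sym_index_add_mset
    have om: "omega_map (a \<odot>\<^bsub>Omega\<^esub> x) = poly_const a * omega_map x" if "a \<in> carrier inv_ring" "x \<in> carrier Omega" for a x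
      using omega_map_smult[of a x] that by (simp add: inv_ring_simps)
    show "h r = \<zero>\<^bsub>form_module\<^esub>"
      using r unfolding sym_rels_def Let_def form_module_simps
      by (elim UnE CollectE exE conjE)
        (simp_all add: minus add sm hg mem omega_prod_def omega_map_add om FS.M.a_closed FS.smult_closed OM.M.a_closed
          OM.smult_closed algebra_simps)
  qed (auto simp: form_module_simps)
  have "h \<in> LinearCombinations.module_hom inv_ring (Sym q) form_module"
    using h(1) module_hom_cong[of "Sym q" "Sym_P q" form_module form_module inv_ring] by (simp add: Sym_simps)
  then show ?thesis using h(2) by blast
qed

definition sym_map where
  "sym_map q = (SOME h. h \<in> LinearCombinations.module_hom inv_ring (Sym q) form_module \<and> (\<forall>T\<in>sym_index q. h (sgen q T) = omega_prod T))"

lemma sym_map_hom: "sym_map q \<in> LinearCombinations.module_hom inv_ring (Sym q) form_module"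
  and sym_map_sgen: "T \<in> sym_index q \<Longrightarrow> sym_map q (sgen q T) = omega_prod T"
  using someI_ex[OF sym_map_ex[of q]] by (simp_all add: sym_map_def)

lemma sym_map_add: "x \<in> carrier (Sym q) \<Longrightarrow> y \<in> carrier (Sym q) \<Longrightarrow> sym_map q (x \<oplus>\<^bsub>Sym q\<^esub> y) = sym_map q x + sym_map q y"
  using LinearCombinations.module_hom_add[OF sym_map_hom] by (simp add: form_module_simps)

lemma sym_map_smult: "r \<in> invs \<Longrightarrow> x \<in> carrier (Sym q) \<Longrightarrow> sym_map q (r \<odot>\<^bsub>Sym q\<^esub> x) = poly_const r * sym_map q x"
  using LinearCombinations.module_hom_smult[OF sym_map_hom] by (simp add: form_module_simps inv_ring_simps)

lemma sym_map_zero: "sym_map q \<zero>\<^bsub>Sym q\<^esub> = 0"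
  using module_hom_zero[OF Sym_module form_module_is_module sym_map_hom] by (simp add: form_module_simps)

lemma sym_map_inv_forms: "z \<in> carrier (Sym q) \<Longrightarrow> sym_map q z \<in> inv_forms q"
proof (induction rule: sym_induct)
  case zero
  then show ?case by (simp add: sym_map_zero inv_forms_0)
next
  case (step z r T)
  have T: "set_mset T \<subseteq> carrier Omega" "size T = q" using step.hyps(3) by (auto simp: sym_gens_def)
  have m: "r \<odot>\<^bsub>Sym q\<^esub> sgen q T \<in> carrier (Sym q)"
    using step sgen_mem by (intro SM.smult_closed) (simp_all add: inv_ring_simps)
  have "sym_map q (z \<oplus>\<^bsub>Sym q\<^esub> r \<odot>\<^bsub>Sym q\<^esub> sgen q T) = sym_map q z + poly_const r * omega_prod T"
    using step m by (simp add: sym_map_add sym_map_smult sym_map_sgen sgen_mem)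
  then show ?case
    using inv_forms_add[OF step.IH inv_forms_smult[OF step.hyps(2) omega_prod_inv_forms[OF T(1), unfolded T(2)]]] by simp
qed

lemma sym_map_fixed: "z \<in> carrier (Sym q) \<Longrightarrow> lookup (sym_map q z) \<in> rep.fixed q"
  by (rule inv_forms_fixed[OF sym_map_inv_forms])

lemma dgen_image_index: "size T = q \<Longrightarrow> set_mset T \<subseteq> invs \<Longrightarrow> image_mset dgen T \<in> sym_index q"
  using dgen_mem by (auto simp: sym_gens_def)

lemma omega_prod_degree:
  "(\<And>x. x \<in># T \<Longrightarrow> x \<in> mod_comp Omega (deg x)) \<Longrightarrow> omega_prod T \<in> coeffs_in_degree ((\<Sum>x\<in>#T. deg x) - int (size T))"
proof (induction T)
  case empty
  then show ?case using coeffs_in_degree_const[OF degree_part_const[of 1]]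
    by (simp add: omega_prod_def poly_const_1)
next
  case (add x T)
  have "omega_map x \<in> coeffs_in_degree (deg x - 1)" using omega_map_degree add.prems by simp
  moreover have "omega_prod T \<in> coeffs_in_degree ((\<Sum>x\<in>#T. deg x) - int (size T))" using add by simp
  ultimately have "omega_map x * omega_prod T \<in> coeffs_in_degree ((deg x - 1) + ((\<Sum>x\<in>#T. deg x) - int (size T)))"
    by (rule coeffs_in_degree_mult)
  moreover have "(deg x - 1) + ((\<Sum>x\<in>#T. deg x) - int (size T)) = (\<Sum>x\<in>#add_mset x T. deg x) - int (size (add_mset x T))"
    by simp
  ultimately show ?case by (simp only:) (simp add: omega_prod_def)
qed

lemma sym_map_degree: "z \<in> mod_comp (Sym q) d \<Longrightarrow> z \<in> carrier (Sym q) \<and> sym_map q z \<in> coeffs_in_degree (d - int q)"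
proof -
  have mc: "mod_comp (Sym q) d = generate (add_monoid (Sym_P q))
      {a \<odot>\<^bsub>Sym_P q\<^esub> sgen q T | a i T deg. a \<in> ring_comp inv_ring i \<and> T \<in> sym_index q \<and>
        (\<forall>x\<in>#T. x \<in> mod_comp Omega (deg x)) \<and> i + (\<Sum>x\<in>#T. deg x) = d}"
    by (simp add: sym_power_def Let_def with_grading_simps)
  have gen: "a \<odot>\<^bsub>Sym_P q\<^esub> sgen q T \<in> carrier (Sym q) \<and> sym_map q (a \<odot>\<^bsub>Sym_P q\<^esub> sgen q T) \<in> coeffs_in_degree (d - int q)"
    if "a \<in> ring_comp inv_ring i" "T \<in> sym_index q" "\<forall>x\<in>#T. x \<in> mod_comp Omega (deg x)" "i + (\<Sum>x\<in>#T. deg x) = d" for a i T deg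
  proof -
    have a: "a \<in> invs" "a \<in> degree_part i" using that by (simp_all add: inv_ring_simps)
    have "a \<odot>\<^bsub>Sym q\<^esub> sgen q T \<in> carrier (Sym q)" using a sgen_mem that by (intro SM.smult_closed) (simp_all add: inv_ring_simps)
    moreover have "sym_map q (a \<odot>\<^bsub>Sym q\<^esub> sgen q T) = poly_const a * omega_prod T"
      using a that by (simp add: sym_map_smult sym_map_sgen sgen_mem)
    moreover have "poly_const a * omega_prod T \<in> coeffs_in_degree (i + ((\<Sum>x\<in>#T. deg x) - int (size T)))"
      using that by (intro coeffs_in_degree_mult coeffs_in_degree_const omega_prod_degree a) simp
    moreover have "i + ((\<Sum>x\<in>#T. deg x) - int (size T)) = d - int q" using that by (simp add: sym_gens_def)
    ultimately show ?thesis by (simp add: Sym_simps)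
  qed
  assume "z \<in> mod_comp (Sym q) d"
  then show ?thesis unfolding mc
  proof (induction rule: generate.induct)
    case one
    then show ?case using SM.M.zero_closed by (simp add: Sym_simps[symmetric] sym_map_zero coeffs_in_degree_0)
  next
    case (incl h)
    then show ?case using gen by blast
  next
    case (inv h)
    then have h: "h \<in> carrier (Sym q)" "sym_map q h \<in> coeffs_in_degree (d - int q)" using gen by blast+
    have e: "inv\<^bsub>add_monoid (Sym_P q)\<^esub> h = \<ominus>\<^bsub>Sym q\<^esub> h"
      by (simp add: a_inv_def m_inv_def Sym_simps)
    have "sym_map q (\<ominus>\<^bsub>Sym q\<^esub> h) + sym_map q h = 0"
      using h(1) by (simp add: sym_map_add[symmetric] SM.M.l_neg sym_map_zero)
    then have "sym_map q (\<ominus>\<^bsub>Sym q\<^esub> h) = - sym_map q h" by (simp add: eq_neg_iff_add_eq_0)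
    then show ?case unfolding e using h by (simp add: coeffs_in_degree_uminus)
  next
    case (eng h1 h2)
    then show ?case
      using SM.M.a_closed[of h1 q h2] by (simp add: Sym_simps[symmetric] sym_map_add coeffs_in_degree_add)
  qed
qed

end

context linear_action
begin

interpretation R: domain inv_ring by (rule inv_ring_domain)
interpretation rep: semilinear_rep \<Gamma> v w "monomials_of_degree q" mono_rho for q by (rule monomial_rep)
interpretation drep: semilinear_rep \<Gamma> v w "monomials_of_degree q" "rep.dual_rho" for q by (rule rep.dual)
interpretation SM: module inv_ring "Sym q" for q by (rule Sym_module)

subsection \<open>The dual and the bidual of the symmetric power\<close>

abbreviation "D1 q \<equiv> dual_module inv_ring (Sym q)"
abbreviation "D2 q \<equiv> dual_module inv_ring (D1 q)"

lemma D1_module: "module inv_ring (D1 q)"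
  by (rule dual_is_module[OF R.is_cring Sym_module])

lemma D2_module: "module inv_ring (D2 q)"
  by (rule dual_is_module[OF R.is_cring D1_module])

lemma regular_is_module: "module inv_ring (regular_module inv_ring)"
  by (rule module_cong[OF R.self_is_module]) (simp_all add: self_module_def regular_module_simps)

interpretation D1: module inv_ring "D1 q" for q by (rule D1_module)
interpretation D2: module inv_ring "D2 q" for q by (rule D2_module)

lemma dual_carrier_iff:
  "\<mu> \<in> carrier (dual_module inv_ring M) \<longleftrightarrow> \<mu> \<in> extensional (carrier M) \<and> (\<forall>x\<in>carrier M. \<mu> x \<in> invs) \<and>
    (\<forall>x\<in>carrier M. \<forall>y\<in>carrier M. \<mu> (x \<oplus>\<^bsub>M\<^esub> y) = \<mu> x + \<mu> y) \<and>
    (\<forall>r\<in>invs. \<forall>x\<in>carrier M. \<mu> (r \<odot>\<^bsub>M\<^esub> x) = r * \<mu> x)"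
  by (auto simp: dual_module_simps LinearCombinations.module_hom_def regular_module_simps inv_ring_simps)

lemma dual_add_apply: "x \<in> carrier M \<Longrightarrow> (\<mu> \<oplus>\<^bsub>dual_module inv_ring M\<^esub> \<nu>) x = \<mu> x + \<nu> x"
  and dual_smult_apply: "x \<in> carrier M \<Longrightarrow> (r \<odot>\<^bsub>dual_module inv_ring M\<^esub> \<mu>) x = r * \<mu> x"
  by (simp_all add: dual_module_simps R.func_space_simps inv_ring_simps)

lemma dual_ext:
  assumes "\<mu> \<in> carrier (dual_module inv_ring M)" "\<nu> \<in> carrier (dual_module inv_ring M)"
    "\<And>x. x \<in> carrier M \<Longrightarrow> \<mu> x = \<nu> x"
  shows "\<mu> = \<nu>"
  using assms by (intro extensionalityI[of _ "carrier M"]) (auto simp: dual_carrier_iff)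

text \<open>The functional on \<open>Sym\<^sup>q \<Omega>\<^sub>R\<close> with coefficient vector \<open>a\<close>: contraction of the form \<open>sym_map q m\<close>.\<close>

definition psi where
  "psi q a = (\<lambda>m\<in>carrier (Sym q). pairing (monomials_of_degree q) a (lookup (sym_map q m)))"

lemma psi_apply: "m \<in> carrier (Sym q) \<Longrightarrow> psi q a m = pairing (monomials_of_degree q) a (lookup (sym_map q m))"
  by (simp add: psi_def)

lemma lookup_add_fun: "lookup (b + c) = (\<lambda>x. lookup b x + lookup c x)"
  by (rule ext) (rule lookup_add)

lemma lookup_const_mult_fun:
  "lookup (poly_const r * b) = (\<lambda>x. r * lookup (b :: ('n, ('n, 'k) polynomial) polynomial) x)"
  by (rule ext) (rule lookup_const_mult)

lemma psi_mem:
  assumes a: "a \<in> rep.dual_fixed q" shows "psi q a \<in> carrier (D1 q)"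
proof -
  have "psi q a m \<in> invs" if "m \<in> carrier (Sym q)" for m
    using rep.pairing_invs[OF a sym_map_fixed[OF that]] that by (simp add: psi_apply)
  moreover have "r \<odot>\<^bsub>Sym q\<^esub> m \<in> carrier (Sym q)" if "r \<in> invs" "m \<in> carrier (Sym q)" for r m
    using that by (intro SM.smult_closed) (simp_all add: inv_ring_simps)
  ultimately show ?thesis
    unfolding dual_carrier_iff
    by (simp add: psi_apply sym_map_add sym_map_smult lookup_add_fun lookup_const_mult_fun pairing_add pairing_smult)
      (simp add: psi_def)
qed

lemma psi_dgen: "size T = q \<Longrightarrow> set_mset T \<subseteq> invs \<Longrightarrow>
    psi q a (sgen q (image_mset dgen T)) = pairing (monomials_of_degree q) a (lookup (diff_prod T))"
  using dgen_image_index[of T q] by (simp add: psi_apply sgen_mem sym_map_sgen omega_prod_dgen)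

text \<open>The map taking \<open>f\<^sub>1, \<dots>, f\<^sub>q\<close> to the value at \<open>df\<^sub>1 \<cdots> df\<^sub>q\<close> is a symmetric multiderivation; its coefficient
  vector exists by \<open>multiderivation_pairing\<close> and can be averaged because the values are invariant.\<close>

lemma D1_cases:
  assumes \<mu>: "\<mu> \<in> carrier (D1 q)"
  obtains a where "a \<in> rep.dual_fixed q" "\<mu> = psi q a"
proof -
  have madd: "\<mu> (x \<oplus>\<^bsub>Sym q\<^esub> y) = \<mu> x + \<mu> y" if "x \<in> carrier (Sym q)" "y \<in> carrier (Sym q)" for x y
    using \<mu> that by (simp add: dual_carrier_iff)
  have msm: "\<mu> (r \<odot>\<^bsub>Sym q\<^esub> x) = r * \<mu> x" if "r \<in> invs" "x \<in> carrier (Sym q)" for r x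
    using \<mu> that by (simp add: dual_carrier_iff)
  define D where "D T = \<mu> (sgen q (image_mset dgen T))" for T
  have mD: "multiderivation q D"
    unfolding multiderivation_def
  proof (intro allI impI conjI)
    fix T :: "('n, 'k) polynomial multiset" assume T: "Suc (size T) = q" "set_mset T \<subseteq> invs"
    define V where "V = image_mset dgen T"
    have V: "set_mset V \<subseteq> carrier Omega" "Suc (size V) = q" using T dgen_mem by (auto simp: V_def)
    have D: "D (add_mset f T) = \<mu> (sgen q (add_mset (dgen f) V))" for f by (simp add: D_def V_def)
    have s: "sgen q (add_mset x V) \<in> carrier (Sym q)" if "x \<in> carrier Omega" for x
      by (rule sgen_mem[OF sym_index_add_mset[OF V(2,1) that]])
    have sm: "r \<odot>\<^bsub>Omega\<^esub> x \<in> carrier Omega" if "r \<in> invs" "x \<in> carrier Omega" for r x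
      using module.smult_closed[OF Omega_module] that by (simp add: inv_ring_simps)
    show "inv_derivation (\<lambda>f. D (add_mset f T))"
      unfolding inv_derivation_def D
    proof (intro ballI conjI)
      fix f g assume fg: "f \<in> invs" "g \<in> invs"
      note d = dgen_mem[OF fg(1)] dgen_mem[OF fg(2)]
      show "\<mu> (sgen q (add_mset (dgen (f + g)) V)) = \<mu> (sgen q (add_mset (dgen f) V)) + \<mu> (sgen q (add_mset (dgen g) V))"
        using fg d V by (simp add: dgen_add sgen_add madd s)
      show "\<mu> (sgen q (add_mset (dgen (f * g)) V)) = f * \<mu> (sgen q (add_mset (dgen g) V)) + g * \<mu> (sgen q (add_mset (dgen f) V))"
      proof -
        note mem = s[OF sm[OF fg(1) d(2)], unfolded sgen_smult[OF fg(1) d(2) V]]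
          s[OF sm[OF fg(2) d(1)], unfolded sgen_smult[OF fg(2) d(1) V]]
        show ?thesis
          by (simp only: dgen_mult[OF fg] sgen_add[OF sm[OF fg(1) d(2)] sm[OF fg(2) d(1)] V]
            sgen_smult[OF fg(1) d(2) V] sgen_smult[OF fg(2) d(1) V] madd[OF mem]
            msm[OF fg(1) s[OF d(2)]] msm[OF fg(2) s[OF d(1)]])
      qed
    qed
    fix c
    have "\<mu> \<zero>\<^bsub>Sym q\<^esub> = 0" using madd[OF SM.M.zero_closed SM.M.zero_closed] by simp
    then show "D (add_mset (poly_const c) T) = 0" unfolding D dgen_const sgen_zero[OF V] .
  qed
  obtain a where a: "\<And>T. size T = q \<Longrightarrow> set_mset T \<subseteq> invs \<Longrightarrow>
      D T = pairing (monomials_of_degree q) a (lookup (diff_prod T))"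
    by (rule multiderivation_pairing[OF mD], rule that)
  define B where "B = {lookup (diff_prod T) | T. size T = q \<and> set_mset T \<subseteq> invs}"
  have Bf: "b \<in> rep.fixed q" if bB: "b \<in> B" for b
  proof -
    obtain T where T: "b = lookup (diff_prod T)" "size T = q" "set_mset T \<subseteq> invs" using bB by (auto simp: B_def)
    have "diff_prod T \<in> inv_forms q"
      using omega_prod_inv_forms[of "image_mset dgen T"] dgen_mem T by (auto simp: omega_prod_dgen)
    then show ?thesis unfolding T(1) by (rule inv_forms_fixed)
  qed
  have Bi: "pairing (monomials_of_degree q) a b \<in> invs" if bB: "b \<in> B" for b
  proof -
    obtain T where T: "b = lookup (diff_prod T)" "size T = q" "set_mset T \<subseteq> invs" using bB by (auto simp: B_def)
    have "D T \<in> invs" unfolding D_def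
      using \<mu> sgen_mem[OF dgen_image_index[OF T(2,3)]] by (simp add: dual_carrier_iff)
    then show ?thesis using a T by simp
  qed
  obtain a' where a': "a' \<in> rep.dual_fixed q"
    "\<And>b. b \<in> B \<Longrightarrow> pairing (monomials_of_degree q) a' b = pairing (monomials_of_degree q) a b"
    by (rule rep.average_functional[of B q a]) (use Bf Bi in auto)
  have hom: "\<nu> \<in> LinearCombinations.module_hom inv_ring (Sym q) (regular_module inv_ring)" if "\<nu> \<in> carrier (D1 q)" for \<nu>
    using that by (simp add: dual_module_simps)
  have "\<mu> m = psi q a' m" if "m \<in> carrier (Sym q)" for m
  proof (rule sym_hom_eq[OF regular_is_module hom[OF \<mu>] hom[OF psi_mem[OF a'(1)]] _ that])
    fix T assume T: "size T = q" "set_mset T \<subseteq> invs"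
    then have "lookup (diff_prod T) \<in> B" by (auto simp: B_def)
    then show "\<mu> (sgen q (image_mset dgen T)) = psi q a' (sgen q (image_mset dgen T))"
      using a[OF T] a'(2) T by (simp add: psi_dgen D_def)
  qed
  then have "\<mu> = psi q a'" by (intro dual_ext[OF \<mu> psi_mem[OF a'(1)]])
  with a'(1) show ?thesis by (rule that)
qed

lemma psi_inject:
  assumes "a \<in> rep.dual_fixed q" "a' \<in> rep.dual_fixed q" "psi q a = psi q a'" shows "a = a'"
proof
  fix x
  show "a x = a' x"
  proof (cases "x \<in> monomials_of_degree q")
    case True
    have "pairing (monomials_of_degree q) (\<lambda>x. a x - a' x) (lookup (diff_prod T)) = 0"
      if "size T = q" "set_mset T \<subseteq> invs" for T
      using psi_dgen[OF that, of a] psi_dgen[OF that, of a'] assms(3)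
      by (simp add: pairing_def left_diff_distrib sum_subtractf)
    from pairing_diff_prod_faithful[OF this True] show ?thesis by simp
  next
    case False
    then show ?thesis
      using assms(1,2) drep.fixed_outside[of a q x] drep.fixed_outside[of a' q x] by (simp add: rep.dual_fixed_def)
  qed
qed

lemma dual_fixed_add: "a \<in> rep.dual_fixed q \<Longrightarrow> a' \<in> rep.dual_fixed q \<Longrightarrow> (\<lambda>x. a x + a' x) \<in> rep.dual_fixed q"
  and dual_fixed_smult: "r \<in> invs \<Longrightarrow> a \<in> rep.dual_fixed q \<Longrightarrow> (\<lambda>x. r * a x) \<in> rep.dual_fixed q"
  by (simp_all add: rep.dual_fixed_def drep.fixed_add drep.fixed_smult)

lemma psi_add:
  assumes "a \<in> rep.dual_fixed q" "a' \<in> rep.dual_fixed q"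
  shows "psi q (\<lambda>x. a x + a' x) = psi q a \<oplus>\<^bsub>D1 q\<^esub> psi q a'"
  by (rule dual_ext[OF psi_mem[OF dual_fixed_add[OF assms]] D1.M.a_closed[OF psi_mem[OF assms(1)] psi_mem[OF assms(2)]]])
    (simp add: dual_add_apply psi_apply pairing_add)

lemma psi_smult:
  assumes "r \<in> invs" "a \<in> rep.dual_fixed q"
  shows "psi q (\<lambda>x. r * a x) = r \<odot>\<^bsub>D1 q\<^esub> psi q a"
proof (rule dual_ext[OF psi_mem[OF dual_fixed_smult[OF assms]] D1.smult_closed[OF _ psi_mem[OF assms(2)]]])
  show "r \<in> carrier inv_ring" using assms by (simp add: inv_ring_simps)
qed (simp add: dual_smult_apply psi_apply pairing_smult)

text \<open>A constant contraction lowers degrees by \<open>q\<close>, since each of the \<open>q\<close> differentials has degree \<open>1\<close>.\<close>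

lemma psi_degree:
  assumes a: "a \<in> rep.dual_fixed q" and const: "\<And>x. a x \<in> degree_part 0"
  shows "psi q a \<in> mod_comp (D1 q) (- int q)"
proof -
  have "psi q a z \<in> ring_comp inv_ring (i + - int q)" if z: "z \<in> mod_comp (Sym q) i" for z i
  proof -
    have z': "z \<in> carrier (Sym q)" "sym_map q z \<in> coeffs_in_degree (i - int q)" using sym_map_degree[OF z] by auto
    have "psi q a z \<in> invs" using psi_mem[OF a] z' by (simp add: dual_carrier_iff)
    moreover have "(\<Sum>x\<in>monomials_of_degree q. a x * lookup (sym_map q z) x) \<in> degree_part (0 + (i - int q))"
      using z'(2) by (intro degree_part_sum degree_part_mult const) (simp add: coeffs_in_degree_def)
    ultimately show ?thesis using z' by (simp add: inv_ring_simps psi_apply pairing_def)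
  qed
  then show ?thesis using psi_mem[OF a] by (auto simp: dual_module_simps(5))
qed

text \<open>The inverse of \<open>psi q\<close>; together with \<open>Phi\<close> it makes the bidual a copy of the invariant forms.\<close>

definition coef where "coef q \<mu> = (THE a. a \<in> rep.dual_fixed q \<and> psi q a = \<mu>)"

lemma coef_psi: "a \<in> rep.dual_fixed q \<Longrightarrow> coef q (psi q a) = a"
  unfolding coef_def by (rule the_equality) (auto intro: psi_inject)

definition Phi where "Phi q b = (\<lambda>\<mu>\<in>carrier (D1 q). pairing (monomials_of_degree q) (coef q \<mu>) b)"

lemma Phi_psi: "a \<in> rep.dual_fixed q \<Longrightarrow> Phi q b (psi q a) = pairing (monomials_of_degree q) a b"
  by (simp add: Phi_def psi_mem coef_psi)

lemma Phi_mem: assumes b: "b \<in> rep.fixed q" shows "Phi q b \<in> carrier (D2 q)"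
  unfolding dual_carrier_iff[of _ "D1 q"]
proof (intro conjI ballI)
  show "Phi q b \<in> extensional (carrier (D1 q))" by (simp add: Phi_def)
  fix \<mu> assume "\<mu> \<in> carrier (D1 q)"
  then obtain a where a: "a \<in> rep.dual_fixed q" "\<mu> = psi q a" by (rule D1_cases)
  show "Phi q b \<mu> \<in> invs" using rep.pairing_invs[OF a(1) b] by (simp add: a Phi_psi)
  { fix \<nu> assume "\<nu> \<in> carrier (D1 q)"
    then obtain a' where a': "a' \<in> rep.dual_fixed q" "\<nu> = psi q a'" by (rule D1_cases)
    show "Phi q b (\<mu> \<oplus>\<^bsub>D1 q\<^esub> \<nu>) = Phi q b \<mu> + Phi q b \<nu>"
      unfolding a(2) a'(2) psi_add[OF a(1) a'(1), symmetric]
      by (simp add: Phi_psi a a' dual_fixed_add pairing_add) }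
  { fix r assume r: "r \<in> invs"
    show "Phi q b (r \<odot>\<^bsub>D1 q\<^esub> \<mu>) = r * Phi q b \<mu>"
      unfolding a(2) psi_smult[OF r a(1), symmetric]
      by (simp add: Phi_psi a r dual_fixed_smult pairing_smult) }
qed

text \<open>Through \<open>psi\<close>, an element of the bidual is a functional on the fixed vectors of the contragredient
  representation, to which \<open>functional_on_fixed\<close> applies.\<close>

lemma D2_cases:
  assumes \<Phi>: "\<Phi> \<in> carrier (D2 q)"
  obtains b where "b \<in> rep.fixed q" "\<Phi> = Phi q b"
proof -
  have add: "\<Phi> (\<mu> \<oplus>\<^bsub>D1 q\<^esub> \<nu>) = \<Phi> \<mu> + \<Phi> \<nu>" if "\<mu> \<in> carrier (D1 q)" "\<nu> \<in> carrier (D1 q)" for \<mu> \<nu>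
    using \<Phi> that by (simp add: dual_carrier_iff[of _ "D1 q"])
  have sm: "\<Phi> (r \<odot>\<^bsub>D1 q\<^esub> \<mu>) = r * \<Phi> \<mu>" if "r \<in> invs" "\<mu> \<in> carrier (D1 q)" for r \<mu>
    using \<Phi> that by (simp add: dual_carrier_iff[of _ "D1 q"])
  have closed: "\<Phi> \<mu> \<in> invs" if "\<mu> \<in> carrier (D1 q)" for \<mu>
    using \<Phi> that by (simp add: dual_carrier_iff[of _ "D1 q"])
  obtain b where b: "b \<in> drep.dual_fixed q" "\<And>a. a \<in> drep.fixed q \<Longrightarrow> \<Phi> (psi q a) = pairing (monomials_of_degree q) b a"
  proof (rule drep.functional_on_fixed[of q "\<lambda>a. \<Phi> (psi q a)"])
    show "\<Phi> (psi q (\<lambda>x. a x + b x)) = \<Phi> (psi q a) + \<Phi> (psi q b)"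
      if "a \<in> drep.fixed q" "b \<in> drep.fixed q" for a b
      using that unfolding rep.dual_fixed_def[symmetric] by (simp add: psi_add psi_mem add)
    show "\<Phi> (psi q (\<lambda>x. r * b x)) = r * \<Phi> (psi q b)" if "r \<in> invs" "b \<in> drep.fixed q" for r b
      using that unfolding rep.dual_fixed_def[symmetric] by (simp add: psi_smult psi_mem sm)
    show "\<Phi> (psi q b) \<in> invs" if "b \<in> drep.fixed q" for b
      using that unfolding rep.dual_fixed_def[symmetric] by (simp add: psi_mem closed)
  qed auto
  have bf: "b \<in> rep.fixed q" using b(1) by (simp add: rep.dual_dual_fixed)
  have "\<Phi> = Phi q b"
  proof (rule dual_ext[OF \<Phi> Phi_mem[OF bf]])
    fix \<mu> assume "\<mu> \<in> carrier (D1 q)"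
    then obtain a where a: "a \<in> rep.dual_fixed q" "\<mu> = psi q a" by (rule D1_cases)
    show "\<Phi> \<mu> = Phi q b \<mu>"
      using b(2)[of a] a(1) by (simp add: a(2) Phi_psi rep.dual_fixed_def[symmetric] pairing_commute)
  qed
  with bf show ?thesis by (rule that)
qed

lemma Phi_add:
  assumes "b \<in> rep.fixed q" "b' \<in> rep.fixed q"
  shows "Phi q (\<lambda>x. b x + b' x) = Phi q b \<oplus>\<^bsub>D2 q\<^esub> Phi q b'"
  by (rule dual_ext[OF Phi_mem[OF rep.fixed_add[OF assms]] D2.M.a_closed[OF Phi_mem[OF assms(1)] Phi_mem[OF assms(2)]]])
    (simp add: dual_add_apply Phi_def pairing_add)

lemma Phi_smult:
  assumes "r \<in> invs" "b \<in> rep.fixed q"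
  shows "Phi q (\<lambda>x. r * b x) = r \<odot>\<^bsub>D2 q\<^esub> Phi q b"
proof (rule dual_ext[OF Phi_mem[OF rep.fixed_smult[OF assms]] D2.smult_closed[OF _ Phi_mem[OF assms(2)]]])
  show "r \<in> carrier inv_ring" using assms by (simp add: inv_ring_simps)
qed (simp add: dual_smult_apply Phi_def pairing_smult)

lemma D2_add_apply: "\<mu> \<in> carrier (D1 q) \<Longrightarrow> (\<Phi> \<oplus>\<^bsub>D2 q\<^esub> \<Psi>) \<mu> = \<Phi> \<mu> + \<Psi> \<mu>"
  and D2_smult_apply: "\<mu> \<in> carrier (D1 q) \<Longrightarrow> (r \<odot>\<^bsub>D2 q\<^esub> \<Phi>) \<mu> = r * \<Phi> \<mu>"
  by (rule dual_add_apply, assumption) (rule dual_smult_apply)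

subsection \<open>The rank\<close>

theorem rank_reflexive_sym: "module_rank inv_ring (D2 q) = card (monomials_of_degree q :: ('n \<Rightarrow>\<^sub>0 nat) set)"
proof (rule rep.generic_basis[of q])
  fix c h :: "('n \<Rightarrow>\<^sub>0 nat) \<Rightarrow> ('n \<Rightarrow>\<^sub>0 nat) \<Rightarrow> ('n, 'k) polynomial" and N
  assume N: "N \<in> invs" "N \<noteq> 0"
    and c: "\<And>x. x \<in> monomials_of_degree q \<Longrightarrow> c x \<in> rep.fixed q"
    and h: "\<And>x. x \<in> monomials_of_degree q \<Longrightarrow> h x \<in> rep.dual_fixed q"
    and hc: "\<And>x y. x \<in> monomials_of_degree q \<Longrightarrow> y \<in> monomials_of_degree q \<Longrightarrow>
      pairing (monomials_of_degree q) (h x) (c y) = (if x = y then N else 0)"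
    and ex: "\<And>b. b \<in> rep.fixed q \<Longrightarrow> (\<lambda>z. N * b z) =
      (\<lambda>z. \<Sum>x\<in>monomials_of_degree q. pairing (monomials_of_degree q) (h x) b * c x z)"
  show ?thesis
  proof (rule module_rank_eq_card[where c = "\<lambda>x. Phi q (c x)" and l = "\<lambda>x \<Phi>. \<Phi> (psi q (h x))" and d = N])
    show "domain inv_ring" by (rule inv_ring_domain)
    show "module inv_ring (D2 q)" by (rule D2_module)
    show "finite (monomials_of_degree q :: ('n \<Rightarrow>\<^sub>0 nat) set)" by (rule finite_monomials_of_degree)
    show "Phi q (c x) \<in> carrier (D2 q)" if "x \<in> monomials_of_degree q" for x by (rule Phi_mem[OF c[OF that]])
    show "(\<lambda>\<Phi>. \<Phi> (psi q (h x))) \<in> LinearCombinations.module_hom inv_ring (D2 q) (self_module inv_ring)"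
      if "x \<in> monomials_of_degree q" for x
    proof (rule module_homI)
      note p = psi_mem[OF h[OF that]]
      show "\<Phi> (psi q (h x)) \<in> carrier (self_module inv_ring)" if "\<Phi> \<in> carrier (D2 q)" for \<Phi>
        using that p by (simp add: self_module_def inv_ring_simps dual_carrier_iff[of _ "D1 q"])
    qed (use psi_mem[OF h[OF that]] in \<open>simp_all add: D2_add_apply D2_smult_apply self_module_def inv_ring_simps\<close>)
    show "N \<in> carrier inv_ring" "N \<noteq> \<zero>\<^bsub>inv_ring\<^esub>" using N by (simp_all add: inv_ring_simps)
    show "Phi q (c y) (psi q (h x)) = (if x = y then N else \<zero>\<^bsub>inv_ring\<^esub>)"
      if "x \<in> monomials_of_degree q" "y \<in> monomials_of_degree q" for x y
      using that by (simp add: Phi_psi h hc inv_ring_simps)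
    show "N \<odot>\<^bsub>D2 q\<^esub> \<Phi> \<in> P"
      if P: "LinearCombinations.submodule inv_ring P (D2 q)"
        and cP: "\<And>x. x \<in> monomials_of_degree q \<Longrightarrow> Phi q (c x) \<in> P" and \<Phi>: "\<Phi> \<in> carrier (D2 q)" for P \<Phi>
    proof -
      obtain b where b: "b \<in> rep.fixed q" "\<Phi> = Phi q b" using \<Phi> by (rule D2_cases)
      have coeffs: "pairing (monomials_of_degree q) (h x) b \<in> invs" if "x \<in> monomials_of_degree q" for x
        by (rule rep.pairing_invs[OF h[OF that] b(1)])
      have zero: "Phi q (\<lambda>z. 0) \<in> P"
      proof -
        have "Phi q (\<lambda>z. 0 * b z) = 0 \<odot>\<^bsub>D2 q\<^esub> Phi q b" by (rule Phi_smult[OF invs_zero b(1)])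
        also have "\<dots> = \<zero>\<^bsub>D2 q\<^esub>" using D2.smult_l_null[OF Phi_mem[OF b(1)]] by (simp add: inv_ring_simps)
        finally show ?thesis using LinearCombinations.submodule.zero_closed[OF P] by simp
      qed
      have "(\<lambda>z. \<Sum>x\<in>A. pairing (monomials_of_degree q) (h x) b * c x z) \<in> rep.fixed q \<and>
          Phi q (\<lambda>z. \<Sum>x\<in>A. pairing (monomials_of_degree q) (h x) b * c x z) \<in> P"
        if "finite A" "A \<subseteq> monomials_of_degree q" for A
        using that
      proof (induction A rule: finite_induct)
        case empty
        then show ?case using zero rep.fixed_zero by simp
      next
        case (insert x A)
        then have x: "x \<in> monomials_of_degree q" by simp
        have t: "(\<lambda>z. pairing (monomials_of_degree q) (h x) b * c x z) \<in> rep.fixed q"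
          by (rule rep.fixed_smult[OF coeffs[OF x] c[OF x]])
        have "Phi q (\<lambda>z. pairing (monomials_of_degree q) (h x) b * c x z) \<in> P"
          unfolding Phi_smult[OF coeffs[OF x] c[OF x]]
          by (rule LinearCombinations.submodule.smult_closed[OF P _ cP[OF x]]) (simp add: inv_ring_simps coeffs[OF x])
        then show ?case
          using insert t rep.fixed_add[OF t] Phi_add[OF t] LinearCombinations.submodule.m_closed[OF P] by simp
      qed
      then have "Phi q (\<lambda>z. N * b z) \<in> P" unfolding ex[OF b(1)] using finite_monomials_of_degree by blast
      then show ?thesis by (simp add: b(2) Phi_smult[OF N(1) b(1)])
    qed
  qed
qed

end

section \<open>Linear algebra in the polynomial ring\<close>

abbreviation kscale :: "'k \<Rightarrow> ('n, 'k::field) polynomial \<Rightarrow> ('n, 'k) polynomial" where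
  "kscale c p \<equiv> poly_const c * p"

interpretation kvec: vector_space "kscale :: 'k::field \<Rightarrow> ('n::finite, 'k) polynomial \<Rightarrow> _"
  by unfold_locales (simp_all add: poly_const_add poly_const_mult poly_const_1 algebra_simps)

interpretation kpair: vector_space_pair "kscale :: 'k::field \<Rightarrow> ('n::finite, 'k) polynomial \<Rightarrow> _" "(*)"
  by unfold_locales (simp_all add: algebra_simps)

abbreviation monomial :: "('n \<Rightarrow>\<^sub>0 nat) \<Rightarrow> ('n, 'k::zero_neq_one) polynomial" where
  "monomial m \<equiv> Poly_Mapping.single m 1"

lemma polynomial_expand:
  assumes "finite A" "keys p \<subseteq> A"
  shows "p = (\<Sum>m\<in>A. kscale (lookup p m) (monomial m))"
proof -
  have "p = (\<Sum>m\<in>keys p. Poly_Mapping.single m (lookup p m))" by (rule poly_mapping_as_sum)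
  also have "\<dots> = (\<Sum>m\<in>A. Poly_Mapping.single m (lookup p m))"
    by (rule sum.mono_neutral_left[OF assms]) (simp add: in_keys_iff)
  finally show ?thesis by (simp add: poly_const_single)
qed

lemma span_monomials:
  fixes p :: "('n::finite, 'k::field) polynomial"
  assumes "finite A" "keys p \<subseteq> A" shows "p \<in> kvec.span (monomial ` A)"
  by (subst polynomial_expand[OF assms]) (intro kvec.span_sum kvec.span_scale kvec.span_base imageI)

lemma independent_card_le:
  fixes B :: "('n::finite, 'k::field) polynomial set"
  assumes A: "finite A" and B: "kvec.independent B" "\<And>p. p \<in> B \<Longrightarrow> keys p \<subseteq> A"
  shows "finite B \<and> card B \<le> card A"
proof -
  have "finite B \<and> card B \<le> card ((monomial :: _ \<Rightarrow> ('n, 'k) polynomial) ` A)"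
    by (rule kvec.independent_span_bound[OF finite_imageI[OF A] B(1)], rule subsetI, rule span_monomials[OF A B(2)])
  then show ?thesis using card_image_le[OF A, of "monomial :: _ \<Rightarrow> ('n, 'k) polynomial"] by auto
qed

lemma independent_by_dual_family:
  fixes p :: "'i \<Rightarrow> ('n::finite, 'k::field) polynomial"
  assumes add: "\<And>i x y. i \<in> I \<Longrightarrow> \<Lambda> i (x + y) = \<Lambda> i x + \<Lambda> i y"
    and scale: "\<And>i c x. i \<in> I \<Longrightarrow> \<Lambda> i (kscale c x) = c * \<Lambda> i x"
    and dual: "\<And>i j. i \<in> I \<Longrightarrow> j \<in> I \<Longrightarrow> \<Lambda> i (p j) = (if i = j then 1 else 0)"
  shows "inj_on p I" "kvec.independent (p ` I)"
proof -
  show inj: "inj_on p I"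
  proof (rule inj_onI, rule ccontr)
    fix i j assume ij: "i \<in> I" "j \<in> I" "p i = p j" "i \<noteq> j"
    then show False using dual[of i i] dual[of i j] by simp
  qed
  show "kvec.independent (p ` I)"
  proof
    assume "kvec.dependent (p ` I)"
    then obtain i where i: "i \<in> I" "p i \<in> kvec.span (p ` I - {p i})" by (auto simp: kvec.dependent_def)
    have "kvec.subspace {x. \<Lambda> i x = 0}"
      using add[OF i(1)] scale[OF i(1), of 0 0] scale[OF i(1)] by (simp add: kvec.subspace_def)
    moreover have "p ` I - {p i} \<subseteq> {x. \<Lambda> i x = 0}"
    proof
      fix x assume "x \<in> p ` I - {p i}"
      then obtain j where j: "j \<in> I" "x = p j" "j \<noteq> i" by auto
      then show "x \<in> {x. \<Lambda> i x = 0}" using dual[OF i(1) j(1)] by simp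
    qed
    ultimately have "\<Lambda> i (p i) = 0" using kvec.span_minimal i(2) by blast
    then show False using dual[OF i(1) i(1)] by simp
  qed
qed

lemma lookup_mult_0: "lookup (p * q) 0 = lookup p 0 * lookup (q :: ('n::finite, 'k::field) polynomial) 0"
proof (induction p rule: poly_mapping_single_induct)
  case (single m c)
  show ?case
  proof (induction q rule: poly_mapping_single_induct)
    case (single m' c')
    have "m + m' = 0 \<longleftrightarrow> m = 0 \<and> m' = 0" by (auto simp: poly_mapping_eq_iff fun_eq_iff lookup_add)
    then show ?case by (auto simp: mult_single lookup_single when_def)
  qed (simp_all add: lookup_add algebra_simps)
qed (simp_all add: lookup_add algebra_simps)

lemma lookup_sum_at: "lookup (\<Sum>x\<in>A. f x) m = (\<Sum>x\<in>A. lookup (f x) m)"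
  by (induction A rule: infinite_finite_induct) (simp_all add: lookup_add)

section \<open>The free rank\<close>

context linear_action
begin

interpretation R: domain inv_ring by (rule inv_ring_domain)
interpretation rep: semilinear_rep \<Gamma> v w "monomials_of_degree q" mono_rho for q by (rule monomial_rep)
interpretation drep: semilinear_rep \<Gamma> v w "monomials_of_degree q" "rep.dual_rho" for q by (rule rep.dual)

definition inv_comp :: "nat \<Rightarrow> ('n, 'k) polynomial set" where
  "inv_comp q = {p \<in> invs. homogeneous q p}"

lemma inv_comp_basis:
  obtains B where "B \<subseteq> inv_comp q" "kvec.independent B" "inv_comp q \<subseteq> kvec.span B"
    "finite B" "card B = kvec.dim (inv_comp q)"
proof (rule kvec.basis_exists[of "inv_comp q"])
  fix B assume B: "B \<subseteq> inv_comp q" "kvec.independent B" "inv_comp q \<subseteq> kvec.span B" "card B = kvec.dim (inv_comp q)"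
  have "finite B \<and> card B \<le> card (monomials_of_degree q :: ('n \<Rightarrow>\<^sub>0 nat) set)"
    by (rule independent_card_le[OF finite_monomials_of_degree B(2)])
      (use B(1) in \<open>auto simp: inv_comp_def homogeneous_def monomials_of_degree_def\<close>)
  with B show ?thesis using that by blast
qed

text \<open>The action is linear, hence preserves the ideal generated by the variables.\<close>

lemma lookup_act_0: assumes g: "g \<in> \<Gamma>" shows "lookup (g p) 0 = lookup p 0"
proof (induction p rule: polynomial_induct)
  case (var i)
  have h: "homogeneous 1 (poly_var i :: ('n, 'k) polynomial)" by (rule homogeneous_var)
  then have "homogeneous 1 (g (poly_var i))" by (rule homogeneous_act[OF g])
  with h show ?case by (simp add: homogeneous_lookup monomial_degree_0)
qed (simp_all add: act_const[OF g] act_add[OF g] act_mult[OF g] lookup_add lookup_mult_0)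

lemma constant_vector_fixed:
  assumes p: "p \<in> inv_comp q" shows "(\<lambda>x. poly_const (lookup p x)) \<in> rep.fixed q"
proof -
  have "rep.act q g (\<lambda>x. poly_const (lookup p x)) x = poly_const (lookup p x)" if g: "g \<in> \<Gamma>" for g x
  proof (cases "x \<in> monomials_of_degree q")
    case True
    have "rep.act q g (\<lambda>x. poly_const (lookup p x)) x =
        poly_const (\<Sum>y\<in>monomials_of_degree q. lookup (g (monomial y)) x * lookup p y)"
      using True by (simp add: rep.act_def mono_rho_def act_const[OF g] poly_const_sum poly_const_mult)
    also have "\<dots> = poly_const (lookup (g p) x)"
      using monomial_act_expand[OF g, of q p x] p by (simp add: inv_comp_def)
    finally show ?thesis using p g by (simp add: inv_comp_def invsD)
  next
    case False
    then have "lookup p x = 0"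
      using p homogeneous_lookup[of q p x] by (simp add: inv_comp_def monomials_of_degree_def)
    then show ?thesis using False by (simp add: rep.act_def poly_const_0)
  qed
  then show ?thesis by (auto simp: rep.fixed_def)
qed

lemma constant_terms_invariant:
  assumes b: "b \<in> rep.fixed q"
  shows "(\<Sum>x\<in>monomials_of_degree q. Poly_Mapping.single x (lookup (b x) 0)) \<in> inv_comp q" (is "?p \<in> _")
proof -
  have lp: "lookup ?p x = (if x \<in> monomials_of_degree q then lookup (b x) 0 else 0)" for x
    by (simp add: finite_monomials_of_degree lookup_sum_at lookup_single when_def)
  have h: "homogeneous q ?p" unfolding homogeneous_alt lp by (simp add: monomials_of_degree_def)
  have "g ?p = ?p" if g: "g \<in> \<Gamma>" for g
  proof (rule poly_mapping_eqI)
    fix x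
    show "lookup (g ?p) x = lookup ?p x"
    proof (cases "x \<in> monomials_of_degree q")
      case True
      have "lookup (g ?p) x = (\<Sum>y\<in>monomials_of_degree q. lookup (g (monomial y)) x * lookup ?p y)"
        by (rule monomial_act_expand[OF g h])
      also have "\<dots> = (\<Sum>y\<in>monomials_of_degree q. lookup (g (monomial y)) x * lookup (g (b y)) 0)"
        by (rule sum.cong[OF refl]) (simp only: lp if_True lookup_act_0[OF g])
      also have "\<dots> = lookup (rep.act q g b x) 0"
        using True by (simp add: rep.act_def lookup_sum_at mono_rho_def lookup_const_mult)
      also have "\<dots> = lookup ?p x" using True by (simp only: lp if_True rep.fixedD[OF b g])
      finally show ?thesis .
    next
      case False
      then show ?thesis
        using homogeneous_lookup[OF h, of x] homogeneous_lookup[OF homogeneous_act[OF g h], of x]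
        by (simp add: monomials_of_degree_def)
    qed
  qed
  with h show ?thesis by (simp add: inv_comp_def invs_def)
qed

text \<open>The basis of the free module lifts to invariant tensors \<open>b j\<close>, and its coordinates are contractions
  with invariant vectors \<open>a i\<close>.  The constant terms of the \<open>b j\<close> are independent elements of \<open>R\<^sub>q\<close>.\<close>

lemma free_quotient_rank_le:
  assumes f: "graded_surjection inv_ring (D2 q) (free_graded_module inv_ring m s) f"
  shows "m \<le> kvec.dim (inv_comp q)"
proof -
  define X where "X = (monomials_of_degree q :: ('n \<Rightarrow>\<^sub>0 nat) set)"
  define L where "L = free_graded_module inv_ring m s"
  have finX: "finite X" by (simp add: X_def finite_monomials_of_degree)
  have Lc: "carrier L = carrier (free_module inv_ring {..<m})" "add L = add (free_module inv_ring {..<m})"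
    "module.smult L = module.smult (free_module inv_ring {..<m})"
    by (simp_all add: L_def free_graded_module_def with_grading_simps)
  have hom: "f \<in> LinearCombinations.module_hom inv_ring (D2 q) L" and surj: "f ` carrier (D2 q) = carrier L"
    using f by (simp_all add: graded_surjection_def L_def)
  have fadd: "f (x \<oplus>\<^bsub>D2 q\<^esub> y) = f x \<oplus>\<^bsub>L\<^esub> f y" if "x \<in> carrier (D2 q)" "y \<in> carrier (D2 q)" for x y
    using hom that by (simp add: LinearCombinations.module_hom_def)
  have fsm: "f (r \<odot>\<^bsub>D2 q\<^esub> x) = r \<odot>\<^bsub>L\<^esub> f x" if "r \<in> invs" "x \<in> carrier (D2 q)" for r x
    using hom that by (simp add: LinearCombinations.module_hom_def inv_ring_simps)
  have fmem: "f x i \<in> invs" if "x \<in> carrier (D2 q)" "i < m" for x i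
  proof -
    have "f x \<in> carrier L" using surj that(1) by blast
    then show ?thesis using that(2) by (auto simp: Lc R.free_carrier inv_ring_simps)
  qed
  have "\<exists>a. a \<in> rep.dual_fixed q \<and> (\<forall>b\<in>rep.fixed q. f (Phi q b) i = pairing X a b)" if i: "i < m" for i
  proof -
    obtain a where "a \<in> rep.dual_fixed q" "\<And>b. b \<in> rep.fixed q \<Longrightarrow> f (Phi q b) i = pairing X a b"
      unfolding X_def
    proof (rule rep.functional_on_fixed[of q "\<lambda>b. f (Phi q b) i"])
      show "f (Phi q (\<lambda>x. a x + b x)) i = f (Phi q a) i + f (Phi q b) i"
        if "a \<in> rep.fixed q" "b \<in> rep.fixed q" for a b
        using that i by (simp add: Phi_add Phi_mem fadd Lc R.free_add inv_ring_simps)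
      show "f (Phi q (\<lambda>x. r * b x)) i = r * f (Phi q b) i"
        if "r \<in> invs" "b \<in> rep.fixed q" for r b
        using that i by (simp add: Phi_smult Phi_mem fsm Lc R.free_smult inv_ring_simps)
      show "f (Phi q b) i \<in> invs" if "b \<in> rep.fixed q" for b
        by (rule fmem[OF Phi_mem[OF that] i])
    qed auto
    then show ?thesis by blast
  qed
  then obtain a where a: "\<And>i. i < m \<Longrightarrow> a i \<in> rep.dual_fixed q"
    "\<And>i b. i < m \<Longrightarrow> b \<in> rep.fixed q \<Longrightarrow> f (Phi q b) i = pairing X (a i) b" by metis
  have "\<exists>b. b \<in> rep.fixed q \<and> f (Phi q b) = free_gen inv_ring {..<m} j" if j: "j < m" for j
  proof -
    have "free_gen inv_ring {..<m} j \<in> f ` carrier (D2 q)"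
      unfolding surj Lc by (rule R.free_gen_mem) (use j in simp)
    then obtain \<Phi> where \<Phi>: "\<Phi> \<in> carrier (D2 q)" "f \<Phi> = free_gen inv_ring {..<m} j" by auto
    obtain b where "b \<in> rep.fixed q" "\<Phi> = Phi q b" using \<Phi>(1) by (rule D2_cases)
    then show ?thesis using \<Phi> by blast
  qed
  then obtain b where b: "\<And>j. j < m \<Longrightarrow> b j \<in> rep.fixed q"
    "\<And>j. j < m \<Longrightarrow> f (Phi q (b j)) = free_gen inv_ring {..<m} j" by metis
  have ab: "pairing X (a i) (b j) = (if i = j then 1 else 0)" if "i < m" "j < m" for i j
    using that by (simp add: a(2)[OF that(1) b(1)[OF that(2)], symmetric] b free_gen_def inv_ring_simps)
  \<comment> \<open>Taking constant terms of all coefficients turns the duality over the invariants into a duality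
    over the ground field.\<close>
  define p where "p j = (\<Sum>x\<in>X. Poly_Mapping.single x (lookup (b j x) 0))" for j
  define \<Lambda> where "\<Lambda> i u = (\<Sum>x\<in>X. lookup (a i x) 0 * lookup u x)" for i and u :: "('n, 'k) polynomial"
  have lp: "lookup (p j) x = (if x \<in> X then lookup (b j x) 0 else 0)" for j x
    unfolding p_def using finX by (simp add: lookup_sum_at lookup_single when_def)
  have dual: "\<Lambda> i (p j) = (if i = j then 1 else 0)" if "i < m" "j < m" for i j
  proof -
    have "\<Lambda> i (p j) = (\<Sum>x\<in>X. lookup (a i x) 0 * lookup (b j x) 0)"
      unfolding \<Lambda>_def by (rule sum.cong[OF refl]) (simp add: lp)
    also have "\<dots> = lookup (pairing X (a i) (b j)) 0"
      by (simp add: pairing_def lookup_sum_at lookup_mult_0)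
    finally show ?thesis using ab[OF that] by (auto simp: lookup_one when_def)
  qed
  have \<Lambda>_add: "\<Lambda> i (x + y) = \<Lambda> i x + \<Lambda> i y" for i x y
    by (simp add: \<Lambda>_def lookup_add distrib_left sum.distrib)
  have \<Lambda>_scale: "\<Lambda> i (kscale c x) = c * \<Lambda> i x" for i c x
    unfolding \<Lambda>_def lookup_const_mult sum_distrib_left by (rule sum.cong[OF refl]) (rule mult.left_commute)
  have ind: "inj_on p {..<m}" "kvec.independent (p ` {..<m})"
    by (rule independent_by_dual_family[where \<Lambda> = \<Lambda>, OF \<Lambda>_add \<Lambda>_scale], rule dual, simp_all)+
  obtain B where B: "B \<subseteq> inv_comp q" "kvec.independent B" "inv_comp q \<subseteq> kvec.span B"
    "finite B" "card B = kvec.dim (inv_comp q)" by (rule inv_comp_basis)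
  have "p j \<in> inv_comp q" if "j < m" for j
    using constant_terms_invariant[OF b(1)[OF that]] by (simp add: p_def X_def)
  then have "p ` {..<m} \<subseteq> kvec.span B" using B(3) by auto
  then have "card (p ` {..<m}) \<le> card B" using kvec.independent_span_bound[OF B(4) ind(2)] by blast
  then show ?thesis using card_image[OF ind(1)] B(5) by simp
qed

text \<open>A dual basis of \<open>R\<^sub>q\<close> in the dual of \<open>Sym\<^sup>q F\<close> becomes invariant by averaging and remains dual to the
  invariant elements of \<open>R\<^sub>q\<close>.  Contraction with constants lowers degrees by \<open>q\<close>, whence the common degree
  \<open>q\<close> of the generators.\<close>

lemma free_quotient_exists:
  "\<exists>s f. graded_surjection inv_ring (D2 q) (free_graded_module inv_ring (kvec.dim (inv_comp q)) s) f"
proof -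
  define X where "X = (monomials_of_degree q :: ('n \<Rightarrow>\<^sub>0 nat) set)"
  have finX: "finite X" by (simp add: X_def finite_monomials_of_degree)
  obtain B where B: "B \<subseteq> inv_comp q" "kvec.independent B" "inv_comp q \<subseteq> kvec.span B"
    "finite B" "card B = kvec.dim (inv_comp q)" by (rule inv_comp_basis)
  define m where "m = card B"
  obtain p where p: "bij_betw p {0..<m} B" using ex_bij_betw_nat_finite[OF B(4)] by (auto simp: m_def)
  have pB: "p j \<in> B" if "j < m" for j using p that by (auto simp: bij_betw_def)
  have pV: "p j \<in> inv_comp q" if "j < m" for j using pB[OF that] B(1) by blast
  have "\<exists>h. Vector_Spaces.linear kscale (*) h \<and> (\<forall>x\<in>B. h x = (if x = p i then 1 else 0))" for i
    by (rule kpair.linear_independent_extend[OF B(2)])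
  then obtain \<Lambda> where \<Lambda>: "\<And>i. Vector_Spaces.linear kscale (*) (\<Lambda> i)"
    "\<And>i x. x \<in> B \<Longrightarrow> \<Lambda> i x = (if x = p i then 1 else 0)" by metis
  have \<Lambda>_sum: "\<Lambda> i (\<Sum>x\<in>X. kscale (c x) (u x)) = (\<Sum>x\<in>X. c x * \<Lambda> i (u x))" for i c and u :: "_ \<Rightarrow> ('n, 'k) polynomial"
    by (simp add: kpair.linear_sum[OF \<Lambda>(1)] kpair.linear_scale[OF \<Lambda>(1)])
  define a0 where "a0 i x = (if x \<in> X then (poly_const (\<Lambda> i (monomial x)) :: ('n, 'k) polynomial) else 0)" for i x
  define b where "b j x = (poly_const (lookup (p j) x) :: ('n, 'k) polynomial)" for j x
  have bf: "b j \<in> rep.fixed q" if "j < m" for j unfolding b_def by (rule constant_vector_fixed[OF pV[OF that]])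
  have ab0: "pairing X (a0 i) (b j) = (if i = j then 1 else 0)" if "i < m" "j < m" for i j
  proof -
    have "keys (p j) \<subseteq> X"
      using pV[OF that(2)] by (auto simp: inv_comp_def homogeneous_def X_def monomials_of_degree_def)
    from polynomial_expand[OF finX this]
    have "\<Lambda> i (p j) = \<Lambda> i (\<Sum>x\<in>X. kscale (lookup (p j) x) (monomial x))" by simp
    also have "\<dots> = (\<Sum>x\<in>X. lookup (p j) x * \<Lambda> i (monomial x))" by (rule \<Lambda>_sum)
    finally have "\<Lambda> i (p j) = (\<Sum>x\<in>X. lookup (p j) x * \<Lambda> i (monomial x))" .
    moreover have "pairing X (a0 i) (b j) = poly_const (\<Sum>x\<in>X. lookup (p j) x * \<Lambda> i (monomial x))"
      by (simp add: pairing_def a0_def b_def poly_const_sum poly_const_mult mult.commute)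
    moreover have "\<Lambda> i (p j) = (if i = j then 1 else 0)"
      using \<Lambda>(2)[OF pB[OF that(2)], of i] that p by (auto simp: bij_betw_def inj_on_def)
    ultimately show ?thesis by (auto simp: poly_const_0 poly_const_1)
  qed
  define e where "e = (poly_const (1 / of_nat (card \<Gamma>)) :: ('n, 'k) polynomial)"
  have e: "e * of_nat (card \<Gamma>) = 1"
    using card_nonzero by (simp add: e_def poly_const_of_nat[symmetric] poly_const_mult[symmetric] poly_const_1)
  have einv: "e \<in> invs" by (simp add: e_def poly_const_invs)
  define a where "a i = (\<lambda>x. e * drep.trace_vec q (a0 i) x)" for i
  have af: "a i \<in> rep.dual_fixed q" for i
    unfolding rep.dual_fixed_def a_def by (rule drep.fixed_smult[OF einv drep.trace_vec_fixed])
  have ab: "pairing X (a i) (b j) = (if i = j then 1 else 0)" if "i < m" "j < m" for i j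
  proof -
    have "pairing X (a0 i) (b j) \<in> invs" using ab0[OF that] by (auto simp: invs_zero invs_one)
    from rep.pairing_dual_trace_vec[OF bf[OF that(2)] this[unfolded X_def]]
    show ?thesis using e ab0[OF that] by (simp add: a_def pairing_smult X_def)
  qed
  have adeg: "a i x \<in> degree_part 0" for i x
  proof -
    have "drep.act q g (a0 i) x \<in> degree_part 0" if g: "g \<in> \<Gamma>" for g
    proof -
      have "rep.dual_rho g x y * g (a0 i y) \<in> degree_part (0 + 0)" for y
      proof (rule degree_part_mult)
        show "rep.dual_rho g x y \<in> degree_part 0"
          unfolding rep.dual_rho_def mono_rho_def by (rule degree_part_const)
        show "g (a0 i y) \<in> degree_part 0"
          by (cases "y \<in> X") (simp_all add: a0_def act_const[OF g] degree_part_const act_zero[OF g] degree_part_0)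
      qed
      then show ?thesis unfolding drep.act_def by (auto intro: degree_part_sum degree_part_0)
    qed
    then have "drep.trace_vec q (a0 i) x \<in> degree_part 0"
      unfolding drep.trace_vec_def by (rule degree_part_sum)
    from degree_part_mult[OF degree_part_const this, of "1 / of_nat (card \<Gamma>)"]
    show ?thesis by (simp add: a_def e_def)
  qed
  define F where "F \<Phi> = (\<lambda>i\<in>{..<m}. \<Phi> (psi q (a i)))" for \<Phi> :: "(((('n, 'k) polynomial \<Rightarrow> ('n, 'k) polynomial) set multiset \<Rightarrow> ('n, 'k) polynomial) set \<Rightarrow> ('n, 'k) polynomial) \<Rightarrow> ('n, 'k) polynomial"
  note pm = psi_mem[OF af]
  define L where "L = free_graded_module inv_ring m (\<lambda>_. int q)"
  have Lc: "carrier L = carrier (free_module inv_ring {..<m})" "add L = add (free_module inv_ring {..<m})"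
    "module.smult L = module.smult (free_module inv_ring {..<m})"
    "mod_comp L d = {v \<in> carrier (free_module inv_ring {..<m}). \<forall>i<m. v i \<in> ring_comp inv_ring (d - int q)}" for d
    by (simp_all add: L_def free_graded_module_def with_grading_simps)
  have carr: "y \<in> carrier L \<longleftrightarrow> y \<in> {..<m} \<rightarrow>\<^sub>E invs" for y
    by (simp add: Lc R.free_carrier inv_ring_simps)
  have Fmem: "F \<Phi> \<in> carrier L" if "\<Phi> \<in> carrier (D2 q)" for \<Phi>
    using that pm by (auto simp: carr F_def dual_carrier_iff[of _ "D1 q"])
  have "F \<in> LinearCombinations.module_hom inv_ring (D2 q) L"
    by (rule module_homI) (use Fmem pm in
      \<open>auto simp: Lc R.free_add R.free_smult F_def D2_add_apply D2_smult_apply inv_ring_simps intro!: restrict_ext\<close>)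
  moreover have "F ` carrier (D2 q) = carrier L"
  proof
    show "F ` carrier (D2 q) \<subseteq> carrier L" using Fmem by blast
    show "carrier L \<subseteq> F ` carrier (D2 q)"
    proof
      fix y assume "y \<in> carrier L"
      then have y: "y \<in> {..<m} \<rightarrow>\<^sub>E invs" by (simp add: carr)
      define c where "c = (\<lambda>x. \<Sum>j<m. y j * b j x)"
      have c: "c \<in> rep.fixed q" unfolding c_def
        by (rule rep.fixed_sum, rule rep.fixed_smult) (use y bf in auto)
      have "pairing X (a i) c = y i" if "i < m" for i
      proof -
        have "pairing X (a i) c = (\<Sum>j<m. y j * pairing X (a i) (b j))"
          unfolding c_def by (simp add: pairing_sum pairing_smult)
        also have "\<dots> = (\<Sum>j<m. if j = i then y i else 0)"
          by (rule sum.cong[OF refl]) (use that in \<open>simp add: ab\<close>)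
        finally show ?thesis using that by simp
      qed
      then have "F (Phi q c) i = y i" for i
        using y by (cases "i < m") (simp_all add: F_def Phi_psi[OF af] X_def PiE_def extensional_def)
      then have "F (Phi q c) = y" by (rule ext)
      then show "y \<in> F ` carrier (D2 q)" using Phi_mem[OF c] by blast
    qed
  qed
  moreover have "F ` mod_comp (D2 q) d \<subseteq> mod_comp L d" for d
  proof
    fix y assume "y \<in> F ` mod_comp (D2 q) d"
    then obtain \<Phi> where \<Phi>: "\<Phi> \<in> mod_comp (D2 q) d" "y = F \<Phi>" by blast
    have \<Phi>c: "\<Phi> \<in> carrier (D2 q)" "\<And>i. \<Phi> ` mod_comp (D1 q) i \<subseteq> ring_comp inv_ring (i + d)"
      using \<Phi>(1) unfolding dual_module_simps(5)[of _ "D1 q"] by auto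
    have "\<Phi> (psi q (a i)) \<in> ring_comp inv_ring (d - int q)" for i
    proof -
      have "\<Phi> (psi q (a i)) \<in> ring_comp inv_ring (- int q + d)"
        using \<Phi>c(2)[of "- int q"] psi_degree[OF af adeg] by blast
      then show ?thesis by (simp add: algebra_simps)
    qed
    then show "y \<in> mod_comp L d" using Fmem[OF \<Phi>c(1)] by (simp add: Lc \<Phi>(2) F_def)
  qed
  ultimately have "graded_surjection inv_ring (D2 q) L F" by (simp add: graded_surjection_def)
  then show ?thesis unfolding L_def m_def B(5) by blast
qed

theorem free_rank_reflexive_sym: "free_rank inv_ring (D2 q) = kvec.dim (inv_comp q)"
proof -
  let ?A = "{m. \<exists>s f. graded_surjection inv_ring (D2 q) (free_graded_module inv_ring m s) f}"
  have le: "m \<le> kvec.dim (inv_comp q)" if "m \<in> ?A" for m using that free_quotient_rank_le by blast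
  then have "finite ?A" by (meson finite_nat_set_iff_bounded_le)
  then show ?thesis
    unfolding free_rank_def by (rule Max_eqI) (use le free_quotient_exists in auto)
qed

end

section \<open>Counting invariants\<close>

lemma independent_family:
  fixes f :: "'i \<Rightarrow> ('n::finite, 'k::field) polynomial"
  assumes fin: "finite I" and rel: "\<And>c i. (\<Sum>i\<in>I. kscale (c i) (f i)) = 0 \<Longrightarrow> i \<in> I \<Longrightarrow> c i = 0"
  shows "inj_on f I" "kvec.independent (f ` I)"
proof -
  show inj: "inj_on f I"
  proof (rule inj_onI, rule ccontr)
    fix i j assume ij: "i \<in> I" "j \<in> I" "f i = f j" "i \<noteq> j"
    define c :: "'i \<Rightarrow> 'k" where "c l = (if l = i then 1 else 0) - (if l = j then 1 else 0)" for l
    have "(\<Sum>l\<in>I. kscale (c l) (f l)) = (\<Sum>l\<in>I. if l = i then f l else 0) - (\<Sum>l\<in>I. if l = j then f l else 0)"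
      unfolding sum_subtractf[symmetric]
      by (rule sum.cong[OF refl]) (simp add: c_def poly_const_diff poly_const_0 poly_const_1 left_diff_distrib)
    also have "\<dots> = 0" using ij fin by simp
    finally have "c i = 0" using ij(1) by (rule rel)
    then show False using ij(4) by (simp add: c_def)
  qed
  have "c v = 0" if s: "(\<Sum>v\<in>f ` I. kscale (c v) v) = 0" and v: "v \<in> f ` I" for c v
  proof -
    have "(\<Sum>i\<in>I. kscale (c (f i)) (f i)) = 0" using s by (simp add: sum.reindex[OF inj])
    from rel[OF this] v show ?thesis by auto
  qed
  then show "kvec.independent (f ` I)" by (auto simp: kvec.dependent_finite[OF finite_imageI[OF fin]])
qed

definition degree_le :: "nat \<Rightarrow> ('n::finite, 'k::zero) polynomial \<Rightarrow> bool" where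
  "degree_le N p \<longleftrightarrow> (\<forall>m\<in>keys p. monomial_degree m \<le> N)"

lemma degree_le_mono: "degree_le N p \<Longrightarrow> N \<le> N' \<Longrightarrow> degree_le N' p"
  by (force simp: degree_le_def)

lemma degree_le_0: "degree_le N 0"
  by (simp add: degree_le_def)

lemma degree_le_1: "degree_le N (1 :: ('n::finite, 'k::comm_semiring_1) polynomial)"
  by (auto simp: degree_le_def in_keys_iff lookup_one when_def monomial_degree_0)

lemma degree_le_add: "degree_le N p \<Longrightarrow> degree_le N q \<Longrightarrow> degree_le N (p + q)"
  using keys_add[of p q] by (auto simp: degree_le_def)

lemma degree_le_uminus: "degree_le N p \<Longrightarrow> degree_le N (- p :: ('n::finite, 'k::ab_group_add) polynomial)"
  by (simp add: degree_le_def)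

lemma degree_le_sum: "(\<And>i. i \<in> I \<Longrightarrow> degree_le N (f i)) \<Longrightarrow> degree_le N (\<Sum>i\<in>I. f i)"
  by (induction I rule: infinite_finite_induct) (simp_all add: degree_le_0 degree_le_add)

lemma degree_le_mult: "degree_le N p \<Longrightarrow> degree_le N' q \<Longrightarrow> degree_le (N + N') (p * q)"
  using keys_mult[of p q] by (fastforce simp: degree_le_def monomial_degree_add intro: add_mono)

lemma degree_le_power: "degree_le e p \<Longrightarrow> degree_le (j * e) (p ^ j :: ('n::finite, 'k::comm_semiring_1) polynomial)"
  by (induction j) (simp_all add: degree_le_1 degree_le_mult)

lemma degree_le_ex: "\<exists>e. degree_le e p"
proof
  show "degree_le (\<Sum>m\<in>keys p. monomial_degree m) p"
    unfolding degree_le_def by (auto intro: member_le_sum)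
qed

definition degree_component :: "nat \<Rightarrow> ('n::finite, 'k::comm_monoid_add) polynomial \<Rightarrow> ('n, 'k) polynomial" where
  "degree_component q p = (\<Sum>m\<in>{m \<in> keys p. monomial_degree m = q}. Poly_Mapping.single m (lookup p m))"

lemma lookup_degree_component:
  "lookup (degree_component q p) m = (if monomial_degree m = q then lookup p m else 0)"
  by (auto simp: degree_component_def lookup_sum_at lookup_single when_def in_keys_iff)

lemma homogeneous_degree_component: "homogeneous q (degree_component q p)"
  by (simp add: homogeneous_alt lookup_degree_component)

lemma sum_degree_components:
  assumes "degree_le N p" shows "(\<Sum>q\<le>N. degree_component q p) = p"
proof (rule poly_mapping_eqI)
  fix m
  show "lookup (\<Sum>q\<le>N. degree_component q p) m = lookup p m"
    using assms by (auto simp: lookup_sum_at lookup_degree_component degree_le_def in_keys_iff)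
qed

definition monomials_upto :: "nat \<Rightarrow> ('n::finite \<Rightarrow>\<^sub>0 nat) set" where
  "monomials_upto N = (\<Union>q\<le>N. monomials_of_degree q)"

lemma monomials_upto_iff: "m \<in> monomials_upto N \<longleftrightarrow> monomial_degree m \<le> N"
  by (auto simp: monomials_upto_def monomials_of_degree_def)

lemma finite_monomials_upto: "finite (monomials_upto N)"
  by (simp add: monomials_upto_def finite_monomials_of_degree)

lemma card_monomials_upto:
  "card (monomials_upto N :: ('n::finite \<Rightarrow>\<^sub>0 nat) set) = (\<Sum>q\<le>N. card (monomials_of_degree q :: ('n \<Rightarrow>\<^sub>0 nat) set))"
  unfolding monomials_upto_def
  by (rule card_UN_disjoint) (simp_all add: finite_monomials_of_degree, auto simp: monomials_of_degree_def)

lemma card_monomials_of_degree: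
  "card (monomials_of_degree q :: ('n::finite \<Rightarrow>\<^sub>0 nat) set) = (card (UNIV :: 'n set) + q - 1) choose q"
proof -
  define f where "f X = (exponent (SOME xs. mset xs = X) :: 'n \<Rightarrow>\<^sub>0 nat)" for X
  have f: "\<exists>xs. mset xs = X \<and> f X = exponent xs" for X
    unfolding f_def using someI_ex[OF ex_mset[of X]] by blast
  have fm: "f (mset xs) = exponent xs" for xs using f[of "mset xs"] by (auto simp: exponent_eq_iff)
  have "bij_betw f (multisets_of_size UNIV q) (monomials_of_degree q)"
  proof (rule bij_betw_imageI)
    show "inj_on f (multisets_of_size UNIV q)"
    proof (rule inj_onI)
      fix X Y assume "f X = f Y"
      then show "X = Y" using f[of X] f[of Y] by (auto simp: exponent_eq_iff)
    qed
    show "f ` multisets_of_size UNIV q = monomials_of_degree q"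
    proof (intro equalityI subsetI)
      fix m assume "m \<in> f ` multisets_of_size UNIV q"
      then obtain X where X: "size X = q" "m = f X" by (auto simp: multisets_of_size_def)
      then show "m \<in> monomials_of_degree q"
        using f[of X] by (auto simp: monomials_of_degree_def monomial_degree_exponent)
    next
      fix m :: "'n \<Rightarrow>\<^sub>0 nat" assume "m \<in> monomials_of_degree q"
      then obtain xs where "length xs = q" "exponent xs = m"
        using exponent_surj[of m q] by (auto simp: monomials_of_degree_def)
      then show "m \<in> f ` multisets_of_size UNIV q"
        by (intro image_eqI[of _ _ "mset xs"]) (simp_all add: fm multisets_of_size_def)
    qed
  qed
  then show ?thesis by (simp add: bij_betw_same_card[symmetric] card_multisets_of_size)
qed

lemma card_monomials_upto_binomial:
  "card (monomials_upto N :: ('n::finite \<Rightarrow>\<^sub>0 nat) set) = (card (UNIV :: 'n set) + N) choose N"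
proof -
  obtain r where r: "card (UNIV :: 'n set) = Suc r" using not0_implies_Suc[of "card (UNIV :: 'n set)"] by auto
  show ?thesis by (simp add: card_monomials_upto card_monomials_of_degree r sum_choose_lower)
qed

lemma monomials_upto_pos: "card (monomials_upto N :: ('n::finite \<Rightarrow>\<^sub>0 nat) set) > 0"
  by (simp add: card_monomials_upto_binomial)

lemma card_monomials_upto_ratio:
  "(\<lambda>N. real (card (monomials_upto (N + c) :: ('n::finite \<Rightarrow>\<^sub>0 nat) set)) / real (card (monomials_upto N :: ('n \<Rightarrow>\<^sub>0 nat) set)))
    \<longlonglongrightarrow> 1"
proof -
  define M where "M N = real (card (monomials_upto N :: ('n \<Rightarrow>\<^sub>0 nat) set))" for N
  define \<nu> where "\<nu> = card (UNIV :: 'n set)"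
  have M0: "M N > 0" for N by (simp add: M_def monomials_upto_pos)
  have step: "M (Suc N) / M N = real (\<nu> + Suc N) / real (Suc N)" for N
  proof -
    have "real (Suc N) * M (Suc N) = real (Suc N * (Suc (\<nu> + N) choose Suc N))"
      by (simp only: M_def card_monomials_upto_binomial \<nu>_def of_nat_mult add_Suc_right)
    also have "\<dots> = real (Suc (\<nu> + N) * ((\<nu> + N) choose N))"
      by (simp only: Suc_times_binomial_eq mult.commute)
    also have "\<dots> = real (\<nu> + Suc N) * M N"
      by (simp only: M_def card_monomials_upto_binomial \<nu>_def of_nat_mult add_Suc_right)
    finally have "real (Suc N) * M (Suc N) = real (\<nu> + Suc N) * M N" .
    then show ?thesis using M0[of N] by (simp add: field_simps)
  qed
  have "(\<lambda>N. 1 + real \<nu> / real (Suc N)) \<longlonglongrightarrow> 1 + 0"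
    by (intro tendsto_add tendsto_const LIMSEQ_Suc lim_const_over_n)
  moreover have "(\<lambda>N. 1 + real \<nu> / real (Suc N)) = (\<lambda>N. M (Suc N) / M N)"
    unfolding step by (rule ext) (simp add: field_simps)
  ultimately have lim1: "(\<lambda>N. M (Suc N) / M N) \<longlonglongrightarrow> 1" by simp
  have "(\<lambda>N. M (N + c) / M N) \<longlonglongrightarrow> 1"
  proof (induction c)
    case 0
    have "M N \<noteq> 0" for N using M0[of N] by simp
    then show ?case by simp
  next
    case (Suc c)
    have "(\<lambda>N. M (N + c) / M N * (M (Suc (N + c)) / M (N + c))) \<longlonglongrightarrow> 1 * 1"
      by (rule tendsto_mult[OF Suc LIMSEQ_ignore_initial_segment[OF lim1]])
    moreover have "M (N + c) / M N * (M (Suc (N + c)) / M (N + c)) = M (N + Suc c) / M N" for N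
      using M0[of "N + c"] by simp
    ultimately show ?case by simp
  qed
  then show ?thesis by (simp add: M_def)
qed

text \<open>A bounded shift of the argument does not matter for a function \<open>M\<close> with \<open>M (N + c) / M N \<rightarrow> 1\<close>.\<close>

lemma comparable_growth_limit:
  fixes A M :: "nat \<Rightarrow> real" and n :: real
  assumes n: "n > 0" and M0: "\<And>N. M N > 0" and ratio: "\<And>c. (\<lambda>N. M (N + c) / M N) \<longlonglongrightarrow> 1"
    and le: "\<And>N. n * A N \<le> M (N + c)" and ge: "\<And>N. M N \<le> n * A (N + c)"
  shows "(\<lambda>N. A N / M N) \<longlonglongrightarrow> 1 / n"
proof (rule LIMSEQ_offset[of _ c], rule tendsto_sandwich)
  show "(\<lambda>N. 1 / n * inverse (M (N + c) / M N)) \<longlonglongrightarrow> 1 / n"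
    using tendsto_mult[OF tendsto_const tendsto_inverse[OF ratio[of c]], of "1 / n"] by simp
  show "(\<lambda>N. 1 / n * (M (N + c + c) / M (N + c))) \<longlonglongrightarrow> 1 / n"
    using tendsto_mult[OF tendsto_const LIMSEQ_ignore_initial_segment[OF ratio[of c]], of "1 / n" c] by simp
  show "\<forall>\<^sub>F N in sequentially. 1 / n * inverse (M (N + c) / M N) \<le> A (N + c) / M (N + c)"
  proof (rule always_eventually, rule allI)
    fix N
    have "1 / n * inverse (M (N + c) / M N) = (M N / n) / M (N + c)" by (simp add: field_simps)
    also have "\<dots> \<le> A (N + c) / M (N + c)"
      by (rule divide_right_mono) (use ge[of N] n M0[of "N + c"] in \<open>simp_all add: field_simps less_imp_le\<close>)
    finally show "1 / n * inverse (M (N + c) / M N) \<le> A (N + c) / M (N + c)" .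
  qed
  show "\<forall>\<^sub>F N in sequentially. A (N + c) / M (N + c) \<le> 1 / n * (M (N + c + c) / M (N + c))"
  proof (rule always_eventually, rule allI)
    fix N
    have "A (N + c) / M (N + c) \<le> (M (N + c + c) / n) / M (N + c)"
      by (rule divide_right_mono) (use le[of "N + c"] n M0[of "N + c"] in \<open>simp_all add: field_simps less_imp_le\<close>)
    then show "A (N + c) / M (N + c) \<le> 1 / n * (M (N + c + c) / M (N + c))" by simp
  qed
qed

lemma degree_prod_linear:
  fixes f :: "'i \<Rightarrow> 'a::comm_ring_1"
  assumes "finite F" shows "degree (\<Prod>x\<in>F. [:- f x, 1:]) = card F"
proof -
  have "coeff (\<Prod>x\<in>F. [:- f x, 1:]) (card F) = 1 \<and> degree (\<Prod>x\<in>F. [:- f x, 1:]) \<le> card F"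
    using assms
  proof (induction F rule: finite_induct)
    case (insert x F)
    define P where "P = (\<Prod>x\<in>F. [:- f x, 1:])"
    have P: "coeff P (card F) = 1" "degree P \<le> card F" using insert.IH by (simp_all add: P_def)
    have "coeff ([:- f x, 1:] * P) (Suc (card F)) = 1" using P by (simp add: coeff_eq_0)
    moreover have "degree ([:- f x, 1:] * P) \<le> Suc (card F)"
      using degree_mult_le[of "[:- f x, 1:]" P] P(2) by simp
    moreover have "(\<Prod>x\<in>insert x F. [:- f x, 1:]) = [:- f x, 1:] * P"
      unfolding P_def by (rule prod.insert[OF insert.hyps])
    ultimately show ?case using insert.hyps by (simp only: card_insert_disjoint simp_thms)
  qed simp
  then show ?thesis using le_degree[of "\<Prod>x\<in>F. [:- f x, 1:]" "card F"] by simp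
qed

lemma coeff_prod_linear_degree_le:
  fixes f :: "'i \<Rightarrow> ('n::finite, 'k::comm_ring_1) polynomial"
  assumes "finite F" "\<And>x. x \<in> F \<Longrightarrow> degree_le e (f x)"
  shows "degree_le (card F * e) (coeff (\<Prod>x\<in>F. [:- f x, 1:]) i)"
  using assms
proof (induction F arbitrary: i rule: finite_induct)
  case empty
  then show ?case by (simp add: coeff_1 degree_le_0 degree_le_1)
next
  case (insert x F)
  define P where "P = (\<Prod>x\<in>F. [:- f x, 1:])"
  have IH: "degree_le (card F * e) (coeff P i)" for i using insert by (simp add: P_def)
  have "coeff ([:- f x, 1:] * P) i = - f x * coeff P i + (if i = 0 then 0 else coeff P (i - 1))"
    by (simp add: coeff_pCons split: nat.split)
  moreover have "degree_le (card (insert x F) * e) (- f x * coeff P i)"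
    using degree_le_mult[OF degree_le_uminus IH, of e "f x"] insert by simp
  moreover have "degree_le (card (insert x F) * e) (if i = 0 then 0 else coeff P (i - 1))"
    using degree_le_mono[OF IH] insert by (simp add: degree_le_0)
  moreover have "(\<Prod>x\<in>insert x F. [:- f x, 1:]) = [:- f x, 1:] * P"
    unfolding P_def by (rule prod.insert[OF insert.hyps])
  ultimately show ?case by (simp only: degree_le_add)
qed

lemma poly_as_sum_lessThan:
  fixes p :: "'a::comm_ring_1 poly"
  assumes "degree p < n" shows "poly p x = (\<Sum>j<n. coeff p j * x ^ j)"
  unfolding poly_altdef by (rule sum.mono_neutral_left) (use assms in \<open>auto simp: coeff_eq_0\<close>)

context linear_action
begin

lemma degree_le_act: assumes g: "g \<in> \<Gamma>" and p: "degree_le N p" shows "degree_le N (g p)"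
proof -
  interpret ring_map g by (rule ring_map_act[OF g])
  have eq: "g p = (\<Sum>q\<le>N. g (degree_component q p))"
    using sum_degree_components[OF p] by (metis map_sum)
  have le: "degree_le N (g (degree_component q p))" if "q \<le> N" for q
    using homogeneous_act[OF g homogeneous_degree_component, of q p] that by (auto simp: homogeneous_def degree_le_def)
  show ?thesis by (subst eq, rule degree_le_sum) (simp add: le)
qed

text \<open>A linear action commutes with taking homogeneous components.\<close>

lemma degree_component_invariant:
  assumes p: "p \<in> invs" shows "degree_component q p \<in> inv_comp q"
proof -
  have "g (degree_component q p) = degree_component q p" if g: "g \<in> \<Gamma>" for g
  proof (rule poly_mapping_eqI)
    fix m
    interpret ring_map g by (rule ring_map_act[OF g])
    obtain N where N: "degree_le N p" using degree_le_ex by blast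
    have hom: "lookup (g (degree_component r p)) m = 0" if "monomial_degree m \<noteq> r" for r
      by (rule homogeneous_lookup[OF homogeneous_act[OF g homogeneous_degree_component] that])
    show "lookup (g (degree_component q p)) m = lookup (degree_component q p) m"
    proof (cases "monomial_degree m = q")
      case True
      have "degree_le (max N q) p" by (rule degree_le_mono[OF N]) simp
      from sum_degree_components[OF this] have "g p = (\<Sum>r\<le>max N q. g (degree_component r p))" by (metis map_sum)
      then have "lookup p m = (\<Sum>r\<le>max N q. lookup (g (degree_component r p)) m)"
        by (simp only: invsD[OF p g] lookup_sum_at[symmetric])
      also have "\<dots> = (\<Sum>r\<in>{q}. lookup (g (degree_component r p)) m)"
        by (rule sum.mono_neutral_right) (use True hom in auto)
      finally show ?thesis using True by (simp add: lookup_degree_component)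
    next
      case False
      then show ?thesis by (simp add: hom lookup_degree_component)
    qed
  qed
  then show ?thesis by (simp add: inv_comp_def homogeneous_degree_component invs_def)
qed

text \<open>A relation is a polynomial of degree less than \<open>|G|\<close> with invariant coefficients vanishing at \<open>\<theta>\<close>, hence
  zero, being a multiple of the monic characteristic polynomial of \<open>\<theta>\<close>, which has degree \<open>|G|\<close>.\<close>

lemma power_family_independent:
  assumes \<theta>: "primitive \<theta>" and fin: "finite I" and u: "\<And>i. i \<in> I \<Longrightarrow> u i \<in> invs"
    and ind: "\<And>c i. (\<Sum>i\<in>I. kscale (c i) (u i)) = 0 \<Longrightarrow> i \<in> I \<Longrightarrow> c i = 0"
    and rel: "(\<Sum>(i, j)\<in>I \<times> {..<card \<Gamma>}. kscale (c (i, j)) (u i * \<theta> ^ j)) = 0"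
    and ij: "i \<in> I" "j < card \<Gamma>"
  shows "c (i, j) = 0"
proof -
  let ?n = "card \<Gamma>"
  define r where "r j = (\<Sum>i\<in>I. kscale (c (i, j)) (u i))" for j
  define q where "q = (\<Sum>j<?n. Polynomial.monom (r j) j)"
  have r: "r j \<in> invs" for j
    unfolding r_def by (intro invs_sum invs_mult poly_const_invs u)
  have cq: "coeff q j = (if j < ?n then r j else 0)" for j
    by (simp add: q_def coeff_sum)
  have "poly q \<theta> = (\<Sum>j<?n. \<Sum>i\<in>I. kscale (c (i, j)) (u i * \<theta> ^ j))"
    by (simp add: q_def poly_sum poly_monom r_def sum_distrib_right mult.assoc)
  also have "\<dots> = (\<Sum>i\<in>I. \<Sum>j<?n. kscale (c (i, j)) (u i * \<theta> ^ j))" by (rule sum.swap)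
  also have "\<dots> = 0" using rel by (simp add: sum.cartesian_product)
  finally have root: "poly q \<theta> = 0" .
  have inv: "inv_poly q" by (simp add: inv_poly_def cq r invs_zero)
  obtain t where t: "q = char_poly_of \<theta> * t" by (rule vanishing_inv_poly[OF \<theta> inv root])
  have "t = 0"
  proof (rule ccontr)
    assume "t \<noteq> 0"
    have deg: "degree (char_poly_of \<theta>) = ?n" unfolding char_poly_of_def by (rule degree_prod_linear[OF finite_group])
    have lead: "coeff (char_poly_of \<theta>) ?n = 1"
      using monic_prod_linear[OF finite_group, of "\<lambda>g. g \<theta>"] deg by (simp add: char_poly_of_def)
    have "coeff q (?n + degree t) = lead_coeff t"
      using coeff_mult_degree_sum[of "char_poly_of \<theta>" t] by (simp add: t deg lead)
    then show False using \<open>t \<noteq> 0\<close> by (simp add: cq)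
  qed
  then have "coeff q j = 0" by (simp add: t)
  then have "(\<Sum>i\<in>I. kscale (c (i, j)) (u i)) = 0" using ij(2) by (simp add: cq r_def)
  then show ?thesis using ij(1) by (rule ind)
qed

lemma graded_family_independent:
  assumes B: "\<And>q. B q \<subseteq> inv_comp q" "\<And>q. kvec.independent (B q)" "\<And>q. finite (B q)"
    and rel: "(\<Sum>(q, b)\<in>Sigma {..N} B. kscale (c (q, b)) b) = 0" and i: "q \<le> N" "b \<in> B q"
  shows "c (q, b) = 0"
proof -
  define p where "p q = (\<Sum>b\<in>B q. kscale (c (q, b)) b)" for q
  have hom: "homogeneous q (p q)" for q
    unfolding p_def using B(1) by (intro homogeneous_sum homogeneous_const_mult) (auto simp: inv_comp_def)
  have total: "(\<Sum>q\<le>N. p q) = 0"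
    using rel by (simp add: p_def sum.Sigma B(3))
  have "p q = 0"
  proof (rule poly_mapping_eqI)
    fix m
    show "lookup (p q) m = lookup 0 m"
    proof (cases "monomial_degree m = q")
      case True
      have "(\<Sum>r\<le>N. lookup (p r) m) = (\<Sum>r\<in>{q}. lookup (p r) m)"
        by (rule sum.mono_neutral_right) (use i True homogeneous_lookup[OF hom] in auto)
      moreover have "(\<Sum>r\<le>N. lookup (p r) m) = 0" by (simp add: lookup_sum_at[symmetric] total)
      ultimately show ?thesis by simp
    next
      case False
      then show ?thesis by (simp add: homogeneous_lookup[OF hom])
    qed
  qed
  then show ?thesis
    using kvec.independentD[OF B(2) B(3) subset_refl, of "\<lambda>b. c (q, b)" q b] i(2) by (simp add: p_def)
qed

text \<open>The products of a basis of the invariants of degree at most \<open>N\<close> with \<open>1, \<theta>, \<dots>, \<theta>\<^bsup>|G|-1\<^esup>\<close> are independent;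
  this gives the first estimate.  They span, for a larger degree bound, all multiples by
  \<open>discr \<theta>\<close> of polynomials of degree at most \<open>N\<close>, as is seen by evaluating interpolants at \<open>\<theta>\<close>; this gives
  the second one.\<close>

theorem count_invariants:
  obtains C where
    "\<And>N. card \<Gamma> * (\<Sum>q\<le>N. kvec.dim (inv_comp q)) \<le> card (monomials_upto (N + C) :: ('n \<Rightarrow>\<^sub>0 nat) set)"
    "\<And>N. card (monomials_upto N :: ('n \<Rightarrow>\<^sub>0 nat) set) \<le> card \<Gamma> * (\<Sum>q\<le>N + C. kvec.dim (inv_comp q))"
proof -
  let ?n = "card \<Gamma>"
  obtain \<theta> where \<theta>: "primitive \<theta>" by (rule primitive_ex)
  obtain e where e: "degree_le e \<theta>" using degree_le_ex by blast
  have "\<exists>B. B \<subseteq> inv_comp q \<and> kvec.independent B \<and> inv_comp q \<subseteq> kvec.span B \<and> finite B \<and> card B = kvec.dim (inv_comp q)" for q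
    by (rule inv_comp_basis[of q]) blast
  then obtain B where B: "\<And>q. B q \<subseteq> inv_comp q" "\<And>q. kvec.independent (B q)" "\<And>q. inv_comp q \<subseteq> kvec.span (B q)"
    "\<And>q. finite (B q)" "\<And>q. card (B q) = kvec.dim (inv_comp q)" by metis
  define I where "I N = Sigma {..N} B" for N :: nat
  have finI: "finite (I N)" for N by (simp add: I_def B(4))
  have cardI: "card (I N) = (\<Sum>q\<le>N. kvec.dim (inv_comp q))" for N by (simp add: I_def B(4,5))
  define f where "f = (\<lambda>((q :: nat, b), j). b * \<theta> ^ j)"
  define J where "J N = I N \<times> {..<?n}" for N
  have finJ: "finite (J N)" for N by (simp add: J_def finI)
  have cardJ: "card (J N) = ?n * (\<Sum>q\<le>N. kvec.dim (inv_comp q))" for N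
    by (simp add: J_def card_cartesian_product cardI mult.commute)
  have I_inv: "snd i \<in> invs" "degree_le N (snd i)" if "i \<in> I N" for i N
  proof -
    have "fst i \<le> N" "snd i \<in> inv_comp (fst i)" using that subsetD[OF B(1)] by (auto simp: I_def)
    then show "snd i \<in> invs" "degree_le N (snd i)" by (auto simp: inv_comp_def homogeneous_def degree_le_def)
  qed
  have upper: "card (J N) \<le> card (monomials_upto (N + ?n * e) :: ('n \<Rightarrow>\<^sub>0 nat) set)" for N
  proof -
    have "c (i, j) = 0" if "(\<Sum>x\<in>J N. kscale (c x) (f x)) = 0" "(i, j) \<in> J N" for c i j
    proof (rule power_family_independent[OF \<theta> finI[of N], where u = snd])
      show "(\<Sum>(i, j)\<in>I N \<times> {..<?n}. kscale (c (i, j)) (snd i * \<theta> ^ j)) = 0"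
        using that(1) by (simp add: J_def f_def case_prod_beta)
      show "i \<in> I N" "j < ?n" using that(2) by (auto simp: J_def)
      show "d i = 0" if d: "(\<Sum>i\<in>I N. kscale (d i) (snd i)) = 0" "i \<in> I N" for d i
      proof -
        obtain q b where qb: "i = (q, b)" by fastforce
        show ?thesis unfolding qb
          by (rule graded_family_independent[OF B(1,2,4), where N = N])
            (use d in \<open>simp_all add: I_def qb case_prod_beta\<close>)
      qed
    qed (rule I_inv)
    then have ind: "inj_on f (J N)" "kvec.independent (f ` J N)"
      using independent_family[where f = f and I = "J N"] finJ by (auto simp: J_def)
    have "keys p \<subseteq> monomials_upto (N + ?n * e)" if "p \<in> f ` J N" for p
    proof -
      from that obtain x where "x \<in> J N" "p = f x" by blast
      then obtain i j where ij: "i \<in> I N" "j < ?n" "p = snd i * \<theta> ^ j"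
        by (cases x) (auto simp: J_def f_def case_prod_beta)
      have "degree_le (N + j * e) p" unfolding ij(3) by (rule degree_le_mult[OF I_inv(2)[OF ij(1)] degree_le_power[OF e]])
      then have "degree_le (N + ?n * e) p" by (rule degree_le_mono) (use ij(2) in simp)
      then show ?thesis by (auto simp: degree_le_def monomials_upto_iff)
    qed
    from independent_card_le[OF finite_monomials_upto ind(2) this] show ?thesis
      using card_image[OF ind(1)] by simp
  qed
  have lower: "card (monomials_upto N :: ('n \<Rightarrow>\<^sub>0 nat) set) \<le> card (J (N + ?n * e))" for N
  proof -
    define d where "d = discr (\<lambda>_. \<theta>)"
    have d: "d \<noteq> 0" unfolding d_def by (rule discr_primitive[OF \<theta>])
    \<comment> \<open>Multiplication by \<open>d\<close> is injective, so that it preserves independence.\<close>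
    define h where "h m = d * (monomial m :: ('n, 'k) polynomial)" for m
    have "c m = 0" if s: "(\<Sum>m\<in>monomials_upto N. kscale (c m) (h m)) = 0" and m: "m \<in> monomials_upto N" for c m
    proof -
      have "d * (\<Sum>m\<in>monomials_upto N. kscale (c m) (monomial m)) = 0"
        using s by (simp add: h_def sum_distrib_left mult.left_commute)
      then have "(\<Sum>m\<in>monomials_upto N. kscale (c m) (monomial m)) = 0" using no_zero_div d by blast
      then have "lookup (\<Sum>m\<in>monomials_upto N. Poly_Mapping.single m (c m)) m = 0" by (simp add: poly_const_single)
      then show ?thesis using m by (simp add: lookup_sum_at lookup_single when_def finite_monomials_upto)
    qed
    then have ind: "inj_on h (monomials_upto N)" "kvec.independent (h ` monomials_upto N)"
      using independent_family[where f = h and I = "monomials_upto N"] finite_monomials_upto by auto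
    have span_inv: "p \<in> kvec.span (snd ` I K)" if p: "p \<in> invs" "degree_le K p" for p K
    proof -
      have "degree_component q p \<in> kvec.span (snd ` I K)" if "q \<le> K" for q
      proof -
        have "B q \<subseteq> snd ` I K" using that by (force simp: I_def)
        then show ?thesis using kvec.span_mono degree_component_invariant[OF p(1)] B(3) by blast
      qed
      then have "(\<Sum>q\<le>K. degree_component q p) \<in> kvec.span (snd ` I K)" by (intro kvec.span_sum) auto
      then show ?thesis by (simp only: sum_degree_components[OF p(2)])
    qed
    have "h m \<in> kvec.span (f ` J (N + ?n * e))" if m: "m \<in> monomials_upto N" for m
    proof -
      let ?s = "monomial m :: ('n, 'k) polynomial" and ?p = "interpolant \<theta> (monomial m)"
      have s: "degree_le N ?s" using m by (auto simp: degree_le_def monomials_upto_iff)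
      have "degree ?p < ?n"
      proof -
        have "degree (Polynomial.smult (g ?s) (\<Prod>h\<in>\<Gamma> - {g}. [:- h \<theta>, 1:])) \<le> ?n - 1" if "g \<in> \<Gamma>" for g
          using order_trans[OF degree_smult_le, of "\<Prod>h\<in>\<Gamma> - {g}. [:- h \<theta>, 1:]" "?n - 1" "g ?s"] that finite_group
          by (simp add: degree_prod_linear)
        then have "degree ?p \<le> ?n - 1" unfolding interpolant_def by (intro degree_sum_le) (auto simp: finite_group)
        moreover have "?n > 0" using finite_group id_mem card_gt_0_iff by blast
        ultimately show ?thesis by simp
      qed
      then have hm: "h m = (\<Sum>j<?n. coeff ?p j * \<theta> ^ j)"
        using poly_as_sum_lessThan[of ?p ?n \<theta>] by (simp add: h_def d_def poly_interpolant mult.commute)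
      have terms: "coeff ?p j * \<theta> ^ j \<in> kvec.span (f ` J (N + ?n * e))" if j: "j < ?n" for j
      proof -
        have "degree_le (N + ?n * e) (coeff ?p j)"
          unfolding interpolant_def coeff_sum coeff_smult
        proof (rule degree_le_sum)
          fix g assume g: "g \<in> \<Gamma>"
          have "degree_le (card (\<Gamma> - {g}) * e) (coeff (\<Prod>h\<in>\<Gamma> - {g}. [:- h \<theta>, 1:]) j)"
            by (rule coeff_prod_linear_degree_le) (use finite_group e degree_le_act in auto)
          then have "degree_le (?n * e) (coeff (\<Prod>h\<in>\<Gamma> - {g}. [:- h \<theta>, 1:]) j)"
            by (rule degree_le_mono) (simp add: card_mono finite_group)
          from degree_le_mult[OF degree_le_act[OF g s] this]
          show "degree_le (N + ?n * e) (g ?s * coeff (\<Prod>h\<in>\<Gamma> - {g}. [:- h \<theta>, 1:]) j)" .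
        qed
        moreover have "coeff ?p j \<in> invs" using inv_poly_interpolant[of \<theta> ?s] by (simp add: inv_poly_def)
        ultimately have "coeff ?p j \<in> kvec.span (snd ` I (N + ?n * e))" by (intro span_inv)
        then show ?thesis
        proof (induction rule: kvec.span_induct_alt)
          case base
          then show ?case by (simp add: kvec.span_zero)
        next
          case (step c x y)
          have "x * \<theta> ^ j \<in> f ` J (N + ?n * e)"
          proof -
            obtain i where "i \<in> I (N + ?n * e)" "x = snd i" using step(1) by blast
            then show ?thesis using j by (intro image_eqI[of _ _ "(i, j)"]) (auto simp: f_def J_def case_prod_beta)
          qed
          then have "kscale c (x * \<theta> ^ j) + y * \<theta> ^ j \<in> kvec.span (f ` J (N + ?n * e))"
            by (intro kvec.span_add kvec.span_scale kvec.span_base step(2))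
          then show ?case by (simp add: algebra_simps)
        qed
      qed
      show ?thesis unfolding hm by (rule kvec.span_sum) (use terms in simp)
    qed
    then have "card (h ` monomials_upto N) \<le> card (f ` J (N + ?n * e))"
      using kvec.independent_span_bound[OF finite_imageI[OF finJ] ind(2)] by blast
    then show ?thesis using card_image[OF ind(1)] card_image_le[OF finJ, of f "N + ?n * e"] by simp
  qed
  show ?thesis
  \<comment> \<open>Multiplication by \<open>\<theta> ^ j\<close> with \<open>j < |G|\<close> raises degrees by at most \<open>|G| * e\<close>, and so do the coefficients of
    interpolants.\<close>
  proof (rule that[of "?n * e"])
    fix N
    show "?n * (\<Sum>q\<le>N. kvec.dim (inv_comp q)) \<le> card (monomials_upto (N + ?n * e) :: ('n \<Rightarrow>\<^sub>0 nat) set)"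
      using upper[of N] by (simp add: cardJ)
    show "card (monomials_upto N :: ('n \<Rightarrow>\<^sub>0 nat) set) \<le> ?n * (\<Sum>q\<le>N + ?n * e. kvec.dim (inv_comp q))"
      using lower[of N] by (simp add: cardJ)
  qed
qed

theorem rank_ratio_limit:
  "(\<lambda>N. real (\<Sum>q\<le>N. free_rank inv_ring (D2 q)) / real (\<Sum>q\<le>N. module_rank inv_ring (D2 q)))
    \<longlonglongrightarrow> 1 / real (card \<Gamma>)"
proof -
  obtain C where C:
    "\<And>N. card \<Gamma> * (\<Sum>q\<le>N. kvec.dim (inv_comp q)) \<le> card (monomials_upto (N + C) :: ('n \<Rightarrow>\<^sub>0 nat) set)"
    "\<And>N. card (monomials_upto N :: ('n \<Rightarrow>\<^sub>0 nat) set) \<le> card \<Gamma> * (\<Sum>q\<le>N + C. kvec.dim (inv_comp q))"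
    using count_invariants by metis
  have n: "real (card \<Gamma>) > 0" using finite_group id_mem by (auto simp: card_gt_0_iff)
  have "(\<lambda>N. real (\<Sum>q\<le>N. kvec.dim (inv_comp q)) / real (card (monomials_upto N :: ('n \<Rightarrow>\<^sub>0 nat) set))) \<longlonglongrightarrow> 1 / real (card \<Gamma>)"
    by (rule comparable_growth_limit[OF n _ card_monomials_upto_ratio, where c = C])
      (use C in \<open>simp_all add: monomials_upto_pos of_nat_mult[symmetric] del: of_nat_mult of_nat_sum\<close>)
  then show ?thesis
    by (simp add: free_rank_reflexive_sym rank_reflexive_sym card_monomials_upto)
qed

end

section \<open>Small linear groups\<close>

text \<open>Over a finite field, one plus the product of all \<open>X - a\<close> has no root.\<close>

lemma infinite_alg_closed: "infinite (UNIV :: 'k::alg_closed_field set)"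
proof
  assume fin: "finite (UNIV :: 'k set)"
  define p where "p = (\<Prod>a\<in>(UNIV :: 'k set). [:- a, 1:])"
  have "degree p > 0" unfolding p_def degree_prod_linear[OF fin] using fin by (simp add: card_gt_0_iff)
  then have "degree (p + 1) > 0" by (simp add: degree_add_eq_left)
  then obtain x where "poly (p + 1) x = 0" using alg_closed_imp_poly_has_root by blast
  moreover have "poly p x = 0" unfolding p_def poly_prod by (rule prod_zero[OF fin]) auto
  ultimately show False by simp
qed

locale coordinate_space = finite_dimensional_vector_space scale "range e"
  for scale :: "'k::field \<Rightarrow> 'v::ab_group_add \<Rightarrow> 'v" and e :: "'n::finite \<Rightarrow> 'v" +
  assumes inj_e: "inj e"
begin

abbreviation lin :: "'v \<Rightarrow> ('n, 'k) polynomial" where "lin \<equiv> vec_poly scale e"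

definition coords :: "'v \<Rightarrow> 'n \<Rightarrow> 'k" where "coords v i = representation (range e) v (e i)"

lemma lin_linear_form: "lin v = linear_form (coords v)"
  by (simp add: vec_poly_def linear_form_def coords_def)

lemma in_span_basis: "v \<in> span (range e)" by (simp add: span_Basis)

lemma coords_add: "coords (v + v') = (\<lambda>i. coords v i + coords v' i)"
  and coords_scale: "coords (scale c v) = (\<lambda>i. c * coords v i)"
  by (simp_all add: fun_eq_iff coords_def representation_add representation_scale independent_Basis in_span_basis)

lemma expand_coords: "(\<Sum>i\<in>UNIV. scale (coords v i) (e i)) = v"
  using sum_representation_eq[OF independent_Basis in_span_basis, of "range e" v]
  by (simp add: sum.reindex[OF inj_e] coords_def)

lemma coords_inject: "coords v = coords v' \<longleftrightarrow> v = v'"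
  by (metis expand_coords)

lemma lin_inject: "lin v = lin v' \<longleftrightarrow> v = v'"
  by (simp add: lin_linear_form linear_form_inject coords_inject)

lemma lin_add: "lin (v + v') = lin v + lin v'"
  by (simp add: lin_linear_form coords_add linear_form_add)

lemma lin_scale: "lin (scale c v) = poly_const c * lin v"
  by (simp add: lin_linear_form coords_scale linear_form_scale)

lemma lin_0: "lin 0 = 0"
  using lin_add[of 0 0] by simp

lemma lin_diff: "lin (v - v') = lin v - lin v'"
  using lin_add[of "v - v'" v'] by simp

lemma lin_sum: "lin (\<Sum>i\<in>I. f i) = (\<Sum>i\<in>I. lin (f i))"
  by (induction I rule: infinite_finite_induct) (simp_all add: lin_0 lin_add)

lemma lin_basis: "lin (e j) = poly_var j"
proof -
  have "coords (e j) = (\<lambda>i. if i = j then 1 else 0)"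
    using inj_e by (auto simp: coords_def representation_basis[OF independent_Basis] fun_eq_iff inj_eq)
  then show ?thesis by (simp add: lin_linear_form linear_form_unit)
qed

abbreviation action :: "('v \<Rightarrow> 'v) \<Rightarrow> ('n, 'k) polynomial \<Rightarrow> ('n, 'k) polynomial" where
  "action \<equiv> poly_action scale e"

lemma action_const: "action f (poly_const c) = poly_const c"
  by (simp add: poly_action_def poly_subst_const)

lemma action_var: "action f (poly_var i) = lin (f (e i))"
  by (simp add: poly_action_def poly_subst_var)

lemma ring_map_action: "ring_map (action f)"
  by unfold_locales (simp_all add: poly_action_def poly_subst.map_add poly_subst.map_mult poly_subst.map_one)

lemma apply_linear: 
  assumes "Vector_Spaces.linear scale scale f"
  shows "f v = (\<Sum>i\<in>UNIV. scale (coords v i) (f (e i)))"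
proof -
  interpret f: Vector_Spaces.linear scale scale f by fact
  show ?thesis by (subst (1) expand_coords[of v, symmetric]) (simp only: f.sum f.scale)
qed

lemma action_lin:
  assumes "Vector_Spaces.linear scale scale f" shows "action f (lin v) = lin (f v)"
proof -
  have "action f (lin v) = (\<Sum>i\<in>UNIV. poly_const (coords v i) * lin (f (e i)))"
    unfolding lin_linear_form[of v] poly_action_def by (rule poly_subst_linear_form)
  also have "\<dots> = lin (f v)" by (subst apply_linear[OF assms]) (simp add: lin_sum lin_scale)
  finally show ?thesis .
qed

lemma action_id: "action id = id"
proof
  fix p
  have "ring_map (id :: ('n, 'k) polynomial \<Rightarrow> _)" by unfold_locales simp_all
  from ring_map_eqI[OF ring_map_action this, of id]
  show "action id p = id p" by (simp add: action_const action_var lin_basis)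
qed

lemma action_comp:
  assumes "Vector_Spaces.linear scale scale f"
  shows "action (f \<circ> g) = action f \<circ> action g"
proof
  fix p show "action (f \<circ> g) p = (action f \<circ> action g) p"
    by (rule ring_map_eqI[OF ring_map_action ring_map_comp[OF ring_map_action ring_map_action]])
      (simp_all add: action_const action_var action_lin[OF assms])
qed

lemma action_inject:
  assumes "Vector_Spaces.linear scale scale f" "Vector_Spaces.linear scale scale g" "action f = action g"
  shows "f = g"
proof
  fix v
  have "lin (f (e i)) = lin (g (e i))" for i using assms(3) by (metis action_var)
  then have "f (e i) = g (e i)" for i by (simp add: lin_inject)
  then have "(\<Sum>i\<in>UNIV. scale (coords v i) (f (e i))) = (\<Sum>i\<in>UNIV. scale (coords v i) (g (e i)))" by simp
  then show "f v = g v" by (simp only: apply_linear[OF assms(1), of v, symmetric] apply_linear[OF assms(2), of v, symmetric])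
qed

text \<open>If all vectors \<open>w - f w\<close> were multiples of a nonzero vector \<open>v - f v\<close>, then the fixed space of \<open>f\<close>
  and \<open>v\<close> together would span the space, so that \<open>f\<close> would be a pseudo-reflection.\<close>

lemma not_pseudo_reflection_independent:
  assumes lin: "Vector_Spaces.linear scale scale f" and bij: "bij f" and order: "m > 0" "f ^^ m = id"
    and small: "\<not> pseudo_reflection scale f" and f: "f \<noteq> id"
  obtains v w where "v - f v \<noteq> 0" "\<And>t. w - f w \<noteq> scale t (v - f v)"
proof -
  interpret f: Vector_Spaces.linear scale scale f by fact
  obtain v where "f v \<noteq> v" using f by (auto simp: fun_eq_iff)
  then have v: "v - f v \<noteq> 0" by (metis eq_iff_diff_eq_0)
  show ?thesis
  proof (cases "\<exists>w. \<forall>t. w - f w \<noteq> scale t (v - f v)")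
    case True
    then obtain w where "\<And>t. w - f w \<noteq> scale t (v - f v)" by blast
    with v show ?thesis by (rule that)
  next
    case False
    then have mult: "\<exists>t. w - f w = scale t (v - f v)" for w by blast
    let ?K = "{v. f v = v}"
    have K: "subspace ?K" by (simp add: subspace_def f.zero f.add f.scale)
    have "w \<in> span (insert v ?K)" for w
    proof -
      obtain t where t: "w - f w = scale t (v - f v)" using mult by blast
      have "f (w - scale t v) = w - scale t v"
        using t by (simp add: f.diff f.scale scale_right_diff_distrib algebra_simps)
      then have "w - scale t v \<in> span (insert v ?K)" by (intro span_base) simp
      moreover have "scale t v \<in> span (insert v ?K)" by (intro span_scale span_base) simp
      ultimately have "(w - scale t v) + scale t v \<in> span (insert v ?K)" by (rule span_add)
      then show ?thesis by simp
    qed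
    then have "span (insert v ?K) = UNIV" by blast
    then have "dim (UNIV :: 'v set) = dim (insert v ?K)" by (metis dim_span)
    also have "\<dots> = dim ?K + 1" using v by (simp add: dim_insert span_eq_iff[THEN iffD2, OF K])
    finally have "pseudo_reflection scale f"
      using order lin bij by (auto simp: pseudo_reflection_def general_linear_group_def)
    with small show ?thesis by blast
  qed
qed

end

locale small_linear_group = coordinate_space scale e
  for scale :: "'k::alg_closed_field \<Rightarrow> 'v::ab_group_add \<Rightarrow> 'v" and e :: "'n::finite \<Rightarrow> 'v" +
  fixes G :: "('v \<Rightarrow> 'v) set"
  assumes subgroup: "subgroup G (general_linear_group scale)"
    and finite_G: "finite G" and small: "small_group scale G"
    and char: "\<not> CHAR('k) dvd card G"
begin

lemma G_linear: "f \<in> G \<Longrightarrow> Vector_Spaces.linear scale scale f"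
  and G_bij: "f \<in> G \<Longrightarrow> bij f"
  using subgroup.subset[OF subgroup] by (auto simp: general_linear_group_def)

lemma G_id: "id \<in> G"
  using subgroup.one_closed[OF subgroup] by (simp add: general_linear_group_def)

lemma G_comp: "f \<in> G \<Longrightarrow> g \<in> G \<Longrightarrow> f \<circ> g \<in> G"
  using subgroup.m_closed[OF subgroup, of f g] by (simp add: general_linear_group_def)

text \<open>The composition with \<open>f\<close> maps the finite set \<open>G\<close> injectively to itself, hence onto.\<close>

lemma G_inverse:
  assumes f: "f \<in> G" obtains g where "g \<in> G" "f \<circ> g = id" "g \<circ> f = id"
proof -
  have "inj_on ((\<circ>) f) G"
  proof (rule inj_onI, rule ext)
    fix g h x assume "f \<circ> g = f \<circ> h"
    then have "f (g x) = f (h x)" by (simp add: fun_eq_iff)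
    then show "g x = h x" by (rule injD[OF bij_is_inj[OF G_bij[OF f]]])
  qed
  then have "(\<circ>) f ` G = G" using finite_G G_comp[OF f] by (intro endo_inj_surj) auto
  then have "id \<in> (\<circ>) f ` G" using G_id by (simp only:)
  then obtain g where g: "g \<in> G" "f \<circ> g = id" by (elim imageE) simp
  have fg: "f (g y) = y" for y using fun_cong[OF g(2), of y] by simp
  have "g \<circ> f = id"
  proof
    fix x
    have "f ((g \<circ> f) x) = f (id x)" by (simp add: fg)
    then show "(g \<circ> f) x = id x" by (rule injD[OF bij_is_inj[OF G_bij[OF f]]])
  qed
  with g show ?thesis by (rule that)
qed

lemma G_order:
  assumes f: "f \<in> G" obtains m where "m > 0" "f ^^ m = id"
proof -
  have mem: "f ^^ k \<in> G" for k by (induction k) (simp_all only: funpow.simps G_id G_comp f)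
  have "\<not> inj (\<lambda>k. f ^^ k)"
    using range_inj_infinite[of "\<lambda>k. f ^^ k"] finite_subset[OF _ finite_G, of "range (\<lambda>k. f ^^ k)"] mem by blast
  then obtain i j where "i \<noteq> j" "f ^^ i = f ^^ j" unfolding inj_def by blast
  then obtain i j where ij: "i < j" "f ^^ i = f ^^ j" by (metis linorder_neqE_nat)
  have "f ^^ (j - i) = id"
  proof
    fix x
    have "(f ^^ i) ((f ^^ (j - i)) x) = (f ^^ (i + (j - i))) x" by (simp only: funpow_add comp_apply)
    also have "\<dots> = (f ^^ i) (id x)" using ij by simp
    finally show "(f ^^ (j - i)) x = id x" by (rule injD[OF bij_is_inj[OF G_bij[OF mem[of i]]]])
  qed
  moreover have "j - i > 0" using ij by simp
  ultimately show ?thesis using that by blast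
qed

lemma inj_on_action: "inj_on action G"
  by (rule inj_onI) (rule action_inject[OF G_linear G_linear])

lemma moving_vectors:
  assumes "f \<in> G" "f \<noteq> id"
  shows "\<exists>v w. v - f v \<noteq> 0 \<and> (\<forall>t. w - f w \<noteq> scale t (v - f v))"
proof -
  obtain m where "m > 0" "f ^^ m = id" using assms(1) by (rule G_order)
  moreover have "\<not> pseudo_reflection scale f" using small assms(1) by (simp add: small_group_def)
  ultimately show ?thesis
    by (rule not_pseudo_reflection_independent[OF G_linear[OF assms(1)] G_bij[OF assms(1)] _ _ _ assms(2)]) blast
qed

theorem linear_action_ex: obtains v w where "linear_action (action ` G) v w"
proof -
  have "\<exists>a b. \<forall>f. f \<in> G \<longrightarrow> f \<noteq> id \<longrightarrow> a f - f (a f) \<noteq> 0 \<and> (\<forall>t. b f - f (b f) \<noteq> scale t (a f - f (a f)))"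
    using moving_vectors by metis
  then obtain a b where ab: "\<And>f. f \<in> G \<Longrightarrow> f \<noteq> id \<Longrightarrow> a f - f (a f) \<noteq> 0"
    "\<And>f t. f \<in> G \<Longrightarrow> f \<noteq> id \<Longrightarrow> b f - f (b f) \<noteq> scale t (a f - f (a f))" by metis
  define el where "el = inv_into G action"
  have el: "el g \<in> G" "action (el g) = g" if "g \<in> action ` G" for g
    using inv_into_into[OF that] f_inv_into_f[OF that] by (simp_all add: el_def)
  have el_id: "el g \<noteq> id" if "g \<in> action ` G" "g \<noteq> id" for g
    using el(2)[OF that(1)] that(2) by (auto simp: action_id)
  define v where "v g = lin (a (el g))" for g
  define w where "w g = lin (b (el g))" for g
  have moved: "lin x - g (lin x) = lin (x - el g x)" if "g \<in> action ` G" for g x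
    using action_lin[OF G_linear[OF el(1)[OF that]], of x] el(2)[OF that] by (simp add: lin_diff)
  have v0: "v g - g (v g) \<noteq> 0" if "g \<in> action ` G" "g \<noteq> id" for g
    using ab(1)[OF el(1)[OF that(1)] el_id[OF that]] lin_inject[of _ 0]
    by (simp add: v_def moved[OF that(1)] lin_0)
  have w0: "w g - g (w g) \<noteq> 0" if "g \<in> action ` G" "g \<noteq> id" for g
    using ab(2)[OF el(1)[OF that(1)] el_id[OF that], of 0] lin_inject[of _ 0]
    by (simp add: w_def moved[OF that(1)] lin_0)
  have "linear_action (action ` G) v w"
  proof (unfold_locales)
    show "finite (action ` G)" using finite_G by simp
    show "id \<in> action ` G" using G_id action_id by (metis imageI)
    show "g \<circ> h \<in> action ` G" if "g \<in> action ` G" "h \<in> action ` G" for g h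
    proof -
      from that obtain f f' where f: "f \<in> G" "g = action f" "f' \<in> G" "h = action f'" by blast
      have "g \<circ> h = action (f \<circ> f')" using action_comp[OF G_linear[OF f(1)]] by (simp only: f)
      then show ?thesis using G_comp[OF f(1,3)] by blast
    qed
    show "\<exists>h\<in>action ` G. h \<circ> g = id \<and> g \<circ> h = id" if "g \<in> action ` G" for g
    proof -
      note g = el[OF that]
      obtain h where h: "h \<in> G" "el g \<circ> h = id" "h \<circ> el g = id" using G_inverse[OF g(1)] by blast
      have "g \<circ> action h = id" "action h \<circ> g = id"
        using action_comp[OF G_linear[OF g(1)], of h] action_comp[OF G_linear[OF h(1)], of "el g"]
        by (simp_all add: h g(2) action_id)
      with h(1) show ?thesis by blast
    qed
    show "g (p + q) = g p + g q" "g (p * q) = g p * g q" "g 1 = 1" if "g \<in> action ` G" for g p q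
      using that ring_map.map_add[OF ring_map_action] ring_map.map_mult[OF ring_map_action]
        ring_map.map_one[OF ring_map_action] by auto
    show "p = 0 \<or> q = 0" if "p * q = 0" for p q :: "('n, 'k) polynomial" using that by (rule polynomial_no_zero_div)
    show "v g - g (v g) \<noteq> 0" "w g - g (w g) \<noteq> 0" if "g \<in> action ` G" "g \<noteq> id" for g
      using v0 w0 that by blast+
    show "v g - g (v g) dvd q"
      if g: "g \<in> action ` G" "g \<noteq> id" and eq: "(v g - g (v g)) * p = (w g - g (w g)) * q" for g p q
    proof -
      let ?x = "a (el g) - el g (a (el g))" and ?y = "b (el g) - el g (b (el g))"
      note m = moved[OF g(1), of "a (el g)", folded v_def] moved[OF g(1), of "b (el g)", folded w_def]
      note ab = ab[OF el(1)[OF g(1)] el_id[OF g]]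
      show ?thesis unfolding m lin_linear_form
      proof (rule linear_forms_regular)
        show "coords ?x \<noteq> (\<lambda>_. 0)"
          using v0[OF g] unfolding m lin_linear_form by (auto simp: linear_form_zero)
        show "coords ?y \<noteq> (\<lambda>i. t * coords ?x i)" for t
          using ab(2)[of t] by (simp add: coords_scale[symmetric] coords_inject)
        show "linear_form (coords ?x) * p = linear_form (coords ?y) * q"
          using eq unfolding m lin_linear_form .
      qed
    qed
    show "infinite {p. \<forall>g\<in>action ` G. g p = p}"
    proof -
      have "inj (poly_const :: 'k \<Rightarrow> ('n, 'k) polynomial)"
      proof (rule injI)
        fix c d :: 'k assume "(poly_const c :: ('n, 'k) polynomial) = poly_const d"
        then have "poly_const (c - d) = (0 :: ('n, 'k) polynomial)" by (simp add: poly_const_diff)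
        then show "c = d" by (simp add: poly_const_eq_0)
      qed
      then have "infinite (range (poly_const :: 'k \<Rightarrow> ('n, 'k) polynomial))"
        using infinite_alg_closed finite_imageD by blast
      moreover have "range poly_const \<subseteq> {p. \<forall>g\<in>action ` G. g p = p}" by (auto simp: action_const)
      ultimately show ?thesis using finite_subset by blast
    qed
    show "g (poly_const c) = poly_const c" if "g \<in> action ` G" for g c using that by (auto simp: action_const)
    show "\<exists>c. g (poly_var i) = linear_form c" if "g \<in> action ` G" for g i
      using that by (auto simp: action_var lin_linear_form)
    show "of_nat (card (action ` G)) \<noteq> (0 :: 'k)"
      using char by (simp add: card_image[OF inj_on_action] of_nat_eq_0_iff_char_dvd)
  qed
  then show ?thesis by (rule that)
qed

theorem signature_limit:
  "diff_sym_ratio (invariant_ring scale e G) (range poly_const) \<longlonglongrightarrow> 1 / real (card G)"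
proof -
  obtain v w where "linear_action (action ` G) v w" by (rule linear_action_ex)
  then interpret linear_action "action ` G" v w .
  have "invariant_ring scale e G = inv_ring"
    by (auto simp: invariant_ring_def inv_ring_def invs_def degree_part_def Let_def fun_eq_iff)
  then have "diff_sym_ratio (invariant_ring scale e G) (range poly_const) =
      (\<lambda>N. real (\<Sum>q\<le>N. free_rank inv_ring (D2 q)) / real (\<Sum>q\<le>N. module_rank inv_ring (D2 q)))"
    by (simp only: diff_sym_ratio_def[abs_def] reflexive_sym_kaehler_def)
  then show ?thesis using rank_ratio_limit by (simp only: card_image[OF inj_on_action])
qed

end

theorem theorem2p8:
  fixes scale :: "'k::alg_closed_field \<Rightarrow> 'v::ab_group_add \<Rightarrow> 'v"
    and e :: "'n::finite \<Rightarrow> 'v"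
    and G :: "('v \<Rightarrow> 'v) set"
  assumes basis: "finite_dimensional_vector_space scale (range e)" "inj e"
    and dim: "2 \<le> vector_space.dim scale UNIV"
    and G: "subgroup G (general_linear_group scale)" "finite G" "small_group scale G"
    and char: "\<not> CHAR('k) dvd card G"
  shows "convergent (diff_sym_ratio (invariant_ring scale e G) (range poly_const)) \<and>
    diff_sym_signature (invariant_ring scale e G) (range poly_const) = 1 / real (card G)"
proof -
  interpret small_linear_group scale e G
    by (intro small_linear_group.intro coordinate_space.intro coordinate_space_axioms.intro
      small_linear_group_axioms.intro basis G char)
  from signature_limit show ?thesis
    by (auto simp: convergent_def diff_sym_signature_def intro: limI)
qed

end
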